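(* Let $\mathcal T$ be a triangulation of a polygonal domain $\Omega$ with $n_V$ vertices, $n_E$ edges, $n_T$ triangles. Let $\mathcal M$ be a set of pairs $(\Delta,i)$ formed as follows: for each vertex $v$ of $\mathcal T$, choose one triangle $\Delta\ni v$ and include the six pairs $(\Delta,i)$ with $i$ an index associated with $v$ in $\Delta$; for each edge $e$ of $\mathcal T$, choose one triangle $\Delta$ containing $e$ and include the three pairs $(\Delta,i)$ with $i$ an index associated with $e$ in $\Delta$; for each triangle $\Delta$ include $(\Delta,28)$. Then $\mathcal M$ is a minimal determining set for $\mathbb S_3^2(\mathcal T_{WS_3})$: if $s\in\mathbb S_3^2(\mathcal T_{WS_3})$ satisfies $\tilde b_{i,\Delta}(s)=0$ for all $(\Delta,i)\in\mathcal M$, then $s\equiv0$; and $\#\mathcal M=6n_V+3n_E+n_T=\dim\mathbb S_3^2(\mathcal T_{WS_3})$.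
   Context: For each triangle $\Delta$ of $\mathcal T$ fix an ordering $(v_1,v_2,v_3)$ of its vertices and set $v_{1,2}=\tfrac23v_2+\tfrac13v_3$, $v_{1,3}=\tfrac13v_2+\tfrac23v_3$, $v_{2,1}=\tfrac23v_1+\tfrac13v_3$, $v_{2,3}=\tfrac13v_1+\tfrac23v_3$, $v_{3,1}=\tfrac23v_1+\tfrac13v_2$, $v_{3,2}=\tfrac13v_1+\tfrac23v_2$. $\Delta_{WS_3}$ is the partition of $\Delta$ by all segments joining pairs of the nine points $v_k,v_{k,l}$; $\mathcal T_{WS_3}$ applies this split to every triangle; $\mathbb S_3^2(\mathcal T_{WS_3})$ is the space of $C^2(\Omega)$ functions that are cubic polynomials on each polygon of $\mathcal T_{WS_3}$. Local basis on $\Delta$: for a multiset $\Xi$ of six points with full-dimensional hull, $M_\Xi(x)=\mathrm{vol}_3(\sigma\cap\pi^{-1}(x))/\mathrm{vol}_5(\sigma)$ for any positive-volume simplex $\sigma\subset\mathbb R^5$ whose vertices project (first two coordinates, $\pi$) onto $\Xi$. $B_i=w_iM_{\Xi_i}$ (values on $\partial\Delta$ by continuity from the interior) with $\Xi_1=\{v_1^{(4)},v_{3,1},v_{2,1}\}$, $\Xi_2=\{v_2^{(4)},v_{3,2},v_{1,2}\}$, $\Xi_3=\{v_3^{(4)},v_{1,3},v_{2,3}\}$, $\Xi_4=\{v_1^{(3)},v_{3,1},v_{3,2},v_{2,1}\}$, $\Xi_5=\{v_1^{(3)},v_{2,1},v_{2,3},v_{3,1}\}$, $\Xi_6=\{v_2^{(3)},v_{1,2},v_{1,3},v_{3,2}\}$,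 $\Xi_7=\{v_2^{(3)},v_{3,2},v_{3,1},v_{1,2}\}$, $\Xi_8=\{v_3^{(3)},v_{2,3},v_{2,1},v_{1,3}\}$, $\Xi_9=\{v_3^{(3)},v_{1,3},v_{1,2},v_{2,3}\}$, $\Xi_{10}=\{v_1^{(2)},v_{3,1},v_{3,2},v_2,v_{2,1}\}$, $\Xi_{11}=\{v_1^{(2)},v_{2,1},v_{2,3},v_3,v_{3,1}\}$, $\Xi_{12}=\{v_2^{(2)},v_{1,2},v_{1,3},v_3,v_{3,2}\}$, $\Xi_{13}=\{v_2^{(2)},v_{3,2},v_{3,1},v_1,v_{1,2}\}$, $\Xi_{14}=\{v_3^{(2)},v_{2,3},v_{2,1},v_1,v_{1,3}\}$, $\Xi_{15}=\{v_3^{(2)},v_{1,3},v_{1,2},v_2,v_{2,3}\}$, $\Xi_{16}=\{v_1^{(2)},v_{3,1},v_{3,2},v_{2,1},v_{2,3}\}$, $\Xi_{17}=\{v_2^{(2)},v_{3,2},v_{3,1},v_{1,2},v_{1,3}\}$, $\Xi_{18}=\{v_3^{(2)},v_{1,3},v_{1,2},v_{2,3},v_{2,1}\}$, $\Xi_{19}=\{v_1,v_2,v_{3,1},v_{3,2},v_{2,1},v_{1,2}\}$, $\Xi_{20}=\{v_2,v_3,v_{1,2},v_{1,3},v_{3,2},v_{2,3}\}$, $\Xi_{21}=\{v_3,v_1,v_{2,3},v_{2,1},v_{1,3},v_{3,1}\}$, $\Xi_{22}=\{v_1,v_{3,1},v_{3,2},v_{1,2},v_{2,3},v_{2,1}\}$,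 $\Xi_{23}=\{v_1,v_{2,1},v_{2,3},v_{1,3},v_{3,2},v_{3,1}\}$, $\Xi_{24}=\{v_2,v_{1,2},v_{1,3},v_{2,3},v_{3,1},v_{3,2}\}$, $\Xi_{25}=\{v_2,v_{3,1},v_{3,2},v_{1,2},v_{1,3},v_{2,1}\}$, $\Xi_{26}=\{v_3,v_{2,3},v_{2,1},v_{3,1},v_{1,2},v_{1,3}\}$, $\Xi_{27}=\{v_3,v_{1,2},v_{1,3},v_{2,3},v_{2,1},v_{3,2}\}$, $\Xi_{28}=\{v_{3,1},v_{3,2},v_{1,2},v_{1,3},v_{2,3},v_{2,1}\}$ (superscript = multiplicity), $w_i=\frac{|\Delta|}{15}c_i$, $c=(\tfrac16^{\times3},\tfrac13^{\times6},\tfrac12^{\times6},\tfrac23^{\times3},\tfrac56^{\times3},\tfrac23^{\times6},1)$; and $\tilde B_{i,\Delta}=B_i$ ($i\le21$), $\tilde B_{22,\Delta}=2B_{22}-B_{23}+\tfrac13B_{28}$, $\tilde B_{23,\Delta}=2B_{23}-B_{22}+\tfrac13B_{28}$, $\tilde B_{24,\Delta}=2B_{24}-B_{25}+\tfrac13B_{28}$, $\tilde B_{25,\Delta}=2B_{25}-B_{24}+\tfrac13B_{28}$, $\tilde B_{26,\Delta}=2B_{26}-B_{27}+\tfrac13B_{28}$, $\tilde B_{27,\Delta}=2B_{27}-B_{26}+\tfrac13B_{28}$, $\tilde B_{28,\Delta}=-B_{28}$. These 28 functions form a basis of the $C^2$ piecewise cubics on $\Delta_{WS_3}$, so each $s\in\mathbb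 S_3^2(\mathcal T_{WS_3})$ has unique coefficients with $s|_\Delta=\sum_{i=1}^{28}\tilde b_{i,\Delta}(s)\tilde B_{i,\Delta}$. Index association in $\Delta$: indices associated with vertex $v_1$: $\{1,4,5,10,11,16\}$; with $v_2$: $\{2,6,7,12,13,17\}$; with $v_3$: $\{3,8,9,14,15,18\}$; with edge $[v_1,v_2]$: $\{19,22,25\}$; with edge $[v_1,v_3]$: $\{21,23,26\}$; with edge $[v_2,v_3]$: $\{20,24,27\}$; with the triangle: $\{28\}$. *)

theory Defs
  imports "HOL-Analysis.Analysis" "HOL-Library.Function_Algebras"
begin

type_synonym pt = "real \<times> real"
type_synonym tri = "pt \<times> pt \<times> pt"

definition tv1 :: "tri \<Rightarrow> pt" where "tv1 T = fst T"
definition tv2 :: "tri \<Rightarrow> pt" where "tv2 T = fst (snd T)"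
definition tv3 :: "tri \<Rightarrow> pt" where "tv3 T = snd (snd T)"

definition vset :: "tri \<Rightarrow> pt set" where "vset T = {tv1 T, tv2 T, tv3 T}"

definition tri_set :: "tri \<Rightarrow> pt set" where "tri_set T = convex hull (vset T)"

definition nondegenerate :: "tri \<Rightarrow> bool" where
  "nondegenerate T \<longleftrightarrow> \<not> affine_dependent (vset T) \<and> card (vset T) = 3"

definition is_triangulation :: "tri set \<Rightarrow> bool" where
  "is_triangulation \<T> \<longleftrightarrow> finite \<T> \<and> \<T> \<noteq> {} \<and>
     (\<forall>T\<in>\<T>. nondegenerate T) \<and>
     (\<forall>T\<in>\<T>. \<forall>T'\<in>\<T>. vset T = vset T' \<longrightarrow> T = T') \<and>
     (\<forall>T\<in>\<T>. \<forall>T'\<in>\<T>. T \<noteq> T' \<longrightarrow>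
         tri_set T \<inter> tri_set T' = convex hull (vset T \<inter> vset T'))"

definition domain_of :: "tri set \<Rightarrow> pt set" where
  "domain_of \<T> = (\<Union>T\<in>\<T>. tri_set T)"

definition verts :: "tri set \<Rightarrow> pt set" where
  "verts \<T> = (\<Union>T\<in>\<T>. vset T)"

definition edges :: "tri set \<Rightarrow> pt set set" where
  "edges \<T> = {{a, b} | a b T. T \<in> \<T> \<and> a \<in> vset T \<and> b \<in> vset T \<and> a \<noteq> b}"

definition v12 :: "tri \<Rightarrow> pt" where "v12 T = (2/3) *\<^sub>R tv2 T + (1/3) *\<^sub>R tv3 T"
definition v13 :: "tri \<Rightarrow> pt" where "v13 T = (1/3) *\<^sub>R tv2 T + (2/3) *\<^sub>R tv3 T"
definition v21 :: "tri \<Rightarrow> pt" where "v21 T = (2/3) *\<^sub>R tv1 T + (1/3) *\<^sub>R tv3 T"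
definition v23 :: "tri \<Rightarrow> pt" where "v23 T = (1/3) *\<^sub>R tv1 T + (2/3) *\<^sub>R tv3 T"
definition v31 :: "tri \<Rightarrow> pt" where "v31 T = (2/3) *\<^sub>R tv1 T + (1/3) *\<^sub>R tv2 T"
definition v32 :: "tri \<Rightarrow> pt" where "v32 T = (1/3) *\<^sub>R tv1 T + (2/3) *\<^sub>R tv2 T"

definition ws_points :: "tri \<Rightarrow> pt set" where
  "ws_points T = {tv1 T, tv2 T, tv3 T, v12 T, v13 T, v21 T, v23 T, v31 T, v32 T}"

definition ws_segments :: "tri \<Rightarrow> pt set" where
  "ws_segments T = (\<Union>p\<in>ws_points T. \<Union>q\<in>ws_points T. closed_segment p q)"

definition ws_cells :: "tri \<Rightarrow> pt set set" where
  "ws_cells T = components (interior (tri_set T) - ws_segments T)"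

definition cubic_on :: "pt set \<Rightarrow> (pt \<Rightarrow> real) \<Rightarrow> bool" where
  "cubic_on C f \<longleftrightarrow> (\<exists>c :: nat \<Rightarrow> nat \<Rightarrow> real. \<forall>x\<in>C.
      f x = (\<Sum>i\<le>3. \<Sum>j\<le>3 - i. c i j * fst x ^ i * snd x ^ j))"

definition C2_on :: "pt set \<Rightarrow> (pt \<Rightarrow> real) \<Rightarrow> bool" where
  "C2_on \<Omega> f \<longleftrightarrow> (\<exists>f1 f2 f11 f12 f21 f22 :: pt \<Rightarrow> real.
     continuous_on \<Omega> f \<and> continuous_on \<Omega> f1 \<and> continuous_on \<Omega> f2 \<and>
     continuous_on \<Omega> f11 \<and> continuous_on \<Omega> f12 \<and>
     continuous_on \<Omega> f21 \<and> continuous_on \<Omega> f22 \<and>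
     (\<forall>x\<in>interior \<Omega>.
        (f has_derivative (\<lambda>h. f1 x * fst h + f2 x * snd h)) (at x) \<and>
        (f1 has_derivative (\<lambda>h. f11 x * fst h + f12 x * snd h)) (at x) \<and>
        (f2 has_derivative (\<lambda>h. f21 x * fst h + f22 x * snd h)) (at x)))"

definition S32 :: "tri set \<Rightarrow> (pt \<Rightarrow> real) set" where
  "S32 \<T> = {s. C2_on (domain_of \<T>) s \<and> (\<forall>x. x \<notin> domain_of \<T> \<longrightarrow> s x = 0) \<and>
              (\<forall>T\<in>\<T>. \<forall>C\<in>ws_cells T. cubic_on C s)}"

type_synonym lpt = "pt \<times> (real \<times> real \<times> real)"

text \<open>A positive-volume simplex in R^5 whose vertices project onto the knot multiset
  (given as a list).\<close>
definition simplex_lift :: "pt list \<Rightarrow> lpt list" where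
  "simplex_lift \<Xi> = (SOME ps. map fst ps = \<Xi> \<and> measure lborel (convex hull (set ps)) > 0)"

definition simplex_spline :: "pt list \<Rightarrow> pt \<Rightarrow> real" where
  "simplex_spline \<Xi> x =
     (let \<sigma> = convex hull (set (simplex_lift \<Xi>))
      in measure lborel {y. (x, y) \<in> \<sigma>} / measure lborel \<sigma>)"

definition Xi_list :: "tri \<Rightarrow> pt list list" where
  "Xi_list T = (let v1 = tv1 T; v2 = tv2 T; v3 = tv3 T;
      a12 = v12 T; a13 = v13 T; a21 = v21 T; a23 = v23 T; a31 = v31 T; a32 = v32 T in
   [ [v1, v1, v1, v1, a31, a21],
     [v2, v2, v2, v2, a32, a12],
     [v3, v3, v3, v3, a13, a23],
     [v1, v1, v1, a31, a32, a21],
     [v1, v1, v1, a21, a23, a31],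
     [v2, v2, v2, a12, a13, a32],
     [v2, v2, v2, a32, a31, a12],
     [v3, v3, v3, a23, a21, a13],
     [v3, v3, v3, a13, a12, a23],
     [v1, v1, a31, a32, v2, a21],
     [v1, v1, a21, a23, v3, a31],
     [v2, v2, a12, a13, v3, a32],
     [v2, v2, a32, a31, v1, a12],
     [v3, v3, a23, a21, v1, a13],
     [v3, v3, a13, a12, v2, a23],
     [v1, v1, a31, a32, a21, a23],
     [v2, v2, a32, a31, a12, a13],
     [v3, v3, a13, a12, a23, a21],
     [v1, v2, a31, a32, a21, a12],
     [v2, v3, a12, a13, a32, a23],
     [v3, v1, a23, a21, a13, a31],
     [v1, a31, a32, a12, a23, a21],
     [v1, a21, a23, a13, a32, a31],
     [v2, a12, a13, a23, a31, a32],
     [v2, a31, a32, a12, a13, a21],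
     [v3, a23, a21, a31, a12, a13],
     [v3, a12, a13, a23, a21, a32],
     [a31, a32, a12, a13, a23, a21] ])"

definition Xi :: "tri \<Rightarrow> nat \<Rightarrow> pt list" where
  "Xi T i = Xi_list T ! (i - 1)"

definition c_list :: "real list" where
  "c_list = [1/6, 1/6, 1/6, 1/3, 1/3, 1/3, 1/3, 1/3, 1/3,
             1/2, 1/2, 1/2, 1/2, 1/2, 1/2, 2/3, 2/3, 2/3, 5/6, 5/6, 5/6,
             2/3, 2/3, 2/3, 2/3, 2/3, 2/3, 1]"

definition wt :: "tri \<Rightarrow> nat \<Rightarrow> real" where
  "wt T i = measure lborel (tri_set T) / 15 * c_list ! (i - 1)"

text \<open>B_i on the triangle; values on the boundary by continuity from the interior.\<close>
definition Bfun :: "tri \<Rightarrow> nat \<Rightarrow> pt \<Rightarrow> real" where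
  "Bfun T i x = wt T i * Lim (at x within interior (tri_set T)) (simplex_spline (Xi T i))"

definition Bt :: "tri \<Rightarrow> nat \<Rightarrow> pt \<Rightarrow> real" where
  "Bt T i x =
    (if i = 22 then 2 * Bfun T 22 x - Bfun T 23 x + 1/3 * Bfun T 28 x
     else if i = 23 then 2 * Bfun T 23 x - Bfun T 22 x + 1/3 * Bfun T 28 x
     else if i = 24 then 2 * Bfun T 24 x - Bfun T 25 x + 1/3 * Bfun T 28 x
     else if i = 25 then 2 * Bfun T 25 x - Bfun T 24 x + 1/3 * Bfun T 28 x
     else if i = 26 then 2 * Bfun T 26 x - Bfun T 27 x + 1/3 * Bfun T 28 x
     else if i = 27 then 2 * Bfun T 27 x - Bfun T 26 x + 1/3 * Bfun T 28 x
     else if i = 28 then - Bfun T 28 x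
     else Bfun T i x)"

definition bcoeffs :: "(pt \<Rightarrow> real) \<Rightarrow> tri \<Rightarrow> nat \<Rightarrow> real" where
  "bcoeffs s T = (THE b. (\<forall>i. i \<notin> {1..28} \<longrightarrow> b i = 0) \<and>
                       (\<forall>x\<in>tri_set T. s x = (\<Sum>i=1..28. b i * Bt T i x)))"

definition vertex_indices :: "tri \<Rightarrow> pt \<Rightarrow> nat set" where
  "vertex_indices T v =
     (if v = tv1 T then {1,4,5,10,11,16}
      else if v = tv2 T then {2,6,7,12,13,17}
      else if v = tv3 T then {3,8,9,14,15,18} else {})"

definition edge_indices :: "tri \<Rightarrow> pt set \<Rightarrow> nat set" where
  "edge_indices T e =
     (if e = {tv1 T, tv2 T} then {19,22,25}
      else if e = {tv1 T, tv3 T} then {21,23,26}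
      else if e = {tv2 T, tv3 T} then {20,24,27} else {})"

definition MDS :: "tri set \<Rightarrow> (pt \<Rightarrow> tri) \<Rightarrow> (pt set \<Rightarrow> tri) \<Rightarrow> (tri \<times> nat) set" where
  "MDS \<T> tv te =
     {(tv v, i) | v i. v \<in> verts \<T> \<and> i \<in> vertex_indices (tv v) v} \<union>
     {(te e, i) | e i. e \<in> edges \<T> \<and> i \<in> edge_indices (te e) e} \<union>
     {(T, 28) | T. T \<in> \<T>}"

definition fun_scale :: "real \<Rightarrow> (pt \<Rightarrow> real) \<Rightarrow> (pt \<Rightarrow> real)" where
  "fun_scale c f = (\<lambda>x. c * f x)"

end

theory Submission
  imports Defs
begin

text \<open>In barycentric coordinates the volume of a slice of a lifted simplex is obtained by integrating the
  indicator of a cone three times; this writes every \<open>B\<^sub>i\<close> as an explicit combination of 28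
  truncated cubes \<open>max 0 (l\<^sub>j)\<^sup>3\<close>, with \<open>l\<^sub>j\<close> running over the 18 interior lines and 10 forms positive on
  the triangle. Conversely a \<open>C\<^sup>2\<close> piecewise cubic picks up a multiple of \<open>l\<^sup>3\<close> when it crosses
  a line \<open>l\<close>, and the multiple cannot change at an interior crossing because at most four lines meet there; so the same 28
  functions span the local space. Its 2-jet at a point is a quadratic form, and evaluating these
  forms at the nine boundary knots gives triangular systems: the 2-jet at a vertex corresponds to the six coefficients
  of that vertex, and once the end points of an edge are settled the 2-jets at its two thirds correspond to the three
  coefficients of the edge. This determines the spline from the coefficients in the minimal determining set.
  For the dimension one shows that the 2-jets along an edge depend only on the 2-jets at its end points and
  three further nodal values, by symmetry of the trilinear polar form across the thirds. Hence
  arbitrary nodal values on vertices, edges and triangles can be glued to a global \<open>C\<^sup>2\<close> spline.\<close>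

section \<open>Certificates for the spline coefficients\<close>

text \<open>The modified functions have a form that the proof exploits. At the third of the side
  [v_1, v_2] next to v_1 the 2-jets of B_22 and B_23 stand in the ratio 2 : 1, so 2 B_23 - B_22 has
  zero 2-jet there; each pair is decoupled in the same way, and this makes the edge systems
  triangular. B_28 has zero 2-jet at all nine boundary knots, so only an interior value detects its
  coefficient. The volumes that normalise the simplex splines are never evaluated. The chosen lift
  scales all its slices by one factor, which cancels; what is left is a positive factor depending on
  the triangle, the weight and the three base knots, and the two splines of a pair share all three.
  A determining set bounds the dimension only from above. Basis coefficients in neighbouring
  triangles are coupled through the shapes of both, so they cannot simply be prescribed; nodal
  values are read off from the 2-jets of the function and can be.\<close>

type_synonym int3 = "int \<times> int \<times> int"

text \<open>Linear forms in the barycentric coordinates scaled by 3: rows 0 to 17 are the oriented interior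
  lines of the split, rows 18 to 27 are positive inside the triangle and their cubes span the cubics.\<close>

definition lform_list :: "int3 list" where
  "lform_list = [
    (1, -2, -2), (2, -4, -1), (2, -1, -4), (2, -1, -1), (-2, 1, -2), (-4, 2, -1), (-1, 2, -4),
    (-1, 2, -1), (-2, -2, 1), (-1, -4, 2), (-4, -1, 2), (-1, -1, 2), (0, 1, -2), (0, -2, 1),
    (1, 0, -2), (-2, 0, 1), (1, -2, 0), (-2, 1, 0), (1, 0, 0), (0, 1, 0), (0, 0, 1), (1, 2, 0),
    (2, 1, 0), (0, 1, 2), (0, 2, 1), (1, 0, 2), (2, 0, 1), (1, 1, 1)]"

text \<open>Row \<open>i\<close> expresses \<open>7776\<close> times a suitably normalised \<open>B\<^bsub>i+1\<^esub>\<close> in the truncated cubes of the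
  forms of \<open>lform_list\<close>; found by solving the conditions of \<open>unit_ok\<close> below.\<close>

definition coeff_list :: "int list list" where
  "coeff_list = [
    [48, 0, 0, 0, 0, 0, 0, 0, 0, 0, 0, 0, 0, 0, 0, 0, 0, 0, 0, 0, 0, 0, 0, 0, 0, 0, 0, 0],
    [0, 0, 0, 0, 48, 0, 0, 0, 0, 0, 0, 0, 0, 0, 0, 0, 0, 0, 0, 0, 0, 0, 0, 0, 0, 0, 0, 0],
    [0, 0, 0, 0, 0, 0, 0, 0, 48, 0, 0, 0, 0, 0, 0, 0, 0, 0, 0, 0, 0, 0, 0, 0, 0, 0, 0, 0],
    [-48, 0, 6, 0, 0, 0, 0, 0, 0, 0, 0, 0, 0, 0, 0, 0, 0, 0, 0, 0, 0, 0, 0, 0, 0, 0, 0, 0],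
    [-48, 6, 0, 0, 0, 0, 0, 0, 0, 0, 0, 0, 0, 0, 0, 0, 0, 0, 0, 0, 0, 0, 0, 0, 0, 0, 0, 0],
    [0, 0, 0, 0, -48, 6, 0, 0, 0, 0, 0, 0, 0, 0, 0, 0, 0, 0, 0, 0, 0, 0, 0, 0, 0, 0, 0, 0],
    [0, 0, 0, 0, -48, 0, 6, 0, 0, 0, 0, 0, 0, 0, 0, 0, 0, 0, 0, 0, 0, 0, 0, 0, 0, 0, 0, 0],
    [0, 0, 0, 0, 0, 0, 0, 0, -48, 6, 0, 0, 0, 0, 0, 0, 0, 0, 0, 0, 0, 0, 0, 0, 0, 0, 0, 0],
    [0, 0, 0, 0, 0, 0, 0, 0, -48, 0, 6, 0, 0, 0, 0, 0, 0, 0, 0, 0, 0, 0, 0, 0, 0, 0, 0, 0],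
    [24, 0, -12, 0, 0, 0, 0, 0, 0, 0, 0, 0, 0, 0, 72, 0, 0, 0, 0, 0, 0, 0, 0, 0, 0, 0, 0, 0],
    [24, -12, 0, 0, 0, 0, 0, 0, 0, 0, 0, 0, 0, 0, 0, 0, 72, 0, 0, 0, 0, 0, 0, 0, 0, 0, 0, 0],
    [0, 0, 0, 0, 24, -12, 0, 0, 0, 0, 0, 0, 0, 0, 0, 0, 0, 72, 0, 0, 0, 0, 0, 0, 0, 0, 0, 0],
    [0, 0, 0, 0, 24, 0, -12, 0, 0, 0, 0, 0, 72, 0, 0, 0, 0, 0, 0, 0, 0, 0, 0, 0, 0, 0, 0, 0],
    [0, 0, 0, 0, 0, 0, 0, 0, 24, -12, 0, 0, 0, 72, 0, 0, 0, 0, 0, 0, 0, 0, 0, 0, 0, 0, 0, 0],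
    [0, 0, 0, 0, 0, 0, 0, 0, 24, 0, -12, 0, 0, 0, 0, 72, 0, 0, 0, 0, 0, 0, 0, 0, 0, 0, 0, 0],
    [48, -6, -6, 6, 0, 0, 0, 0, 0, 0, 0, 0, 0, 0, 0, 0, 0, 0, 0, 0, 0, 0, 0, 0, 0, 0, 0, 0],
    [0, 0, 0, 0, 48, -6, -6, 6, 0, 0, 0, 0, 0, 0, 0, 0, 0, 0, 0, 0, 0, 0, 0, 0, 0, 0, 0, 0],
    [0, 0, 0, 0, 0, 0, 0, 0, 48, -6, -6, 6, 0, 0, 0, 0, 0, 0, 0, 0, 0, 0, 0, 0, 0, 0, 0, 0],
    [-12, 0, 12, 0, -12, 0, 12, 0, 0, 0, 0, 24, -108, 0, -108, 0, 0, 0, 108, 108, -864, 12, 12, 48, -24, 48, -24, -48],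
    [0, 0, 0, 24, -12, 12, 0, 0, -12, 0, 12, 0, 0, 0, 0, -108, 0, -108, -864, 108, 108, -24, 48, 12, 12, -24, 48, -48],
    [-12, 12, 0, 0, 0, 0, 0, 24, -12, 12, 0, 0, 0, -108, 0, 0, -108, 0, 108, -864, 108, 48, -24, -24, 48, 12, 12, -48],
    [-24, 4, 6, -12, 6, 0, -8, 0, 0, 0, 1, -24, 81, 0, 0, 0, 0, 0, 0, -108, 756, -12, -6, -45, 24, -36, 12, 40],
    [-24, 6, 4, -12, 0, 1, 0, -24, 6, -8, 0, 0, 0, 81, 0, 0, 0, 0, 0, 756, -108, -36, 12, 24, -45, -12, -6, 40],
    [0, 1, 0, -24, -24, 6, 4, -12, 6, 0, -8, 0, 0, 0, 0, 81, 0, 0, 756, 0, -108, 12, -36, -12, -6, 24, -45, 40],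
    [6, 0, -8, 0, -24, 4, 6, -12, 0, 1, 0, -24, 0, 0, 81, 0, 0, 0, -108, 0, 756, -6, -12, -36, 12, -45, 24, 40],
    [6, -8, 0, 0, 0, 0, 1, -24, -24, 6, 4, -12, 0, 0, 0, 0, 81, 0, -108, 756, 0, -45, 24, 12, -36, -6, -12, 40],
    [0, 0, 1, -24, 6, -8, 0, 0, -24, 4, 6, -12, 0, 0, 0, 0, 0, 81, 756, -108, 0, 24, -45, -6, -12, 12, -36, 40],
    [12, -4, -4, 24, 12, -4, -4, 24, 12, -4, -4, 24, 0, 0, 0, 0, 0, 0, -324, -324, -324, 12, 12, 12, 12, 12, 12, -32]]"

text \<open>The multiset \<open>\<Xi>\<^bsub>i+1\<^esub>\<close> in scaled barycentric coordinates, split into three knots spanning a cone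
  and the three remaining ones.\<close>

definition knot_list :: "((int3 \<times> int3 \<times> int3) \<times> int3 \<times> int3 \<times> int3) list" where
  "knot_list = [
    (((3, 0, 0), (2, 1, 0), (2, 0, 1)), (3, 0, 0), (3, 0, 0), (3, 0, 0)),
    (((0, 3, 0), (1, 2, 0), (0, 2, 1)), (0, 3, 0), (0, 3, 0), (0, 3, 0)),
    (((0, 0, 3), (0, 1, 2), (1, 0, 2)), (0, 0, 3), (0, 0, 3), (0, 0, 3)),
    (((3, 0, 0), (2, 1, 0), (2, 0, 1)), (3, 0, 0), (3, 0, 0), (1, 2, 0)),
    (((3, 0, 0), (2, 1, 0), (2, 0, 1)), (3, 0, 0), (3, 0, 0), (1, 0, 2)),
    (((0, 3, 0), (1, 2, 0), (0, 2, 1)), (0, 3, 0), (0, 3, 0), (0, 1, 2)),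
    (((0, 3, 0), (1, 2, 0), (0, 2, 1)), (0, 3, 0), (0, 3, 0), (2, 1, 0)),
    (((0, 0, 3), (0, 1, 2), (1, 0, 2)), (0, 0, 3), (0, 0, 3), (2, 0, 1)),
    (((0, 0, 3), (0, 1, 2), (1, 0, 2)), (0, 0, 3), (0, 0, 3), (0, 2, 1)),
    (((3, 0, 0), (2, 1, 0), (2, 0, 1)), (3, 0, 0), (1, 2, 0), (0, 3, 0)),
    (((3, 0, 0), (2, 1, 0), (2, 0, 1)), (3, 0, 0), (1, 0, 2), (0, 0, 3)),
    (((0, 3, 0), (1, 2, 0), (0, 2, 1)), (0, 3, 0), (0, 1, 2), (0, 0, 3)),
    (((0, 3, 0), (1, 2, 0), (0, 2, 1)), (0, 3, 0), (2, 1, 0), (3, 0, 0)),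
    (((0, 0, 3), (0, 1, 2), (1, 0, 2)), (0, 0, 3), (2, 0, 1), (3, 0, 0)),
    (((0, 0, 3), (0, 1, 2), (1, 0, 2)), (0, 0, 3), (0, 2, 1), (0, 3, 0)),
    (((3, 0, 0), (2, 1, 0), (2, 0, 1)), (3, 0, 0), (1, 2, 0), (1, 0, 2)),
    (((0, 3, 0), (1, 2, 0), (0, 2, 1)), (0, 3, 0), (2, 1, 0), (0, 1, 2)),
    (((0, 0, 3), (0, 1, 2), (1, 0, 2)), (0, 0, 3), (0, 2, 1), (2, 0, 1)),
    (((3, 0, 0), (2, 1, 0), (2, 0, 1)), (0, 3, 0), (1, 2, 0), (0, 2, 1)),
    (((0, 3, 0), (1, 2, 0), (0, 2, 1)), (0, 0, 3), (0, 1, 2), (1, 0, 2)),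
    (((3, 0, 0), (2, 1, 0), (2, 0, 1)), (0, 0, 3), (1, 0, 2), (0, 1, 2)),
    (((3, 0, 0), (2, 1, 0), (2, 0, 1)), (1, 2, 0), (0, 2, 1), (1, 0, 2)),
    (((3, 0, 0), (2, 1, 0), (2, 0, 1)), (1, 0, 2), (0, 1, 2), (1, 2, 0)),
    (((0, 3, 0), (1, 2, 0), (0, 2, 1)), (0, 1, 2), (1, 0, 2), (2, 1, 0)),
    (((0, 3, 0), (1, 2, 0), (0, 2, 1)), (2, 1, 0), (0, 1, 2), (2, 0, 1)),
    (((0, 0, 3), (0, 1, 2), (1, 0, 2)), (2, 0, 1), (2, 1, 0), (0, 2, 1)),
    (((0, 0, 3), (0, 1, 2), (1, 0, 2)), (0, 2, 1), (2, 0, 1), (1, 2, 0)),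
    (((2, 1, 0), (1, 2, 0), (2, 0, 1)), (0, 2, 1), (0, 1, 2), (1, 0, 2))]"

fun idot :: "int3 \<Rightarrow> int3 \<Rightarrow> int" where
  "idot (a, b, c) (x, y, z) = a * x + b * y + c * z"

definition ipos :: "int \<Rightarrow> int" where "ipos x = (if x > 0 then x else 0)"

definition isum :: "int list \<Rightarrow> int list \<Rightarrow> int" where
  "isum xs ys = sum_list (map2 (*) xs ys)"

definition lvals :: "int3 \<Rightarrow> int list" where "lvals p = map (\<lambda>l. idot l p) lform_list"

definition dirs :: "int list \<Rightarrow> int3 \<Rightarrow> int list" where "dirs cs w = map2 (*) cs (lvals w)"

text \<open>Side \<open>f\<close> lies opposite vertex \<open>f\<close> (both counted from 0).\<close>

definition edge_chain :: "nat \<Rightarrow> int3 list" where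
  "edge_chain f = (if f = 0 then [(0,3,0), (0,2,1), (0,1,2), (0,0,3)]
     else if f = 1 then [(0,0,3), (1,0,2), (2,0,1), (3,0,0)]
     else [(3,0,0), (2,1,0), (1,2,0), (0,3,0)])"

definition exps :: "nat \<Rightarrow> nat list" where
  "exps k = (if k = 1 then [0, 1] else if k = 2 then [0, 1, 2] else [0, 1, 2, 3])"

text \<open>On the cone over a segment that no line separates, every truncated power equals
  \<open>(a * ipos x + b * ipos y) ^ k\<close>, where x and y are the values of the form at the
  ends. After binomial expansion the combination vanishes on the segment once each coefficient of
  \<open>a ^ r * b ^ (k - r)\<close> does, a finite integer check.\<close>

definition seg_vanish :: "nat \<Rightarrow> int list \<Rightarrow> int3 \<Rightarrow> int3 \<Rightarrow> bool" where
  "seg_vanish k cs p q \<longleftrightarrow> list_all (\<lambda>r.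
     isum cs (map2 (\<lambda>x y. ipos x ^ r * ipos y ^ (k - r)) (lvals p) (lvals q)) = 0) (exps k)"

definition face_vanish :: "nat \<Rightarrow> int list \<Rightarrow> nat \<Rightarrow> bool" where
  "face_vanish k cs f \<longleftrightarrow> (let e = edge_chain f in
     seg_vanish k cs (e ! 0) (e ! 1) \<and> seg_vanish k cs (e ! 1) (e ! 2) \<and> seg_vanish k cs (e ! 2) (e ! 3))"

definition exit_vanish :: "nat \<Rightarrow> int list \<Rightarrow> int3 \<Rightarrow> bool" where
  "exit_vanish k cs w \<longleftrightarrow> (fst w > 0 \<longrightarrow> face_vanish k cs 0) \<and> (fst (snd w) > 0 \<longrightarrow> face_vanish k cs 1) \<and>
     (snd (snd w) > 0 \<longrightarrow> face_vanish k cs 2)"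

definition row_ok :: "int list \<Rightarrow> int3 \<Rightarrow> int3 \<Rightarrow> int3 \<Rightarrow> bool" where
  "row_ok cs w3 w4 w5 \<longleftrightarrow> exit_vanish 3 cs w5 \<and> exit_vanish 2 (dirs cs w5) w4 \<and>
     exit_vanish 1 (dirs (dirs cs w5) w4) w3"

text \<open>1296 is 7776 / 6, the 6 coming from three derivatives of a cube. Inside the triangle
  each corner base is the positive side of a single line, so its indicator is one step function; the
  last base lies between two lines and is a larger corner minus a smaller one.\<close>

definition base_row :: "int3 \<times> int3 \<times> int3 \<Rightarrow> int list" where
  "base_row b = (
     if b = ((3,0,0), (2,1,0), (2,0,1)) then [1296,0,0,0, 0,0,0,0, 0,0,0,0, 0,0,0,0,0,0]
     else if b = ((0,3,0), (1,2,0), (0,2,1)) then [0,0,0,0, 1296,0,0,0, 0,0,0,0, 0,0,0,0,0,0]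
     else if b = ((0,0,3), (0,1,2), (1,0,2)) then [0,0,0,0, 0,0,0,0, 1296,0,0,0, 0,0,0,0,0,0]
     else [-1296,0,1296,0, 0,0,0,0, 0,0,0,0, 0,0,0,0,0,0])"

text \<open>The last ten forms are positive inside the triangle, so after three derivatives they
  contribute only the constant \<open>sum_list (drop 18 ds)\<close>.\<close>

definition base_ok :: "int3 \<times> int3 \<times> int3 \<Rightarrow> int list \<Rightarrow> bool" where
  "base_ok b ds \<longleftrightarrow> take 18 ds = base_row b \<and> sum_list (drop 18 ds) = 0"

text \<open>Certificate for three successive integrations along \<open>w3\<close>, \<open>w4\<close>, \<open>w5\<close>: the third mixed derivative
  is the indicator of the cone over the base, and each antiderivative vanishes on the sides through
  which its rays leave the triangle.\<close>

definition unit_ok :: "int list \<Rightarrow> (int3 \<times> int3 \<times> int3) \<times> int3 \<times> int3 \<times> int3 \<Rightarrow> bool" where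
  "unit_ok cs bw = (case bw of (b, w3, w4, w5) \<Rightarrow> row_ok cs w3 w4 w5 \<and> base_ok b (dirs (dirs (dirs cs w5) w4) w3))"

lemma lvals_simps:
  "lvals (3, 0, 0) = [3, 6, 6, 6, -6, -12, -3, -3, -6, -3, -12, -3, 0, 0, 3, -6, 3, -6, 3, 0, 0, 3, 6, 0, 0, 3, 6, 3]"
  "lvals (2, 1, 0) = [0, 0, 3, 3, -3, -6, 0, 0, -6, -6, -9, -3, 1, -2, 2, -4, 0, -3, 2, 1, 0, 4, 5, 1, 2, 2, 4, 3]"
  "lvals (1, 2, 0) = [-3, -6, 0, 0, 0, 0, 3, 3, -6, -9, -6, -3, 2, -4, 1, -2, -3, 0, 1, 2, 0, 5, 4, 2, 4, 1, 2, 3]"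
  "lvals (0, 3, 0) = [-6, -12, -3, -3, 3, 6, 6, 6, -6, -12, -3, -3, 3, -6, 0, 0, -6, 3, 0, 3, 0, 6, 3, 3, 6, 0, 0, 3]"
  "lvals (0, 2, 1) = [-6, -9, -6, -3, 0, 3, 0, 3, -3, -6, 0, 0, 0, -3, -2, 1, -4, 2, 0, 2, 1, 4, 2, 4, 5, 2, 1, 3]"
  "lvals (0, 1, 2) = [-6, -6, -9, -3, -3, 0, -6, 0, 0, 0, 3, 3, -3, 0, -4, 2, -2, 1, 0, 1, 2, 2, 1, 5, 4, 4, 2, 3]"
  "lvals (0, 0, 3) = [-6, -3, -12, -3, -6, -3, -12, -3, 3, 6, 6, 6, -6, 3, -6, 3, 0, 0, 0, 0, 3, 0, 0, 6, 3, 6, 3, 3]"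
  "lvals (1, 0, 2) = [-3, 0, -6, 0, -6, -6, -9, -3, 0, 3, 0, 3, -4, 2, -3, 0, 1, -2, 1, 0, 2, 1, 2, 4, 2, 5, 4, 3]"
  "lvals (2, 0, 1) = [0, 3, 0, 3, -6, -9, -6, -3, -3, 0, -6, 0, -2, 1, 0, -3, 2, -4, 2, 0, 1, 2, 4, 2, 1, 4, 5, 3]"
  by (simp_all add: lvals_def lform_list_def)

lemmas unit_simps = base_ok_def base_row_def unit_ok_def row_ok_def exit_vanish_def face_vanish_def edge_chain_def seg_vanish_def
  exps_def lvals_simps isum_def ipos_def dirs_def

lemma unit_ok_0: "unit_ok (coeff_list ! 0) (knot_list ! 0)"
  by (simp add: unit_simps knot_list_def coeff_list_def)
lemma unit_ok_1: "unit_ok (coeff_list ! 1) (knot_list ! 1)"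
  by (simp add: unit_simps knot_list_def coeff_list_def)
lemma unit_ok_2: "unit_ok (coeff_list ! 2) (knot_list ! 2)"
  by (simp add: unit_simps knot_list_def coeff_list_def)
lemma unit_ok_3: "unit_ok (coeff_list ! 3) (knot_list ! 3)"
  by (simp add: unit_simps knot_list_def coeff_list_def)
lemma unit_ok_4: "unit_ok (coeff_list ! 4) (knot_list ! 4)"
  by (simp add: unit_simps knot_list_def coeff_list_def)
lemma unit_ok_5: "unit_ok (coeff_list ! 5) (knot_list ! 5)"
  by (simp add: unit_simps knot_list_def coeff_list_def)
lemma unit_ok_6: "unit_ok (coeff_list ! 6) (knot_list ! 6)"
  by (simp add: unit_simps knot_list_def coeff_list_def)
lemma unit_ok_7: "unit_ok (coeff_list ! 7) (knot_list ! 7)"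
  by (simp add: unit_simps knot_list_def coeff_list_def)
lemma unit_ok_8: "unit_ok (coeff_list ! 8) (knot_list ! 8)"
  by (simp add: unit_simps knot_list_def coeff_list_def)
lemma unit_ok_9: "unit_ok (coeff_list ! 9) (knot_list ! 9)"
  by (simp add: unit_simps knot_list_def coeff_list_def)
lemma unit_ok_10: "unit_ok (coeff_list ! 10) (knot_list ! 10)"
  by (simp add: unit_simps knot_list_def coeff_list_def)
lemma unit_ok_11: "unit_ok (coeff_list ! 11) (knot_list ! 11)"
  by (simp add: unit_simps knot_list_def coeff_list_def)
lemma unit_ok_12: "unit_ok (coeff_list ! 12) (knot_list ! 12)"
  by (simp add: unit_simps knot_list_def coeff_list_def)
lemma unit_ok_13: "unit_ok (coeff_list ! 13) (knot_list ! 13)"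
  by (simp add: unit_simps knot_list_def coeff_list_def)
lemma unit_ok_14: "unit_ok (coeff_list ! 14) (knot_list ! 14)"
  by (simp add: unit_simps knot_list_def coeff_list_def)
lemma unit_ok_15: "unit_ok (coeff_list ! 15) (knot_list ! 15)"
  by (simp add: unit_simps knot_list_def coeff_list_def)
lemma unit_ok_16: "unit_ok (coeff_list ! 16) (knot_list ! 16)"
  by (simp add: unit_simps knot_list_def coeff_list_def)
lemma unit_ok_17: "unit_ok (coeff_list ! 17) (knot_list ! 17)"
  by (simp add: unit_simps knot_list_def coeff_list_def)
lemma unit_ok_18: "unit_ok (coeff_list ! 18) (knot_list ! 18)"
  by (simp add: unit_simps knot_list_def coeff_list_def)
lemma unit_ok_19: "unit_ok (coeff_list ! 19) (knot_list ! 19)"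
  by (simp add: unit_simps knot_list_def coeff_list_def)
lemma unit_ok_20: "unit_ok (coeff_list ! 20) (knot_list ! 20)"
  by (simp add: unit_simps knot_list_def coeff_list_def)
lemma unit_ok_21: "unit_ok (coeff_list ! 21) (knot_list ! 21)"
  by (simp add: unit_simps knot_list_def coeff_list_def)
lemma unit_ok_22: "unit_ok (coeff_list ! 22) (knot_list ! 22)"
  by (simp add: unit_simps knot_list_def coeff_list_def)
lemma unit_ok_23: "unit_ok (coeff_list ! 23) (knot_list ! 23)"
  by (simp add: unit_simps knot_list_def coeff_list_def)
lemma unit_ok_24: "unit_ok (coeff_list ! 24) (knot_list ! 24)"
  by (simp add: unit_simps knot_list_def coeff_list_def)
lemma unit_ok_25: "unit_ok (coeff_list ! 25) (knot_list ! 25)"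
  by (simp add: unit_simps knot_list_def coeff_list_def)
lemma unit_ok_26: "unit_ok (coeff_list ! 26) (knot_list ! 26)"
  by (simp add: unit_simps knot_list_def coeff_list_def)
lemma unit_ok_27: "unit_ok (coeff_list ! 27) (knot_list ! 27)"
  by (simp add: unit_simps knot_list_def coeff_list_def)

lemma less28E: "i < (28::nat) \<Longrightarrow> P 0 \<Longrightarrow> P 1 \<Longrightarrow> P 2 \<Longrightarrow> P 3 \<Longrightarrow> P 4 \<Longrightarrow> P 5 \<Longrightarrow> P 6 \<Longrightarrow> P 7 \<Longrightarrow> P 8 \<Longrightarrow> P 9 \<Longrightarrow>
  P 10 \<Longrightarrow> P 11 \<Longrightarrow> P 12 \<Longrightarrow> P 13 \<Longrightarrow> P 14 \<Longrightarrow> P 15 \<Longrightarrow> P 16 \<Longrightarrow> P 17 \<Longrightarrow> P 18 \<Longrightarrow> P 19 \<Longrightarrow>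
  P 20 \<Longrightarrow> P 21 \<Longrightarrow> P 22 \<Longrightarrow> P 23 \<Longrightarrow> P 24 \<Longrightarrow> P 25 \<Longrightarrow> P 26 \<Longrightarrow> P 27 \<Longrightarrow> P i"
  by (cases i rule: nat.exhaust; simp?)  (auto simp: numeral_eq_Suc less_Suc_eq)

lemma unit_ok_all: "i < 28 \<Longrightarrow> unit_ok (coeff_list ! i) (knot_list ! i)"
  by (rule less28E[where P = "\<lambda>i. unit_ok (coeff_list ! i) (knot_list ! i)",
    OF _ unit_ok_0 unit_ok_1 unit_ok_2 unit_ok_3 unit_ok_4 unit_ok_5 unit_ok_6
    unit_ok_7 unit_ok_8 unit_ok_9 unit_ok_10 unit_ok_11 unit_ok_12 unit_ok_13
    unit_ok_14 unit_ok_15 unit_ok_16 unit_ok_17 unit_ok_18 unit_ok_19 unit_ok_20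
    unit_ok_21 unit_ok_22 unit_ok_23 unit_ok_24 unit_ok_25 unit_ok_26 unit_ok_27])

section \<open>Volumes under linear maps and translations; hulls of indexed families\<close>

lemma Basis_triple: "(Basis :: (real \<times> real \<times> real) set) = {(1, 0, 0), (0, 1, 0), (0, 0, 1)}"
  by (simp add: Basis_prod_def zero_prod_def image_Un insert_commute)

text \<open>Identifies triples with \<open>real^3\<close> as measure spaces, so that the determinant
  formula for the volume of a linear image can be applied to sets of triples.\<close>

lemma distr_lborel_vector3:
  "distr lborel lborel (\<lambda>(a, b, c). vector [a, b, c] :: real^3) = (lborel :: (real^3) measure)"
proof (rule lborel_eqI[symmetric])
  let ?f = "\<lambda>(a, b, c). vector [a, b, c] :: real^3"
  have lin: "?f = (\<lambda>p. fst p *\<^sub>R axis 1 1 + fst (snd p) *\<^sub>R axis 2 1 + snd (snd p) *\<^sub>R axis 3 1)"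
    by (auto simp: fun_eq_iff vec_eq_iff forall_3 axis_def)
  have [measurable]: "?f \<in> borel_measurable borel"
    unfolding lin by (intro borel_measurable_continuous_onI continuous_intros)
  fix l u :: "real^3"
  assume le: "\<And>b. b \<in> Basis \<Longrightarrow> l \<bullet> b \<le> u \<bullet> b"
  have le': "l $ i \<le> u $ i" for i using le[of "axis i 1"] by (simp add: inner_axis axis_in_Basis_iff)
  have "?f -` box l u = box (l$1, l$2, l$3) (u$1, u$2, u$3)"
  proof (rule set_eqI)
    fix p :: "real \<times> real \<times> real"
    show "p \<in> ?f -` box l u \<longleftrightarrow> p \<in> box (l$1, l$2, l$3) (u$1, u$2, u$3)"
      by (cases p) (simp add: mem_box_cart forall_3 mem_box Basis_triple)
  qed
  then have "emeasure (distr lborel lborel ?f) (box l u) = emeasure lborel (box (l$1, l$2, l$3) (u$1, u$2, u$3))"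
    by (simp add: emeasure_distr)
  also have "\<dots> = (\<Prod>b\<in>Basis. ((u$1, u$2, u$3) - (l$1, l$2, l$3)) \<bullet> b)"
    by (rule emeasure_lborel_box) (use le' in \<open>auto simp: Basis_triple\<close>)
  also have "\<dots> = (u$1 - l$1) * (u$2 - l$2) * (u$3 - l$3)"
    by (simp add: Basis_triple mult.assoc)
  also have "\<dots> = (\<Prod>i\<in>UNIV. (u - l) $ i)"
    unfolding UNIV_3 by (simp add: mult.assoc)
  also have "\<dots> = (\<Prod>b\<in>Basis. (u - l) \<bullet> b)"
  proof -
    have "(Basis :: (real^3) set) = (\<lambda>i. axis i 1) ` UNIV" by (auto simp: Basis_vec_def)
    moreover have "inj (\<lambda>i. axis i 1 :: real^3)" by (auto simp: inj_on_def axis_eq_axis)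
    moreover have "prod ((\<bullet>) (u - l)) (range (\<lambda>i. axis i 1)) = prod ((\<bullet>) (u - l) \<circ> (\<lambda>i. axis i 1)) UNIV"
      by (rule prod.reindex[OF calculation(2)])
    ultimately have "(\<Prod>b\<in>Basis. (u - l) \<bullet> b) = prod ((\<bullet>) (u - l) \<circ> (\<lambda>i. axis i 1)) UNIV"
      by metis
    then show ?thesis by (simp add: o_def inner_axis)
  qed
  finally show "emeasure (distr lborel lborel ?f) (box l u) = ennreal (\<Prod>b\<in>Basis. (u - l) \<bullet> b)" .
qed simp

text \<open>\<open>D\<close> is the absolute determinant and may be 0 at this stage; in the quotient
  that defines a simplex spline it will cancel.\<close>

lemma linear_image_scales_volume:
  fixes M :: "real \<times> real \<times> real \<Rightarrow> real \<times> real \<times> real"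
  assumes M: "linear M"
  obtains D where "0 \<le> D" "\<And>S. compact S \<Longrightarrow> measure lborel (M ` S) = D * measure lborel S"
proof -
  define f where "f = (\<lambda>(a, b, c). vector [a, b, c] :: real^3)"
  define g where "g v = (v $ 1, v $ 2, v $ 3)" for v :: "real^3"
  have fg: "f (g v) = v" "g (f p) = p" for v p
    by (simp add: f_def g_def vec_eq_iff forall_3) (cases p, simp add: f_def g_def)
  have flin: "f = (\<lambda>p. fst p *\<^sub>R axis 1 1 + fst (snd p) *\<^sub>R axis 2 1 + snd (snd p) *\<^sub>R axis 3 1)"
    by (auto simp: fun_eq_iff vec_eq_iff forall_3 axis_def f_def)
  have linf: "linear f" unfolding flin by (rule linearI) (auto simp: algebra_simps)
  have ling: "linear g" by (rule linearI) (auto simp: g_def)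
  have contf: "continuous_on S f" for S using linf by (simp add: linear_continuous_on linear_conv_bounded_linear)
  have contM: "continuous_on S M" for S using M by (simp add: linear_continuous_on linear_conv_bounded_linear)
  have meas: "measure lebesgue (f ` S) = measure lborel S" if S: "compact S" for S
  proof -
    have cf: "compact (f ` S)" using S contf compact_continuous_image by blast
    have "inj f" by (rule inj_on_inverseI[of _ g]) (rule fg(2))
    then have "f -` (f ` S) = S" by (rule inj_vimage_image_eq)
    moreover have "f \<in> borel_measurable borel" using contf borel_measurable_continuous_onI by blast
    ultimately have "measure (distr lborel lborel f) (f ` S) = measure lborel S"
      using cf by (subst measure_distr) (auto dest: compact_imp_closed)
    moreover have "measure lebesgue (f ` S) = measure lborel (f ` S)"
      using cf by (intro measure_completion) (auto dest: compact_imp_closed)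
    ultimately show ?thesis using distr_lborel_vector3 by (simp add: f_def)
  qed
  define A where "A = f \<circ> M \<circ> g"
  have linA: "linear A" unfolding A_def by (intro linear_compose linf ling M)
  show ?thesis
  proof (rule that[of "\<bar>det (matrix A)\<bar>"])
    fix S :: "(real \<times> real \<times> real) set" assume S: "compact S"
    have MS: "compact (M ` S)" using S contM compact_continuous_image by blast
    have fS: "compact (f ` S)" using S contf compact_continuous_image by blast
    have "f ` (M ` S) = A ` (f ` S)" by (auto simp: A_def fg image_image)
    moreover have "measure lebesgue (A ` (f ` S)) = \<bar>det (matrix A)\<bar> * measure lebesgue (f ` S)"
      using measure_linear_image[OF linA lmeasurable_compact[OF fS]] .
    ultimately show "measure lborel (M ` S) = \<bar>det (matrix A)\<bar> * measure lborel S"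
      using meas[OF MS] meas[OF S] by simp
  qed simp
qed

text \<open>Weights are attached to indices rather than to points, so that the six weights of a
  lifted simplex can be read as weights of its knots, which repeat.\<close>

lemma convex_hull_set_list:
  fixes q :: "nat \<Rightarrow> 'a::real_vector"
  shows "convex hull (q ` {..<n}) = {\<Sum>i<n. u i *\<^sub>R q i | u. (\<forall>i<n. 0 \<le> u i) \<and> (\<Sum>i<n. u i) = 1}" (is "_ = ?R")
proof
  show "convex hull (q ` {..<n}) \<subseteq> ?R"
  proof (rule hull_minimal)
    show "q ` {..<n} \<subseteq> ?R"
    proof
      fix x assume "x \<in> q ` {..<n}"
      then obtain k where k: "k < n" "x = q k" by auto
      then have "(\<Sum>i<n. (if i = k then 1 else 0) *\<^sub>R q i) = x"
        by (simp add: if_distrib[of "\<lambda>c. c *\<^sub>R _"] sum.delta cong: if_cong)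
      moreover have "(\<Sum>i<n. (if i = k then 1 else 0 :: real)) = 1" using k by simp
      ultimately show "x \<in> ?R" by (auto intro!: exI[of _ "\<lambda>i. if i = k then 1 else 0"])
    qed
    show "convex ?R"
    proof (rule convexI)
      fix x y and a b :: real assume x: "x \<in> ?R" and y: "y \<in> ?R" and ab: "0 \<le> a" "0 \<le> b" "a + b = 1"
      from x obtain u where u: "\<forall>i<n. 0 \<le> u i" "(\<Sum>i<n. u i) = 1" "x = (\<Sum>i<n. u i *\<^sub>R q i)" by auto
      from y obtain v where v: "\<forall>i<n. 0 \<le> v i" "(\<Sum>i<n. v i) = 1" "y = (\<Sum>i<n. v i *\<^sub>R q i)" by auto
      have "(\<Sum>i<n. a * u i + b * v i) = a * (\<Sum>i<n. u i) + b * (\<Sum>i<n. v i)"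
        by (simp add: sum.distrib sum_distrib_left)
      then have "(\<Sum>i<n. a * u i + b * v i) = 1" using u v ab by simp
      moreover have "a *\<^sub>R x + b *\<^sub>R y = (\<Sum>i<n. (a * u i + b * v i) *\<^sub>R q i)"
        by (simp add: u v scaleR_sum_right sum.distrib scaleR_left_distrib)
      moreover have "\<forall>i<n. 0 \<le> a * u i + b * v i" using u v ab by simp
      ultimately show "a *\<^sub>R x + b *\<^sub>R y \<in> ?R"
        unfolding mem_Collect_eq by (intro exI[of _ "\<lambda>i. a * u i + b * v i"] conjI)
    qed
  qed
  show "?R \<subseteq> convex hull (q ` {..<n})"
  proof
    fix x assume "x \<in> ?R"
    then obtain u where u: "\<forall>i<n. 0 \<le> u i" "(\<Sum>i<n. u i) = 1" "x = (\<Sum>i<n. u i *\<^sub>R q i)" by auto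
    show "x \<in> convex hull (q ` {..<n})" unfolding u(3)
      by (rule convex_sum) (use u in \<open>auto intro: hull_inc\<close>)
  qed
qed

text \<open>Knot multisets are listed in one order and integrated in another; a reordering of the
  knots is matched by a reordering of the lifted vertices above them.\<close>

lemma mset_map_eq_ex:
  "mset (map f xs) = mset ys \<Longrightarrow> \<exists>zs. mset zs = mset xs \<and> map f zs = ys"
proof (induction ys arbitrary: xs)
  case (Cons y ys)
  then have "y \<in> set (map f xs)" by (metis list.set_intros(1) set_mset_mset)
  then obtain x where x: "x \<in> set xs" "f x = y" by auto
  have e: "mset xs = add_mset x (mset (remove1 x xs))" using x by simp
  have "mset (map f xs) = add_mset (f x) (mset (map f (remove1 x xs)))" unfolding mset_map e by simp
  then have "mset (map f (remove1 x xs)) = mset ys" using Cons.prems x(2) by simp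
  from Cons.IH[OF this] obtain zs where "mset zs = mset (remove1 x xs)" "map f zs = ys" by auto
  then show ?case using x by (intro exI[of _ "x # zs"]) simp
qed simp
lemma measure_lborel_translate:
  fixes S :: "'a::euclidean_space set"
  assumes "S \<in> sets borel" shows "emeasure lborel ((+) v ` S) = emeasure lborel S"
proof -
  have "(+) v ` S = (\<lambda>x. - v + x) -` S"
  proof safe
    fix x assume "- v + x \<in> S"
    then show "x \<in> (+) v ` S" by (intro image_eqI[of _ _ "- v + x"]) auto
  qed auto
  moreover have "emeasure (distr lborel borel ((+) (- v))) S = emeasure lborel ((\<lambda>x. - v + x) -` S \<inter> space lborel)"
    using assms by (intro emeasure_distr) auto
  ultimately show ?thesis using lborel_distr_plus[of "- v"] by simp
qed

section \<open>Volumes of cone slices\<close>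

type_synonym hpt = "real \<times> real \<times> real"

definition crd :: "nat \<Rightarrow> hpt \<Rightarrow> real" where
  "crd i z = (if i = 0 then fst z else if i = 1 then fst (snd z) else snd (snd z))"

definition pos3 :: "hpt \<Rightarrow> bool" where "pos3 z \<longleftrightarrow> (\<forall>i<3. 0 < crd i z)"
definition nonneg3 :: "hpt \<Rightarrow> bool" where "nonneg3 z \<longleftrightarrow> (\<forall>i<3. 0 \<le> crd i z)"

lemma crd_diff [simp]: "crd i (x - y) = crd i x - crd i y"
  and crd_add [simp]: "crd i (x + y) = crd i x + crd i y"
  and crd_scaleR [simp]: "crd i (c *\<^sub>R x) = c * crd i x"
  and crd_zero [simp]: "crd i 0 = 0"
  by (auto simp: crd_def)

lemma crd_eqI: "(\<And>i. i < 3 \<Longrightarrow> crd i x = crd i y) \<Longrightarrow> x = y"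
proof -
  assume a: "\<And>i. i < 3 \<Longrightarrow> crd i x = crd i y"
  show "x = y" using a[of 0] a[of 1] a[of 2] by (auto simp: crd_def prod_eq_iff)
qed

text \<open>Truncated power; in particular \<open>pw 0\<close> is the indicator of the positive reals.\<close>

definition pw :: "nat \<Rightarrow> real \<Rightarrow> real" where "pw k u = (if u > 0 then u ^ k else 0)"

lemma pw_Suc: "pw (Suc k) u = max u 0 ^ Suc k"
  by (auto simp: pw_def max_def)

lemma continuous_on_pw [continuous_intros]:
  "continuous_on S f \<Longrightarrow> continuous_on S (\<lambda>x. pw (Suc k) (f x))"
  unfolding pw_Suc by (intro continuous_intros)

lemma borel_measurable_pw [measurable]: "pw k \<in> borel_measurable borel"
  unfolding pw_def by measurable

lemma DERIV_pw: 
  assumes "u \<noteq> 0" shows "(pw (Suc k) has_real_derivative (real (Suc k) * pw k u)) (at u)"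
proof (cases "u > 0")
  case True
  have "((\<lambda>x. x ^ Suc k) has_real_derivative (real (Suc k) * u ^ k)) (at u)"
    using DERIV_pow[of "Suc k" u UNIV] by simp
  then have "(pw (Suc k) has_real_derivative (real (Suc k) * u ^ k)) (at u)"
    by (rule has_field_derivative_transform_within_open[where S="{0<..}"])
       (use True in \<open>auto simp: pw_def\<close>)
  then show ?thesis using True by (simp add: pw_def)
next
  case False
  have "((\<lambda>x. 0) has_real_derivative 0) (at u)" by simp
  then have "(pw (Suc k) has_real_derivative 0) (at u)"
    by (rule has_field_derivative_transform_within_open[where S="{..<0}"])
       (use False assms in \<open>auto simp: pw_def\<close>)
  then show ?thesis using False by (simp add: pw_def)
qed

lemma DERIV_pw_affine:
  assumes "b \<noteq> 0 \<Longrightarrow> a - t * b \<noteq> 0"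
  shows "((\<lambda>t. pw (Suc k) (a - t * b)) has_real_derivative - (real (Suc k) * b * pw k (a - t * b))) (at t)"
proof (cases "b = 0")
  case False
  have "((\<lambda>t. a - t * b) has_real_derivative - b) (at t)"
    by (auto intro!: derivative_eq_intros)
  from DERIV_chain2[OF DERIV_pw this, of k] assms False show ?thesis
    by (simp add: algebra_simps)
qed auto

lemma exit_time:
  assumes z: "pos3 z" and w: "nonneg3 w" "w \<noteq> 0"
  obtains T i where "0 < T" "i < 3" "0 < crd i w" "crd i (z - T *\<^sub>R w) = 0" "nonneg3 (z - T *\<^sub>R w)"
    "\<And>t. 0 \<le> t \<Longrightarrow> t < T \<Longrightarrow> pos3 (z - t *\<^sub>R w)"
    "\<And>t. t > T \<Longrightarrow> crd i (z - t *\<^sub>R w) < 0"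
proof -
  define K where "K = {i. i < 3 \<and> 0 < crd i w}"
  define r where "r i = crd i z / crd i w" for i
  have fin: "finite K" unfolding K_def by auto
  have ne: "K \<noteq> {}"
  proof
    assume "K = {}"
    then have "\<And>i. i < 3 \<Longrightarrow> crd i w = crd i 0" using w(1) unfolding K_def nonneg3_def by force
    then show False using crd_eqI w(2) by blast
  qed
  \<comment> \<open>The side reached first minimises the time \<open>crd i z / crd i w\<close> among
    the coordinates that decrease along the ray.\<close>
  obtain i where i: "i \<in> K" "r i = Min (r ` K)" using Min_in[of "r ` K"] fin ne by fastforce
  have le: "r i \<le> r j" if "j \<in> K" for j using i(2) that fin by simp
  have ri: "0 < r i" using i(1) z unfolding K_def r_def pos3_def by auto
  have nn: "0 \<le> crd j w" if "j < 3" for j using w that unfolding nonneg3_def by auto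
  show ?thesis
  proof (rule that[of "r i" i])
    show "crd i (z - r i *\<^sub>R w) = 0" using i(1) by (auto simp: K_def r_def)
    show "nonneg3 (z - r i *\<^sub>R w)" unfolding nonneg3_def
    proof (intro allI impI)
      fix j :: nat assume j: "j < 3"
      show "0 \<le> crd j (z - r i *\<^sub>R w)"
      proof (cases "crd j w > 0")
        case True
        then have "r i \<le> crd j z / crd j w" using le[of j] j by (auto simp: K_def r_def)
        then show ?thesis using True by (simp add: field_simps)
      next
        case False
        then show ?thesis using nn[OF j] z j by (auto simp: pos3_def intro: less_imp_le)
      qed
    qed
    show "pos3 (z - t *\<^sub>R w)" if t: "0 \<le> t" "t < r i" for t unfolding pos3_def
    proof (intro allI impI)
      fix j :: nat assume j: "j < 3"
      show "0 < crd j (z - t *\<^sub>R w)"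
      proof (cases "crd j w > 0")
        case True
        then have "t < crd j z / crd j w" using le[of j] j t by (auto simp: K_def r_def)
        then show ?thesis using True by (simp add: field_simps)
      next
        case False
        then show ?thesis using nn[OF j] z j by (auto simp: pos3_def intro: less_imp_le)
      qed
    qed
    show "crd i (z - t *\<^sub>R w) < 0" if "r i < t" for t
      using i(1) that by (auto simp: K_def r_def field_simps)
  qed (use i ri in \<open>auto simp: K_def\<close>)
qed

text \<open>Fundamental theorem of calculus along the ray \<open>z - t w\<close>: the antiderivative
  vanishes where the ray leaves the positive cone.\<close>

lemma ray_integral:
  fixes g :: "hpt \<Rightarrow> ennreal" and c :: "nat \<Rightarrow> real" and L :: "nat \<Rightarrow> hpt"
  assumes g: "\<And>y. pos3 y \<Longrightarrow> (\<And>j. j < n \<Longrightarrow> c j * (L j \<bullet> w) \<noteq> 0 \<Longrightarrow> L j \<bullet> y \<noteq> 0) \<Longrightarrow>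
       g y = ennreal (\<Sum>j<n. real (Suc k) * c j * (L j \<bullet> w) * pw k (L j \<bullet> y)) \<and>
       0 \<le> (\<Sum>j<n. real (Suc k) * c j * (L j \<bullet> w) * pw k (L j \<bullet> y))"
    and g0: "\<And>y. \<not> nonneg3 y \<Longrightarrow> g y = 0"
    and w: "nonneg3 w" "w \<noteq> 0"
    and face: "\<And>y i. nonneg3 y \<Longrightarrow> i < 3 \<Longrightarrow> 0 < crd i w \<Longrightarrow> crd i y = 0 \<Longrightarrow>
       (\<Sum>j<n. c j * pw (Suc k) (L j \<bullet> y)) = 0"
    and z: "pos3 z"
  shows "(\<integral>\<^sup>+t. indicator {0..} t * g (z - t *\<^sub>R w) \<partial>lborel) = ennreal (\<Sum>j<n. c j * pw (Suc k) (L j \<bullet> z)) \<and>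
     0 \<le> (\<Sum>j<n. c j * pw (Suc k) (L j \<bullet> z))"
proof -
  obtain T i where T: "0 < T" "i < 3" "0 < crd i w" "crd i (z - T *\<^sub>R w) = 0" "nonneg3 (z - T *\<^sub>R w)"
    and Tpos: "\<And>t. 0 \<le> t \<Longrightarrow> t < T \<Longrightarrow> pos3 (z - t *\<^sub>R w)"
    and Tneg: "\<And>t. t > T \<Longrightarrow> crd i (z - t *\<^sub>R w) < 0"
    using exit_time[OF z w] by metis
  define \<phi> where "\<phi> t = (\<Sum>j<n. c j * pw (Suc k) (L j \<bullet> z - t * (L j \<bullet> w)))" for t
  define \<psi> where "\<psi> t = (\<Sum>j<n. real (Suc k) * c j * (L j \<bullet> w) * pw k (L j \<bullet> z - t * (L j \<bullet> w)))" for t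
  \<comment> \<open>The finitely many times at which the ray crosses a breakline. There the
    antiderivative may have a kink and \<open>g\<close> may differ from the sum; neither affects the
    integral.\<close>
  define X where "X = (\<Union>j\<in>{j. j < n \<and> L j \<bullet> w \<noteq> 0}. {(L j \<bullet> z) / (L j \<bullet> w)})"
  have finX: "finite X" unfolding X_def by auto
  have notX: "L j \<bullet> z - t * (L j \<bullet> w) \<noteq> 0" if "j < n" "L j \<bullet> w \<noteq> 0" "t \<notin> X" for j t
    using that unfolding X_def by (auto simp: field_simps)
  have der: "(\<phi> has_real_derivative - \<psi> t) (at t)" if "t \<notin> X" for t
    unfolding \<phi>_def \<psi>_def sum_negf[symmetric]
  proof (rule DERIV_sum)
    fix j assume "j \<in> {..<n}"
    then have "((\<lambda>t. pw (Suc k) (L j \<bullet> z - t * (L j \<bullet> w))) has_real_derivative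
        - (real (Suc k) * (L j \<bullet> w) * pw k (L j \<bullet> z - t * (L j \<bullet> w)))) (at t)"
      using notX that by (intro DERIV_pw_affine) auto
    from DERIV_cmult[OF this, of "c j"]
    show "((\<lambda>t. c j * pw (Suc k) (L j \<bullet> z - t * (L j \<bullet> w))) has_real_derivative
        - (real (Suc k) * c j * (L j \<bullet> w) * pw k (L j \<bullet> z - t * (L j \<bullet> w)))) (at t)"
      by (simp only: mult_minus_right mult.assoc mult.left_commute[of "c j"])
  qed
  have cont: "continuous_on A \<phi>" for A unfolding \<phi>_def by (intro continuous_intros)
  have "((\<lambda>t. - \<psi> t) has_integral \<phi> T - \<phi> 0) {0..T}"
  proof (rule fundamental_theorem_of_calculus_interior_strong[OF finX])
    show "(\<phi> has_vector_derivative - \<psi> t) (at t)" if "t \<in> {0<..<T} - X" for t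
      using der[of t] that by (simp add: has_real_derivative_iff_has_vector_derivative)
  qed (use T cont in auto)
  from has_integral_neg[OF this] have "(\<psi> has_integral \<phi> 0 - \<phi> T) {0..T}" by simp
  moreover have "\<phi> T = 0" using face[OF T(5) T(2) T(3) T(4)] 
    by (simp add: \<phi>_def inner_diff_right)
  ultimately have I: "(\<psi> has_integral \<phi> 0) {0..T}" by simp
  define \<Omega> where "\<Omega> = {0<..<T} - X"
  have neg: "negligible (X \<union> {0, T})" using finX by (intro negligible_finite) auto
  have "(\<psi> has_integral \<phi> 0) {0..T} \<longleftrightarrow> (\<psi> has_integral \<phi> 0) \<Omega>"
    by (rule has_integral_spike_set_eq; rule negligible_subset[OF neg]) (auto simp: \<Omega>_def)
  with I have I2: "(\<psi> has_integral \<phi> 0) \<Omega>" by blast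
  have inn: "L j \<bullet> (z - t *\<^sub>R w) = L j \<bullet> z - t * (L j \<bullet> w)" for j t by (simp add: inner_diff_right)
  have gt: "g (z - t *\<^sub>R w) = ennreal (\<psi> t) \<and> 0 \<le> \<psi> t" if "t \<in> \<Omega>" for t
  proof -
    have "pos3 (z - t *\<^sub>R w)" using that Tpos unfolding \<Omega>_def by auto
    from g[OF this] that notX show ?thesis unfolding \<psi>_def inn \<Omega>_def by force
  qed
  have "(\<integral>\<^sup>+t. indicator {0..} t * g (z - t *\<^sub>R w) \<partial>lborel) = (\<integral>\<^sup>+t. ennreal (indicator \<Omega> t * \<psi> t) \<partial>lborel)"
  proof (rule nn_integral_cong_AE)
    have "AE t in lborel. t \<notin> X \<union> {0, T}"
      using finX by (intro AE_not_in finite_imp_null_set_lborel) auto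
    then show "AE t in lborel. indicator {0..} t * g (z - t *\<^sub>R w) = ennreal (indicator \<Omega> t * \<psi> t)"
    proof eventually_elim
      case (elim t)
      consider "t < 0" | "t \<in> \<Omega>" | "t > T" using elim unfolding \<Omega>_def by force
      then show ?case
      proof cases
        case 3
        then have "\<not> nonneg3 (z - t *\<^sub>R w)" using Tneg T(2) unfolding nonneg3_def by force
        moreover have "t \<notin> \<Omega>" using 3 by (auto simp: \<Omega>_def)
        ultimately show ?thesis using g0 by simp
      qed (use gt T in \<open>auto simp: \<Omega>_def indicator_def\<close>)
    qed
  qed
  also have "\<dots> = ennreal (\<phi> 0)"
    by (rule nn_integral_has_integral_lebesgue[OF _ I2]) (use gt in auto)
  finally have "(\<integral>\<^sup>+t. indicator {0..} t * g (z - t *\<^sub>R w) \<partial>lborel) = ennreal (\<phi> 0)" .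
  moreover have "0 \<le> \<phi> 0" using has_integral_nonneg[OF I2] gt by auto
  ultimately show ?thesis unfolding \<phi>_def by simp
qed

lemma ray_integral_outside:
  fixes g :: "hpt \<Rightarrow> ennreal"
  assumes g0: "\<And>y. \<not> nonneg3 y \<Longrightarrow> g y = 0" and w: "nonneg3 w" and z: "\<not> nonneg3 z"
  shows "(\<integral>\<^sup>+t. indicator {0..} t * g (z - t *\<^sub>R w) \<partial>lborel) = 0"
proof -
  obtain i where i: "i < 3" "crd i z < 0" using z unfolding nonneg3_def by force
  have "indicator {0..} t * g (z - t *\<^sub>R w) = 0" for t :: real
  proof (cases "t \<ge> 0")
    case True
    have "0 \<le> t * crd i w" using True w i unfolding nonneg3_def by auto
    then have "\<not> nonneg3 (z - t *\<^sub>R w)" unfolding nonneg3_def using i by force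
    then show ?thesis using g0 by simp
  qed auto
  then have "(\<integral>\<^sup>+t. indicator {0..} t * g (z - t *\<^sub>R w) \<partial>lborel) = (\<integral>\<^sup>+t. 0 \<partial>(lborel :: real measure))"
    by (intro nn_integral_cong)
  then show ?thesis by simp
qed

definition rp :: "int3 \<Rightarrow> hpt" where
  "rp p = (of_int (fst p), of_int (fst (snd p)), of_int (snd (snd p)))"

definition lf :: "nat \<Rightarrow> hpt" where "lf j = rp (lform_list ! j)"

definition cf :: "nat \<Rightarrow> nat \<Rightarrow> real" where "cf i j = of_int (coeff_list ! i ! j)"

definition in_cone :: "int3 \<times> int3 \<times> int3 \<Rightarrow> hpt \<Rightarrow> bool" where
  "in_cone b y \<longleftrightarrow> (\<exists>r\<ge>0. \<exists>s\<ge>0. \<exists>t\<ge>0.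
     y = r *\<^sub>R rp (fst b) + s *\<^sub>R rp (fst (snd b)) + t *\<^sub>R rp (snd (snd b)))"

lemma in_coneI:
  assumes "0 \<le> r" "0 \<le> s" "0 \<le> t"
    and "y = r *\<^sub>R rp (fst b) + s *\<^sub>R rp (fst (snd b)) + t *\<^sub>R rp (snd (snd b))"
  shows "in_cone b y"
  using assms unfolding in_cone_def by blast

lemma rp_simps [simp]: "rp (a, b, c) = (of_int a, of_int b, of_int c)"
  by (simp add: rp_def)

lemma inner_rp: "rp p \<bullet> rp q = of_int (idot p q)"
  by (cases p; cases q) simp

lemma crd_rp: "crd i (rp p) = of_int (if i = 0 then fst p else if i = 1 then fst (snd p) else snd (snd p))"
  by (simp add: crd_def rp_def)

lemma length_lform: "length lform_list = 28"
  by (simp add: lform_list_def)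

lemma length_coeff: "length coeff_list = 28" "i < 28 \<Longrightarrow> length (coeff_list ! i) = 28"
proof -
  show l: "length coeff_list = 28" by (simp add: coeff_list_def)
  have "\<forall>r\<in>set coeff_list. length r = 28" by (simp add: coeff_list_def)
  then show "i < 28 \<Longrightarrow> length (coeff_list ! i) = 28" using l nth_mem by metis
qed

lemma length_lvals [simp]: "length (lvals p) = 28"
  by (simp add: lvals_def length_lform)

lemma nth_lvals: "j < 28 \<Longrightarrow> real_of_int (lvals p ! j) = lf j \<bullet> rp p"
  by (simp add: lvals_def length_lform lf_def inner_rp)

lemma length_dirs [simp]: "length (dirs cs w) = min (length cs) 28"
  by (simp add: dirs_def)

lemma nth_dirs: "length cs = 28 \<Longrightarrow> j < 28 \<Longrightarrow> real_of_int (dirs cs w ! j) = of_int (cs ! j) * (lf j \<bullet> rp w)"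
  by (simp add: dirs_def nth_lvals[symmetric])

lemma isum_eq: 
  assumes "length cs = 28" "length xs = 28"
  shows "isum cs xs = (\<Sum>j<28. cs ! j * xs ! j)"
  using assms by (simp add: isum_def sum_list_sum_nth lessThan_atLeast0)

text \<open>If x and y do not have opposite signs, positive parts are additive along
  \<open>a * x + b * y\<close>. The condition \<open>0 < k\<close> excludes the step function, which
  is 0 at nonpositive arguments whereas a zeroth power is 1.\<close>

lemma pw_line:
  fixes x y :: int and a b :: real
  assumes "0 \<le> x * y" "0 \<le> a" "0 \<le> b" "0 < k"
  shows "pw k (a * x + b * y) = (\<Sum>r\<le>k. real (k choose r) * a ^ r * b ^ (k - r) * of_int (ipos x ^ r * ipos y ^ (k - r)))"
proof -
  have "pw k (a * x + b * y) = (a * ipos x + b * ipos y) ^ k"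
  proof (cases "x > 0 \<or> y > 0")
    case True
    then have "x \<ge> 0 \<and> y \<ge> 0" using assms(1) by (metis linorder_not_le mult_neg_pos mult_pos_neg order_less_imp_le)
    then have e: "real_of_int x = ipos x" "real_of_int y = ipos y" and n: "0 \<le> real_of_int x" "0 \<le> real_of_int y"
      by (auto simp: ipos_def)
    have "0 \<le> a * x + b * y" using assms n by simp
    then show ?thesis unfolding pw_def e using assms(4) by auto
  next
    case False
    then have "a * x \<le> 0" "b * y \<le> 0" using assms(2,3) by (auto intro: mult_nonneg_nonpos)
    then have "\<not> 0 < a * x + b * y" by linarith
    then show ?thesis using False assms(4) by (simp add: pw_def ipos_def)
  qed
  also have "\<dots> = (\<Sum>r\<le>k. real (k choose r) * (a * ipos x) ^ r * (b * ipos y) ^ (k - r))"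
    by (rule binomial_ring)
  also have "\<dots> = (\<Sum>r\<le>k. real (k choose r) * a ^ r * b ^ (k - r) * of_int (ipos x ^ r * ipos y ^ (k - r)))"
    by (intro sum.cong refl) (simp add: power_mult_distrib)
  finally show ?thesis .
qed

text \<open>No line of the split separates \<open>p\<close> from \<open>q\<close> strictly.\<close>

definition compat :: "int3 \<Rightarrow> int3 \<Rightarrow> bool" where
  "compat p q \<longleftrightarrow> list_all2 (\<lambda>x y. 0 \<le> x * y) (lvals p) (lvals q)"

lemma seg_vanishD:
  assumes s: "seg_vanish k cs p q" and k: "k \<in> {1,2,3}" and len: "length cs = 28"
    and comp: "compat p q" and ab: "0 \<le> a" "0 \<le> b"
  shows "(\<Sum>j<28. of_int (cs ! j) * pw k (lf j \<bullet> (a *\<^sub>R rp p + b *\<^sub>R rp q))) = 0"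
proof -
  define X where "X j = lvals p ! j" for j
  define Y where "Y j = lvals q ! j" for j
  have z: "(\<Sum>j<28. cs ! j * (ipos (X j) ^ r * ipos (Y j) ^ (k - r))) = 0" if "r \<le> k" for r
  proof -
    have "r \<in> set (exps k)" using that k by (auto simp: exps_def)
    then have "isum cs (map2 (\<lambda>x y. ipos x ^ r * ipos y ^ (k - r)) (lvals p) (lvals q)) = 0"
      using s by (auto simp: seg_vanish_def list_all_iff)
    then show ?thesis using len by (simp add: isum_eq X_def Y_def)
  qed
  have "(\<Sum>j<28. of_int (cs ! j) * pw k (lf j \<bullet> (a *\<^sub>R rp p + b *\<^sub>R rp q)))
      = (\<Sum>j<28. \<Sum>r\<le>k. real (k choose r) * a ^ r * b ^ (k - r) * of_int (cs ! j * (ipos (X j) ^ r * ipos (Y j) ^ (k - r))))"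
  proof (intro sum.cong refl)
    fix j :: nat assume "j \<in> {..<28}"
    then have j: "j < 28" by simp
    have "0 \<le> X j * Y j" using comp j by (auto simp: compat_def list_all2_conv_all_nth X_def Y_def)
    then have "pw k (a * X j + b * Y j) = (\<Sum>r\<le>k. real (k choose r) * a ^ r * b ^ (k - r) * of_int (ipos (X j) ^ r * ipos (Y j) ^ (k - r)))"
      using pw_line[of "X j" "Y j" a b k] ab k by auto
    moreover have "lf j \<bullet> (a *\<^sub>R rp p + b *\<^sub>R rp q) = a * X j + b * Y j"
      by (simp add: inner_add_right nth_lvals[OF j] X_def Y_def)
    ultimately show "of_int (cs ! j) * pw k (lf j \<bullet> (a *\<^sub>R rp p + b *\<^sub>R rp q))
       = (\<Sum>r\<le>k. real (k choose r) * a ^ r * b ^ (k - r) * of_int (cs ! j * (ipos (X j) ^ r * ipos (Y j) ^ (k - r))))"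
      by (simp add: sum_distrib_left mult.assoc mult.left_commute)
  qed
  also have "\<dots> = (\<Sum>r\<le>k. \<Sum>j<28. real (k choose r) * a ^ r * b ^ (k - r) * of_int (cs ! j * (ipos (X j) ^ r * ipos (Y j) ^ (k - r))))"
    by (rule sum.swap)
  also have "\<dots> = (\<Sum>r\<le>k. real (k choose r) * a ^ r * b ^ (k - r) * of_int (\<Sum>j<28. cs ! j * (ipos (X j) ^ r * ipos (Y j) ^ (k - r))))"
    by (simp only: sum_distrib_left of_int_sum)
  also have "\<dots> = 0" using z by simp
  finally show ?thesis .
qed

lemma compat_chain:
  assumes "f < 3" "m < 3"
  shows "compat (edge_chain f ! m) (edge_chain f ! Suc m)"
proof -
  have "\<forall>f\<in>{0,1,2}. \<forall>m\<in>{0,1,2}. compat (edge_chain f ! m) (edge_chain f ! Suc m)"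
    by (simp add: edge_chain_def compat_def lvals_simps)
  moreover have "f \<in> {0,1,2}" "m \<in> {0,1,2}" using assms by auto
  ultimately show ?thesis by blast
qed

text \<open>u and v are the two coordinates that survive on the side, in the order of
  \<open>edge_chain f\<close>; the rays u = 2 v and v = 2 u pass through its two interior
  knots.\<close>

lemma side_cases:
  assumes "nonneg3 y" "f < 3" "crd f y = 0"
  obtains m a b where "m < 3" "0 \<le> a" "0 \<le> b" "y = a *\<^sub>R rp (edge_chain f ! m) + b *\<^sub>R rp (edge_chain f ! Suc m)"
proof -
  define u where "u = (if f = 0 then fst (snd y) else if f = 1 then snd (snd y) else fst y)"
  define v where "v = (if f = 0 then snd (snd y) else if f = 1 then fst y else fst (snd y))"
  have uv: "0 \<le> u" "0 \<le> v"
    using assms(1)[unfolded nonneg3_def, rule_format, of 0] assms(1)[unfolded nonneg3_def, rule_format, of 1]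
      assms(1)[unfolded nonneg3_def, rule_format, of 2]
    by (auto simp: u_def v_def crd_def)
  have f: "f = 0 \<or> f = 1 \<or> f = 2" using assms(2) by auto
  consider "u \<ge> 2 * v" | "u \<le> 2 * v" "v \<le> 2 * u" | "v \<ge> 2 * u" by linarith
  then show ?thesis
  proof cases
    case 1
    show ?thesis by (rule that[of 0 "(u - 2 * v) / 3" v])
      (use 1 uv f assms(3) in \<open>auto simp: edge_chain_def u_def v_def crd_def prod_eq_iff field_simps\<close>)
  next
    case 2
    show ?thesis by (rule that[of 1 "(2 * u - v) / 3" "(2 * v - u) / 3"])
      (use 2 uv f assms(3) in \<open>auto simp: edge_chain_def u_def v_def crd_def prod_eq_iff field_simps numeral_2_eq_2[symmetric]\<close>)
  next
    case 3
    show ?thesis by (rule that[of 2 u "(v - 2 * u) / 3"])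
      (use 3 uv f assms(3) in \<open>auto simp: edge_chain_def u_def v_def crd_def prod_eq_iff field_simps numeral_3_eq_3[symmetric]\<close>)
  qed
qed

lemma exit_vanishD:
  assumes e: "exit_vanish k cs w" and k: "k \<in> {1,2,3}" and len: "length cs = 28"
    and y: "nonneg3 y" "f < 3" "crd f y = 0" and w: "0 < crd f (rp w)"
  shows "(\<Sum>j<28. of_int (cs ! j) * pw k (lf j \<bullet> y)) = 0"
proof -
  obtain m a b where m: "m < 3" "0 \<le> a" "0 \<le> b" "y = a *\<^sub>R rp (edge_chain f ! m) + b *\<^sub>R rp (edge_chain f ! Suc m)"
    using side_cases[OF y] .
  have f: "f = 0 \<or> f = 1 \<or> f = 2" using y(2) by auto
  then have "face_vanish k cs f" using e w unfolding exit_vanish_def crd_rp by auto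
  moreover have "m = 0 \<or> m = 1 \<or> m = 2" using m(1) by auto
  ultimately have "seg_vanish k cs (edge_chain f ! m) (edge_chain f ! Suc m)"
    by (auto simp: face_vanish_def Let_def numeral_2_eq_2[symmetric] numeral_3_eq_3[symmetric])
  from seg_vanishD[OF this k len compat_chain[OF y(2) m(1)] m(2,3)] show ?thesis using m(4) by simp
qed

lemma in_cone_simps:
  "in_cone ((3,0,0), (2,1,0), (2,0,1)) y \<longleftrightarrow>
     0 \<le> fst (snd y) \<and> 0 \<le> snd (snd y) \<and> 2 * fst (snd y) + 2 * snd (snd y) \<le> fst y"
  "in_cone ((0,3,0), (1,2,0), (0,2,1)) y \<longleftrightarrow>
     0 \<le> fst y \<and> 0 \<le> snd (snd y) \<and> 2 * fst y + 2 * snd (snd y) \<le> fst (snd y)"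
  "in_cone ((0,0,3), (0,1,2), (1,0,2)) y \<longleftrightarrow>
     0 \<le> fst (snd y) \<and> 0 \<le> fst y \<and> 2 * fst (snd y) + 2 * fst y \<le> snd (snd y)"
  "in_cone ((2,1,0), (1,2,0), (2,0,1)) y \<longleftrightarrow>
     0 \<le> snd (snd y) \<and> 4 * snd (snd y) + fst (snd y) \<le> 2 * fst y \<and> fst y \<le> 2 * fst (snd y) + 2 * snd (snd y)"
proof -
  show "in_cone ((3,0,0), (2,1,0), (2,0,1)) y \<longleftrightarrow>
     0 \<le> fst (snd y) \<and> 0 \<le> snd (snd y) \<and> 2 * fst (snd y) + 2 * snd (snd y) \<le> fst y" (is "_ \<longleftrightarrow> ?R")
  proof
    assume ?R
    then show "in_cone ((3,0,0), (2,1,0), (2,0,1)) y"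
      by (intro in_coneI[of "(fst y - 2 * fst (snd y) - 2 * snd (snd y)) / 3"
          "fst (snd y)" "snd (snd y)"])
        (auto simp: prod_eq_iff field_simps)
  qed (auto simp: in_cone_def)
  show "in_cone ((0,3,0), (1,2,0), (0,2,1)) y \<longleftrightarrow>
     0 \<le> fst y \<and> 0 \<le> snd (snd y) \<and> 2 * fst y + 2 * snd (snd y) \<le> fst (snd y)" (is "_ \<longleftrightarrow> ?R")
  proof
    assume ?R
    then show "in_cone ((0,3,0), (1,2,0), (0,2,1)) y"
      by (intro in_coneI[of "(fst (snd y) - 2 * fst y - 2 * snd (snd y)) / 3"
          "fst y" "snd (snd y)"])
        (auto simp: prod_eq_iff field_simps)
  qed (auto simp: in_cone_def)
  show "in_cone ((0,0,3), (0,1,2), (1,0,2)) y \<longleftrightarrow>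
     0 \<le> fst (snd y) \<and> 0 \<le> fst y \<and> 2 * fst (snd y) + 2 * fst y \<le> snd (snd y)" (is "_ \<longleftrightarrow> ?R")
  proof
    assume ?R
    then show "in_cone ((0,0,3), (0,1,2), (1,0,2)) y"
      by (intro in_coneI[of "(snd (snd y) - 2 * fst y - 2 * fst (snd y)) / 3"
          "fst (snd y)" "fst y"])
        (auto simp: prod_eq_iff field_simps)
  qed (auto simp: in_cone_def)
  show "in_cone ((2,1,0), (1,2,0), (2,0,1)) y \<longleftrightarrow>
     0 \<le> snd (snd y) \<and> 4 * snd (snd y) + fst (snd y) \<le> 2 * fst y \<and> fst y \<le> 2 * fst (snd y) + 2 * snd (snd y)" (is "_ \<longleftrightarrow> ?R")
  proof
    assume ?R
    then show "in_cone ((2,1,0), (1,2,0), (2,0,1)) y"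
      by (intro in_coneI[of "(2 * fst y - 4 * snd (snd y) - fst (snd y)) / 3"
          "(2 * fst (snd y) - fst y + 2 * snd (snd y)) / 3" "snd (snd y)"])
        (auto simp: prod_eq_iff field_simps)
  qed (auto simp: in_cone_def)
qed

definition bases :: "(int3 \<times> int3 \<times> int3) set" where
  "bases = {((3,0,0), (2,1,0), (2,0,1)), ((0,3,0), (1,2,0), (0,2,1)), ((0,0,3), (0,1,2), (1,0,2)), ((2,1,0), (1,2,0), (2,0,1))}"

lemma knot_bases: "i < 28 \<Longrightarrow> fst (knot_list ! i) \<in> bases"
proof -
  assume i: "i < 28"
  have "length knot_list = 28" by (simp add: knot_list_def)
  moreover have "\<forall>k\<in>set knot_list. fst k \<in> bases" by (simp add: knot_list_def bases_def)
  ultimately show ?thesis using i nth_mem by metis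
qed

lemma in_cone_nonneg: "b \<in> bases \<Longrightarrow> in_cone b y \<Longrightarrow> nonneg3 y"
  unfolding bases_def by (auto simp: in_cone_simps nonneg3_def crd_def)

lemma closed_in_cone: "b \<in> bases \<Longrightarrow> closed {y. in_cone b y}"
  unfolding bases_def
  by (elim insertE emptyE; hypsubst; unfold in_cone_simps)
    (intro closed_Collect_conj closed_Collect_le continuous_intros)+

lemma form_pos: 
  assumes "18 \<le> j" "j < 28" "pos3 y" shows "0 < lf j \<bullet> y"
proof -
  obtain p q r where y: "y = (p, q, r)" by (cases y)
  have "0 < p" "0 < q" "0 < r"
    using assms(3)[unfolded pos3_def, rule_format, of 0] assms(3)[unfolded pos3_def, rule_format, of 1]
      assms(3)[unfolded pos3_def, rule_format, of 2] by (auto simp: y crd_def)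
  then have "18 \<le> j \<longrightarrow> 0 < lf j \<bullet> y"
    by (intro less28E[where P = "\<lambda>j. 18 \<le> j \<longrightarrow> 0 < lf j \<bullet> y", OF assms(2)])
      (simp_all add: lf_def lform_list_def y)
  then show ?thesis using assms(1) by blast
qed

text \<open>Step functions are strict and the cone is closed, so the identity is claimed only off
  the lines that occur. In the integration these are lines that the ray crosses transversally, which
  exempts finitely many points of it.\<close>

lemma base_indicator:
  assumes b: "b \<in> bases" and ds: "base_ok b ds" "length ds = 28" and y: "pos3 y"
    and off: "\<And>j. j < 28 \<Longrightarrow> ds ! j \<noteq> 0 \<Longrightarrow> lf j \<bullet> y \<noteq> 0"
  shows "(\<Sum>j<28. of_int (ds ! j) * pw 0 (lf j \<bullet> y)) = 1296 * (if in_cone b y then 1 else 0)"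
proof -
  have y3: "0 < fst y" "0 < fst (snd y)" "0 < snd (snd y)"
    using y[unfolded pos3_def, rule_format, of 0] y[unfolded pos3_def, rule_format, of 1] y[unfolded pos3_def, rule_format, of 2]
    by (auto simp: crd_def)
  have t: "ds ! j = base_row b ! j" if "j < 18" for j using ds that by (metis base_ok_def nth_take)
  have "(\<Sum>j\<in>{18..<28}. of_int (ds ! j) * pw 0 (lf j \<bullet> y)) = (\<Sum>j\<in>{18..<28}. real_of_int (ds ! j))"
    by (intro sum.cong refl) (use form_pos y in \<open>auto simp: pw_def\<close>)
  also have "\<dots> = of_int (sum_list (drop 18 ds))"
    using ds(2) sum.shift_bounds_nat_ivl[of "\<lambda>j. real_of_int (ds ! j)" 0 18 10]
    by (simp add: sum_list_sum_nth add.commute)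
  also have "\<dots> = 0" using ds by (simp add: base_ok_def)
  finally have hi: "(\<Sum>j\<in>{18..<28}. of_int (ds ! j) * pw 0 (lf j \<bullet> y)) = 0" .
  have "(\<Sum>j<28. of_int (ds ! j) * pw 0 (lf j \<bullet> y)) = (\<Sum>j<18. of_int (ds ! j) * pw 0 (lf j \<bullet> y)) + (\<Sum>j\<in>{18..<28}. of_int (ds ! j) * pw 0 (lf j \<bullet> y))"
    by (subst sum.union_disjoint[symmetric]) (auto intro!: sum.cong)
  also have "\<dots> = (\<Sum>j<18. of_int (base_row b ! j) * pw 0 (lf j \<bullet> y))" using hi t by simp
  finally have s: "(\<Sum>j<28. of_int (ds ! j) * pw 0 (lf j \<bullet> y)) = (\<Sum>j<18. of_int (base_row b ! j) * pw 0 (lf j \<bullet> y))" .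
  have off': "base_row b ! j \<noteq> 0 \<Longrightarrow> lf j \<bullet> y \<noteq> 0" if "j < 18" for j using off[of j] t[OF that] that by auto
  obtain p q r where pqr: "y = (p, q, r)" by (cases y)
  have l: "lf 0 \<bullet> y = p - 2*q - 2*r" "lf 4 \<bullet> y = q - 2*p - 2*r" "lf 8 \<bullet> y = r - 2*p - 2*q" "lf 2 \<bullet> y = 2*p - q - 4*r"
    by (simp_all add: pqr lf_def lform_list_def)
  note ex = numeral_eq_Suc lessThan_Suc
  from b show ?thesis unfolding s bases_def
    apply (elim insertE emptyE; hypsubst)
    subgoal using off'[of 0] y3 l by (auto simp: base_row_def ex in_cone_simps pw_def pqr)
    subgoal using off'[of 4] y3 l by (auto simp: base_row_def ex in_cone_simps pw_def pqr)
    subgoal using off'[of 8] y3 l by (auto simp: base_row_def ex in_cone_simps pw_def pqr)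
    subgoal using off'[of 0] off'[of 2] y3 l by (auto simp: base_row_def ex in_cone_simps pw_def pqr)
    done
qed

lemma knot_dirs:
  assumes "i < 28" "knot_list ! i = (b, w3, w4, w5)"
  shows "nonneg3 (rp w3) \<and> rp w3 \<noteq> 0" "nonneg3 (rp w4) \<and> rp w4 \<noteq> 0" "nonneg3 (rp w5) \<and> rp w5 \<noteq> 0"
proof -
  define good :: "int3 \<Rightarrow> bool" where "good w \<longleftrightarrow> 0 \<le> fst w \<and> 0 \<le> fst (snd w) \<and> 0 \<le> snd (snd w) \<and> w \<noteq> (0, 0, 0)" for w
  have "length knot_list = 28" by (simp add: knot_list_def)
  then have m: "(b, w3, w4, w5) \<in> set knot_list" using assms nth_mem by metis
  have "\<forall>(b, w3, w4, w5)\<in>set knot_list. good w3 \<and> good w4 \<and> good w5"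
    unfolding knot_list_def good_def by simp
  then have "good w3 \<and> good w4 \<and> good w5" using m by blast
  moreover have "nonneg3 (rp w) \<and> rp w \<noteq> 0" if "good w" for w
    using that by (cases w) (auto simp: good_def nonneg3_def crd_def zero_prod_def)
  ultimately show "nonneg3 (rp w3) \<and> rp w3 \<noteq> 0" "nonneg3 (rp w4) \<and> rp w4 \<noteq> 0" "nonneg3 (rp w5) \<and> rp w5 \<noteq> 0"
    by blast+
qed

lemma nn_integral_lborel_triple:
  fixes f :: "hpt \<Rightarrow> ennreal"
  assumes [measurable]: "f \<in> borel_measurable borel"
  shows "integral\<^sup>N lborel f = (\<integral>\<^sup>+a. \<integral>\<^sup>+b. \<integral>\<^sup>+c. f (a, b, c) \<partial>lborel \<partial>lborel \<partial>lborel)"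
proof -
  have "integral\<^sup>N lborel f = integral\<^sup>N (lborel \<Otimes>\<^sub>M lborel) f" by (simp add: lborel_prod)
  also have "\<dots> = (\<integral>\<^sup>+a. \<integral>\<^sup>+y. f (a, y) \<partial>lborel \<partial>lborel)"
    by (rule lborel.nn_integral_fst[symmetric]) (simp add: lborel_prod)
  also have "\<dots> = (\<integral>\<^sup>+a. integral\<^sup>N (lborel \<Otimes>\<^sub>M lborel) (\<lambda>y. f (a, y)) \<partial>lborel)"
    by (simp add: lborel_prod)
  also have "\<dots> = (\<integral>\<^sup>+a. \<integral>\<^sup>+b. \<integral>\<^sup>+c. f (a, b, c) \<partial>lborel \<partial>lborel \<partial>lborel)"
  proof (intro nn_integral_cong)
    fix a :: real
    have "(\<lambda>y::real\<times>real. f (a, y)) \<in> borel_measurable borel"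
      by (intro measurable_compose[OF _ assms] borel_measurable_continuous_onI continuous_intros)
    then show "integral\<^sup>N (lborel \<Otimes>\<^sub>M lborel) (\<lambda>y. f (a, y)) = (\<integral>\<^sup>+b. \<integral>\<^sup>+c. f (a, b, c) \<partial>lborel \<partial>lborel)"
      by (intro lborel.nn_integral_fst[symmetric]) (simp add: lborel_prod)
  qed
  finally show ?thesis .
qed

text \<open>The possible weights of the last three knots in a representation of \<open>z\<close> by
  all six knots with nonnegative weights; the weights of the base are then determined. Coordinate 0
  carries the weight of \<open>w5\<close>, the outermost direction of integration.\<close>

definition cone_slice :: "int3 \<times> int3 \<times> int3 \<Rightarrow> int3 \<Rightarrow> int3 \<Rightarrow> int3 \<Rightarrow> hpt \<Rightarrow> hpt set" where
  "cone_slice b w3 w4 w5 z = {t. nonneg3 t \<and>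
     in_cone b (z - crd 0 t *\<^sub>R rp w5 - crd 1 t *\<^sub>R rp w4 - crd 2 t *\<^sub>R rp w3)}"

lemma closed_cone_slice: "b \<in> bases \<Longrightarrow> closed (cone_slice b w3 w4 w5 z)"
proof -
  assume b: "b \<in> bases"
  have cont: "continuous_on UNIV (crd i)" for i
    by (cases "i = 0"; cases "i = 1") (auto simp: crd_def[abs_def] intro!: continuous_intros)
  have "closed ((\<lambda>t. z - crd 0 t *\<^sub>R rp w5 - crd 1 t *\<^sub>R rp w4 - crd 2 t *\<^sub>R rp w3) -` {y. in_cone b y})"
    using closed_in_cone[OF b] by (rule closed_vimage) (intro continuous_intros cont)
  moreover have "closed {t. nonneg3 t}" unfolding nonneg3_def
    by (intro closed_Collect_all closed_Collect_imp closed_Collect_le cont continuous_intros open_Collect_const)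
  ultimately have "closed ({t. nonneg3 t} \<inter> (\<lambda>t. z - crd 0 t *\<^sub>R rp w5 - crd 1 t *\<^sub>R rp w4 - crd 2 t *\<^sub>R rp w3) -` {y. in_cone b y})"
    by blast
  moreover have "{t. nonneg3 t} \<inter> (\<lambda>t. z - crd 0 t *\<^sub>R rp w5 - crd 1 t *\<^sub>R rp w4 - crd 2 t *\<^sub>R rp w3) -` {y. in_cone b y}
     = cone_slice b w3 w4 w5 z" unfolding cone_slice_def by blast
  ultimately show ?thesis by simp
qed

lemma cone_slice_volume:
  assumes i: "i < 28" and kn: "knot_list ! i = (b, w3, w4, w5)" and z: "pos3 z"
  shows "emeasure lborel (cone_slice b w3 w4 w5 z) = ennreal ((\<Sum>j<28. cf i j * pw 3 (lf j \<bullet> z)) / 7776)"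
    and "0 \<le> (\<Sum>j<28. cf i j * pw 3 (lf j \<bullet> z))"
proof -
  define cs where "cs = coeff_list ! i"
  define d1 where "d1 = dirs cs w5"
  define d2 where "d2 = dirs d1 w4"
  define d3 where "d3 = dirs d2 w3"
  have len: "length cs = 28" "length d1 = 28" "length d2 = 28" "length d3 = 28"
    using length_coeff(2)[OF i] by (simp_all add: cs_def d1_def d2_def d3_def)
  have d: "real_of_int (d1 ! j) = cs ! j * (lf j \<bullet> rp w5)" "real_of_int (d2 ! j) = d1 ! j * (lf j \<bullet> rp w4)"
     "real_of_int (d3 ! j) = d2 ! j * (lf j \<bullet> rp w3)" if "j < 28" for j
    using that len by (simp_all only: d1_def d2_def d3_def nth_dirs)
  have ok: "exit_vanish 3 cs w5" "exit_vanish 2 d1 w4" "exit_vanish 1 d2 w3" "base_ok b d3"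
    using unit_ok_all[OF i] kn by (simp_all add: unit_ok_def row_ok_def cs_def d1_def d2_def d3_def)
  have b: "b \<in> bases" using knot_bases[OF i] kn by simp
  note w = knot_dirs[OF i kn]
  define g0 :: "hpt \<Rightarrow> ennreal" where "g0 y = (if in_cone b y then 1 else 0)" for y
  define g1 where "g1 y = (\<integral>\<^sup>+t. indicator {0..} t * g0 (y - t *\<^sub>R rp w3) \<partial>lborel)" for y
  define g2 where "g2 y = (\<integral>\<^sup>+t. indicator {0..} t * g1 (y - t *\<^sub>R rp w4) \<partial>lborel)" for y
  have g0': "g0 y = 0" if "\<not> nonneg3 y" for y using that in_cone_nonneg[OF b, of y] by (auto simp: g0_def)
  have g1': "g1 y = 0" if "\<not> nonneg3 y" for y unfolding g1_def
    using ray_integral_outside[where g=g0, OF g0' _ that] w by blast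
  have g2': "g2 y = 0" if "\<not> nonneg3 y" for y unfolding g2_def
    using ray_integral_outside[where g=g1, OF g1' _ that] w by blast
  have face: "(\<Sum>j<28. a * of_int (ds ! j) / 7776 * pw k (lf j \<bullet> y)) = 0"
    if "exit_vanish k ds u" "k \<in> {1,2,3}" "length ds = 28" "nonneg3 y" "m < 3" "0 < crd m (rp u)" "crd m y = 0"
    for k ds u y m and a :: real
  proof -
    have "(\<Sum>j<28. a * of_int (ds ! j) / 7776 * pw k (lf j \<bullet> y)) = a / 7776 * (\<Sum>j<28. of_int (ds ! j) * pw k (lf j \<bullet> y))"
      by (simp add: sum_distrib_left mult.assoc)
    then show ?thesis using exit_vanishD[OF that(1-5,7,6)] by simp
  qed
  have vd: "real_of_int (d2 ! j) * (lf j \<bullet> rp w3) \<noteq> 0" if "j < 28" "d3 ! j \<noteq> 0" for j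
    using d(3)[OF that(1)] that(2) by (metis of_int_eq_0_iff)
  \<comment> \<open>The three antiderivatives have prefactors 6, 3 and 1: differentiating a cube
    twice, once or not at all leaves 3 * 2, 3 or 1.\<close>
  have 1: "g1 y = ennreal (\<Sum>j<28. 6 * of_int (d2 ! j) / 7776 * pw (Suc 0) (lf j \<bullet> y)) \<and>
     0 \<le> (\<Sum>j<28. 6 * of_int (d2 ! j) / 7776 * pw (Suc 0) (lf j \<bullet> y))" if y: "pos3 y" for y
    unfolding g1_def
  proof (rule ray_integral[where n=28 and k=0 and L=lf and g=g0])
    fix x assume x: "pos3 x" and off: "\<And>j. j < 28 \<Longrightarrow> 6 * of_int (d2 ! j) / 7776 * (lf j \<bullet> rp w3) \<noteq> 0 \<Longrightarrow> lf j \<bullet> x \<noteq> 0"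
    have "lf j \<bullet> x \<noteq> 0" if "j < 28" "d3 ! j \<noteq> 0" for j
      by (rule off[OF that(1)]) (use vd[OF that] in auto)
    then have "(\<Sum>j<28. of_int (d3 ! j) * pw 0 (lf j \<bullet> x)) = 1296 * (if in_cone b x then 1 else 0)"
      using base_indicator[OF b ok(4) len(4) x] by blast
    moreover have "(\<Sum>j<28. real (Suc 0) * (6 * of_int (d2 ! j) / 7776) * (lf j \<bullet> rp w3) * pw 0 (lf j \<bullet> x))
      = (\<Sum>j<28. of_int (d3 ! j) * pw 0 (lf j \<bullet> x)) / 1296"
      unfolding sum_divide_distrib by (intro sum.cong refl) (simp add: d)
    ultimately have "(\<Sum>j<28. real (Suc 0) * (6 * of_int (d2 ! j) / 7776) * (lf j \<bullet> rp w3) * pw 0 (lf j \<bullet> x))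
      = (if in_cone b x then 1 else 0)" by simp
    then show "g0 x = ennreal (\<Sum>j<28. real (Suc 0) * (6 * of_int (d2 ! j) / 7776) * (lf j \<bullet> rp w3) * pw 0 (lf j \<bullet> x)) \<and>
       0 \<le> (\<Sum>j<28. real (Suc 0) * (6 * of_int (d2 ! j) / 7776) * (lf j \<bullet> rp w3) * pw 0 (lf j \<bullet> x))"
      by (simp only: g0_def) simp
  next
    fix x m assume "nonneg3 x" "m < 3" "0 < crd m (rp w3)" "crd m x = 0"
    then show "(\<Sum>j<28. 6 * of_int (d2 ! j) / 7776 * pw (Suc 0) (lf j \<bullet> x)) = 0"
      by (intro face[OF ok(3)[unfolded One_nat_def] _ len(3)]) auto
  qed (use g0' w y in auto)
  have 2: "g2 y = ennreal (\<Sum>j<28. 3 * of_int (d1 ! j) / 7776 * pw (Suc (Suc 0)) (lf j \<bullet> y)) \<and>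
     0 \<le> (\<Sum>j<28. 3 * of_int (d1 ! j) / 7776 * pw (Suc (Suc 0)) (lf j \<bullet> y))" if y: "pos3 y" for y
    unfolding g2_def
  proof (rule ray_integral[where n=28 and k="Suc 0" and L=lf and g=g1])
    fix x assume x: "pos3 x"
    have e: "(\<Sum>j<28. real (Suc (Suc 0)) * (3 * of_int (d1 ! j) / 7776) * (lf j \<bullet> rp w4) * pw (Suc 0) (lf j \<bullet> x))
      = (\<Sum>j<28. 6 * of_int (d2 ! j) / 7776 * pw (Suc 0) (lf j \<bullet> x))"
      by (intro sum.cong refl) (simp add: d)
    show "g1 x = ennreal (\<Sum>j<28. real (Suc (Suc 0)) * (3 * of_int (d1 ! j) / 7776) * (lf j \<bullet> rp w4) * pw (Suc 0) (lf j \<bullet> x)) \<and>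
       0 \<le> (\<Sum>j<28. real (Suc (Suc 0)) * (3 * of_int (d1 ! j) / 7776) * (lf j \<bullet> rp w4) * pw (Suc 0) (lf j \<bullet> x))"
      unfolding e by (rule 1[OF x])
  next
    fix x m assume "nonneg3 x" "m < 3" "0 < crd m (rp w4)" "crd m x = 0"
    then show "(\<Sum>j<28. 3 * of_int (d1 ! j) / 7776 * pw (Suc (Suc 0)) (lf j \<bullet> x)) = 0"
      by (intro face[OF ok(2)[unfolded numeral_2_eq_2 numeral_3_eq_3] _ len(2)]) auto
  qed (use g1' w y in auto)
  have "(\<integral>\<^sup>+t. indicator {0..} t * g2 (z - t *\<^sub>R rp w5) \<partial>lborel) = ennreal (\<Sum>j<28. 1 * of_int (cs ! j) / 7776 * pw (Suc (Suc (Suc 0))) (lf j \<bullet> z)) \<and>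
     0 \<le> (\<Sum>j<28. 1 * of_int (cs ! j) / 7776 * pw (Suc (Suc (Suc 0))) (lf j \<bullet> z))"
  proof (rule ray_integral[where n=28 and k="Suc (Suc 0)" and L=lf and g=g2])
    fix x assume x: "pos3 x"
    have e: "(\<Sum>j<28. real (Suc (Suc (Suc 0))) * (1 * of_int (cs ! j) / 7776) * (lf j \<bullet> rp w5) * pw (Suc (Suc 0)) (lf j \<bullet> x))
      = (\<Sum>j<28. 3 * of_int (d1 ! j) / 7776 * pw (Suc (Suc 0)) (lf j \<bullet> x))"
      by (intro sum.cong refl) (simp add: d)
    show "g2 x = ennreal (\<Sum>j<28. real (Suc (Suc (Suc 0))) * (1 * of_int (cs ! j) / 7776) * (lf j \<bullet> rp w5) * pw (Suc (Suc 0)) (lf j \<bullet> x)) \<and>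
       0 \<le> (\<Sum>j<28. real (Suc (Suc (Suc 0))) * (1 * of_int (cs ! j) / 7776) * (lf j \<bullet> rp w5) * pw (Suc (Suc 0)) (lf j \<bullet> x))"
      unfolding e by (rule 2[OF x])
  next
    fix x m assume "nonneg3 x" "m < 3" "0 < crd m (rp w5)" "crd m x = 0"
    then show "(\<Sum>j<28. 1 * of_int (cs ! j) / 7776 * pw (Suc (Suc (Suc 0))) (lf j \<bullet> x)) = 0"
      by (intro face[OF ok(1)[unfolded numeral_2_eq_2 numeral_3_eq_3] _ len(1)]) auto
  qed (use g2' w z in auto)
  note 3 = this[folded numeral_3_eq_3]
  have sum_eq: "(\<Sum>j<28. 1 * of_int (cs ! j) / 7776 * pw 3 (lf j \<bullet> z)) = (\<Sum>j<28. cf i j * pw 3 (lf j \<bullet> z)) / 7776"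
    by (simp add: sum_divide_distrib cf_def cs_def)
  let ?S = "cone_slice b w3 w4 w5 z"
  have [measurable]: "?S \<in> sets borel" by (rule borel_closed[OF closed_cone_slice[OF b]])
  have "emeasure lborel ?S = (\<integral>\<^sup>+t. indicator ?S t \<partial>lborel)" by simp
  also have "\<dots> = (\<integral>\<^sup>+a. \<integral>\<^sup>+b. \<integral>\<^sup>+c. indicator ?S (a, b, c) \<partial>lborel \<partial>lborel \<partial>lborel)"
    by (rule nn_integral_lborel_triple) measurable
  also have "\<dots> = (\<integral>\<^sup>+t. indicator {0..} t * g2 (z - t *\<^sub>R rp w5) \<partial>lborel)"
  proof (intro nn_integral_cong)
    fix r :: real
    have S: "indicator ?S (r, s, t) = indicator {0..} r * (indicator {0..} s * (indicator {0..} t * g0 (z - r *\<^sub>R rp w5 - s *\<^sub>R rp w4 - t *\<^sub>R rp w3)))" for s t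
      by (auto simp: cone_slice_def g0_def nonneg3_def crd_def indicator_def numeral_3_eq_3 less_Suc_eq)
    show "(\<integral>\<^sup>+b. \<integral>\<^sup>+c. indicator ?S (r, b, c) \<partial>lborel \<partial>lborel) = indicator {0..} r * g2 (z - r *\<^sub>R rp w5)"
    proof (cases "r \<ge> 0")
      case True
      have "(\<integral>\<^sup>+c. indicator ?S (r, s, c) \<partial>lborel) = indicator {0..} s * g1 (z - r *\<^sub>R rp w5 - s *\<^sub>R rp w4)" for s
        using True by (cases "s \<ge> 0") (simp_all add: S g1_def)
      then show ?thesis using True by (simp add: g2_def)
    qed (simp add: S)
  qed
  finally show "emeasure lborel ?S = ennreal ((\<Sum>j<28. cf i j * pw 3 (lf j \<bullet> z)) / 7776)"
    using 3 sum_eq by simp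
  show "0 \<le> (\<Sum>j<28. cf i j * pw 3 (lf j \<bullet> z))" using 3 sum_eq by simp
qed

section \<open>Simplex splines in barycentric coordinates\<close>

text \<open>Twice the signed area, the denominator in Cramer's rule for barycentric
  coordinates.\<close>

definition dtri :: "tri \<Rightarrow> real" where
  "dtri T = (fst (tv2 T) - fst (tv1 T)) * (snd (tv3 T) - snd (tv1 T))
     - (fst (tv3 T) - fst (tv1 T)) * (snd (tv2 T) - snd (tv1 T))"

text \<open>Barycentric coordinates scaled by 3, so that all nine points of the split are integral.\<close>

definition zc :: "tri \<Rightarrow> pt \<Rightarrow> hpt" where
  "zc T x = (let b = ((fst x - fst (tv1 T)) * (snd (tv3 T) - snd (tv1 T)) - (fst (tv3 T) - fst (tv1 T)) * (snd x - snd (tv1 T))) / dtri T;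
       c = ((fst (tv2 T) - fst (tv1 T)) * (snd x - snd (tv1 T)) - (fst x - fst (tv1 T)) * (snd (tv2 T) - snd (tv1 T))) / dtri T
     in (3 - 3 * b - 3 * c, 3 * b, 3 * c))"

definition csum :: "hpt \<Rightarrow> real" where "csum z = crd 0 z + crd 1 z + crd 2 z"

definition bpt :: "tri \<Rightarrow> hpt \<Rightarrow> pt" where
  "bpt T z = (1/3) *\<^sub>R (crd 0 z *\<^sub>R tv1 T + crd 1 z *\<^sub>R tv2 T + crd 2 z *\<^sub>R tv3 T)"

lemma linear_csum: "linear csum" by (rule linearI) (auto simp: csum_def crd_def algebra_simps)
lemma linear_bpt: "linear (bpt T)"
  by (rule linearI) (auto simp: bpt_def crd_def algebra_simps)

lemma nondegenerate_dtri:
  assumes "nondegenerate T" shows "dtri T \<noteq> 0"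
proof
  assume d: "dtri T = 0"
  obtain x1 y1 x2 y2 x3 y3 where T: "T = ((x1, y1), (x2, y2), (x3, y3))" by (metis prod.collapse)
  note sel = T tv1_def tv2_def tv3_def fst_conv snd_conv
  have v: "vset T = {(x1,y1), (x2,y2), (x3,y3)}" by (simp add: vset_def sel)
  have card: "card (vset T) = 3" and ind: "\<not> affine_dependent (vset T)" using assms by (auto simp: nondegenerate_def)
  have ne: "(x1,y1) \<noteq> (x2,y2)" "(x1,y1) \<noteq> (x3,y3)" "(x2,y2) \<noteq> (x3,y3)"
    using card unfolding v by (auto simp: card_insert_if split: if_splits)
  define a where "a = x2 - x1" define b where "b = y2 - y1"
  define c where "c = x3 - x1" define e where "e = y3 - y1"
  have dd: "a * e = c * b" using d by (simp add: dtri_def sel a_def b_def c_def e_def)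
  have ce: "c \<noteq> 0 \<or> e \<noteq> 0" using ne(2) by (auto simp: c_def e_def)
  \<comment> \<open>weights of an affine relation between the vertices\<close>
  define s where "s = (if c \<noteq> 0 then c else e)"
  define t where "t = (if c \<noteq> 0 then a else b)"
  have st: "s \<noteq> 0" "s * a = t * c" "s * b = t * e"
    using dd ce by (auto simp: s_def t_def algebra_simps)
  define u where "u p = (if p = (x1,y1) then t - s else if p = (x2,y2) then s else - t)" for p
  have uv: "u (x1,y1) = t - s" "u (x2,y2) = s" "u (x3,y3) = - t" using ne by (auto simp: u_def)
  have "sum u (vset T) = 0" unfolding v using ne by (simp add: uv)
  moreover have "(\<Sum>p\<in>vset T. u p *\<^sub>R p) = 0"
  proof -
    have "(\<Sum>p\<in>vset T. u p *\<^sub>R p) = ((t - s) * x1 + s * x2 - t * x3, (t - s) * y1 + s * y2 - t * y3)"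
      unfolding v using ne by (simp add: uv)
    moreover have "(t - s) * x1 + s * x2 - t * x3 = s * a - t * c" "(t - s) * y1 + s * y2 - t * y3 = s * b - t * e"
      by (simp_all add: a_def b_def c_def e_def algebra_simps)
    ultimately show ?thesis using st by (simp add: zero_prod_def)
  qed
  ultimately have "affine_dependent (vset T)"
    using st(1) uv(2) by (subst affine_dependent_explicit_finite) (auto simp: v intro!: exI[of _ u])
  then show False using ind by simp
qed

lemma zc_vertices:
  assumes "dtri T \<noteq> 0"
  shows "zc T (tv1 T) = (3, 0, 0)" "zc T (tv2 T) = (0, 3, 0)" "zc T (tv3 T) = (0, 0, 3)"
proof -
  show "zc T (tv1 T) = (3, 0, 0)" by (simp add: zc_def Let_def)
  show "zc T (tv2 T) = (0, 3, 0)"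
    using assms by (simp add: zc_def Let_def dtri_def)
  show "zc T (tv3 T) = (0, 0, 3)"
    using assms by (simp add: zc_def Let_def dtri_def algebra_simps)
qed

lemma csum_zc [simp]: "csum (zc T x) = 3"
  by (simp add: csum_def crd_def zc_def Let_def)

lemma bpt_zc:
  assumes "dtri T \<noteq> 0" shows "bpt T (zc T x) = x"
proof -
  obtain x1 y1 x2 y2 x3 y3 where T: "T = ((x1, y1), (x2, y2), (x3, y3))" by (metis prod.collapse)
  obtain p q where x: "x = (p, q)" by (cases x)
  define d where "d = dtri T"
  have d: "d = (x2 - x1) * (y3 - y1) - (x3 - x1) * (y2 - y1)" by (simp add: d_def dtri_def T tv1_def tv2_def tv3_def)
  have d0: "d \<noteq> 0" using assms by (simp add: d_def)
  define b where "b = ((p - x1) * (y3 - y1) - (x3 - x1) * (q - y1)) / d"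
  define c where "c = ((x2 - x1) * (q - y1) - (p - x1) * (y2 - y1)) / d"
  have z: "zc T x = (3 - 3 * b - 3 * c, 3 * b, 3 * c)"
    by (simp add: zc_def Let_def b_def c_def x T tv1_def tv2_def tv3_def d_def)
  have "d * b = (p - x1) * (y3 - y1) - (x3 - x1) * (q - y1)" "d * c = (x2 - x1) * (q - y1) - (p - x1) * (y2 - y1)"
    using d0 by (simp_all add: b_def c_def)
  then have "d * (b * (x2 - x1) + c * (x3 - x1)) = d * (p - x1)" "d * (b * (y2 - y1) + c * (y3 - y1)) = d * (q - y1)"
    unfolding d by algebra+
  then have "b * (x2 - x1) + c * (x3 - x1) = p - x1" "b * (y2 - y1) + c * (y3 - y1) = q - y1"
    using d0 by simp_all
  then show ?thesis unfolding bpt_def z by (simp add: crd_def T tv1_def tv2_def tv3_def x algebra_simps)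
qed

lemma zc_bpt:
  assumes "dtri T \<noteq> 0" "csum z = 3" shows "zc T (bpt T z) = z"
proof -
  obtain x1 y1 x2 y2 x3 y3 where T: "T = ((x1, y1), (x2, y2), (x3, y3))" by (metis prod.collapse)
  obtain a b c where z: "z = (a, b, c)" by (cases z)
  have a: "a = 3 - b - c" using assms(2) by (simp add: z csum_def crd_def)
  define d where "d = dtri T"
  have d: "d = (x2 - x1) * (y3 - y1) - (x3 - x1) * (y2 - y1)" by (simp add: d_def dtri_def T tv1_def tv2_def tv3_def)
  have d0: "d \<noteq> 0" using assms by (simp add: d_def)
  define p where "p = (a * x1 + b * x2 + c * x3) / 3"
  define q where "q = (a * y1 + b * y2 + c * y3) / 3"
  have "bpt T z = (p, q)" by (simp add: z bpt_def crd_def T tv1_def tv2_def tv3_def p_def q_def)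
  have N: "(p - x1) * (y3 - y1) - (x3 - x1) * (q - y1) = b / 3 * d" "(x2 - x1) * (q - y1) - (p - x1) * (y2 - y1) = c / 3 * d"
    by (simp_all add: p_def q_def a d algebra_simps add_divide_distrib diff_divide_distrib)
  have "zc T (p, q) = (3 - 3 * (((p - x1) * (y3 - y1) - (x3 - x1) * (q - y1)) / d) - 3 * (((x2 - x1) * (q - y1) - (p - x1) * (y2 - y1)) / d),
      3 * (((p - x1) * (y3 - y1) - (x3 - x1) * (q - y1)) / d), 3 * (((x2 - x1) * (q - y1) - (p - x1) * (y2 - y1)) / d))"
    by (simp add: zc_def Let_def T tv1_def tv2_def tv3_def d_def)
  then have "zc T (p, q) = z" unfolding N using d0 by (simp add: z a)
  then show ?thesis using \<open>bpt T z = (p, q)\<close> by simp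
qed

text \<open>Proved through the inverse: \<open>bpt T\<close> is linear on the whole space, and
  \<open>zc_bpt\<close> applies because the weighted sum again has coordinate sum 3.\<close>

lemma zc_affine:
  assumes d: "dtri T \<noteq> 0" and "(\<Sum>i<n. u i) = 1"
  shows "zc T (\<Sum>i<n. u i *\<^sub>R p i) = (\<Sum>i<n. u i *\<^sub>R zc T (p i))"
proof -
  have "csum (\<Sum>i<n. u i *\<^sub>R zc T (p i)) = 3"
    using assms(2) by (simp add: linear_sum[OF linear_csum] linear_cmul[OF linear_csum] sum_distrib_right[symmetric])
  then have "zc T (bpt T (\<Sum>i<n. u i *\<^sub>R zc T (p i))) = (\<Sum>i<n. u i *\<^sub>R zc T (p i))" by (rule zc_bpt[OF d])
  then show ?thesis by (simp add: linear_sum[OF linear_bpt] linear_cmul[OF linear_bpt] bpt_zc[OF d])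
qed

lemma knot_coords:
  assumes d: "dtri T \<noteq> 0"
  shows "zc T (v12 T) = (0, 2, 1)" "zc T (v13 T) = (0, 1, 2)" "zc T (v21 T) = (2, 0, 1)"
    "zc T (v23 T) = (1, 0, 2)" "zc T (v31 T) = (2, 1, 0)" "zc T (v32 T) = (1, 2, 0)"
proof -
  have e: "v12 T = bpt T (0, 2, 1)" "v13 T = bpt T (0, 1, 2)" "v21 T = bpt T (2, 0, 1)"
    "v23 T = bpt T (1, 0, 2)" "v31 T = bpt T (2, 1, 0)" "v32 T = bpt T (1, 2, 0)"
    by (simp_all add: v12_def v13_def v21_def v23_def v31_def v32_def bpt_def crd_def scaleR_add_right)
  show "zc T (v12 T) = (0, 2, 1)" "zc T (v13 T) = (0, 1, 2)" "zc T (v21 T) = (2, 0, 1)"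
    "zc T (v23 T) = (1, 0, 2)" "zc T (v31 T) = (2, 1, 0)" "zc T (v32 T) = (1, 2, 0)"
    unfolding e by (simp_all add: zc_bpt[OF d] csum_def crd_def)
qed

lemma continuous_on_zc [continuous_intros]:
  "continuous_on S f \<Longrightarrow> continuous_on S (\<lambda>x. zc T (f x))"
  unfolding zc_def Let_def divide_inverse by (intro continuous_intros)

text \<open>Each base is a basis of three-space; the witnesses are the rows of the inverse of the
  matrix whose columns are the three knots.\<close>

lemma bases_dual:
  assumes "b \<in> bases"
  obtains l0 l1 l2 :: hpt where
    "\<And>y. y = (l0 \<bullet> y) *\<^sub>R rp (fst b) + (l1 \<bullet> y) *\<^sub>R rp (fst (snd b)) + (l2 \<bullet> y) *\<^sub>R rp (snd (snd b))"
    "\<And>r s t. l0 \<bullet> (r *\<^sub>R rp (fst b) + s *\<^sub>R rp (fst (snd b)) + t *\<^sub>R rp (snd (snd b))) = r"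
    "\<And>r s t. l1 \<bullet> (r *\<^sub>R rp (fst b) + s *\<^sub>R rp (fst (snd b)) + t *\<^sub>R rp (snd (snd b))) = s"
    "\<And>r s t. l2 \<bullet> (r *\<^sub>R rp (fst b) + s *\<^sub>R rp (fst (snd b)) + t *\<^sub>R rp (snd (snd b))) = t"
proof -
  from assms consider "b = ((3,0,0), (2,1,0), (2,0,1))" | "b = ((0,3,0), (1,2,0), (0,2,1))"
    | "b = ((0,0,3), (0,1,2), (1,0,2))" | "b = ((2,1,0), (1,2,0), (2,0,1))" unfolding bases_def by blast
  then show ?thesis
  proof cases
    case 1
    show ?thesis by (rule that[of "(1/3, -2/3, -2/3)" "(0, 1, 0)" "(0, 0, 1)"])
      (auto simp: 1 prod_eq_iff field_simps)
  next
    case 2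
    show ?thesis by (rule that[of "(-2/3, 1/3, -2/3)" "(1, 0, 0)" "(0, 0, 1)"])
      (auto simp: 2 prod_eq_iff field_simps)
  next
    case 3
    show ?thesis by (rule that[of "(-2/3, -2/3, 1/3)" "(0, 1, 0)" "(1, 0, 0)"])
      (auto simp: 3 prod_eq_iff field_simps)
  next
    case 4
    show ?thesis by (rule that[of "(2/3, -1/3, -4/3)" "(-1/3, 2/3, 2/3)" "(0, 0, 1)"])
      (auto simp: 4 prod_eq_iff field_simps)
  qed
qed

lemma cone_slice_iff:
  "t \<in> cone_slice b w3 w4 w5 z \<longleftrightarrow> nonneg3 t \<and>
     in_cone b (z - crd 0 t *\<^sub>R rp w5 - crd 1 t *\<^sub>R rp w4 - crd 2 t *\<^sub>R rp w3)"
  by (simp add: cone_slice_def)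

lemma sum_lessThan_6: "(\<Sum>i<6. f i) = f 0 + f 1 + f 2 + f 3 + f 4 + f (5::nat)"
  by (simp add: eval_nat_numeral)

lemma all_less_6: "(\<forall>i<6. P i) \<longleftrightarrow> P 0 \<and> P 1 \<and> P 2 \<and> P 3 \<and> P 4 \<and> P (5::nat)"
  by (simp add: eval_nat_numeral All_less_Suc conj_ac)

lemma all_less_3: "(\<forall>i<3. P i) \<longleftrightarrow> P 0 \<and> P 1 \<and> P (2::nat)"
  by (simp add: eval_nat_numeral All_less_Suc conj_ac)

lemma in_cone_csum:
  assumes "in_cone b y" "csum (rp (fst b)) = 3" "csum (rp (fst (snd b))) = 3" "csum (rp (snd (snd b))) = 3"
  obtains r s t where "0 \<le> r" "0 \<le> s" "0 \<le> t" "csum y = 3 * (r + s + t)"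
    "y = r *\<^sub>R rp (fst b) + s *\<^sub>R rp (fst (snd b)) + t *\<^sub>R rp (snd (snd b))"
proof -
  obtain r s t where rst: "0 \<le> r" "0 \<le> s" "0 \<le> t"
    and y: "y = r *\<^sub>R rp (fst b) + s *\<^sub>R rp (fst (snd b)) + t *\<^sub>R rp (snd (snd b))"
    using assms(1) unfolding in_cone_def by blast
  have "csum y = r * csum (rp (fst b)) + s * csum (rp (fst (snd b))) + t * csum (rp (snd (snd b)))"
    unfolding y by (simp only: linear_add[OF linear_csum] linear_cmul[OF linear_csum] real_scaleR_def)
  then have "csum y = 3 * (r + s + t)" unfolding assms(2-4) by simp
  then show ?thesis by (rule that[OF rst _ y])
qed

lemma bases_csum:
  "b \<in> bases \<Longrightarrow> csum (rp (fst b)) = 3 \<and> csum (rp (fst (snd b))) = 3 \<and> csum (rp (snd (snd b))) = 3"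
  by (auto simp: bases_def csum_def crd_def)

lemma compact_cone_slice:
  assumes b: "b \<in> bases" and w: "csum (rp w3) = 3" "csum (rp w4) = 3" "csum (rp w5) = 3"
  shows "compact (cone_slice b w3 w4 w5 z)"
proof -
  have "cone_slice b w3 w4 w5 z \<subseteq> cbox (0, 0, 0) (csum z, csum z, csum z)"
  proof
    fix t assume t: "t \<in> cone_slice b w3 w4 w5 z"
    obtain t0 t1 t2 where tt: "t = (t0, t1, t2)" by (cases t)
    have nn: "0 \<le> t0" "0 \<le> t1" "0 \<le> t2" using t by (auto simp: cone_slice_iff nonneg3_def all_less_3 tt crd_def)
    have "in_cone b (z - t0 *\<^sub>R rp w5 - t1 *\<^sub>R rp w4 - t2 *\<^sub>R rp w3)"
      using t by (simp add: cone_slice_iff tt crd_def)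
    then obtain r s u where "0 \<le> r" "0 \<le> s" "0 \<le> u" "csum (z - t0 *\<^sub>R rp w5 - t1 *\<^sub>R rp w4 - t2 *\<^sub>R rp w3) = 3 * (r + s + u)"
      using in_cone_csum bases_csum[OF b] by metis
    then have "3 * t0 + 3 * t1 + 3 * t2 \<le> csum z"
      using w by (simp add: linear_diff[OF linear_csum] linear_cmul[OF linear_csum])
    then show "t \<in> cbox (0, 0, 0) (csum z, csum z, csum z)"
      using nn by (simp add: tt mem_box Basis_triple)
  qed
  then show ?thesis using closed_cone_slice[OF b] bounded_cbox bounded_subset compact_eq_bounded_closed by metis
qed

text \<open>A point of the lifted simplex above \<open>x\<close> is given by six weights. The last
  three are the coordinates of \<open>t\<close>, and the first three are then linear in
  \<open>zc T x\<close> and \<open>t\<close>. So the fibre is an affine image of the cone slice,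
  with a linear part that is the same for all \<open>x\<close>.\<close>

lemma lift_slice:
  assumes d: "dtri T \<noteq> 0" and b: "b \<in> bases"
    and q: "zc T (q 0) = rp (fst b)" "zc T (q 1) = rp (fst (snd b))" "zc T (q 2) = rp (snd (snd b))"
      "zc T (q 3) = rp w3" "zc T (q 4) = rp w4" "zc T (q 5) = rp w5"
  shows "\<exists>(M :: hpt \<Rightarrow> hpt) c. linear M \<and>
    (\<forall>x. {y. (x, y) \<in> convex hull ((\<lambda>i. (q i, \<eta> i)) ` {..<6::nat})} = (\<lambda>t. c x + M t) ` cone_slice b w3 w4 w5 (zc T x))"
proof -
  obtain l0 l1 l2 where dual: 
    "\<And>y. y = (l0 \<bullet> y) *\<^sub>R rp (fst b) + (l1 \<bullet> y) *\<^sub>R rp (fst (snd b)) + (l2 \<bullet> y) *\<^sub>R rp (snd (snd b))"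
    and l: "\<And>r s t. l0 \<bullet> (r *\<^sub>R rp (fst b) + s *\<^sub>R rp (fst (snd b)) + t *\<^sub>R rp (snd (snd b))) = r"
    "\<And>r s t. l1 \<bullet> (r *\<^sub>R rp (fst b) + s *\<^sub>R rp (fst (snd b)) + t *\<^sub>R rp (snd (snd b))) = s"
    "\<And>r s t. l2 \<bullet> (r *\<^sub>R rp (fst b) + s *\<^sub>R rp (fst (snd b)) + t *\<^sub>R rp (snd (snd b))) = t"
    using bases_dual[OF b] by metis
  \<comment> \<open>\<open>E\<close> interpolates the heights over the base knots linearly;
    \<open>M\<close> records how far the other three heights deviate from it.\<close>
  define E where "E v = (l0 \<bullet> v) *\<^sub>R \<eta> 0 + (l1 \<bullet> v) *\<^sub>R \<eta> 1 + (l2 \<bullet> v) *\<^sub>R \<eta> 2" for v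
  define M where "M t = crd 0 t *\<^sub>R (\<eta> 5 - E (rp w5)) + crd 1 t *\<^sub>R (\<eta> 4 - E (rp w4)) + crd 2 t *\<^sub>R (\<eta> 3 - E (rp w3))" for t
  define c where "c x = E (zc T x)" for x
  have linE: "linear E" by (rule linearI) (simp_all add: E_def inner_add_right algebra_simps)
  have "linear M" by (rule linearI) (simp_all add: M_def algebra_simps)
  moreover have "{y. (x, y) \<in> convex hull ((\<lambda>i. (q i, \<eta> i)) ` {..<6::nat})} = (\<lambda>t. c x + M t) ` cone_slice b w3 w4 w5 (zc T x)" (is "?L = ?R") for x
  proof
    show "?L \<subseteq> ?R"
    proof
      fix y assume "y \<in> ?L"
      then obtain u where u: "\<forall>i<6. 0 \<le> u i" "(\<Sum>i<6. u i) = 1" "(x, y) = (\<Sum>i<6. u i *\<^sub>R (q i, \<eta> i))"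
        unfolding convex_hull_set_list by auto
      have x: "x = (\<Sum>i<6. u i *\<^sub>R q i)" and y: "y = (\<Sum>i<6. u i *\<^sub>R \<eta> i)"
        using u(3) by (simp_all add: sum_lessThan_6)
      define t where "t = (u 5, u 4, u 3)"
      have z: "zc T x = u 0 *\<^sub>R rp (fst b) + u 1 *\<^sub>R rp (fst (snd b)) + u 2 *\<^sub>R rp (snd (snd b)) + (u 3 *\<^sub>R rp w3 + u 4 *\<^sub>R rp w4 + u 5 *\<^sub>R rp w5)"
        unfolding x zc_affine[OF d u(2)] by (simp add: sum_lessThan_6 q add.assoc del: One_nat_def)
      then have z2: "zc T x - crd 0 t *\<^sub>R rp w5 - crd 1 t *\<^sub>R rp w4 - crd 2 t *\<^sub>R rp w3 =
          u 0 *\<^sub>R rp (fst b) + u 1 *\<^sub>R rp (fst (snd b)) + u 2 *\<^sub>R rp (snd (snd b))"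
        by (simp add: t_def crd_def)
      have u0: "0 \<le> u 0" "0 \<le> u 1" "0 \<le> u 2" "0 \<le> u 3" "0 \<le> u 4" "0 \<le> u 5" using u(1) by auto
      have "t \<in> cone_slice b w3 w4 w5 (zc T x)" unfolding cone_slice_iff z2
        by (intro conjI in_coneI[OF _ _ _ refl]) (use u0 in \<open>auto simp: nonneg3_def all_less_3 t_def crd_def\<close>)
      moreover have "y = c x + M t"
      proof -
        have "E (zc T x) = u 0 *\<^sub>R \<eta> 0 + u 1 *\<^sub>R \<eta> 1 + u 2 *\<^sub>R \<eta> 2 + E (u 3 *\<^sub>R rp w3 + u 4 *\<^sub>R rp w4 + u 5 *\<^sub>R rp w5)"
        proof -
          have "E (u 0 *\<^sub>R rp (fst b) + u 1 *\<^sub>R rp (fst (snd b)) + u 2 *\<^sub>R rp (snd (snd b))) = u 0 *\<^sub>R \<eta> 0 + u 1 *\<^sub>R \<eta> 1 + u 2 *\<^sub>R \<eta> 2"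
            unfolding E_def l ..
          then show ?thesis unfolding z by (simp only: linear_add[OF linE, of _ "u 3 *\<^sub>R rp w3 + u 4 *\<^sub>R rp w4 + u 5 *\<^sub>R rp w5"])
        qed
        then show ?thesis unfolding c_def M_def y
          by (simp add: sum_lessThan_6 t_def crd_def linear_add[OF linE] linear_cmul[OF linE] scaleR_diff_right del: One_nat_def)
      qed
      ultimately show "y \<in> ?R" by blast
    qed
    show "?R \<subseteq> ?L"
    proof
      fix y assume "y \<in> ?R"
      then obtain t where t: "t \<in> cone_slice b w3 w4 w5 (zc T x)" and y: "y = c x + M t" by blast
      obtain t0 t1 t2 where tt: "t = (t0, t1, t2)" by (cases t)
      have nn: "0 \<le> t0" "0 \<le> t1" "0 \<le> t2" using t by (auto simp: cone_slice_iff nonneg3_def all_less_3 tt crd_def)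
      have "in_cone b (zc T x - t0 *\<^sub>R rp w5 - t1 *\<^sub>R rp w4 - t2 *\<^sub>R rp w3)"
        using t by (simp add: cone_slice_iff tt crd_def)
      then obtain r s v where rsv: "0 \<le> r" "0 \<le> s" "0 \<le> v" and
          cs: "csum (zc T x - t0 *\<^sub>R rp w5 - t1 *\<^sub>R rp w4 - t2 *\<^sub>R rp w3) = 3 * (r + s + v)"
        and e: "zc T x - t0 *\<^sub>R rp w5 - t1 *\<^sub>R rp w4 - t2 *\<^sub>R rp w3 = r *\<^sub>R rp (fst b) + s *\<^sub>R rp (fst (snd b)) + v *\<^sub>R rp (snd (snd b))"
        using in_cone_csum bases_csum[OF b] by metis
      have w: "csum (rp w3) = 3" "csum (rp w4) = 3" "csum (rp w5) = 3" by (metis q csum_zc)+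
      define u :: "nat \<Rightarrow> real" where "u i = [r, s, v, t2, t1, t0] ! i" for i
      have us: "u 0 = r" "u 1 = s" "u 2 = v" "u 3 = t2" "u 4 = t1" "u 5 = t0" by (simp_all add: u_def)
      have u1: "(\<Sum>i<6. u i) = 1" using cs w
        by (simp add: sum_lessThan_6 us linear_diff[OF linear_csum] linear_cmul[OF linear_csum] del: One_nat_def)
      have u0: "\<forall>i<6. 0 \<le> u i" unfolding all_less_6 us using rsv nn by auto
      have z: "zc T x = r *\<^sub>R rp (fst b) + s *\<^sub>R rp (fst (snd b)) + v *\<^sub>R rp (snd (snd b)) + (t2 *\<^sub>R rp w3 + t1 *\<^sub>R rp w4 + t0 *\<^sub>R rp w5)"
        using e by (simp add: algebra_simps)
      have "zc T (\<Sum>i<6. u i *\<^sub>R q i) = zc T x"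
        unfolding zc_affine[OF d u1] z by (simp add: sum_lessThan_6 us q add.assoc del: One_nat_def)
      then have x: "x = (\<Sum>i<6. u i *\<^sub>R q i)" by (metis bpt_zc[OF d])
      have "E (r *\<^sub>R rp (fst b) + s *\<^sub>R rp (fst (snd b)) + v *\<^sub>R rp (snd (snd b))) = r *\<^sub>R \<eta> 0 + s *\<^sub>R \<eta> 1 + v *\<^sub>R \<eta> 2"
        unfolding E_def l ..
      then have "c x = r *\<^sub>R \<eta> 0 + s *\<^sub>R \<eta> 1 + v *\<^sub>R \<eta> 2 + E (t2 *\<^sub>R rp w3 + t1 *\<^sub>R rp w4 + t0 *\<^sub>R rp w5)"
        unfolding c_def z by (simp only: linear_add[OF linE])
      then have "y = (\<Sum>i<6. u i *\<^sub>R \<eta> i)" unfolding y M_def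
        by (simp add: sum_lessThan_6 us tt crd_def linear_add[OF linE] linear_cmul[OF linE] scaleR_diff_right del: One_nat_def)
      with x have "(x, y) = (\<Sum>i<6. u i *\<^sub>R (q i, \<eta> i))" by (simp add: sum_lessThan_6)
      then show "y \<in> ?L" unfolding convex_hull_set_list using u0 u1 by blast
    qed
  qed
  ultimately show ?thesis by blast
qed

text \<open>The integral of the slice volumes over the plane, in a form where all three directions
  are replaced by the first base knot. In this form it visibly depends on the triangle and the base
  alone.\<close>

definition slice_norm :: "tri \<Rightarrow> int3 \<times> int3 \<times> int3 \<Rightarrow> ennreal" where
  "slice_norm T b = (\<integral>\<^sup>+t. indicator {t. nonneg3 t} t *
     emeasure lborel {x. in_cone b (zc T x - csum t *\<^sub>R rp (fst b))} \<partial>lborel)"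

lemma continuous_on_crd [continuous_intros]:
  "continuous_on S f \<Longrightarrow> continuous_on S (\<lambda>x. crd i (f x))"
  unfolding crd_def by (cases "i = 0"; cases "i = 1") (auto intro!: continuous_intros)

lemma closed_slice_graph:
  assumes b: "b \<in> bases"
  shows "closed {p. snd p \<in> cone_slice b w3 w4 w5 (zc T (fst p))}"
proof -
  have "closed ((\<lambda>p. zc T (fst p) - crd 0 (snd p) *\<^sub>R rp w5 - crd 1 (snd p) *\<^sub>R rp w4 - crd 2 (snd p) *\<^sub>R rp w3) -` {y. in_cone b y})"
    using closed_in_cone[OF b] by (rule closed_vimage) (intro continuous_intros)
  moreover have "closed {p::pt \<times> hpt. nonneg3 (snd p)}" unfolding nonneg3_def
    by (intro closed_Collect_all closed_Collect_imp closed_Collect_le continuous_intros open_Collect_const)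
  ultimately show ?thesis by (auto simp: cone_slice_iff vimage_def intro: closed_Collect_conj)
qed

lemma slice_graph_measurable:
  "b \<in> bases \<Longrightarrow> {p. snd p \<in> cone_slice b w3 w4 w5 (zc T (fst p))} \<in> sets (lborel \<Otimes>\<^sub>M lborel)"
  unfolding lborel_prod sets_lborel by (rule borel_closed) (rule closed_slice_graph)

text \<open>Integrating over \<open>x\<close> first, each fibre is a translate of a set that no longer involves \<open>w3\<close>, \<open>w4\<close>, \<open>w5\<close>.\<close>

lemma slice_norm_eq:
  assumes d: "dtri T \<noteq> 0" and b: "b \<in> bases" and w: "csum (rp w3) = 3" "csum (rp w4) = 3" "csum (rp w5) = 3"
  shows "(\<integral>\<^sup>+x. emeasure lborel (cone_slice b w3 w4 w5 (zc T x)) \<partial>lborel) = slice_norm T b"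
proof -
  let ?Q = "{p. snd p \<in> cone_slice b w3 w4 w5 (zc T (fst p))}"
  have [measurable]: "?Q \<in> sets (lborel \<Otimes>\<^sub>M lborel)" by (rule slice_graph_measurable[OF b])
  have "(\<integral>\<^sup>+x. emeasure lborel (cone_slice b w3 w4 w5 (zc T x)) \<partial>lborel) = (\<integral>\<^sup>+x. \<integral>\<^sup>+t. indicator ?Q (x, t) \<partial>lborel \<partial>lborel)"
  proof (intro nn_integral_cong)
    fix x
    have "cone_slice b w3 w4 w5 (zc T x) \<in> sets lborel" using borel_closed[OF closed_cone_slice[OF b]] by simp
    then have "emeasure lborel (cone_slice b w3 w4 w5 (zc T x)) = (\<integral>\<^sup>+t. indicator (cone_slice b w3 w4 w5 (zc T x)) t \<partial>lborel)" by simp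
    also have "\<dots> = (\<integral>\<^sup>+t. indicator ?Q (x, t) \<partial>lborel)"
      by (intro nn_integral_cong) (auto simp: indicator_def)
    finally show "emeasure lborel (cone_slice b w3 w4 w5 (zc T x)) = (\<integral>\<^sup>+t. indicator ?Q (x, t) \<partial>lborel)" .
  qed
  also have "\<dots> = (\<integral>\<^sup>+t. \<integral>\<^sup>+x. indicator ?Q (x, t) \<partial>lborel \<partial>lborel)"
    by (rule lborel_pair.Fubini[symmetric]) measurable
  also have "\<dots> = slice_norm T b" unfolding slice_norm_def
  proof (intro nn_integral_cong)
    fix t :: hpt
    \<comment> \<open>\<open>W\<close> is the total displacement for the weights \<open>t\<close>,
      and \<open>V\<close> its difference from the same total weight placed on the first base knot.
      Both displacements have the same coordinate sum, so \<open>V\<close> induces a translation of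
      the plane, which preserves the area of the fibre.\<close>
    define W where "W = crd 0 t *\<^sub>R rp w5 + crd 1 t *\<^sub>R rp w4 + crd 2 t *\<^sub>R rp w3"
    define V where "V = W - csum t *\<^sub>R rp (fst b)"
    have "csum W = crd 0 t * csum (rp w5) + crd 1 t * csum (rp w4) + crd 2 t * csum (rp w3)"
      by (simp only: W_def linear_add[OF linear_csum] linear_cmul[OF linear_csum] real_scaleR_def)
    then have "csum W = 3 * csum t" unfolding w by (simp add: csum_def)
    then have V0: "csum V = 0" using bases_csum[OF b]
      by (simp add: V_def linear_diff[OF linear_csum] linear_cmul[OF linear_csum])
    have sh: "zc T (x + bpt T V) = zc T x + V" for x
    proof -
      have "bpt T (zc T x + V) = x + bpt T V" by (simp add: linear_add[OF linear_bpt] bpt_zc[OF d])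
      then show ?thesis using zc_bpt[OF d, of "zc T x + V"] V0 by (simp add: linear_add[OF linear_csum])
    qed
    let ?A = "{x. in_cone b (zc T x - csum t *\<^sub>R rp (fst b))}"
    have A: "?A \<in> sets borel"
    proof -
      have "closed ((\<lambda>x. zc T x - csum t *\<^sub>R rp (fst b)) -` {y. in_cone b y})"
        using closed_in_cone[OF b] by (rule closed_vimage) (intro continuous_intros)
      then show ?thesis by (auto simp: vimage_def intro: borel_closed)
    qed
    show "(\<integral>\<^sup>+x. indicator ?Q (x, t) \<partial>lborel) = indicator {t. nonneg3 t} t * emeasure lborel ?A"
    proof (cases "nonneg3 t")
      case True
      have "{x. (x, t) \<in> ?Q} = (+) (bpt T V) ` ?A"
      proof (intro equalityI subsetI)
        fix x assume "x \<in> {x. (x, t) \<in> ?Q}"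
        then have "in_cone b (zc T x - W)" by (simp add: cone_slice_iff W_def diff_diff_eq)
        moreover have "zc T (x - bpt T V) = zc T x - V" using sh[of "x - bpt T V"] by simp
        ultimately have "x - bpt T V \<in> ?A" by (simp add: V_def)
        then show "x \<in> (+) (bpt T V) ` ?A" by (intro image_eqI[of _ _ "x - bpt T V"]) auto
      next
        fix y assume "y \<in> (+) (bpt T V) ` ?A"
        then obtain x where y: "y = bpt T V + x" and "in_cone b (zc T x - csum t *\<^sub>R rp (fst b))" by blast
        then have "in_cone b (zc T (x + bpt T V) - W)" unfolding sh by (simp add: V_def)
        then show "y \<in> {x. (x, t) \<in> ?Q}"
          using True by (simp add: y cone_slice_iff W_def diff_diff_eq add.commute)
      qed
      then have "emeasure lborel {x. (x, t) \<in> ?Q} = emeasure lborel ?A"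
        using measure_lborel_translate[OF A] by simp
      moreover have "(\<integral>\<^sup>+x. indicator ?Q (x, t) \<partial>lborel) = (\<integral>\<^sup>+x. indicator {x. (x, t) \<in> ?Q} x \<partial>lborel)"
        by (intro nn_integral_cong) (auto simp: indicator_def)
      moreover have "{x. (x, t) \<in> ?Q} \<in> sets lborel"
      proof -
        have "closed ((\<lambda>x. (x, t)) -` ?Q)"
          by (rule closed_vimage[OF closed_slice_graph[OF b]]) (intro continuous_intros)
        then show ?thesis by (simp add: vimage_def borel_closed)
      qed
      ultimately show ?thesis using True by simp
    next
      case False
      then have "indicator ?Q (x, t) = (0::ennreal)" for x by (simp add: cone_slice_iff)
      then show ?thesis using False by simp
    qed
  qed
  finally show ?thesis .
qed

lemma convex_hull_pos_measure:
  fixes S :: "'a::euclidean_space set"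
  assumes "finite S" "card S = Suc DIM('a)" "\<not> affine_dependent S"
  shows "0 < measure lborel (convex hull S)"
proof (rule ccontr)
  have c: "compact (convex hull S)" using assms(1) by (rule finite_imp_compact_convex_hull)
  assume "\<not> 0 < measure lborel (convex hull S)"
  then have "measure lborel (convex hull S) = 0" using measure_nonneg[of lborel "convex hull S"] by linarith
  moreover have "measure lebesgue (convex hull S) = measure lborel (convex hull S)"
    using c by (intro measure_completion) (auto dest: compact_imp_closed)
  ultimately have "negligible (convex hull S)"
    using negligible_iff_measure0[OF lmeasurable_compact[OF c]] by simp
  then have "negligible (interior (convex hull S))" using interior_subset negligible_subset by blast
  moreover have "interior (convex hull S) \<noteq> {}" using interior_convex_hull_eq_empty[OF assms(2)] assms(3) by simp
  ultimately show False using open_not_negligible open_interior by blast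
qed

text \<open>The base knots are lifted to height 0 and the others to the three unit vectors. In an
  affine relation the heights kill the last three coefficients, and the independence of the base
  kills the rest.\<close>

lemma positive_lift_exists:
  assumes d: "dtri T \<noteq> 0" and b: "b \<in> bases"
    and q: "zc T q0 = rp (fst b)" "zc T q1 = rp (fst (snd b))" "zc T q2 = rp (snd (snd b))"
    and \<Xi>: "mset \<Xi> = mset [q0, q1, q2, q3, q4, q5]"
  shows "\<exists>ps :: lpt list. map fst ps = \<Xi> \<and> measure lborel (convex hull (set ps)) > 0"
proof -
  define zs :: "lpt list" where "zs = [(q0, 0), (q1, 0), (q2, 0), (q3, (0,0,1)), (q4, (0,1,0)), (q5, (1,0,0))]"
  have "mset (map fst zs) = mset \<Xi>" by (simp add: zs_def \<Xi>)
  from mset_map_eq_ex[OF this] obtain ps where ps: "mset ps = mset zs" "map fst ps = \<Xi>" by auto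
  have set: "set ps = set zs" using ps(1) by (metis set_mset_mset)
  have "rp (fst b) \<noteq> rp (fst (snd b)) \<and> rp (fst b) \<noteq> rp (snd (snd b)) \<and> rp (fst (snd b)) \<noteq> rp (snd (snd b))"
    using b by (auto simp: bases_def)
  then have ne: "q0 \<noteq> q1" "q0 \<noteq> q2" "q1 \<noteq> q2" using q by auto
  have z0: "(0::hpt) = (0, 0, 0)" by (simp add: zero_prod_def)
  have dist: "distinct zs" using ne by (simp add: zs_def z0)
  have card: "card (set zs) = Suc DIM(lpt)" using distinct_card[OF dist] by (simp add: zs_def)
  have "\<not> affine_dependent (set zs)"
  proof
    assume "affine_dependent (set zs)"
    then obtain U where U: "sum U (set zs) = 0" "\<exists>v\<in>set zs. U v \<noteq> 0" "(\<Sum>v\<in>set zs. U v *\<^sub>R v) = 0"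
      using affine_dependent_explicit_finite[of "set zs"] by auto
    have s: "(\<Sum>v\<in>set zs. f v) = sum_list (map f zs)" for f :: "lpt \<Rightarrow> 'b::comm_monoid_add"
      using sum_list_distinct_conv_sum_set[OF dist] by metis
    have e: "snd (\<Sum>v\<in>set zs. U v *\<^sub>R v) = (U (q5, (1,0,0)), U (q4, (0,1,0)), U (q3, (0,0,1)))"
      unfolding s by (simp add: zs_def z0)
    have u3: "U (q5, (1,0,0)) = 0" "U (q4, (0,1,0)) = 0" "U (q3, (0,0,1)) = 0"
      using e U(3) by (simp_all add: z0)
    \<comment> \<open>Adding the relation to the trivial representation of \<open>q0\<close> gives
      weights of sum 1, to which \<open>zc_affine\<close> applies.\<close>
    define u where "u i = [1 + U (q0, 0), U (q1, 0), U (q2, 0)] ! i" for i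
    define p where "p i = [q0, q1, q2] ! i" for i
    have s3: "(\<Sum>i<3. h i) = h 0 + h 1 + h (2::nat)" for h :: "nat \<Rightarrow> 'c::comm_monoid_add" by (simp add: eval_nat_numeral)
    have "U (q0, 0) + U (q1, 0) + U (q2, 0) = 0" using U(1) u3 unfolding s by (simp add: zs_def add.assoc)
    then have u1: "(\<Sum>i<3. u i) = 1" by (simp add: s3 u_def)
    have "U (q0, 0) *\<^sub>R q0 + U (q1, 0) *\<^sub>R q1 + U (q2, 0) *\<^sub>R q2 = fst (\<Sum>v\<in>set zs. U v *\<^sub>R v)"
      unfolding s using u3 by (simp add: zs_def add.assoc)
    then have "U (q0, 0) *\<^sub>R q0 + U (q1, 0) *\<^sub>R q1 + U (q2, 0) *\<^sub>R q2 = 0" using U(3) by simp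
    then have "(\<Sum>i<3. u i *\<^sub>R p i) = q0" by (simp add: s3 u_def p_def scaleR_add_left add.assoc)
    then have "zc T q0 = (\<Sum>i<3. u i *\<^sub>R zc T (p i))" using zc_affine[OF d u1, of p] by simp
    then have z: "U (q0, 0) *\<^sub>R rp (fst b) + U (q1, 0) *\<^sub>R rp (fst (snd b)) + U (q2, 0) *\<^sub>R rp (snd (snd b)) = 0"
      by (simp add: s3 u_def p_def q scaleR_add_left add.assoc)
    have "U (q0, 0) = 0 \<and> U (q1, 0) = 0 \<and> U (q2, 0) = 0"
      using bases_dual[OF b] z by (metis inner_zero_right)
    then show False using U(2) u3 by (auto simp: zs_def)
  qed
  then have "0 < measure lborel (convex hull (set zs))" by (intro convex_hull_pos_measure card) auto
  then show ?thesis using ps(2) set by metis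
qed

lemma emeasure_compact: "compact S \<Longrightarrow> emeasure lborel S = ennreal (measure lborel S)" for S :: "'a::euclidean_space set"
  by (intro emeasure_eq_measure2 fmeasurable_compact)

text \<open>\<open>simplex_lift\<close> is an arbitrary choice. Each of its fibres has
  \<open>D\<close> times the volume of the cone slice, and by Fubini its total volume is
  \<open>D * slice_norm T b\<close>, so \<open>D\<close> cancels. Since the chosen simplex has
  positive volume, both factors are positive.\<close>

lemma simplex_spline_eq:
  assumes d: "dtri T \<noteq> 0" and b: "b \<in> bases"
    and q: "zc T q0 = rp (fst b)" "zc T q1 = rp (fst (snd b))" "zc T q2 = rp (snd (snd b))"
      "zc T q3 = rp w3" "zc T q4 = rp w4" "zc T q5 = rp w5"
    and \<Xi>: "mset \<Xi> = mset [q0, q1, q2, q3, q4, q5]"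
  shows "simplex_spline \<Xi> x = measure lborel (cone_slice b w3 w4 w5 (zc T x)) / enn2real (slice_norm T b)"
    and "0 < enn2real (slice_norm T b)"
proof -
  define ps where "ps = simplex_lift \<Xi>"
  define \<sigma> where "\<sigma> = convex hull (set ps)"
  have ps: "map fst ps = \<Xi>" "measure lborel \<sigma> > 0"
    using someI_ex[OF positive_lift_exists[OF d b q(1-3) \<Xi>]]
    unfolding ps_def simplex_lift_def \<sigma>_def by auto
  have "mset (map fst ps) = mset [q0, q1, q2, q3, q4, q5]" using ps(1) \<Xi> by simp
  then have "\<exists>zs. mset zs = mset ps \<and> map fst zs = [q0, q1, q2, q3, q4, q5]" by (rule mset_map_eq_ex)
  then obtain zs where "mset zs = mset ps \<and> map fst zs = [q0, q1, q2, q3, q4, q5]" ..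
  then have zs: "mset zs = mset ps" "map fst zs = [q0, q1, q2, q3, q4, q5]" by (rule conjunct1, rule conjunct2)
  define qq where "qq i = [q0, q1, q2, q3, q4, q5] ! i" for i
  define \<eta> where "\<eta> i = snd (zs ! i)" for i
  have len: "length zs = 6" using arg_cong[OF zs(2), of length] by simp
  have "zs ! i = (qq i, \<eta> i)" if "i < 6" for i
    using that len zs(2) by (metis nth_map prod.collapse qq_def \<eta>_def)
  then have "(\<lambda>i. (qq i, \<eta> i)) ` {..<6} = (!) zs ` {..<length zs}" unfolding len by (intro image_cong) auto
  also have "\<dots> = set zs" unfolding set_conv_nth by blast
  finally have "set zs = (\<lambda>i. (qq i, \<eta> i)) ` {..<6}" by simp
  then have \<sigma>: "\<sigma> = convex hull ((\<lambda>i. (qq i, \<eta> i)) ` {..<6})"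
    unfolding \<sigma>_def using zs(1) by (metis set_mset_mset)
  have qz: "zc T (qq 0) = rp (fst b)" "zc T (qq 1) = rp (fst (snd b))" "zc T (qq 2) = rp (snd (snd b))"
      "zc T (qq 3) = rp w3" "zc T (qq 4) = rp w4" "zc T (qq 5) = rp w5"
    using q by (simp_all add: qq_def)
  obtain M c where M: "linear M"
    and sl: "\<And>x. {y. (x, y) \<in> \<sigma>} = (\<lambda>t. c x + M t) ` cone_slice b w3 w4 w5 (zc T x)"
    using lift_slice[OF d b qz, of \<eta>] unfolding \<sigma>[symmetric] by blast
  have w: "csum (rp w3) = 3" "csum (rp w4) = 3" "csum (rp w5) = 3" unfolding q(4-6)[symmetric] by simp_all
  have comp: "compact (cone_slice b w3 w4 w5 z)" for z by (rule compact_cone_slice[OF b w])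
  obtain D where D: "0 \<le> D" "\<And>S. compact S \<Longrightarrow> measure lborel (M ` S) = D * measure lborel S"
    using linear_image_scales_volume[OF M] by metis
  have contM: "continuous_on S M" for S using M by (simp add: linear_continuous_on linear_conv_bounded_linear)
  have em: "emeasure lborel {y. (x, y) \<in> \<sigma>} = ennreal D * emeasure lborel (cone_slice b w3 w4 w5 (zc T x))" for x
  proof -
    let ?S = "cone_slice b w3 w4 w5 (zc T x)"
    have MS: "compact (M ` ?S)" using comp contM compact_continuous_image by blast
    have "(\<lambda>t. c x + M t) ` ?S = (+) (c x) ` (M ` ?S)" by (simp add: image_image)
    moreover have "M ` ?S \<in> sets borel" using MS compact_imp_closed borel_closed by blast
    ultimately have "emeasure lborel {y. (x, y) \<in> \<sigma>} = emeasure lborel (M ` ?S)"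
      using sl measure_lborel_translate by metis
    also have "\<dots> = ennreal D * emeasure lborel ?S"
      using D(1) by (simp add: emeasure_compact MS comp D(2) ennreal_mult)
    finally show ?thesis .
  qed
  have \<sigma>c: "compact \<sigma>" unfolding \<sigma>_def by (rule finite_imp_compact_convex_hull) simp
  then have \<sigma>s: "\<sigma> \<in> sets (lborel \<Otimes>\<^sub>M lborel)" unfolding lborel_prod by (simp add: borel_compact)
  have meas: "(\<lambda>x. emeasure lborel (cone_slice b w3 w4 w5 (zc T x))) \<in> borel_measurable lborel"
  proof -
    have "(\<lambda>x. emeasure lborel (Pair x -` {p. snd p \<in> cone_slice b w3 w4 w5 (zc T (fst p))})) \<in> borel_measurable lborel"
      by (rule lborel.measurable_emeasure_Pair[OF slice_graph_measurable[OF b]])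
    then show ?thesis by (simp add: vimage_def)
  qed
  have "emeasure lborel \<sigma> = emeasure (lborel \<Otimes>\<^sub>M lborel) \<sigma>" by (simp add: lborel_prod)
  also have "\<dots> = (\<integral>\<^sup>+x. emeasure lborel (Pair x -` \<sigma>) \<partial>lborel)"
    by (rule lborel.emeasure_pair_measure_alt[OF \<sigma>s])
  also have "\<dots> = (\<integral>\<^sup>+x. ennreal D * emeasure lborel (cone_slice b w3 w4 w5 (zc T x)) \<partial>lborel)"
    using em by (simp add: vimage_def)
  also have "\<dots> = ennreal D * slice_norm T b"
    using meas by (simp add: nn_integral_cmult slice_norm_eq[OF d b w])
  finally have "measure lborel \<sigma> = D * enn2real (slice_norm T b)"
    using D(1) by (simp add: measure_def enn2real_mult)
  then have pos: "0 < D" "0 < enn2real (slice_norm T b)" "measure lborel \<sigma> = D * enn2real (slice_norm T b)"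
    using ps(2) D(1) by (auto simp: zero_less_mult_iff)
  show "0 < enn2real (slice_norm T b)" by (rule pos)
  have "measure lborel {y. (x, y) \<in> \<sigma>} = D * measure lborel (cone_slice b w3 w4 w5 (zc T x))"
    unfolding measure_def em using D(1) by (simp add: enn2real_mult)
  then show "simplex_spline \<Xi> x = measure lborel (cone_slice b w3 w4 w5 (zc T x)) / enn2real (slice_norm T b)"
    using pos by (simp add: simplex_spline_def Let_def ps_def[symmetric] \<sigma>_def[symmetric])
qed

section \<open>The basis functions on a closed triangle as combinations of truncated cubes\<close>

definition FF :: "nat \<Rightarrow> hpt \<Rightarrow> real" where "FF i z = (\<Sum>j<28. cf i j * pw 3 (lf j \<bullet> z))"

lemma tri_set_zc:
  assumes d: "dtri T \<noteq> 0" shows "tri_set T = {x. nonneg3 (zc T x)}"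
proof -
  have "tri_set T = {u *\<^sub>R tv1 T + v *\<^sub>R tv2 T + w *\<^sub>R tv3 T |u v w. 0 \<le> u \<and> 0 \<le> v \<and> 0 \<le> w \<and> u + v + w = 1}"
    unfolding tri_set_def vset_def by (rule convex_hull_3)
  also have "\<dots> = {x. nonneg3 (zc T x)}"
  proof (intro equalityI subsetI)
    fix x assume "x \<in> {u *\<^sub>R tv1 T + v *\<^sub>R tv2 T + w *\<^sub>R tv3 T |u v w. 0 \<le> u \<and> 0 \<le> v \<and> 0 \<le> w \<and> u + v + w = 1}"
    then obtain u v w where uvw: "0 \<le> u" "0 \<le> v" "0 \<le> w" "u + v + w = 1" and x: "x = u *\<^sub>R tv1 T + v *\<^sub>R tv2 T + w *\<^sub>R tv3 T"
      by blast
    have xb: "x = bpt T (3 * u, 3 * v, 3 * w)"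
      by (simp add: x bpt_def crd_def scaleR_add_right)
    have "csum (3 * u, 3 * v, 3 * w) = 3" using uvw by (simp add: csum_def crd_def)
    then have "zc T x = (3 * u, 3 * v, 3 * w)" unfolding xb by (rule zc_bpt[OF d])
    then show "x \<in> {x. nonneg3 (zc T x)}" using uvw by (simp add: nonneg3_def all_less_3 crd_def)
  next
    fix x assume "x \<in> {x. nonneg3 (zc T x)}"
    then have n: "nonneg3 (zc T x)" by simp
    let ?z = "zc T x"
    have "x = (crd 0 ?z / 3) *\<^sub>R tv1 T + (crd 1 ?z / 3) *\<^sub>R tv2 T + (crd 2 ?z / 3) *\<^sub>R tv3 T"
      using bpt_zc[OF d, of x] by (simp add: bpt_def scaleR_add_right)
    moreover have "crd 0 ?z / 3 + crd 1 ?z / 3 + crd 2 ?z / 3 = 1"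
      using csum_zc[of T x] by (simp add: csum_def)
    moreover have "0 \<le> crd 0 ?z / 3" "0 \<le> crd 1 ?z / 3" "0 \<le> crd 2 ?z / 3"
      using n by (auto simp: nonneg3_def all_less_3)
    ultimately show "x \<in> {u *\<^sub>R tv1 T + v *\<^sub>R tv2 T + w *\<^sub>R tv3 T |u v w. 0 \<le> u \<and> 0 \<le> v \<and> 0 \<le> w \<and> u + v + w = 1}"
      by blast
  qed
  finally show ?thesis .
qed

lemma zc_segment:
  assumes d: "dtri T \<noteq> 0"
  shows "zc T (x + e *\<^sub>R (x - y)) = zc T x + e *\<^sub>R (zc T x - zc T y)"
proof -
  have s: "(\<Sum>i<2. h i) = h 0 + h (1::nat)" for h :: "nat \<Rightarrow> 'c::comm_monoid_add" by (simp add: eval_nat_numeral)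
  have "(\<Sum>i<2. [1 + e, - e] ! i) = 1" by (simp add: s)
  from zc_affine[OF d this, of "\<lambda>i. [x, y] ! i"] show ?thesis
    by (simp add: s algebra_simps)
qed

lemma interior_tri_set:
  assumes d: "dtri T \<noteq> 0" shows "interior (tri_set T) = {x. pos3 (zc T x)}"
proof
  have "open {x. pos3 (zc T x)}"
  proof -
    have "{x. pos3 (zc T x)} = (\<Inter>i\<in>{..<3}. {x. 0 < crd i (zc T x)})" by (auto simp: pos3_def)
    also have "open \<dots>" by (intro open_INT ballI open_Collect_less continuous_intros) auto
    finally show ?thesis .
  qed
  moreover have "{x. pos3 (zc T x)} \<subseteq> tri_set T"
    by (auto simp: tri_set_zc[OF d] pos3_def nonneg3_def intro: less_imp_le)
  ultimately show "{x. pos3 (zc T x)} \<subseteq> interior (tri_set T)" by (rule interior_maximal[rotated])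
next
  show "interior (tri_set T) \<subseteq> {x. pos3 (zc T x)}"
  proof
    fix x assume x: "x \<in> interior (tri_set T)"
    \<comment> \<open>Push \<open>x\<close> slightly away from the centroid \<open>g\<close>. The
      point stays in the triangle, so \<open>(1 + e) * crd i (zc T x)\<close> is at least
      \<open>e\<close> for each coordinate.\<close>
    define g where "g = bpt T (1, 1, 1)"
    have zg: "zc T g = (1, 1, 1)" unfolding g_def by (rule zc_bpt[OF d]) (simp add: csum_def crd_def)
    obtain r where r: "0 < r" "ball x r \<subseteq> tri_set T" using x mem_interior by blast
    define e where "e = r / (2 * (norm (x - g) + 1))"
    have n: "0 < norm (x - g) + 1" using norm_ge_zero[of "x - g"] by linarith
    have e: "0 < e" using r n by (simp add: e_def)
    have "norm (e *\<^sub>R (x - g)) \<le> r / 2"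
    proof -
      have "norm (e *\<^sub>R (x - g)) = r / 2 * (norm (x - g) / (norm (x - g) + 1))" using r(1) n by (simp add: e_def)
      also have "\<dots> \<le> r / 2 * 1" using r n by (intro mult_left_mono) auto
      finally show ?thesis by simp
    qed
    then have "x + e *\<^sub>R (x - g) \<in> ball x r" using r by (simp add: dist_norm)
    then have nn: "nonneg3 (zc T (x + e *\<^sub>R (x - g)))" using r tri_set_zc[OF d] by blast
    have "0 < crd i (zc T x)" if i: "i < 3" for i
    proof -
      have "0 \<le> crd i (zc T x) + e * (crd i (zc T x) - 1)"
        using nn i unfolding zc_segment[OF d] nonneg3_def zg by (auto simp: crd_def split: if_splits)
      then have "0 < (1 + e) * crd i (zc T x)" using e by (simp add: algebra_simps)
      then show ?thesis using e by (simp add: zero_less_mult_iff)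
    qed
    then show "x \<in> {x. pos3 (zc T x)}" by (simp add: pos3_def)
  qed
qed

lemma closure_interior_tri_set:
  assumes d: "dtri T \<noteq> 0" shows "closure (interior (tri_set T)) = tri_set T"
proof -
  have "bpt T (1, 1, 1) \<in> interior (tri_set T)"
    unfolding interior_tri_set[OF d] by (simp add: zc_bpt[OF d] csum_def crd_def pos3_def)
  then have "closure (interior (tri_set T)) = closure (tri_set T)"
    by (intro convex_closure_interior) (auto simp: tri_set_def)
  moreover have "closed (tri_set T)" unfolding tri_set_def vset_def
    by (intro compact_imp_closed finite_imp_compact_convex_hull) auto
  ultimately show ?thesis by simp
qed

lemma tri_set_limpt:
  assumes d: "dtri T \<noteq> 0" and x: "x \<in> tri_set T"
  shows "x islimpt interior (tri_set T)"
proof -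
  have "connected (tri_set T)" unfolding tri_set_def by (intro convex_connected) simp
  moreover have "tri_set T \<noteq> {a}" for a
  proof
    assume "tri_set T = {a}"
    moreover have "tv1 T \<in> tri_set T" "tv2 T \<in> tri_set T" unfolding tri_set_def vset_def by (auto intro: hull_inc)
    ultimately have "tv1 T = tv2 T" by auto
    then show False using zc_vertices[OF d] by auto
  qed
  ultimately have "x islimpt tri_set T" using connected_imp_perfect x by metis
  then show ?thesis using closure_interior_tri_set[OF d] limpt_of_closure by metis
qed

lemma length_knot_list: "length knot_list = 28" by (simp add: knot_list_def)

fun same_mset :: "int3 list \<Rightarrow> int3 list \<Rightarrow> bool" where
  "same_mset [] ys \<longleftrightarrow> ys = []"
| "same_mset (x # xs) ys \<longleftrightarrow> x \<in> set ys \<and> same_mset xs (remove1 x ys)"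

lemma same_mset: "same_mset xs ys \<Longrightarrow> mset xs = mset ys"
  by (induction xs ys rule: same_mset.induct) auto

text \<open>The multisets in the order of \<open>Xi_list\<close>, so that they match it term by
  term; \<open>knot_list\<close> holds the same knots with a suitable base in front.\<close>

definition knot_rows :: "int3 list list" where
  "knot_rows = [[(3, 0, 0), (3, 0, 0), (3, 0, 0), (3, 0, 0), (2, 1, 0), (2, 0, 1)],
    [(0, 3, 0), (0, 3, 0), (0, 3, 0), (0, 3, 0), (1, 2, 0), (0, 2, 1)],
    [(0, 0, 3), (0, 0, 3), (0, 0, 3), (0, 0, 3), (0, 1, 2), (1, 0, 2)],
    [(3, 0, 0), (3, 0, 0), (3, 0, 0), (2, 1, 0), (1, 2, 0), (2, 0, 1)],
    [(3, 0, 0), (3, 0, 0), (3, 0, 0), (2, 0, 1), (1, 0, 2), (2, 1, 0)],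
    [(0, 3, 0), (0, 3, 0), (0, 3, 0), (0, 2, 1), (0, 1, 2), (1, 2, 0)],
    [(0, 3, 0), (0, 3, 0), (0, 3, 0), (1, 2, 0), (2, 1, 0), (0, 2, 1)],
    [(0, 0, 3), (0, 0, 3), (0, 0, 3), (1, 0, 2), (2, 0, 1), (0, 1, 2)],
    [(0, 0, 3), (0, 0, 3), (0, 0, 3), (0, 1, 2), (0, 2, 1), (1, 0, 2)],
    [(3, 0, 0), (3, 0, 0), (2, 1, 0), (1, 2, 0), (0, 3, 0), (2, 0, 1)],
    [(3, 0, 0), (3, 0, 0), (2, 0, 1), (1, 0, 2), (0, 0, 3), (2, 1, 0)],
    [(0, 3, 0), (0, 3, 0), (0, 2, 1), (0, 1, 2), (0, 0, 3), (1, 2, 0)],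
    [(0, 3, 0), (0, 3, 0), (1, 2, 0), (2, 1, 0), (3, 0, 0), (0, 2, 1)],
    [(0, 0, 3), (0, 0, 3), (1, 0, 2), (2, 0, 1), (3, 0, 0), (0, 1, 2)],
    [(0, 0, 3), (0, 0, 3), (0, 1, 2), (0, 2, 1), (0, 3, 0), (1, 0, 2)],
    [(3, 0, 0), (3, 0, 0), (2, 1, 0), (1, 2, 0), (2, 0, 1), (1, 0, 2)],
    [(0, 3, 0), (0, 3, 0), (1, 2, 0), (2, 1, 0), (0, 2, 1), (0, 1, 2)],
    [(0, 0, 3), (0, 0, 3), (0, 1, 2), (0, 2, 1), (1, 0, 2), (2, 0, 1)],
    [(3, 0, 0), (0, 3, 0), (2, 1, 0), (1, 2, 0), (2, 0, 1), (0, 2, 1)],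
    [(0, 3, 0), (0, 0, 3), (0, 2, 1), (0, 1, 2), (1, 2, 0), (1, 0, 2)],
    [(0, 0, 3), (3, 0, 0), (1, 0, 2), (2, 0, 1), (0, 1, 2), (2, 1, 0)],
    [(3, 0, 0), (2, 1, 0), (1, 2, 0), (0, 2, 1), (1, 0, 2), (2, 0, 1)],
    [(3, 0, 0), (2, 0, 1), (1, 0, 2), (0, 1, 2), (1, 2, 0), (2, 1, 0)],
    [(0, 3, 0), (0, 2, 1), (0, 1, 2), (1, 0, 2), (2, 1, 0), (1, 2, 0)],
    [(0, 3, 0), (2, 1, 0), (1, 2, 0), (0, 2, 1), (0, 1, 2), (2, 0, 1)],
    [(0, 0, 3), (1, 0, 2), (2, 0, 1), (2, 1, 0), (0, 2, 1), (0, 1, 2)],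
    [(0, 0, 3), (0, 2, 1), (0, 1, 2), (1, 0, 2), (2, 0, 1), (1, 2, 0)],
    [(2, 1, 0), (1, 2, 0), (0, 2, 1), (0, 1, 2), (1, 0, 2), (2, 0, 1)]]"

lemma Xi_list_knot_rows: "Xi_list T = map (map (\<lambda>w. bpt T (rp w))) knot_rows"
proof -
  have v: "bpt T (3, 0, 0) = tv1 T" "bpt T (0, 3, 0) = tv2 T" "bpt T (0, 0, 3) = tv3 T"
    "bpt T (0, 2, 1) = v12 T" "bpt T (0, 1, 2) = v13 T" "bpt T (2, 0, 1) = v21 T"
    "bpt T (1, 0, 2) = v23 T" "bpt T (2, 1, 0) = v31 T" "bpt T (1, 2, 0) = v32 T"
    by (simp_all add: v12_def v13_def v21_def v23_def v31_def v32_def bpt_def crd_def scaleR_add_right)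
  show ?thesis unfolding Xi_list_def Let_def knot_rows_def by (simp add: v)
qed

lemma Xi_knots:
  assumes i: "i < 28" and kn: "knot_list ! i = ((b0, b1, b2), w3, w4, w5)"
  shows "mset (Xi T (Suc i)) = mset (map (\<lambda>w. bpt T (rp w)) [b0, b1, b2, w3, w4, w5])"
proof -
  define flat where "flat k = (case k of ((b0, b1, b2), w3, w4, w5) \<Rightarrow> [b0, b1, b2, w3, w4, w5])"
    for k :: "(int3 \<times> int3 \<times> int3) \<times> int3 \<times> int3 \<times> int3"
  have "list_all2 same_mset knot_rows (map flat knot_list)"
    unfolding knot_rows_def knot_list_def flat_def by simp
  then have "length knot_rows = length (map flat knot_list)"
    and "\<forall>i<length knot_rows. same_mset (knot_rows ! i) (map flat knot_list ! i)"
    unfolding list_all2_conv_all_nth by blast+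
  then have len: "length knot_rows = 28" and "same_mset (knot_rows ! i) (flat (knot_list ! i))"
    using i by (simp_all add: length_knot_list)
  then have "mset (knot_rows ! i) = mset [b0, b1, b2, w3, w4, w5]"
    using same_mset kn by (simp add: flat_def)
  then show ?thesis using i len by (simp only: Xi_def Xi_list_knot_rows nth_map diff_Suc_1 mset_map)
qed

lemma knot_csum:
  assumes "i < 28" "knot_list ! i = (b, w3, w4, w5)"
  shows "csum (rp w3) = 3" "csum (rp w4) = 3" "csum (rp w5) = 3"
proof -
  have m: "(b, w3, w4, w5) \<in> set knot_list" using assms length_knot_list nth_mem by metis
  have "\<forall>(b, w3, w4, w5)\<in>set knot_list. csum (rp w3) = 3 \<and> csum (rp w4) = 3 \<and> csum (rp w5) = 3"
    unfolding knot_list_def by (simp add: csum_def crd_def)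
  then show "csum (rp w3) = 3" "csum (rp w4) = 3" "csum (rp w5) = 3" using m by blast+
qed

definition base_norm :: "tri \<Rightarrow> nat \<Rightarrow> real" where
  "base_norm T i = enn2real (slice_norm T (fst (knot_list ! i)))"

lemma simplex_spline_interior:
  assumes d: "dtri T \<noteq> 0" and i: "i < 28" and x: "pos3 (zc T x)"
  shows "simplex_spline (Xi T (Suc i)) x = FF i (zc T x) / (7776 * base_norm T i)"
    and "0 < base_norm T i"
proof -
  obtain b0 b1 b2 w3 w4 w5 where kn: "knot_list ! i = ((b0, b1, b2), w3, w4, w5)" by (metis prod.collapse)
  have b: "(b0, b1, b2) \<in> bases" using knot_bases[OF i] kn by simp
  note cs = knot_csum[OF i kn] bases_csum[OF b, simplified]
  have z: "zc T (bpt T (rp w)) = rp w" if "csum (rp w) = 3" for w using zc_bpt[OF d that] .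
  have eq: "simplex_spline (Xi T (Suc i)) x = measure lborel (cone_slice (b0, b1, b2) w3 w4 w5 (zc T x)) / enn2real (slice_norm T (b0, b1, b2))"
    and pos: "0 < enn2real (slice_norm T (b0, b1, b2))"
    using simplex_spline_eq[OF d b, of "bpt T (rp b0)" "bpt T (rp b1)" "bpt T (rp b2)" "bpt T (rp w3)" w3 "bpt T (rp w4)" w4 "bpt T (rp w5)" w5 "Xi T (Suc i)"]
      Xi_knots[OF i kn, of T] cs z by simp_all
  show "0 < base_norm T i" using pos kn by (simp add: base_norm_def)
  have m: "measure lborel (cone_slice (b0, b1, b2) w3 w4 w5 (zc T x)) = FF i (zc T x) / 7776"
    unfolding measure_def cone_slice_volume(1)[OF i kn x] FF_def[symmetric]
    using cone_slice_volume(2)[OF i kn x] by (simp add: FF_def)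
  then show "simplex_spline (Xi T (Suc i)) x = FF i (zc T x) / (7776 * base_norm T i)"
    unfolding eq m by (simp add: base_norm_def kn)
qed

lemma continuous_on_FF [continuous_intros]: "continuous_on S f \<Longrightarrow> continuous_on S (\<lambda>x. FF i (f x))"
  unfolding FF_def numeral_3_eq_3 by (intro continuous_intros)

definition kap :: "tri \<Rightarrow> nat \<Rightarrow> real" where "kap T i = wt T (Suc i) / (7776 * base_norm T i)"

text \<open>The explicit formula is continuous on the whole plane and agrees with the simplex spline
  in the interior, so the boundary values obtained by continuity are those of the formula.\<close>

lemma Bfun_FF:
  assumes d: "dtri T \<noteq> 0" and i: "i < 28" and x: "x \<in> tri_set T"
  shows "Bfun T (Suc i) x = kap T i * FF i (zc T x)"
proof -
  let ?F = "at x within interior (tri_set T)"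
  have nt: "?F \<noteq> bot" using tri_set_limpt[OF d x] by (simp add: trivial_limit_within)
  have "continuous_on UNIV (\<lambda>y. FF i (zc T y) / (7776 * base_norm T i))"
    unfolding divide_inverse by (intro continuous_intros)
  then have lim: "((\<lambda>y. FF i (zc T y) / (7776 * base_norm T i)) \<longlongrightarrow> FF i (zc T x) / (7776 * base_norm T i)) ?F"
    by (metis UNIV_I continuous_on_def tendsto_within_subset subset_UNIV)
  have "\<forall>\<^sub>F y in ?F. simplex_spline (Xi T (Suc i)) y = FF i (zc T y) / (7776 * base_norm T i)"
    using simplex_spline_interior(1)[OF d i] interior_tri_set[OF d] by (auto simp: eventually_at_filter)
  from iffD2[OF tendsto_cong[OF this] lim]
  have "(simplex_spline (Xi T (Suc i)) \<longlongrightarrow> FF i (zc T x) / (7776 * base_norm T i)) ?F" .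
  from tendsto_Lim[OF nt this] show ?thesis by (simp add: Bfun_def kap_def)
qed

lemma c_list_pos: "i < 28 \<Longrightarrow> 0 < c_list ! i"
proof -
  assume "i < 28"
  moreover have "length c_list = 28" by (simp add: c_list_def)
  moreover have "\<forall>c\<in>set c_list. 0 < c" by (simp add: c_list_def)
  ultimately show ?thesis using nth_mem by metis
qed

lemma kap_pos:
  assumes nd: "nondegenerate T" and i: "i < 28" shows "0 < kap T i"
proof -
  have d: "dtri T \<noteq> 0" using nondegenerate_dtri[OF nd] .
  have "0 < measure lborel (tri_set T)" unfolding tri_set_def
    using nd by (intro convex_hull_pos_measure) (auto simp: nondegenerate_def vset_def)
  then have "0 < wt T (Suc i)" using c_list_pos[OF i] by (simp add: wt_def)
  moreover have "pos3 (zc T (bpt T (1, 1, 1)))" by (simp add: zc_bpt[OF d] csum_def crd_def pos3_def)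
  ultimately show ?thesis using simplex_spline_interior(2)[OF d i] by (simp add: kap_def)
qed

text \<open>The modified functions 22 to 27 combine two splines over the same base and with equal
  weights. Equal factors allow the combination to be formed on the truncated cubes.\<close>

lemma kap_pairs: "kap T 21 = kap T 22" "kap T 23 = kap T 24" "kap T 25 = kap T 26"
proof -
  have k: "fst (knot_list ! 21) = fst (knot_list ! 22)" "fst (knot_list ! 23) = fst (knot_list ! 24)"
    "fst (knot_list ! 25) = fst (knot_list ! 26)" by (simp_all add: knot_list_def)
  have c: "c_list ! 21 = c_list ! 22" "c_list ! 23 = c_list ! 24" "c_list ! 25 = c_list ! 26" by (simp_all add: c_list_def)
  show "kap T 21 = kap T 22" "kap T 23 = kap T 24" "kap T 25 = kap T 26"
    unfolding kap_def base_norm_def wt_def k diff_Suc_1 c by (rule refl)+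
qed

text \<open>Zero-based rows: row \<open>i\<close> belongs to the paper's index \<open>i + 1\<close>.\<close>

definition ct :: "nat \<Rightarrow> nat \<Rightarrow> real" where
  "ct i j = (if i \<in> {21, 23, 25} then 2 * cf i j - cf (i + 1) j
     else if i \<in> {22, 24, 26} then 2 * cf i j - cf (i - 1) j else cf i j)"

definition FT :: "nat \<Rightarrow> hpt \<Rightarrow> real" where "FT i z = (\<Sum>j<28. ct i j * pw 3 (lf j \<bullet> z))"

lemma FT_FF:
  "FT 21 z = 2 * FF 21 z - FF 22 z" "FT 22 z = 2 * FF 22 z - FF 21 z"
  "FT 23 z = 2 * FF 23 z - FF 24 z" "FT 24 z = 2 * FF 24 z - FF 23 z"
  "FT 25 z = 2 * FF 25 z - FF 26 z" "FT 26 z = 2 * FF 26 z - FF 25 z"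
  "i \<notin> {21, 22, 23, 24, 25, 26} \<Longrightarrow> FT i z = FF i z"
  by (simp_all add: FT_def FF_def ct_def sum_distrib_left sum_subtractf[symmetric] algebra_simps)

text \<open>The share of \<open>Bfun T 28\<close> in the modified functions carries a factor of its
  own and is kept as a separate multiple of \<open>FT 27\<close>.\<close>

lemma Bt_FT:
  assumes d: "dtri T \<noteq> 0" and x: "x \<in> tri_set T"
  shows "i < 27 \<Longrightarrow> Bt T (Suc i) x = kap T i * FT i (zc T x) + (if 21 \<le> i then kap T 27 / 3 * FT 27 (zc T x) else 0)"
    and "Bt T 28 x = - kap T 27 * FT 27 (zc T x)"
proof -
  note B = Bfun_FF[OF d _ x]
  have B': "Bfun T 22 x = kap T 21 * FF 21 (zc T x)" "Bfun T 23 x = kap T 22 * FF 22 (zc T x)"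
    "Bfun T 24 x = kap T 23 * FF 23 (zc T x)" "Bfun T 25 x = kap T 24 * FF 24 (zc T x)"
    "Bfun T 26 x = kap T 25 * FF 25 (zc T x)" "Bfun T 27 x = kap T 26 * FF 26 (zc T x)"
    "Bfun T 28 x = kap T 27 * FF 27 (zc T x)"
    using B[of 21] B[of 22] B[of 23] B[of 24] B[of 25] B[of 26] B[of 27] by simp_all
  have F27: "FF 27 (zc T x) = FT 27 (zc T x)" by (simp add: FT_FF)
  show "Bt T 28 x = - kap T 27 * FT 27 (zc T x)" by (simp add: Bt_def B' F27)
  assume i: "i < 27"
  then consider "i < 21" | "i = 21" | "i = 22" | "i = 23" | "i = 24" | "i = 25" | "i = 26" by linarith
  then show "Bt T (Suc i) x = kap T i * FT i (zc T x) + (if 21 \<le> i then kap T 27 / 3 * FT 27 (zc T x) else 0)"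
  proof cases
    case 1
    then have "Bt T (Suc i) x = Bfun T (Suc i) x" by (simp add: Bt_def)
    then show ?thesis using B[of i] 1 by (simp add: FT_FF(7))
  next
    case 2
    have "Bt T (Suc i) x = 2 * Bfun T 22 x - Bfun T 23 x + 1/3 * Bfun T 28 x" by (simp add: Bt_def 2)
    then show ?thesis unfolding B' 2 FT_FF(1) F27 kap_pairs by (simp add: right_diff_distrib)
  next
    case 3
    have "Bt T (Suc i) x = 2 * Bfun T 23 x - Bfun T 22 x + 1/3 * Bfun T 28 x" by (simp add: Bt_def 3)
    then show ?thesis unfolding B' 3 FT_FF(2) F27 kap_pairs by (simp add: right_diff_distrib)
  next
    case 4
    have "Bt T (Suc i) x = 2 * Bfun T 24 x - Bfun T 25 x + 1/3 * Bfun T 28 x" by (simp add: Bt_def 4)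
    then show ?thesis unfolding B' 4 FT_FF(3) F27 kap_pairs by (simp add: right_diff_distrib)
  next
    case 5
    have "Bt T (Suc i) x = 2 * Bfun T 25 x - Bfun T 24 x + 1/3 * Bfun T 28 x" by (simp add: Bt_def 5)
    then show ?thesis unfolding B' 5 FT_FF(4) F27 kap_pairs by (simp add: right_diff_distrib)
  next
    case 6
    have "Bt T (Suc i) x = 2 * Bfun T 26 x - Bfun T 27 x + 1/3 * Bfun T 28 x" by (simp add: Bt_def 6)
    then show ?thesis unfolding B' 6 FT_FF(5) F27 kap_pairs by (simp add: right_diff_distrib)
  next
    case 7
    have "Bt T (Suc i) x = 2 * Bfun T 27 x - Bfun T 26 x + 1/3 * Bfun T 28 x" by (simp add: Bt_def 7)
    then show ?thesis unfolding B' 7 FT_FF(6) F27 kap_pairs by (simp add: right_diff_distrib)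
  qed
qed

section \<open>Polynomials of bounded degree in two variables and 2-jets\<close>

inductive polyd :: "nat \<Rightarrow> (pt \<Rightarrow> real) \<Rightarrow> bool" where
  polyd_const: "polyd k (\<lambda>_. c)"
| polyd_fst: "polyd k f \<Longrightarrow> polyd (Suc k) (\<lambda>x. fst x * f x)"
| polyd_snd: "polyd k f \<Longrightarrow> polyd (Suc k) (\<lambda>x. snd x * f x)"
| polyd_add: "polyd k f \<Longrightarrow> polyd k g \<Longrightarrow> polyd k (\<lambda>x. f x + g x)"

lemma polyd_Suc: "polyd k f \<Longrightarrow> polyd (Suc k) f"
  by (induction rule: polyd.induct) (auto intro: polyd.intros)

lemma polyd_mono: "polyd k f \<Longrightarrow> k \<le> m \<Longrightarrow> polyd m f"
  by (induction m) (auto simp: le_Suc_eq intro: polyd_Suc)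

lemma polyd_scale: "polyd k f \<Longrightarrow> polyd k (\<lambda>x. c * f x)"
proof (induction rule: polyd.induct)
  case (polyd_fst k f)
  then have "polyd (Suc k) (\<lambda>x. fst x * (c * f x))" by (intro polyd.intros)
  then show ?case by (simp add: mult.left_commute)
next
  case (polyd_snd k f)
  then have "polyd (Suc k) (\<lambda>x. snd x * (c * f x))" by (intro polyd.intros)
  then show ?case by (simp add: mult.left_commute)
next
  case (polyd_add k f g)
  then have "polyd k (\<lambda>x. c * f x + c * g x)" by (intro polyd.intros)
  then show ?case by (simp add: distrib_left)
qed (auto intro: polyd.intros)

lemma polyd_sum: "finite A \<Longrightarrow> (\<And>i. i \<in> A \<Longrightarrow> polyd k (f i)) \<Longrightarrow> polyd k (\<lambda>x. \<Sum>i\<in>A. f i x)"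
  by (induction rule: finite_induct) (auto intro: polyd.intros)

lemma polyd_diff: "polyd k f \<Longrightarrow> polyd k g \<Longrightarrow> polyd k (\<lambda>x. f x - g x)"
  using polyd_add[OF _ polyd_scale[of k g "-1"]] by simp

lemma polyd_affine_mult:
  assumes "polyd k f" shows "polyd (Suc k) (\<lambda>x. (n \<bullet> x + c) * f x)"
proof -
  have "polyd (Suc k) (\<lambda>x. fst n * (fst x * f x) + (snd n * (snd x * f x) + c * f x))"
    by (intro polyd_add polyd_scale polyd_fst polyd_snd polyd_Suc assms)
  moreover have "(\<lambda>x. fst n * (fst x * f x) + (snd n * (snd x * f x) + c * f x)) = (\<lambda>x. (n \<bullet> x + c) * f x)"
    by (auto simp: fun_eq_iff inner_prod_def algebra_simps)
  ultimately show ?thesis by simp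
qed

lemma polyd_affine_power: "polyd k (\<lambda>x. (n \<bullet> x + c) ^ k)"
  by (induction k) (auto intro: polyd_const polyd_affine_mult)

lemma polyd_monom: "polyd (i + j) (\<lambda>x. fst x ^ i * snd x ^ j)"
proof (induction i)
  case 0
  show ?case by (induction j) (auto intro: polyd.intros)
next
  case (Suc i)
  then have "polyd (Suc (i + j)) (\<lambda>x. fst x * (fst x ^ i * snd x ^ j))" by (rule polyd_fst)
  then show ?case by (simp add: mult.assoc)
qed

lemma polyd_coeffs:
  "polyd k f \<Longrightarrow> \<exists>c :: nat \<Rightarrow> nat \<Rightarrow> real. \<forall>x. f x = (\<Sum>i\<le>k. \<Sum>j\<le>k - i. c i j * fst x ^ i * snd x ^ j)"
proof (induction rule: polyd.induct)
  case (polyd_const k c)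
  show ?case
  proof (intro exI allI)
    fix x :: pt
    have "(\<Sum>i\<le>k. \<Sum>j\<le>k - i. (if i = 0 \<and> j = 0 then c else 0) * fst x ^ i * snd x ^ j)
       = (\<Sum>i\<le>k. if i = 0 then c else 0)"
    proof (rule sum.cong[OF refl])
      fix i
      have "(\<Sum>j\<le>k - i. (if i = 0 \<and> j = 0 then c else 0) * fst x ^ i * snd x ^ j)
         = (\<Sum>j\<le>k - i. if j = 0 then (if i = 0 then c else 0) else 0)"
        by (intro sum.cong refl) auto
      then show "(\<Sum>j\<le>k - i. (if i = 0 \<and> j = 0 then c else 0) * fst x ^ i * snd x ^ j) = (if i = 0 then c else 0)"
        by (simp only: sum.delta finite_atMost) simp
    qed
    then show "c = (\<Sum>i\<le>k. \<Sum>j\<le>k - i. (if i = 0 \<and> j = 0 then c else 0) * fst x ^ i * snd x ^ j)"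
      by (simp only: sum.delta finite_atMost) simp
  qed
next
  case (polyd_fst k f)
  then obtain c where c: "\<And>x. f x = (\<Sum>i\<le>k. \<Sum>j\<le>k - i. c i j * fst x ^ i * snd x ^ j)" by blast
  show ?case
  proof (intro exI allI)
    fix x :: pt
    show "fst x * f x = (\<Sum>i\<le>Suc k. \<Sum>j\<le>Suc k - i. (if i = 0 then 0 else c (i - 1) j) * fst x ^ i * snd x ^ j)"
      unfolding c sum.atMost_Suc_shift by (simp add: sum_distrib_left algebra_simps)
  qed
next
  case (polyd_snd k f)
  then obtain c where c: "\<And>x. f x = (\<Sum>i\<le>k. \<Sum>j\<le>k - i. c i j * fst x ^ i * snd x ^ j)" by blast
  show ?case
  proof (intro exI allI)
    fix x :: pt
    have "(\<Sum>i\<le>Suc k. \<Sum>j\<le>Suc k - i. (if j = 0 then 0 else c i (j - 1)) * fst x ^ i * snd x ^ j)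
      = (\<Sum>i\<le>k. \<Sum>j\<le>Suc (k - i). (if j = 0 then 0 else c i (j - 1)) * fst x ^ i * snd x ^ j)"
    proof -
      have "(\<Sum>i\<le>Suc k. \<Sum>j\<le>Suc k - i. (if j = 0 then 0 else c i (j - 1)) * fst x ^ i * snd x ^ j)
        = (\<Sum>i\<le>k. \<Sum>j\<le>Suc k - i. (if j = 0 then 0 else c i (j - 1)) * fst x ^ i * snd x ^ j)"
        by (subst sum.atMost_Suc) simp
      also have "\<dots> = (\<Sum>i\<le>k. \<Sum>j\<le>Suc (k - i). (if j = 0 then 0 else c i (j - 1)) * fst x ^ i * snd x ^ j)"
        by (intro sum.cong refl) (simp only: atMost_iff Suc_diff_le)
      finally show ?thesis .
    qed
    also have "\<dots> = (\<Sum>i\<le>k. \<Sum>j\<le>k - i. c i j * fst x ^ i * snd x ^ Suc j)"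
      unfolding sum.atMost_Suc_shift by simp
    also have "\<dots> = snd x * f x" unfolding c by (simp add: sum_distrib_left algebra_simps)
    finally show "snd x * f x = (\<Sum>i\<le>Suc k. \<Sum>j\<le>Suc k - i. (if j = 0 then 0 else c i (j - 1)) * fst x ^ i * snd x ^ j)" ..
  qed
next
  case (polyd_add k f g)
  then obtain c e where c: "\<And>x. f x = (\<Sum>i\<le>k. \<Sum>j\<le>k - i. c i j * fst x ^ i * snd x ^ j)"
    and e: "\<And>x. g x = (\<Sum>i\<le>k. \<Sum>j\<le>k - i. e i j * fst x ^ i * snd x ^ j)" by blast
  show ?case
    by (rule exI[of _ "\<lambda>i j. c i j + e i j"]) (simp add: c e sum.distrib algebra_simps)
qed

lemma cubic_on_iff_polyd: "cubic_on C f \<longleftrightarrow> (\<exists>q. polyd 3 q \<and> (\<forall>x\<in>C. f x = q x))"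
proof
  assume "cubic_on C f"
  then obtain c where c: "\<forall>x\<in>C. f x = (\<Sum>i\<le>3. \<Sum>j\<le>3 - i. c i j * fst x ^ i * snd x ^ j)"
    unfolding cubic_on_def by blast
  have "polyd 3 (\<lambda>x. c i j * fst x ^ i * snd x ^ j)" if "i \<le> 3" "j \<le> 3 - i" for i j
    using polyd_scale[OF polyd_mono[OF polyd_monom[of i j], of 3], of "c i j"] that by (simp add: mult.assoc)
  then have "polyd 3 (\<lambda>x. \<Sum>i\<le>3. \<Sum>j\<le>3 - i. c i j * fst x ^ i * snd x ^ j)"
    by (intro polyd_sum) auto
  with c show "\<exists>q. polyd 3 q \<and> (\<forall>x\<in>C. f x = q x)" by blast
next
  assume "\<exists>q. polyd 3 q \<and> (\<forall>x\<in>C. f x = q x)"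
  then obtain q where q: "polyd 3 q" "\<forall>x\<in>C. f x = q x" by blast
  from polyd_coeffs[OF q(1)] obtain c where "\<forall>x. q x = (\<Sum>i\<le>3. \<Sum>j\<le>3 - i. c i j * fst x ^ i * snd x ^ j)" ..
  then have c: "q x = (\<Sum>i\<le>3. \<Sum>j\<le>3 - i. c i j * fst x ^ i * snd x ^ j)" for x by (rule spec)
  show "cubic_on C f" unfolding cubic_on_def
    by (intro exI[of _ c] ballI) (use q(2) in \<open>simp only: c[symmetric]\<close>)
qed

text \<open>A function together with its first and second partial derivatives:
  \<open>F 0 = f\<close>, \<open>F 1, F 2\<close> the gradient, \<open>F 3, F 4, F 5, F 6\<close> the Hessian.\<close>

definition C2j :: "pt set \<Rightarrow> (nat \<Rightarrow> pt \<Rightarrow> real) \<Rightarrow> bool" where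
  "C2j U F \<longleftrightarrow> (\<forall>k<7. continuous_on U (F k)) \<and> (\<forall>x\<in>interior U.
     (F 0 has_derivative (\<lambda>h. F 1 x * fst h + F 2 x * snd h)) (at x) \<and>
     (F 1 has_derivative (\<lambda>h. F 3 x * fst h + F 4 x * snd h)) (at x) \<and>
     (F 2 has_derivative (\<lambda>h. F 5 x * fst h + F 6 x * snd h)) (at x))"

lemma all_less_7: "(\<forall>k<7. P k) \<longleftrightarrow> P 0 \<and> P 1 \<and> P 2 \<and> P 3 \<and> P 4 \<and> P 5 \<and> P (6::nat)"
  by (simp add: eval_nat_numeral All_less_Suc conj_ac)

lemma C2_on_iff_C2j: "C2_on U f \<longleftrightarrow> (\<exists>F. F 0 = f \<and> C2j U F)"
proof
  assume "C2_on U f"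
  then show "\<exists>F. F 0 = f \<and> C2j U F" unfolding C2_on_def C2j_def all_less_7
  proof (elim exE)
    fix f1 f2 f11 f12 f21 f22 assume "continuous_on U f \<and> continuous_on U f1 \<and> continuous_on U f2 \<and>
     continuous_on U f11 \<and> continuous_on U f12 \<and> continuous_on U f21 \<and> continuous_on U f22 \<and>
     (\<forall>x\<in>interior U.
        (f has_derivative (\<lambda>h. f1 x * fst h + f2 x * snd h)) (at x) \<and>
        (f1 has_derivative (\<lambda>h. f11 x * fst h + f12 x * snd h)) (at x) \<and>
        (f2 has_derivative (\<lambda>h. f21 x * fst h + f22 x * snd h)) (at x))"
    then show "\<exists>F :: nat \<Rightarrow> pt \<Rightarrow> real. F 0 = f \<and> (continuous_on U (F 0) \<and> continuous_on U (F 1) \<and> continuous_on U (F 2) \<and>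
      continuous_on U (F 3) \<and> continuous_on U (F 4) \<and> continuous_on U (F 5) \<and> continuous_on U (F 6)) \<and>
      (\<forall>x\<in>interior U.
        (F 0 has_derivative (\<lambda>h. F 1 x * fst h + F 2 x * snd h)) (at x) \<and>
        (F 1 has_derivative (\<lambda>h. F 3 x * fst h + F 4 x * snd h)) (at x) \<and>
        (F 2 has_derivative (\<lambda>h. F 5 x * fst h + F 6 x * snd h)) (at x))"
      by (intro exI[of _ "\<lambda>k. [f, f1, f2, f11, f12, f21, f22] ! k"]) simp
  qed
next
  assume "\<exists>F. F 0 = f \<and> C2j U F"
  then obtain F where F: "F 0 = f" "C2j U F" by blast
  show "C2_on U f" unfolding C2_on_def
    by (rule exI[of _ "F 1"], rule exI[of _ "F 2"], rule exI[of _ "F 3"], rule exI[of _ "F 4"], rule exI[of _ "F 5"], rule exI[of _ "F 6"])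
      (use F in \<open>auto simp: C2j_def all_less_7\<close>)
qed

lemma C2j_subset: "C2j U F \<Longrightarrow> V \<subseteq> U \<Longrightarrow> C2j V F"
  unfolding C2j_def using continuous_on_subset interior_mono by blast

lemma C2j_add: "C2j U F \<Longrightarrow> C2j U G \<Longrightarrow> C2j U (\<lambda>k x. F k x + G k x)"
  unfolding C2j_def
  by (auto intro!: continuous_intros derivative_eq_intros simp: algebra_simps)

lemma C2j_scale: "C2j U F \<Longrightarrow> C2j U (\<lambda>k x. c * F k x)"
  unfolding C2j_def
  by (auto intro!: continuous_intros derivative_eq_intros simp: algebra_simps)

lemma C2j_zero: "C2j U (\<lambda>_ _. 0)"
  unfolding C2j_def by (auto intro!: continuous_intros derivative_eq_intros)

lemma C2j_sum: "finite A \<Longrightarrow> (\<And>i. i \<in> A \<Longrightarrow> C2j U (F i)) \<Longrightarrow> C2j U (\<lambda>k x. \<Sum>i\<in>A. F i k x)"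
  by (induction rule: finite_induct) (auto intro: C2j_zero C2j_add)

lemma grad_unique:
  assumes "(f has_derivative (\<lambda>h. a * fst h + b * snd h)) (at (x::pt))"
    "(g has_derivative (\<lambda>h. c * fst h + d * snd h)) (at x)" "open V" "x \<in> V" "\<And>y. y \<in> V \<Longrightarrow> f y = g y"
  shows "a = (c::real) \<and> b = d"
proof -
  have "(g has_derivative (\<lambda>h. a * fst h + b * snd h)) (at x)"
    using has_derivative_transform_within_open[OF assms(1,3,4,5)] .
  from has_derivative_unique[OF this assms(2)] have e: "a * fst h + b * snd h = c * fst h + d * snd h" for h
    by (simp add: fun_eq_iff)
  show ?thesis using e[of "(1, 0)"] e[of "(0, 1)"] by simp
qed

lemma C2j_agree_open:
  assumes F: "C2j U F" and E: "C2j UNIV E" and V: "open V" "V \<subseteq> U" and eq: "\<And>x. x \<in> V \<Longrightarrow> F 0 x = E 0 x"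
    and x: "x \<in> V" and k: "k < 7"
  shows "F k x = E k x"
proof -
  have int: "y \<in> interior U" if "y \<in> V" for y using V that interior_maximal by blast
  note FD = F[unfolded C2j_def, THEN conjunct2, rule_format, OF int]
  note ED = E[unfolded C2j_def interior_UNIV, THEN conjunct2, rule_format, OF UNIV_I]
  have 1: "F 1 y = E 1 y \<and> F 2 y = E 2 y" if "y \<in> V" for y
    using grad_unique[OF FD[OF that, THEN conjunct1] ED[THEN conjunct1] V(1) that eq] by blast
  have 2: "F 3 y = E 3 y \<and> F 4 y = E 4 y" if "y \<in> V" for y
    using grad_unique[OF FD[OF that, THEN conjunct2, THEN conjunct1] ED[THEN conjunct2, THEN conjunct1] V(1) that] 1 by blast
  have 3: "F 5 y = E 5 y \<and> F 6 y = E 6 y" if "y \<in> V" for y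
    using grad_unique[OF FD[OF that, THEN conjunct2, THEN conjunct2] ED[THEN conjunct2, THEN conjunct2] V(1) that] 1 by blast
  have "\<forall>k<7. F k x = E k x" unfolding all_less_7 using eq 1 2 3 x by blast
  then show ?thesis using k by blast
qed

text \<open>Continuity of all derivatives extends agreement on an open set to the 2-jets at its
  limit points. This is how jets are read off on breaklines and on the boundary of a
  triangle.\<close>

lemma C2j_agree:
  assumes F: "C2j U F" and E: "C2j UNIV E" and V: "open V" "V \<subseteq> U" and eq: "\<And>x. x \<in> V \<Longrightarrow> F 0 x = E 0 x"
    and x: "x \<in> U" "x \<in> closure V" and k: "k < 7"
  shows "F k x = E k x"
proof -
  have cF: "continuous_on U (F k)" and cE: "continuous_on UNIV (E k)" using F E k unfolding C2j_def by auto
  obtain y where y: "\<And>n. y n \<in> V" "y \<longlonglongrightarrow> x" using x(2) closure_sequential by metis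
  have "(\<lambda>n. F k (y n)) \<longlonglongrightarrow> F k x"
    using cF x(1) y V(2) unfolding continuous_on_sequentially comp_def by blast
  moreover have "(\<lambda>n. E k (y n)) \<longlonglongrightarrow> E k x"
    using cE y unfolding continuous_on_sequentially comp_def by blast
  moreover have "F k (y n) = E k (y n)" for n using C2j_agree_open[OF F E V eq y(1) k] .
  ultimately show ?thesis using LIMSEQ_unique by simp
qed

lemma polyd_jets:
  "polyd k f \<Longrightarrow> \<exists>f1 f2. polyd (k - 1) f1 \<and> polyd (k - 1) f2 \<and> (\<forall>x. (f has_derivative (\<lambda>h. f1 x * fst h + f2 x * snd h)) (at x))"
proof (induction rule: polyd.induct)
  case (polyd_const k c)
  show ?case by (rule exI[of _ "\<lambda>_. 0"], rule exI[of _ "\<lambda>_. 0"]) (auto intro: polyd.intros)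
next
  case (polyd_fst k f)
  then obtain f1 f2 where f: "polyd (k - 1) f1" "polyd (k - 1) f2" "\<And>x. (f has_derivative (\<lambda>h. f1 x * fst h + f2 x * snd h)) (at x)" by blast
  have m: "polyd k (\<lambda>x. fst x * f1 x)" "polyd k (\<lambda>x. fst x * f2 x)"
  proof -
    have "polyd k (\<lambda>x. fst x * f1 x) \<and> polyd k (\<lambda>x. fst x * f2 x)"
    proof (cases k)
      \<comment> \<open>Subtraction truncates, so \<open>k - 1\<close> is still 0 and multiplying
        the gradient by a coordinate would raise the degree to 1; the gradient has to vanish because
        \<open>f\<close> is constant.\<close>
      case 0
      from polyd_coeffs[OF polyd_fst(1)] obtain e where "\<forall>x. f x = (\<Sum>i\<le>k. \<Sum>j\<le>k - i. e i j * fst x ^ i * snd x ^ j)" ..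
      then have c: "f = (\<lambda>_. e 0 0)" using 0 by (auto simp: fun_eq_iff)
      have "(f has_derivative (\<lambda>h. 0 * fst h + 0 * snd h)) (at x)" for x unfolding c by simp
      from grad_unique[OF f(3) this open_UNIV UNIV_I] have "f1 x = 0 \<and> f2 x = 0" for x by simp
      then show ?thesis using polyd_const[of k 0] by simp
    next
      case (Suc m)
      then show ?thesis using f polyd.polyd_fst by simp
    qed
    then show "polyd k (\<lambda>x. fst x * f1 x)" "polyd k (\<lambda>x. fst x * f2 x)" by auto
  qed
  have "((\<lambda>x. fst x * f x) has_derivative (\<lambda>h. (f x + fst x * f1 x) * fst h + (fst x * f2 x) * snd h)) (at x)" for x
    by (auto intro!: derivative_eq_intros f(3) simp: algebra_simps)
  then show ?case using m polyd_fst(1)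
    by - (rule exI[of _ "\<lambda>x. f x + fst x * f1 x"], rule exI[of _ "\<lambda>x. fst x * f2 x"], auto intro: polyd_add)
next
  case (polyd_snd k f)
  then obtain f1 f2 where f: "polyd (k - 1) f1" "polyd (k - 1) f2" "\<And>x. (f has_derivative (\<lambda>h. f1 x * fst h + f2 x * snd h)) (at x)" by blast
  have m: "polyd k (\<lambda>x. snd x * f1 x)" "polyd k (\<lambda>x. snd x * f2 x)"
  proof -
    have "polyd k (\<lambda>x. snd x * f1 x) \<and> polyd k (\<lambda>x. snd x * f2 x)"
    proof (cases k)
      case 0
      from polyd_coeffs[OF polyd_snd(1)] obtain e where "\<forall>x. f x = (\<Sum>i\<le>k. \<Sum>j\<le>k - i. e i j * fst x ^ i * snd x ^ j)" ..
      then have c: "f = (\<lambda>_. e 0 0)" using 0 by (auto simp: fun_eq_iff)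
      have "(f has_derivative (\<lambda>h. 0 * fst h + 0 * snd h)) (at x)" for x unfolding c by simp
      from grad_unique[OF f(3) this open_UNIV UNIV_I] have "f1 x = 0 \<and> f2 x = 0" for x by simp
      then show ?thesis using polyd_const[of k 0] by simp
    next
      case (Suc m)
      then show ?thesis using f polyd.polyd_snd by simp
    qed
    then show "polyd k (\<lambda>x. snd x * f1 x)" "polyd k (\<lambda>x. snd x * f2 x)" by auto
  qed
  have "((\<lambda>x. snd x * f x) has_derivative (\<lambda>h. (snd x * f1 x) * fst h + (f x + snd x * f2 x) * snd h)) (at x)" for x
    by (auto intro!: derivative_eq_intros f(3) simp: algebra_simps)
  then show ?case using m polyd_snd(1)
    by - (rule exI[of _ "\<lambda>x. snd x * f1 x"], rule exI[of _ "\<lambda>x. f x + snd x * f2 x"], auto intro: polyd_add)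
next
  case (polyd_add k f g)
  then obtain f1 f2 g1 g2 where f: "polyd (k - 1) f1" "polyd (k - 1) f2" "\<And>x. (f has_derivative (\<lambda>h. f1 x * fst h + f2 x * snd h)) (at x)"
    and g: "polyd (k - 1) g1" "polyd (k - 1) g2" "\<And>x. (g has_derivative (\<lambda>h. g1 x * fst h + g2 x * snd h)) (at x)" by blast
  have "((\<lambda>x. f x + g x) has_derivative (\<lambda>h. (f1 x + g1 x) * fst h + (f2 x + g2 x) * snd h)) (at x)" for x
    by (auto intro!: derivative_eq_intros f(3) g(3) simp: algebra_simps)
  then show ?case using f g
    by - (rule exI[of _ "\<lambda>x. f1 x + g1 x"], rule exI[of _ "\<lambda>x. f2 x + g2 x"], auto intro: polyd.polyd_add)
qed

lemma polyd_continuous: "polyd k f \<Longrightarrow> continuous_on S f"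
  by (induction rule: polyd.induct) (auto intro!: continuous_intros)

lemma polyd_C2j:
  assumes "polyd 3 q"
  obtains Q where "Q 0 = q" "C2j UNIV Q" "polyd 2 (Q 1)" "polyd 2 (Q 2)" "polyd 1 (Q 3)" "polyd 1 (Q 4)" "polyd 1 (Q 5)" "polyd 1 (Q 6)"
proof -
  obtain q1 q2 where q: "polyd 2 q1" "polyd 2 q2" "\<And>x. (q has_derivative (\<lambda>h. q1 x * fst h + q2 x * snd h)) (at x)"
    using polyd_jets[OF assms] by auto
  obtain q11 q12 where q1: "polyd 1 q11" "polyd 1 q12" "\<And>x. (q1 has_derivative (\<lambda>h. q11 x * fst h + q12 x * snd h)) (at x)"
    using polyd_jets[OF q(1)] by auto
  obtain q21 q22 where q2: "polyd 1 q21" "polyd 1 q22" "\<And>x. (q2 has_derivative (\<lambda>h. q21 x * fst h + q22 x * snd h)) (at x)"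
    using polyd_jets[OF q(2)] by auto
  show ?thesis
    by (rule that[of "\<lambda>k. [q, q1, q2, q11, q12, q21, q22] ! k"])
      (use assms q q1 q2 in \<open>simp_all add: C2j_def all_less_7 polyd_continuous\<close>)
qed

definition pwj :: "pt \<Rightarrow> real \<Rightarrow> nat \<Rightarrow> pt \<Rightarrow> real" where
  "pwj n c k x = (if k = 0 then pw 3 (n \<bullet> x + c)
     else if k = 1 then 3 * fst n * pw 2 (n \<bullet> x + c) else if k = 2 then 3 * snd n * pw 2 (n \<bullet> x + c)
     else if k = 3 then 6 * fst n * fst n * pw 1 (n \<bullet> x + c) else if k = 4 then 6 * fst n * snd n * pw 1 (n \<bullet> x + c)
     else if k = 5 then 6 * snd n * fst n * pw 1 (n \<bullet> x + c) else 6 * snd n * snd n * pw 1 (n \<bullet> x + c))"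

lemma DERIV_pw_ge2:
  assumes "1 \<le> k" shows "(pw (Suc k) has_real_derivative (real (Suc k) * pw k u)) (at u)"
proof (cases "u = 0")
  case True
  have "((\<lambda>h. (pw (Suc k) (0 + h) - pw (Suc k) 0) / h) \<longlongrightarrow> 0) (at 0)"
  proof (rule Lim_null_comparison)
    have "\<bar>(pw (Suc k) h - pw (Suc k) 0) / h\<bar> \<le> \<bar>h\<bar> ^ k" if "h \<noteq> 0" for h
      using that by (cases "h > 0") (simp_all add: pw_def)
    then show "\<forall>\<^sub>F h in at 0. norm ((pw (Suc k) (0 + h) - pw (Suc k) 0) / h) \<le> \<bar>h\<bar> ^ k"
      by (auto simp: eventually_at_filter)
    have "((\<lambda>h::real. \<bar>h\<bar> ^ k) \<longlongrightarrow> \<bar>0\<bar> ^ k) (at 0)" by (intro tendsto_intros)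
    then show "((\<lambda>h::real. \<bar>h\<bar> ^ k) \<longlongrightarrow> 0) (at 0)" using assms by (simp add: power_0_left split: if_splits)
  qed
  then show ?thesis using True assms by (simp add: DERIV_def pw_def)
qed (rule DERIV_pw)

lemma pw_has_derivative:
  assumes "1 \<le> k"
  shows "((\<lambda>x::pt. pw (Suc k) (n \<bullet> x + c)) has_derivative (\<lambda>h. (real (Suc k) * fst n * pw k (n \<bullet> x + c)) * fst h + (real (Suc k) * snd n * pw k (n \<bullet> x + c)) * snd h)) (at x)"
proof -
  have "((\<lambda>x::pt. n \<bullet> x + c) has_derivative (\<lambda>h. n \<bullet> h)) (at x)"
    by (auto intro!: derivative_eq_intros)
  from has_derivative_compose[OF this DERIV_pw_ge2[OF assms, unfolded has_field_derivative_def]]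
  show ?thesis by (simp add: inner_prod_def algebra_simps)
qed

lemma pwj_C2j: "C2j UNIV (pwj n c)"
proof -
  have c: "continuous_on UNIV (\<lambda>x. n \<bullet> x + c)" by (intro continuous_intros)
  have cont: "continuous_on UNIV (\<lambda>x. pw 3 (n \<bullet> x + c))" "continuous_on UNIV (\<lambda>x. pw 2 (n \<bullet> x + c))" "continuous_on UNIV (\<lambda>x. pw 1 (n \<bullet> x + c))"
    using continuous_on_pw[OF c] by (metis numeral_3_eq_3 numeral_2_eq_2 One_nat_def)+
  have d3: "((\<lambda>x::pt. pw 3 (n \<bullet> x + c)) has_derivative (\<lambda>h. (3 * fst n * pw 2 (n \<bullet> x + c)) * fst h + (3 * snd n * pw 2 (n \<bullet> x + c)) * snd h)) (at x)" for x
    using pw_has_derivative[of 2 n c x] by (simp add: numeral_3_eq_3[symmetric])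
  have d2: "((\<lambda>x::pt. pw 2 (n \<bullet> x + c)) has_derivative (\<lambda>h. (2 * fst n * pw 1 (n \<bullet> x + c)) * fst h + (2 * snd n * pw 1 (n \<bullet> x + c)) * snd h)) (at x)" for x
    using pw_has_derivative[of 1 n c x] by (simp add: numeral_2_eq_2[symmetric])
  have e1: "((\<lambda>x::pt. 3 * fst n * pw 2 (n \<bullet> x + c)) has_derivative (\<lambda>h. (6 * fst n * fst n * pw 1 (n \<bullet> x + c)) * fst h + (6 * fst n * snd n * pw 1 (n \<bullet> x + c)) * snd h)) (at x)" for x
    using has_derivative_mult_right[OF d2, of "3 * fst n" x] by (simp add: algebra_simps)
  have e2: "((\<lambda>x::pt. 3 * snd n * pw 2 (n \<bullet> x + c)) has_derivative (\<lambda>h. (6 * snd n * fst n * pw 1 (n \<bullet> x + c)) * fst h + (6 * snd n * snd n * pw 1 (n \<bullet> x + c)) * snd h)) (at x)" for x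
    using has_derivative_mult_right[OF d2, of "3 * snd n" x] by (simp add: algebra_simps)
  have j: "pwj n c 0 = (\<lambda>x. pw 3 (n \<bullet> x + c))" "pwj n c 1 = (\<lambda>x. 3 * fst n * pw 2 (n \<bullet> x + c))"
    "pwj n c 2 = (\<lambda>x. 3 * snd n * pw 2 (n \<bullet> x + c))" "pwj n c 3 = (\<lambda>x. 6 * fst n * fst n * pw 1 (n \<bullet> x + c))"
    "pwj n c 4 = (\<lambda>x. 6 * fst n * snd n * pw 1 (n \<bullet> x + c))" "pwj n c 5 = (\<lambda>x. 6 * snd n * fst n * pw 1 (n \<bullet> x + c))"
    "pwj n c 6 = (\<lambda>x. 6 * snd n * snd n * pw 1 (n \<bullet> x + c))"
    by (simp_all add: pwj_def fun_eq_iff)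
  show ?thesis unfolding C2j_def all_less_7 j
    by (intro conjI ballI d3 e1 e2 cont continuous_on_mult_left)
qed

section \<open>Piecewise cubics across lines\<close>

definition crs :: "pt \<Rightarrow> pt \<Rightarrow> real" where "crs a b = fst a * snd b - snd a * fst b"
definition perp :: "pt \<Rightarrow> pt" where "perp a = (- snd a, fst a)"

lemma inner_perp: "n \<bullet> perp a = crs a n" "perp a \<bullet> n = crs a n"
  by (simp_all add: perp_def crs_def inner_prod_def)

lemma crs_self [simp]: "crs a a = 0" by (simp add: crs_def)

lemma polyd1_affine: "polyd 1 f \<Longrightarrow> \<exists>g e. \<forall>x. f x = g \<bullet> x + e"
proof -
  assume "polyd 1 f"
  from polyd_coeffs[OF this] obtain c where "\<forall>x. f x = (\<Sum>i\<le>1. \<Sum>j\<le>1 - i. c i j * fst x ^ i * snd x ^ j)" ..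
  then have "\<forall>x. f x = (c 1 0, c 0 1) \<bullet> x + c 0 0" by (auto simp: inner_prod_def)
  then show ?thesis by blast
qed

lemma DERIV_line:
  assumes "(f has_derivative (\<lambda>h. a * fst h + b * snd h)) (at (p + s *\<^sub>R t))"
  shows "((\<lambda>s. f (p + s *\<^sub>R t)) has_real_derivative a * fst t + b * snd t) (at s)"
proof -
  have "((\<lambda>s. p + s *\<^sub>R t) has_derivative (\<lambda>h. h *\<^sub>R t)) (at s)"
    by (auto intro!: derivative_eq_intros)
  from has_derivative_compose[OF this assms] show ?thesis
    unfolding has_field_derivative_def by (rule has_derivative_eq_rhs) (auto simp: algebra_simps)
qed

lemma open_line_nbhd:
  fixes p t :: pt
  assumes "open U" "p \<in> U"
  obtains e where "0 < e" "\<And>s. \<bar>s\<bar> < e \<Longrightarrow> p + s *\<^sub>R t \<in> U"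
proof -
  have "open ((\<lambda>s. p + s *\<^sub>R t) -` U)" by (intro open_vimage assms continuous_intros)
  moreover have "0 \<in> (\<lambda>s. p + s *\<^sub>R t) -` U" using assms by simp
  ultimately obtain e where "0 < e" "ball 0 e \<subseteq> (\<lambda>s. p + s *\<^sub>R t) -` U" using open_contains_ball by blast
  then show ?thesis by (intro that[of e]) (auto simp: subset_iff)
qed

text \<open>The second derivatives are affine, so vanishing on a piece of the line makes each of
  them a multiple of the distance from the line. Integrating twice across the line from zero data
  leaves a multiple of the cube.\<close>

lemma jets_vanish_cube:
  assumes Q: "C2j UNIV Q" and Q1: "polyd 1 (Q 3)" "polyd 1 (Q 4)" "polyd 1 (Q 5)" "polyd 1 (Q 6)"
    and U: "open U" "p \<in> U" "n \<bullet> p + c = 0" and n: "n \<noteq> 0"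
    and van: "\<And>x k. x \<in> U \<Longrightarrow> n \<bullet> x + c = 0 \<Longrightarrow> k < 7 \<Longrightarrow> Q k x = 0"
  shows "\<exists>A. \<forall>x. Q 0 x = A * (n \<bullet> x + c) ^ 3"
proof -
  \<comment> \<open>Coordinates along and across the line: \<open>t\<close> is parallel to it, and
    \<open>v\<close> is normalised so that the affine form grows at unit rate along it.\<close>
  define t where "t = perp n"
  define v where "v = (1 / (n \<bullet> n)) *\<^sub>R n"
  have nt: "n \<bullet> t = 0" by (simp add: t_def inner_perp)
  have nv: "n \<bullet> v = 1" using n by (simp add: v_def)
  obtain e where e: "0 < e" "\<And>s. \<bar>s\<bar> < e \<Longrightarrow> p + s *\<^sub>R t \<in> U" using open_line_nbhd[OF U(1,2), of t] by blast
  have D: "(Q 0 has_derivative (\<lambda>h. Q 1 x * fst h + Q 2 x * snd h)) (at x)"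
    "(Q 1 has_derivative (\<lambda>h. Q 3 x * fst h + Q 4 x * snd h)) (at x)"
    "(Q 2 has_derivative (\<lambda>h. Q 5 x * fst h + Q 6 x * snd h)) (at x)" for x
    using Q[unfolded C2j_def interior_UNIV, THEN conjunct2, rule_format, OF UNIV_I, of x] by blast+
  have lin: "\<exists>B. \<forall>s m. Q k (p + s *\<^sub>R t + m *\<^sub>R v) = B * m" if k: "polyd 1 (Q k)" "k < 7" for k
  proof -
    obtain g d where g: "\<And>x. Q k x = g \<bullet> x + d" using polyd1_affine[OF k(1)] by blast
    have "Q k p = 0" using van[OF U(2,3) k(2)] .
    moreover have "Q k (p + (e/2) *\<^sub>R t) = 0"
      by (rule van[OF _ _ k(2)]) (use e U nt in \<open>auto simp: inner_add_right\<close>)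
    ultimately have g0: "g \<bullet> p + d = 0" and "g \<bullet> p + e * (g \<bullet> t) / 2 + d = 0" by (simp_all add: g inner_add_right)
    then have "e * (g \<bullet> t) = 0" by linarith
    with g0 e have "g \<bullet> p + d = 0" "g \<bullet> t = 0" by simp_all
    then have "\<forall>s m. Q k (p + s *\<^sub>R t + m *\<^sub>R v) = (g \<bullet> v) * m" by (simp add: g inner_add_right algebra_simps)
    then show ?thesis by blast
  qed
  obtain B3 B4 B5 B6 where B: "\<And>s m. Q 3 (p + s *\<^sub>R t + m *\<^sub>R v) = B3 * m" "\<And>s m. Q 4 (p + s *\<^sub>R t + m *\<^sub>R v) = B4 * m"
    "\<And>s m. Q 5 (p + s *\<^sub>R t + m *\<^sub>R v) = B5 * m" "\<And>s m. Q 6 (p + s *\<^sub>R t + m *\<^sub>R v) = B6 * m"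
    using lin[OF Q1(1)] lin[OF Q1(2)] lin[OF Q1(3)] lin[OF Q1(4)] by auto
  have B0: "Q 3 (p + s *\<^sub>R t) = 0" "Q 4 (p + s *\<^sub>R t) = 0" "Q 5 (p + s *\<^sub>R t) = 0" "Q 6 (p + s *\<^sub>R t) = 0" for s
    using B[of s 0] by simp_all
  have const: "f s = f 0" if "\<And>s. (f has_real_derivative 0) (at s)" for f :: "real \<Rightarrow> real" and s
    using DERIV_isconst_all[of f s 0] that by blast
  have d1: "((\<lambda>s. Q 1 (p + s *\<^sub>R t)) has_real_derivative 0) (at s)" for s
    using DERIV_line[OF D(2), where p=p and s=s and t=t] by (simp add: B0)
  have q1: "Q 1 (p + s *\<^sub>R t) = 0" for s
    using const[of "\<lambda>s. Q 1 (p + s *\<^sub>R t)" s, OF d1] van[OF U(2,3), of 1] by simp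
  have d2: "((\<lambda>s. Q 2 (p + s *\<^sub>R t)) has_real_derivative 0) (at s)" for s
    using DERIV_line[OF D(3), where p=p and s=s and t=t] by (simp add: B0)
  have q2: "Q 2 (p + s *\<^sub>R t) = 0" for s
    using const[of "\<lambda>s. Q 2 (p + s *\<^sub>R t)" s, OF d2] van[OF U(2,3), of 2] by simp
  have d0: "((\<lambda>s. Q 0 (p + s *\<^sub>R t)) has_real_derivative 0) (at s)" for s
    using DERIV_line[OF D(1), where p=p and s=s and t=t] unfolding q1 q2 by simp
  have q0: "Q 0 (p + s *\<^sub>R t) = 0" for s
    using const[of "\<lambda>s. Q 0 (p + s *\<^sub>R t)" s, OF d0] van[OF U(2,3), of 0] by simp
  define B where "B = fst v * (B3 * fst v + B4 * snd v) + snd v * (B5 * fst v + B6 * snd v)"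
  have r: "Q 0 (p + s *\<^sub>R t + m *\<^sub>R v) = B / 6 * m ^ 3" for s m
  proof -
    let ?p = "p + s *\<^sub>R t"
    define r1 where "r1 m = Q 1 (?p + m *\<^sub>R v) * fst v + Q 2 (?p + m *\<^sub>R v) * snd v" for m
    have r1d: "(r1 has_real_derivative B * m) (at m)" for m
    proof -
      have a1: "((\<lambda>m. Q 1 (?p + m *\<^sub>R v)) has_real_derivative B3 * m * fst v + B4 * m * snd v) (at m)"
        using DERIV_line[OF D(2), where p="?p" and s=m and t=v] unfolding B .
      have a2: "((\<lambda>m. Q 2 (?p + m *\<^sub>R v)) has_real_derivative B5 * m * fst v + B6 * m * snd v) (at m)"
        using DERIV_line[OF D(3), where p="?p" and s=m and t=v] unfolding B .
      show ?thesis unfolding r1_def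
        by (rule DERIV_cong[OF DERIV_add[OF DERIV_cmult_right[OF a1, of "fst v"] DERIV_cmult_right[OF a2, of "snd v"]]])
          (simp add: B_def algebra_simps)
    qed
    have "((\<lambda>m. r1 m - B / 2 * m ^ 2) has_real_derivative 0) (at m)" for m
      by (rule derivative_eq_intros r1d refl | simp)+
    from const[of "\<lambda>m. r1 m - B / 2 * m ^ 2", OF this] have r1: "r1 m = B / 2 * m ^ 2" for m
      using q1[of s] q2[of s] by (simp add: r1_def)
    have "((\<lambda>m. Q 0 (?p + m *\<^sub>R v) - B / 6 * m ^ 3) has_real_derivative 0) (at m)" for m
    proof -
      have "((\<lambda>m. Q 0 (?p + m *\<^sub>R v)) has_real_derivative B / 2 * m ^ 2) (at m)"
      proof -
        have e: "Q 1 (?p + m *\<^sub>R v) * fst v + Q 2 (?p + m *\<^sub>R v) * snd v = B / 2 * m ^ 2"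
          using r1[of m] unfolding r1_def .
        show ?thesis using DERIV_line[OF D(1), where p="?p" and s=m and t=v] unfolding e .
      qed
      then show ?thesis by (auto intro!: derivative_eq_intros)
    qed
    from const[of "\<lambda>m. Q 0 (?p + m *\<^sub>R v) - B / 6 * m ^ 3" m, OF this] show ?thesis
      using q0[of s] by simp
  qed
  show ?thesis
  proof (intro exI[of _ "B / 6"] allI)
    fix x :: pt
    define m where "m = n \<bullet> x + c"
    define s where "s = (t \<bullet> (x - p)) / (n \<bullet> n)"
    have nn: "n \<bullet> n \<noteq> 0" using n by simp
    have mp: "m = n \<bullet> (x - p)" using U(3) by (simp add: m_def inner_diff_right)
    have "(n \<bullet> n) *\<^sub>R (s *\<^sub>R t + m *\<^sub>R v) = (t \<bullet> (x - p)) *\<^sub>R t + (n \<bullet> (x - p)) *\<^sub>R n"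
      using nn by (simp add: s_def mp v_def scaleR_add_right)
    also have "\<dots> = (n \<bullet> n) *\<^sub>R (x - p)"
      by (simp add: t_def perp_def inner_prod_def prod_eq_iff algebra_simps)
    finally have "s *\<^sub>R t + m *\<^sub>R v = x - p" using nn by simp
    then have "x = p + (s *\<^sub>R t + m *\<^sub>R v)" by simp
    then have "x = p + s *\<^sub>R t + m *\<^sub>R v" by (simp only: add.assoc)
    then show "Q 0 x = B / 6 * (n \<bullet> x + c) ^ 3" using r[of s m] m_def by simp
  qed
qed

lemma pw1_second_difference:
  assumes "\<bar>d\<bar> < \<bar>a\<bar>" shows "pw 1 (a + d) + pw 1 (a - d) - 2 * pw 1 a = 0"
  using assms by (auto simp: pw_def)

lemma hessian_pwj:
  "fst u * fst v * pwj n c 3 x + fst u * snd v * pwj n c 4 x + snd u * fst v * pwj n c 5 x + snd u * snd v * pwj n c 6 x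
    = 6 * (n \<bullet> u) * (n \<bullet> v) * pw 1 (n \<bullet> x + c)"
  by (simp add: pwj_def inner_prod_def algebra_simps)

text \<open>With at most three further lines through \<open>p\<close>, the rank-one Hessians \<open>n i \<otimes> n i\<close> are independent:
  test directions orthogonal to the other normals isolate one jump coefficient.\<close>

lemma crossing_coeff_zero:
  fixes n :: "nat \<Rightarrow> pt" and c d :: "nat \<Rightarrow> real"
  assumes U: "open U" "p \<in> U" "n0 \<bullet> p + c0 = 0" and J: "finite J" "i0 \<in> J" "n i0 \<bullet> p + c i0 = 0"
    and Q: "polyd 1 (Q 3)" "polyd 1 (Q 4)" "polyd 1 (Q 5)" "polyd 1 (Q 6)"
    and eq: "\<And>x k. x \<in> U \<Longrightarrow> n0 \<bullet> x + c0 = 0 \<Longrightarrow> 3 \<le> k \<Longrightarrow> k < 7 \<Longrightarrow> Q k x + (\<Sum>i\<in>J. d i * pwj (n i) (c i) k x) = 0"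
    and cr0: "crs n0 (n i0) \<noteq> 0"
    and cr: "\<And>i. i \<in> J \<Longrightarrow> i \<noteq> i0 \<Longrightarrow> n i \<bullet> p + c i = 0 \<Longrightarrow> crs (n i) (n i0) \<noteq> 0"
    and card: "card {i \<in> J. n i \<bullet> p + c i = 0} \<le> 3"
  shows "d i0 = 0"
proof -
  define K where "K = {i \<in> J. n i \<bullet> p + c i = 0} - {i0}"
  have "card K \<le> 2" "finite K" using card J by (auto simp: K_def card_Diff_singleton)
  \<comment> \<open>Besides \<open>i0\<close> at most two lines of \<open>J\<close> pass through
    \<open>p\<close>. Taking u parallel to one and v parallel to the other makes the product of
    normal components vanish for both, but not for \<open>i0\<close>.\<close>
  obtain u v where uv: "n i0 \<bullet> u \<noteq> 0" "n i0 \<bullet> v \<noteq> 0" "\<And>i. i \<in> K \<Longrightarrow> n i \<bullet> u = 0 \<or> n i \<bullet> v = 0"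
  proof (cases "K = {}")
    case True
    have "n i0 \<noteq> 0" using cr0 by (auto simp: crs_def)
    then show ?thesis using that[of "n i0" "n i0"] True by auto
  next
    case False
    obtain i1 i2 where i12: "i1 \<in> K" "i2 \<in> K" "K = {i1, i2}"
    proof -
      have "card K = 1 \<or> card K = 2" using \<open>card K \<le> 2\<close> \<open>finite K\<close> False by (cases "card K") auto
      then show ?thesis using that by (auto simp: card_1_singleton_iff card_2_iff)
    qed
    have "crs (n i1) (n i0) \<noteq> 0" "crs (n i2) (n i0) \<noteq> 0" using cr i12(1,2) by (auto simp: K_def)
    then show ?thesis using i12(3) by (intro that[of "perp (n i1)" "perp (n i2)"]) (auto simp: inner_perp)
  qed
  define t where "t = perp n0"
  obtain e where e: "0 < e" "\<And>s. \<bar>s\<bar> < e \<Longrightarrow> p + s *\<^sub>R t \<in> U" using open_line_nbhd[OF U(1,2), of t] by blast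
  define al where "al i = n i \<bullet> t" for i
  define l where "l i = n i \<bullet> p + c i" for i
  \<comment> \<open>On a step this short no line missing \<open>p\<close> is crossed, so only lines
    through \<open>p\<close> contribute to second differences.\<close>
  obtain s where s: "0 < s" "s < e" "\<And>i. i \<in> J \<Longrightarrow> l i \<noteq> 0 \<Longrightarrow> s * \<bar>al i\<bar> < \<bar>l i\<bar>"
  proof -
    define m where "m = Min (insert e ((\<lambda>i. \<bar>l i\<bar> / (\<bar>al i\<bar> + 1)) ` {i \<in> J. l i \<noteq> 0}))"
    have fin: "finite (insert e ((\<lambda>i. \<bar>l i\<bar> / (\<bar>al i\<bar> + 1)) ` {i \<in> J. l i \<noteq> 0}))" using J by auto
    have "0 < m" unfolding m_def using e fin by (subst Min_gr_iff) auto
    moreover have "m \<le> e" unfolding m_def using fin by simp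
    moreover have "m / 2 * \<bar>al i\<bar> < \<bar>l i\<bar>" if "i \<in> J" "l i \<noteq> 0" for i
    proof -
      have "m \<le> \<bar>l i\<bar> / (\<bar>al i\<bar> + 1)" unfolding m_def using fin that by (intro Min_le) auto
      then have "m * (\<bar>al i\<bar> + 1) \<le> \<bar>l i\<bar>" by (simp add: pos_le_divide_eq)
      moreover have "m / 2 * \<bar>al i\<bar> < m * (\<bar>al i\<bar> + 1)"
        using \<open>0 < m\<close> by (simp add: algebra_simps add_strict_increasing2)
      ultimately show ?thesis by linarith
    qed
    ultimately show ?thesis by (intro that[of "m / 2"]) auto
  qed
  define W where "W x = fst u * fst v * Q 3 x + fst u * snd v * Q 4 x + snd u * fst v * Q 5 x + snd u * snd v * Q 6 x" for x
  obtain g h where W: "\<And>x. W x = g \<bullet> x + h"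
  proof -
    have "polyd 1 W" unfolding W_def[abs_def] by (intro polyd_add polyd_scale Q)
    then show ?thesis using polyd1_affine that by blast
  qed
  define b where "b i = 6 * d i * (n i \<bullet> u) * (n i \<bullet> v)" for i
  have tot: "W x + (\<Sum>i\<in>J. b i * pw 1 (n i \<bullet> x + c i)) = 0" if x: "x \<in> U" "n0 \<bullet> x + c0 = 0" for x
  proof -
    define S where "S k = (\<Sum>i\<in>J. d i * pwj (n i) (c i) k x)" for k
    have "(\<Sum>i\<in>J. b i * pw 1 (n i \<bullet> x + c i)) = (\<Sum>i\<in>J. d i * (6 * (n i \<bullet> u) * (n i \<bullet> v) * pw 1 (n i \<bullet> x + c i)))"
      by (intro sum.cong refl) (simp add: b_def)
    also have "\<dots> = fst u * fst v * S 3 + fst u * snd v * S 4 + snd u * fst v * S 5 + snd u * snd v * S 6"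
      unfolding hessian_pwj[symmetric] S_def sum_distrib_left sum.distrib[symmetric]
      by (intro sum.cong refl) (simp add: algebra_simps)
    finally have "W x + (\<Sum>i\<in>J. b i * pw 1 (n i \<bullet> x + c i)) =
       fst u * fst v * (Q 3 x + S 3) + fst u * snd v * (Q 4 x + S 4) + snd u * fst v * (Q 5 x + S 5) + snd u * snd v * (Q 6 x + S 6)"
      by (simp add: W_def algebra_simps)
    then show ?thesis using eq[OF x] by (simp add: S_def)
  qed
  have n0t: "n0 \<bullet> t = 0" by (simp add: t_def inner_perp)
  have at: "n i \<bullet> (p + r *\<^sub>R t) + c i = l i + r * al i" for i r by (simp add: l_def al_def inner_add_right)
  have T: "W (p + r *\<^sub>R t) + (\<Sum>i\<in>J. b i * pw 1 (l i + r * al i)) = 0" if "\<bar>r\<bar> < e" for r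
  proof -
    have "n0 \<bullet> (p + r *\<^sub>R t) + c0 = 0" using U(3) n0t by (simp add: inner_add_right)
    from tot[OF e(2)[OF that] this] show ?thesis unfolding at .
  qed
  \<comment> \<open>Second differences along the line annihilate the affine function
    \<open>W\<close> and every truncated form without a kink at \<open>p\<close>. Lines through
    \<open>p\<close> other than \<open>i0\<close> have \<open>b i = 0\<close> by the choice of u and
    v, so the term of \<open>i0\<close> stands alone.\<close>
  define D where "D i = pw 1 (l i + s * al i) + pw 1 (l i - s * al i) - 2 * pw 1 (l i)" for i
  have "(\<Sum>i\<in>J. b i * D i) = 0"
  proof -
    have "W (p + s *\<^sub>R t) + W (p + (-s) *\<^sub>R t) - 2 * W (p + 0 *\<^sub>R t) = 0"
      unfolding W by (simp add: inner_add_right inner_diff_right)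
    moreover have "(\<Sum>i\<in>J. b i * D i) = (\<Sum>i\<in>J. b i * pw 1 (l i + s * al i)) + (\<Sum>i\<in>J. b i * pw 1 (l i + (-s) * al i)) - 2 * (\<Sum>i\<in>J. b i * pw 1 (l i + 0 * al i))"
      by (simp add: D_def sum.distrib sum_subtractf sum_distrib_left algebra_simps)
    ultimately show ?thesis using T[of s] T[of "-s"] T[of 0] s e by simp
  qed
  moreover have "(\<Sum>i\<in>J. b i * D i) = b i0 * D i0"
  proof -
    have "b i * D i = 0" if i: "i \<in> J - {i0}" for i
    proof (cases "l i = 0")
      case True
      then have "i \<in> K" using i by (auto simp: K_def l_def)
      then show ?thesis using uv(3)[of i] by (auto simp: b_def)
    next
      case False
      have "\<bar>s * al i\<bar> < \<bar>l i\<bar>" using s(3)[of i] i False s(1) by (simp add: abs_mult)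
      from pw1_second_difference[OF this] show ?thesis by (simp add: D_def)
    qed
    then have "(\<Sum>i\<in>J - {i0}. b i * D i) = 0" by (intro sum.neutral ballI)
    then show ?thesis using J by (simp add: sum.remove[of J i0])
  qed
  moreover have "D i0 = s * \<bar>al i0\<bar>"
  proof -
    have y: "pw 1 y + pw 1 (- y) = \<bar>y\<bar>" for y by (simp add: pw_def abs_if)
    have "l i0 = 0" using J(3) by (simp add: l_def)
    then have "D i0 = pw 1 (s * al i0) + pw 1 (- (s * al i0))" by (simp add: D_def pw_def)
    then show ?thesis unfolding y using s(1) by (simp add: abs_mult)
  qed
  moreover have "al i0 \<noteq> 0" using cr0 by (simp add: al_def t_def inner_perp)
  ultimately have "b i0 = 0" using s(1) by auto
  then show ?thesis using uv by (simp add: b_def)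
qed

lemma line_side_closure:
  assumes U: "open U" "x \<in> U" "n \<bullet> x + c = 0" and n: "n \<noteq> (0::pt)"
  shows "x \<in> closure {y \<in> U. 0 < n \<bullet> y + c}"
proof (subst closure_approachable, intro allI impI)
  fix r :: real assume r: "0 < r"
  obtain e where e: "0 < e" "\<And>s. \<bar>s\<bar> < e \<Longrightarrow> x + s *\<^sub>R n \<in> U" using open_line_nbhd[OF U(1,2), of n] by blast
  obtain e' where e': "0 < e'" "\<And>s. \<bar>s\<bar> < e' \<Longrightarrow> x + s *\<^sub>R n \<in> ball x r"
    using open_line_nbhd[of "ball x r" x n] r by (metis centre_in_ball open_ball)
  define s where "s = min e e' / 2"
  have s: "0 < s" "\<bar>s\<bar> < e" "\<bar>s\<bar> < e'" using e e' by (auto simp: s_def)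
  have "0 < s * (n \<bullet> n)" using s(1) n by simp
  then have "0 < n \<bullet> (x + s *\<^sub>R n) + c" using U(3) by (simp add: inner_add_right)
  then show "\<exists>y\<in>{y \<in> U. 0 < n \<bullet> y + c}. dist y x < r"
    using e(2)[OF s(2)] e'(2)[OF s(3)] by (intro bexI[of _ "x + s *\<^sub>R n"]) (auto simp: dist_commute)
qed

lemma convex_side: "convex U \<Longrightarrow> convex {x \<in> U. 0 < n \<bullet> x + (c::real)}"
proof -
  assume "convex U"
  moreover have "{x. 0 < n \<bullet> x + c} = {x. n \<bullet> x > - c}" by auto
  moreover have "{x \<in> U. 0 < n \<bullet> x + c} = U \<inter> {x. 0 < n \<bullet> x + c}" by auto
  ultimately show ?thesis using convex_halfspace_gt[of "- c" n] by (simp add: convex_Int)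
qed

lemma open_side: "open U \<Longrightarrow> open {x \<in> U. 0 < n \<bullet> x + (c::real)}"
proof -
  assume "open U"
  moreover have "open {x. 0 < n \<bullet> x + c}" by (intro open_Collect_less continuous_intros)
  moreover have "{x \<in> U. 0 < n \<bullet> x + c} = U \<inter> {x. 0 < n \<bullet> x + c}" by auto
  ultimately show ?thesis by auto
qed

text \<open>The point is the weighted mean of x and y that balances the two values. The last
  conjunct records that it lies on every line through both ends.\<close>

lemma segment_zero:
  fixes x y n :: pt
  assumes U: "convex U" "x \<in> U" "y \<in> U" and s: "n \<bullet> x + c > 0" "n \<bullet> y + c < 0"
  shows "\<exists>z\<in>U. n \<bullet> z + c = 0 \<and> (\<forall>m d. m \<bullet> x + d = 0 \<longrightarrow> m \<bullet> y + d = 0 \<longrightarrow> m \<bullet> z + d = 0)"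
proof -
  define a where "a = n \<bullet> x + c"
  define b where "b = - (n \<bullet> y + c)"
  have ab: "0 < a" "0 < b" using s by (auto simp: a_def b_def)
  define r where "r = b / (a + b)"
  define t where "t = a / (a + b)"
  have rt: "0 \<le> r" "0 \<le> t" "r + t = 1" using ab by (auto simp: r_def t_def add_divide_distrib[symmetric])
  define z where "z = r *\<^sub>R x + t *\<^sub>R y"
  have val: "m \<bullet> z + d = r * (m \<bullet> x + d) + t * (m \<bullet> y + d)" for m d
  proof -
    have "r * (m \<bullet> x + d) + t * (m \<bullet> y + d) = r * (m \<bullet> x) + t * (m \<bullet> y) + (r + t) * d" by (simp add: algebra_simps)
    then show ?thesis unfolding rt(3) by (simp add: z_def inner_add_right)
  qed
  show ?thesis
  proof (intro bexI[of _ z] conjI allI impI)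
    show "z \<in> U" unfolding z_def using U rt by (intro convexD) auto
    have "n \<bullet> z + c = r * a + t * (- b)" unfolding val by (simp add: a_def b_def)
    then show "n \<bullet> z + c = 0" by (simp add: r_def t_def)
  qed (simp add: val)
qed

lemma constant_sign:
  fixes n :: pt
  assumes "convex V" "\<And>x. x \<in> V \<Longrightarrow> n \<bullet> x + c \<noteq> 0"
  shows "(\<forall>x\<in>V. 0 < n \<bullet> x + c) \<or> (\<forall>x\<in>V. n \<bullet> x + c < 0)"
proof (rule ccontr)
  assume "\<not> ?thesis"
  then obtain x y where "x \<in> V" "y \<in> V" "n \<bullet> x + c > 0" "n \<bullet> y + c < 0"
    using assms(2) by (meson linorder_neqE_linordered_idom)
  then show False using segment_zero[OF assms(1)] assms(2) by metis
qed

text \<open>Where a line misses the convex set, its truncated cube is either 0 or the full cube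
  there, so its coefficient may be changed and the difference absorbed into the polynomial.\<close>

lemma adjust_coeffs:
  fixes n :: "nat \<Rightarrow> pt"
  assumes V: "convex V" and J: "finite J" and q: "polyd 3 q"
    and f: "\<And>x. x \<in> V \<Longrightarrow> f x = q x + (\<Sum>i\<in>J. a i * pw 3 (n i \<bullet> x + c i))"
    and nz: "\<And>i x. i \<in> J \<Longrightarrow> a' i \<noteq> a i \<Longrightarrow> x \<in> V \<Longrightarrow> n i \<bullet> x + c i \<noteq> 0"
  shows "\<exists>q'. polyd 3 q' \<and> (\<forall>x\<in>V. f x = q' x + (\<Sum>i\<in>J. a' i * pw 3 (n i \<bullet> x + c i)))"
proof -
  define e where "e i x = (if a' i \<noteq> a i \<and> (\<forall>x\<in>V. 0 < n i \<bullet> x + c i) then (a i - a' i) * (n i \<bullet> x + c i) ^ 3 else 0)" for i x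
  have pe: "polyd 3 (e i)" for i
  proof (cases "a' i \<noteq> a i \<and> (\<forall>x\<in>V. 0 < n i \<bullet> x + c i)")
    case True
    show ?thesis unfolding e_def[abs_def] if_P[OF True] by (rule polyd_scale[OF polyd_affine_power])
  next
    case False
    show ?thesis unfolding e_def[abs_def] if_not_P[OF False] by (rule polyd_const)
  qed
  have ee: "(a i - a' i) * pw 3 (n i \<bullet> x + c i) = e i x" if iV: "i \<in> J" "x \<in> V" for i x
  proof (cases "a' i = a i")
    case False
    then consider "\<forall>x\<in>V. 0 < n i \<bullet> x + c i" | "\<forall>x\<in>V. n i \<bullet> x + c i < 0"
      using constant_sign[OF V, of "n i" "c i"] nz[OF iV(1)] by blast
    then show ?thesis
    proof cases
      case 2
      then have no: "\<not> (a' i \<noteq> a i \<and> (\<forall>x\<in>V. 0 < n i \<bullet> x + c i))" and "\<not> 0 < n i \<bullet> x + c i" using iV by force+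
      then show ?thesis unfolding e_def if_not_P[OF no] by (simp add: pw_def)
    qed (use False iV in \<open>auto simp: e_def pw_def\<close>)
  qed (simp add: e_def)
  show ?thesis
  proof (intro exI[of _ "\<lambda>x. q x + (\<Sum>i\<in>J. e i x)"] conjI ballI)
    show "polyd 3 (\<lambda>x. q x + (\<Sum>i\<in>J. e i x))" by (intro polyd_add q polyd_sum J pe)
    fix x assume x: "x \<in> V"
    have "(\<Sum>i\<in>J. e i x) = (\<Sum>i\<in>J. (a i - a' i) * pw 3 (n i \<bullet> x + c i))" using ee x by simp
    then show "f x = (q x + (\<Sum>i\<in>J. e i x)) + (\<Sum>i\<in>J. a' i * pw 3 (n i \<bullet> x + c i))"
      using f[OF x] by (simp add: left_diff_distrib sum_subtractf)
  qed
qed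

text \<open>In the induction the new line cuts \<open>U\<close> into two convex halves with
  coefficients \<open>ap\<close> and \<open>am\<close>. The bound of four lines through a point
  leaves at most three lines of \<open>J\<close> at a crossing with the new line, which is what
  \<open>crossing_coeff_zero\<close> requires.\<close>

theorem piecewise_cubic_classification:
  fixes n :: "nat \<Rightarrow> pt" and c :: "nat \<Rightarrow> real"
  assumes "finite J" "open U" "convex U" "C2j U F"
    and "\<And>x. x \<in> U \<Longrightarrow> card {j \<in> J. n j \<bullet> x + c j = 0} \<le> 4"
    and "\<And>j. j \<in> J \<Longrightarrow> n j \<noteq> 0"
    and "\<And>i j x. i \<in> J \<Longrightarrow> j \<in> J \<Longrightarrow> i \<noteq> j \<Longrightarrow> x \<in> U \<Longrightarrow> n i \<bullet> x + c i = 0 \<Longrightarrow> n j \<bullet> x + c j = 0 \<Longrightarrow> crs (n i) (n j) \<noteq> 0"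
    and "\<And>P. cubic_on {x \<in> U. \<forall>j\<in>J. if j \<in> P then 0 < n j \<bullet> x + c j else n j \<bullet> x + c j < 0} (F 0)"
  shows "\<exists>q a. polyd 3 q \<and> (\<forall>x\<in>U. F 0 x = q x + (\<Sum>j\<in>J. a j * pw 3 (n j \<bullet> x + c j)))"
  using assms
proof (induction J arbitrary: U rule: finite_induct)
  case empty
  then have "cubic_on U (F 0)" by simp
  then show ?case unfolding cubic_on_iff_polyd by simp
next
  case (insert j0 J)
  note card = insert.prems(4) and nz = insert.prems(5) and cr = insert.prems(6) and cells = insert.prems(7)
  have cardJ: "card {j \<in> J. n j \<bullet> x + c j = 0} \<le> 4" if "x \<in> U" for x
    by (rule order_trans[OF card_mono card[OF that]]) (use insert.hyps in auto)
  define Up where "Up = {x \<in> U. 0 < n j0 \<bullet> x + c j0}"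
  define Um where "Um = {x \<in> U. n j0 \<bullet> x + c j0 < 0}"
  have Um': "Um = {x \<in> U. 0 < (- n j0) \<bullet> x + (- c j0)}" by (auto simp: Um_def)
  have "open Up" unfolding Up_def by (rule open_side[OF insert.prems(1)])
  moreover have "convex Up" unfolding Up_def by (rule convex_side[OF insert.prems(2)])
  moreover have "Up \<subseteq> U" by (auto simp: Up_def)
  ultimately have Up: "open Up" "convex Up" "Up \<subseteq> U" by blast+
  have "open Um" unfolding Um' by (rule open_side[OF insert.prems(1)])
  moreover have "convex Um" unfolding Um' by (rule convex_side[OF insert.prems(2)])
  moreover have "Um \<subseteq> U" by (auto simp: Um_def)
  ultimately have Um: "open Um" "convex Um" "Um \<subseteq> U" by blast+
  have "\<exists>q a. polyd 3 q \<and> (\<forall>x\<in>Up. F 0 x = q x + (\<Sum>j\<in>J. a j * pw 3 (n j \<bullet> x + c j)))"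
  proof (rule insert.IH[OF Up(1,2) C2j_subset[OF insert.prems(3) Up(3)]])
    fix P
    have eq: "{x \<in> Up. \<forall>j\<in>J. if j \<in> P then 0 < n j \<bullet> x + c j else n j \<bullet> x + c j < 0}
      = {x \<in> U. \<forall>j\<in>insert j0 J. if j \<in> insert j0 P then 0 < n j \<bullet> x + c j else n j \<bullet> x + c j < 0}"
      using insert.hyps by (auto simp: Up_def)
    show "cubic_on {x \<in> Up. \<forall>j\<in>J. if j \<in> P then 0 < n j \<bullet> x + c j else n j \<bullet> x + c j < 0} (F 0)"
      unfolding eq by (rule cells)
  qed (use Up cardJ nz cr in blast)+
  then obtain qp ap where qp: "polyd 3 qp" and fp: "\<And>x. x \<in> Up \<Longrightarrow> F 0 x = qp x + (\<Sum>j\<in>J. ap j * pw 3 (n j \<bullet> x + c j))" by blast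
  have "\<exists>q a. polyd 3 q \<and> (\<forall>x\<in>Um. F 0 x = q x + (\<Sum>j\<in>J. a j * pw 3 (n j \<bullet> x + c j)))"
  proof (rule insert.IH[OF Um(1,2) C2j_subset[OF insert.prems(3) Um(3)]])
    fix P
    have eq: "{x \<in> Um. \<forall>j\<in>J. if j \<in> P then 0 < n j \<bullet> x + c j else n j \<bullet> x + c j < 0}
      = {x \<in> U. \<forall>j\<in>insert j0 J. if j \<in> P - {j0} then 0 < n j \<bullet> x + c j else n j \<bullet> x + c j < 0}"
      using insert.hyps by (auto simp: Um_def)
    show "cubic_on {x \<in> Um. \<forall>j\<in>J. if j \<in> P then 0 < n j \<bullet> x + c j else n j \<bullet> x + c j < 0} (F 0)"
      unfolding eq by (rule cells)
  qed (use Um cardJ nz cr in blast)+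
  then obtain qm am where qm: "polyd 3 qm" and fm: "\<And>x. x \<in> Um \<Longrightarrow> F 0 x = qm x + (\<Sum>j\<in>J. am j * pw 3 (n j \<bullet> x + c j))" by blast
  show ?case
  proof (cases "\<exists>p\<in>U. n j0 \<bullet> p + c j0 = 0")
    \<comment> \<open>If the line misses \<open>U\<close>, one of the halves is all of
      \<open>U\<close> and the line receives coefficient 0.\<close>
    case False
    then have "Up = U \<or> Um = U" using constant_sign[OF insert.prems(2), of "n j0" "c j0"] by (auto simp: Up_def Um_def)
    then obtain q a where q: "polyd 3 q" "\<And>x. x \<in> U \<Longrightarrow> F 0 x = q x + (\<Sum>j\<in>J. a j * pw 3 (n j \<bullet> x + c j))"
      using qp fp qm fm by metis
    have "(\<Sum>j\<in>insert j0 J. (a(j0 := 0)) j * g j) = (\<Sum>j\<in>J. a j * g j)" for g :: "nat \<Rightarrow> real"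
      using insert.hyps by (auto intro!: sum.cong)
    then show ?thesis using q by (intro exI[of _ q] exI[of _ "a(j0 := 0)"]) simp
  next
    case True
    then obtain p where p: "p \<in> U" "n j0 \<bullet> p + c j0 = 0" by blast
    have clp: "x \<in> closure Up" if "x \<in> U" "n j0 \<bullet> x + c j0 = 0" for x
      unfolding Up_def using line_side_closure[OF insert.prems(1) that] nz[of j0] by simp
    have clm: "x \<in> closure Um" if "x \<in> U" "n j0 \<bullet> x + c j0 = 0" for x
      unfolding Um' using line_side_closure[OF insert.prems(1) that(1), of "- n j0" "- c j0"] that(2) nz[of j0] by simp
    have jets: "Q k x + (\<Sum>i\<in>J. a i * pwj (n i) (c i) k x) = F k x"
      if Q: "C2j UNIV Q" and V: "open V" "V \<subseteq> U" "x \<in> closure V" and x: "x \<in> U"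
        and f: "\<And>x. x \<in> V \<Longrightarrow> F 0 x = Q 0 x + (\<Sum>j\<in>J. a j * pw 3 (n j \<bullet> x + c j))" and k: "k < 7" for Q a V x k
    proof -
      have E: "C2j UNIV (\<lambda>k x. Q k x + (\<Sum>i\<in>J. a i * pwj (n i) (c i) k x))"
        by (intro C2j_add Q C2j_sum insert.hyps C2j_scale pwj_C2j)
      have "F 0 y = Q 0 y + (\<Sum>i\<in>J. a i * pwj (n i) (c i) 0 y)" if "y \<in> V" for y
        using f[OF that] by (simp add: pwj_def)
      from C2j_agree[OF insert.prems(3) E V(1,2) this x V(3) k] show ?thesis by simp
    qed
    obtain Qp where Qp: "Qp 0 = qp" "C2j UNIV Qp" "polyd 1 (Qp 3)" "polyd 1 (Qp 4)" "polyd 1 (Qp 5)" "polyd 1 (Qp 6)"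
      using polyd_C2j[OF qp] by metis
    obtain Qm where Qm: "Qm 0 = qm" "C2j UNIV Qm" "polyd 1 (Qm 3)" "polyd 1 (Qm 4)" "polyd 1 (Qm 5)" "polyd 1 (Qm 6)"
      using polyd_C2j[OF qm] by metis
    define Q where "Q k x = Qp k x - Qm k x" for k x
    have Q1: "polyd 1 (Q 3)" "polyd 1 (Q 4)" "polyd 1 (Q 5)" "polyd 1 (Q 6)"
      unfolding Q_def[abs_def] using Qp Qm by (auto intro: polyd_diff)
    have Qeq: "Q k x + (\<Sum>i\<in>J. (ap i - am i) * pwj (n i) (c i) k x) = 0"
      if x: "x \<in> U" "n j0 \<bullet> x + c j0 = 0" and k: "k < 7" for x k
      using jets[OF Qp(2) Up(1,3) clp[OF x] x(1) fp[folded Qp(1)] k] jets[OF Qm(2) Um(1,3) clm[OF x] x(1) fm[folded Qm(1)] k]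
      by (simp add: Q_def left_diff_distrib sum_subtractf)
    have crossing: "ap i = am i" if i: "i \<in> J" and x: "x \<in> U" "n i \<bullet> x + c i = 0" "n j0 \<bullet> x + c j0 = 0" for i x
    proof -
      have "ap i - am i = 0"
      proof (rule crossing_coeff_zero[where U=U and p=x and ?n0.0="n j0" and ?c0.0="c j0" and J=J and n=n and c=c and Q=Q and d="\<lambda>i. ap i - am i"])
        show "crs (n j0) (n i) \<noteq> 0" using cr[of j0 i x] i x insert.hyps by auto
        show "crs (n k) (n i) \<noteq> 0" if "k \<in> J" "k \<noteq> i" "n k \<bullet> x + c k = 0" for k using cr[of k i x] i x that by auto
        have "{k \<in> insert j0 J. n k \<bullet> x + c k = 0} = insert j0 {k \<in> J. n k \<bullet> x + c k = 0}" using x by auto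
        then show "card {k \<in> J. n k \<bullet> x + c k = 0} \<le> 3" using card[OF x(1)] insert.hyps by (simp add: card_insert_if)
      qed (use insert i x Q1 Qeq in auto)
      then show ?thesis by simp
    qed
    \<comment> \<open>A common choice of coefficients for both halves. A line meeting both halves
      crosses line \<open>j0\<close> inside \<open>U\<close> by convexity, where
      \<open>crossing\<close> makes its two coefficients equal; in a half that a line misses, its
      coefficient is free.\<close>
    define a where "a i = (if (\<exists>x\<in>Up. n i \<bullet> x + c i = 0) then ap i else am i)" for i
    obtain q1 where q1: "polyd 3 q1" "\<And>x. x \<in> Up \<Longrightarrow> F 0 x = q1 x + (\<Sum>i\<in>J. a i * pw 3 (n i \<bullet> x + c i))"
    proof -
      have nzp: "n i \<bullet> x + c i \<noteq> 0" if "i \<in> J" "a i \<noteq> ap i" "x \<in> Up" for i x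
        using that by (auto simp: a_def split: if_splits)
      show ?thesis using adjust_coeffs[where a'=a, OF Up(2) insert.hyps(1) qp fp nzp] that by blast
    qed
    have nzm: "n i \<bullet> y + c i \<noteq> 0" if i: "i \<in> J" "a i \<noteq> am i" and y: "y \<in> Um" for i y
    proof
      obtain x where x: "x \<in> Up" "n i \<bullet> x + c i = 0" using i by (auto simp: a_def split: if_splits)
      have ne: "ap i \<noteq> am i" using i by (auto simp: a_def split: if_splits)
      assume yz: "n i \<bullet> y + c i = 0"
      have "x \<in> U" "y \<in> U" "0 < n j0 \<bullet> x + c j0" "n j0 \<bullet> y + c j0 < 0" using x(1) y by (simp_all add: Up_def Um_def)
      from segment_zero[OF insert.prems(2) this] obtain z where z: "z \<in> U" "n j0 \<bullet> z + c j0 = 0"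
        and "\<forall>m d. m \<bullet> x + d = 0 \<longrightarrow> m \<bullet> y + d = 0 \<longrightarrow> m \<bullet> z + d = 0" by (elim bexE conjE)
      then have "n i \<bullet> z + c i = 0" using x(2) yz by blast
      then show False using crossing[OF i(1) z(1) _ z(2)] ne by blast
    qed
    obtain q2 where q2: "polyd 3 q2" "\<And>x. x \<in> Um \<Longrightarrow> F 0 x = q2 x + (\<Sum>i\<in>J. a i * pw 3 (n i \<bullet> x + c i))"
      using adjust_coeffs[where a'=a, OF Um(2) insert.hyps(1) qm fm nzm] by blast
    obtain Q1 where Q1: "Q1 0 = q1" "C2j UNIV Q1" "polyd 1 (Q1 3)" "polyd 1 (Q1 4)" "polyd 1 (Q1 5)" "polyd 1 (Q1 6)"
      using polyd_C2j[OF q1(1)] by metis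
    obtain Q2 where Q2: "Q2 0 = q2" "C2j UNIV Q2" "polyd 1 (Q2 3)" "polyd 1 (Q2 4)" "polyd 1 (Q2 5)" "polyd 1 (Q2 6)"
      using polyd_C2j[OF q2(1)] by metis
    \<comment> \<open>With equal coefficients on both sides the truncated cubes cancel in the
      difference, so the 2-jets of the two polynomials agree along the line.\<close>
    define R where "R k x = Q1 k x + (- 1) * Q2 k x" for k x
    have R: "C2j UNIV R" unfolding R_def[abs_def] by (intro C2j_add C2j_scale Q1 Q2)
    have R1: "polyd 1 (R 3)" "polyd 1 (R 4)" "polyd 1 (R 5)" "polyd 1 (R 6)"
      unfolding R_def[abs_def] by (intro polyd_add polyd_scale Q1 Q2)+
    have Rz: "R k x = 0" if x: "x \<in> U" "n j0 \<bullet> x + c j0 = 0" and k: "k < 7" for x k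
      using jets[OF Q1(2) Up(1,3) clp[OF x] x(1) q1(2)[folded Q1(1)] k] jets[OF Q2(2) Um(1,3) clm[OF x] x(1) q2(2)[folded Q2(1)] k]
      by (simp add: R_def)
    obtain A where A: "\<forall>x. R 0 x = A * (n j0 \<bullet> x + c j0) ^ 3"
      using jets_vanish_cube[OF R R1 insert.prems(1) p nz[OF insertI1] Rz] by blast
    have R0: "q1 x = q2 x + A * (n j0 \<bullet> x + c j0) ^ 3" for x using spec[OF A, of x] by (simp add: R_def Q1(1) Q2(1))
    have "F 0 x = q2 x + (\<Sum>j\<in>insert j0 J. (a(j0 := A)) j * pw 3 (n j \<bullet> x + c j))" if x: "x \<in> U" for x
    proof -
      have s: "(\<Sum>j\<in>insert j0 J. (a(j0 := A)) j * pw 3 (n j \<bullet> x + c j)) = A * pw 3 (n j0 \<bullet> x + c j0) + (\<Sum>j\<in>J. a j * pw 3 (n j \<bullet> x + c j))"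
        using insert.hyps by (auto intro!: sum.cong)
      consider "x \<in> Up" | "x \<in> Um" | "n j0 \<bullet> x + c j0 = 0" using x by (force simp: Up_def Um_def)
      then show ?thesis
      proof cases
        case 1
        then have "pw 3 (n j0 \<bullet> x + c j0) = (n j0 \<bullet> x + c j0) ^ 3" by (simp add: Up_def pw_def)
        then show ?thesis unfolding s using q1(2)[OF 1] R0[of x] by simp
      next
        case 2
        then have "pw 3 (n j0 \<bullet> x + c j0) = 0" by (simp add: Um_def pw_def)
        then show ?thesis unfolding s using q2(2)[OF 2] by simp
      next
        case 3
        have "F 0 x = q2 x + (\<Sum>i\<in>J. a i * pw 3 (n i \<bullet> x + c i))"
          using jets[OF Q2(2) Um(1,3) clm[OF x 3] x q2(2)[folded Q2(1)], of 0] by (simp add: Q2(1) pwj_def)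
        then show ?thesis unfolding s using 3 by (simp add: pw_def)
      qed
    qed
    then show ?thesis using q2(1) by blast
  qed
qed

section \<open>The lines of the split\<close>

text \<open>For each of the 18 interior lines: its two boundary knots \<open>p\<close>, \<open>q\<close>, a coordinate vanishing
  at \<open>q\<close> but not at \<open>p\<close>, and one vanishing at \<open>p\<close> but not at \<open>q\<close>.\<close>

definition pair_list :: "(int3 \<times> int3 \<times> nat \<times> nat) list" where
  "pair_list = [
    ((2, 1, 0), (2, 0, 1), 1, 2), ((2, 1, 0), (1, 0, 2), 1, 2),
    ((1, 2, 0), (2, 0, 1), 1, 2), ((1, 2, 0), (1, 0, 2), 1, 2),
    ((1, 2, 0), (0, 2, 1), 0, 2), ((1, 2, 0), (0, 1, 2), 0, 2),
    ((2, 1, 0), (0, 2, 1), 0, 2), ((2, 1, 0), (0, 1, 2), 0, 2),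
    ((0, 1, 2), (1, 0, 2), 1, 0), ((0, 1, 2), (2, 0, 1), 1, 0),
    ((0, 2, 1), (1, 0, 2), 1, 0), ((0, 2, 1), (2, 0, 1), 1, 0),
    ((3, 0, 0), (0, 2, 1), 0, 1), ((3, 0, 0), (0, 1, 2), 0, 1),
    ((0, 3, 0), (2, 0, 1), 1, 0), ((0, 3, 0), (1, 0, 2), 1, 0),
    ((0, 0, 3), (2, 1, 0), 2, 0), ((0, 0, 3), (1, 2, 0), 2, 0)]"

definition lp :: "nat \<Rightarrow> int3" where "lp j = fst (pair_list ! j)"
definition lq :: "nat \<Rightarrow> int3" where "lq j = fst (snd (pair_list ! j))"

definition nine :: "int3 list" where
  "nine = [(3,0,0), (2,1,0), (1,2,0), (0,3,0), (0,2,1), (0,1,2), (0,0,3), (1,0,2), (2,0,1)]"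

lemma length_pair_list: "length pair_list = 18" by (simp add: pair_list_def)

lemma pair_facts:
  assumes "j < 18"
  shows "lf j \<bullet> rp (lp j) = 0" "lf j \<bullet> rp (lq j) = 0" "lp j \<in> set nine" "lq j \<in> set nine" "lp j \<noteq> lq j"
    "\<exists>f<3. crd f (rp (lp j)) = 0" "\<exists>f<3. crd f (rp (lq j)) = 0"
    "lf j \<bullet> z = 0 \<Longrightarrow> pos3 z \<Longrightarrow> \<exists>a b. 0 \<le> a \<and> 0 \<le> b \<and> z = a *\<^sub>R rp (lp j) + b *\<^sub>R rp (lq j)"
proof -
  \<comment> \<open>On the plane spanned by the two knots, the coefficient of each knot is read off
    from the coordinate that vanishes at the other one.\<close>
  define P where "P l k = (case k of (p, q, m, m') \<Rightarrow> idot l p = 0 \<and> idot l q = 0 \<and> p \<in> set nine \<and> q \<in> set nine \<and> p \<noteq> q \<and>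
     m < 3 \<and> m' < 3 \<and> crd m (rp p) > 0 \<and> crd m (rp q) = 0 \<and> crd m' (rp q) > 0 \<and> crd m' (rp p) = 0 \<and>
     (\<forall>x y w. rp l \<bullet> (x, y, w) = 0 \<longrightarrow> (x, y, w) = (crd m (x, y, w) / crd m (rp p)) *\<^sub>R rp p + (crd m' (x, y, w) / crd m' (rp q)) *\<^sub>R rp q))"
    for l and k :: "int3 \<times> int3 \<times> nat \<times> nat"
  have "list_all2 P (take 18 lform_list) pair_list"
    unfolding pair_list_def lform_list_def P_def nine_def
    by (simp add: crd_def) (auto simp: field_simps)
  then have P: "P (lform_list ! j) (pair_list ! j)"
    using assms by (simp add: list_all2_conv_all_nth length_pair_list length_lform)
  obtain p q m m' where k: "pair_list ! j = (p, q, m, m')" by (metis prod.collapse)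
  note P' = P[unfolded k P_def prod.case]
  have pq: "lp j = p" "lq j = q" by (simp_all add: lp_def lq_def k)
  show "lf j \<bullet> rp (lp j) = 0" "lf j \<bullet> rp (lq j) = 0" using P' by (simp_all add: pq lf_def inner_rp)
  show "lp j \<in> set nine" "lq j \<in> set nine" "lp j \<noteq> lq j" using P' by (simp_all add: pq)
  show "\<exists>f<3. crd f (rp (lp j)) = 0" "\<exists>f<3. crd f (rp (lq j)) = 0" unfolding pq using P' by blast+
  assume z: "lf j \<bullet> z = 0" "pos3 z"
  obtain x y w where xyw: "z = (x, y, w)" by (cases z)
  have "z = (crd m z / crd m (rp p)) *\<^sub>R rp p + (crd m' z / crd m' (rp q)) *\<^sub>R rp q"
    using P' z(1) unfolding xyw lf_def by blast
  moreover have "0 \<le> crd m z / crd m (rp p)" "0 \<le> crd m' z / crd m' (rp q)"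
    using P' z(2) by (auto simp: pos3_def intro!: divide_nonneg_pos less_imp_le)
  ultimately show "\<exists>a b. 0 \<le> a \<and> 0 \<le> b \<and> z = a *\<^sub>R rp (lp j) + b *\<^sub>R rp (lq j)" unfolding pq by blast
qed

text \<open>Of the 36 pairs of the nine points, 18 lie on a common side, and the other 18 correspond
  to the listed lines. Hence a segment of the split that enters the interior lies on one of these
  lines.\<close>

lemma nine_pairs:
  assumes "p \<in> set nine" "q \<in> set nine"
  shows "(\<exists>f<3. crd f (rp p) = 0 \<and> crd f (rp q) = 0) \<or> (\<exists>j<18. lf j \<bullet> rp p = 0 \<and> lf j \<bullet> rp q = 0)"
proof -
  define R where "R p q \<longleftrightarrow> (fst p = 0 \<and> fst q = 0) \<or> (fst (snd p) = 0 \<and> fst (snd q) = 0) \<or> (snd (snd p) = 0 \<and> snd (snd q) = 0)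
     \<or> list_ex (\<lambda>l. idot l p = 0 \<and> idot l q = 0) (take 18 lform_list)" for p q :: int3
  have "list_all (\<lambda>p. list_all (R p) nine) nine"
    unfolding nine_def lform_list_def R_def by simp
  then have "R p q" using assms by (simp add: list_all_iff)
  then consider "fst p = 0 \<and> fst q = 0" | "fst (snd p) = 0 \<and> fst (snd q) = 0" | "snd (snd p) = 0 \<and> snd (snd q) = 0"
    | "\<exists>l\<in>set (take 18 lform_list). idot l p = 0 \<and> idot l q = 0" by (auto simp: R_def list_ex_iff)
  then show ?thesis
  proof cases
    case 1 then show ?thesis by (intro disjI1 exI[of _ 0]) (simp add: crd_rp)
  next
    case 2 then show ?thesis by (intro disjI1 exI[of _ 1]) (simp add: crd_rp)
  next
    case 3 then show ?thesis by (intro disjI1 exI[of _ 2]) (simp add: crd_rp)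
  next
    case 4
    then obtain j where "j < 18" "idot (lform_list ! j) p = 0" "idot (lform_list ! j) q = 0"
      by (auto simp: in_set_conv_nth length_lform)
    then show ?thesis by (intro disjI2 exI[of _ j]) (simp add: lf_def inner_rp)
  qed
qed

definition crs3 :: "hpt \<Rightarrow> hpt \<Rightarrow> hpt" where
  "crs3 a b = (fst (snd a) * snd (snd b) - snd (snd a) * fst (snd b), snd (snd a) * fst b - fst a * snd (snd b),
     fst a * fst (snd b) - fst (snd a) * fst b)"

lemma lines_distinct:
  assumes "i < 18" "j < 18" "i \<noteq> j" shows "crs3 (lf i) (lf j) \<noteq> 0"
proof -
  define ic where "ic a b = (fst (snd a) * snd (snd b) - snd (snd a) * fst (snd b), snd (snd a) * fst b - fst a * snd (snd b),
     fst a * fst (snd b) - fst (snd a) * fst b)" for a b :: int3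
  have "sorted_wrt (\<lambda>a b. ic a b \<noteq> (0, 0, 0)) (take 18 lform_list)"
    unfolding lform_list_def ic_def by simp
  then have s: "ic (lform_list ! i) (lform_list ! j) \<noteq> (0, 0, 0)" if "i < j" "j < 18" for i j
    using that by (simp add: sorted_wrt_iff_nth_less length_lform)
  have sym: "ic a b = (0, 0, 0) \<longleftrightarrow> ic b a = (0, 0, 0)" for a b by (auto simp: ic_def mult.commute)
  have "ic (lform_list ! i) (lform_list ! j) \<noteq> (0, 0, 0)"
    using s[of i j] s[of j i] assms sym[of "lform_list ! i"] by (metis linorder_neqE_nat)
  moreover have "crs3 (rp a) (rp b) = rp (ic a b)" for a b by (simp add: crs3_def rp_def ic_def)
  moreover have "rp a = 0 \<longleftrightarrow> a = (0, 0, 0)" for a by (cases a) (simp add: zero_prod_def)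
  ultimately show ?thesis by (simp add: lf_def)
qed

lemma common_kernel:
  assumes "crs3 a b \<noteq> 0" "a \<bullet> z = 0" "b \<bullet> z = 0"
  shows "\<exists>t. z = t *\<^sub>R crs3 a b"
proof -
  obtain a1 a2 a3 b1 b2 b3 z1 z2 z3 where abz: "a = (a1, a2, a3)" "b = (b1, b2, b3)" "z = (z1, z2, z3)" by (metis prod.collapse)
  define c1 where "c1 = a2 * b3 - a3 * b2" define c2 where "c2 = a3 * b1 - a1 * b3" define c3 where "c3 = a1 * b2 - a2 * b1"
  have c: "crs3 a b = (c1, c2, c3)" by (simp add: crs3_def abz c1_def c2_def c3_def)
  have e: "a1 * z1 + a2 * z2 + a3 * z3 = 0" "b1 * z1 + b2 * z2 + b3 * z3 = 0" using assms(2,3) by (simp_all add: abz)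
  have k: "c1 * z2 = c2 * z1" "c1 * z3 = c3 * z1" "c2 * z3 = c3 * z2"
    unfolding c1_def c2_def c3_def using e by algebra+
  from assms(1) consider "c1 \<noteq> 0" | "c2 \<noteq> 0" | "c3 \<noteq> 0" unfolding c by (auto simp: zero_prod_def)
  then show ?thesis
  proof cases
    case 1 then show ?thesis unfolding c using k by (intro exI[of _ "z1 / c1"]) (simp add: abz(3) field_simps)
  next
    case 2 then show ?thesis unfolding c using k by (intro exI[of _ "z2 / c2"]) (simp add: abz(3) field_simps)
  next
    case 3 then show ?thesis unfolding c using k by (intro exI[of _ "z3 / c3"]) (simp add: abz(3) field_simps)
  qed
qed

text \<open>Two distinct planes through the origin meet in a line, which the plane of coordinate sum
  3 cuts at most once.\<close>

lemma lines_meet_once: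
  assumes ij: "i < 18" "j < 18" "i \<noteq> j" and z: "lf i \<bullet> z = 0" "lf j \<bullet> z = 0" "csum z = 3"
    and y: "lf i \<bullet> y = 0" "lf j \<bullet> y = 0" "csum y = 3"
  shows "y = z"
proof -
  let ?c = "crs3 (lf i) (lf j)"
  obtain s t where st: "z = s *\<^sub>R ?c" "y = t *\<^sub>R ?c"
    using common_kernel[OF lines_distinct[OF ij]] z y by metis
  then have "s * csum ?c = 3" "t * csum ?c = 3" using z(3) y(3) linear_cmul[OF linear_csum] by auto
  then have "s = t" by (metis mult_cancel_right zero_neq_numeral mult_zero_right)
  then show ?thesis using st by simp
qed

lemma csum_nine: "p \<in> set nine \<Longrightarrow> csum (rp p) = 3"
  by (auto simp: nine_def csum_def crd_def)

text \<open>Two lines through \<open>z\<close> cannot share a boundary knot, since they would meet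
  there and at the interior point \<open>z\<close>. So the knot pairs of the lines through
  \<open>z\<close> are disjoint, and nine knots hold at most four disjoint pairs.\<close>

lemma card_lines_through:
  assumes z: "pos3 z" "csum z = 3" shows "card {j \<in> {..<18}. lf j \<bullet> z = 0} \<le> 4"
proof -
  let ?J = "{j \<in> {..<18}. lf j \<bullet> z = 0}"
  define E where "E j = {lp j, lq j}" for j
  have dj: "disjoint_family_on E ?J" unfolding disjoint_family_on_def
  proof (intro ballI impI)
    fix i j assume ij: "i \<in> ?J" "j \<in> ?J" "i \<noteq> j"
    have "p \<notin> E j" if p: "p \<in> E i" for p
    proof
      assume p': "p \<in> E j"
      have n: "p \<in> set nine" "lf i \<bullet> rp p = 0" "\<exists>f<3. crd f (rp p) = 0" using p ij pair_facts[of i] by (auto simp: E_def)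
      have "lf j \<bullet> rp p = 0" using p' ij pair_facts[of j] by (auto simp: E_def)
      then have "rp p = z" using lines_meet_once[of i j z "rp p"] ij n z csum_nine by auto
      then show False using n(3) z(1) by (auto simp: pos3_def)
    qed
    then show "E i \<inter> E j = {}" by blast
  qed
  have "card (\<Union>j\<in>?J. E j) = (\<Sum>j\<in>?J. card (E j))"
    by (rule card_UN_disjoint'[OF dj]) (auto simp: E_def)
  also have "\<dots> = (\<Sum>j\<in>?J. 2)" by (intro sum.cong refl) (use pair_facts(5) in \<open>auto simp: E_def\<close>)
  finally have "card (\<Union>j\<in>?J. E j) = 2 * card ?J" by simp
  moreover have "card (\<Union>j\<in>?J. E j) \<le> card (set nine)"
    by (intro card_mono) (use pair_facts(3,4) in \<open>auto simp: E_def\<close>)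
  moreover have "card (set nine) \<le> 9" using card_length[of nine] by (simp add: nine_def)
  ultimately show ?thesis by linarith
qed

definition nl :: "tri \<Rightarrow> nat \<Rightarrow> pt" where
  "nl T j = (lf j \<bullet> (zc T (1, 0) - zc T 0), lf j \<bullet> (zc T (0, 1) - zc T 0))"
definition cl :: "tri \<Rightarrow> nat \<Rightarrow> real" where "cl T j = lf j \<bullet> zc T 0"

lemma lf_zc:
  assumes d: "dtri T \<noteq> 0" shows "lf j \<bullet> zc T x = nl T j \<bullet> x + cl T j"
proof -
  define u :: "nat \<Rightarrow> real" where "u i = [1 - fst x - snd x, fst x, snd x] ! i" for i
  define p :: "nat \<Rightarrow> pt" where "p i = [0, (1, 0), (0, 1)] ! i" for i
  have s3: "(\<Sum>i<3. h i) = h 0 + h 1 + h (2::nat)" for h :: "nat \<Rightarrow> 'c::comm_monoid_add" by (simp add: eval_nat_numeral)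
  have "(\<Sum>i<3. u i) = 1" by (simp add: s3 u_def)
  from zc_affine[OF d this, of p]
  have "zc T x = (1 - fst x - snd x) *\<^sub>R zc T 0 + fst x *\<^sub>R zc T (1, 0) + snd x *\<^sub>R zc T (0, 1)"
    by (simp add: s3 u_def p_def)
  then have e: "lf j \<bullet> zc T x = (1 - fst x - snd x) * (lf j \<bullet> zc T 0) + fst x * (lf j \<bullet> zc T (1, 0)) + snd x * (lf j \<bullet> zc T (0, 1))"
    by (simp only: inner_add_right inner_scaleR_right)
  have "nl T j \<bullet> x = fst (nl T j) * fst x + snd (nl T j) * snd x" by (simp add: inner_prod_def)
  also have "\<dots> = (lf j \<bullet> zc T (1, 0) - lf j \<bullet> zc T 0) * fst x + (lf j \<bullet> zc T (0, 1) - lf j \<bullet> zc T 0) * snd x"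
    by (simp only: nl_def fst_conv snd_conv inner_diff_right)
  finally show ?thesis unfolding e cl_def by (simp add: algebra_simps)
qed

lemma nl_nonzero:
  assumes d: "dtri T \<noteq> 0" and j: "j < 18" shows "nl T j \<noteq> 0"
proof
  assume n: "nl T j = 0"
  have c: "lf j \<bullet> z = cl T j" if "csum z = 3" for z
    using lf_zc[OF d, of j "bpt T z"] zc_bpt[OF d that] n by simp
  have "lf j \<bullet> rp (lp j) = 0" "csum (rp (lp j)) = 3" using pair_facts[OF j] csum_nine by auto
  then have "cl T j = 0" using c[of "rp (lp j)"] by simp
  then have "lf j \<bullet> (3, 0, 0) = 0" "lf j \<bullet> (0, 3, 0) = 0" "lf j \<bullet> (0, 0, 3) = 0"
    using c[of "(3, 0, 0)"] c[of "(0, 3, 0)"] c[of "(0, 0, 3)"] by (simp_all add: csum_def crd_def)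
  then have "lf j = 0" by (simp add: inner_prod_def prod_eq_iff)
  then have "crs3 (lf j) (lf i) = 0" for i by (simp add: crs3_def zero_prod_def)
  moreover obtain i :: nat where "i < 18" "i \<noteq> j" using that[of 0] that[of 1] by (cases "j = 0") auto
  ultimately show False using lines_distinct[of j i] j by auto
qed

text \<open>If the normals were parallel, moving from the common point along the first line would
  give a second common point, against \<open>lines_meet_once\<close>.\<close>

lemma nl_crossing:
  assumes d: "dtri T \<noteq> 0" and ij: "i < 18" "j < 18" "i \<noteq> j"
    and x: "nl T i \<bullet> x + cl T i = 0" "nl T j \<bullet> x + cl T j = 0"
  shows "crs (nl T i) (nl T j) \<noteq> 0"
proof
  assume c: "crs (nl T i) (nl T j) = 0"
  define y where "y = x + perp (nl T i)"
  have "nl T i \<bullet> y + cl T i = 0" "nl T j \<bullet> y + cl T j = 0"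
    using x c by (simp_all add: y_def inner_add_right inner_perp)
  then have "zc T y = zc T x"
    using x by (intro lines_meet_once[OF ij]) (simp_all add: lf_zc[OF d])
  then have "y = x" using bpt_zc[OF d] by metis
  then have "perp (nl T i) = 0" by (simp add: y_def)
  then have "nl T i = 0" by (auto simp: perp_def prod_eq_iff)
  then show False using nl_nonzero[OF d ij(1)] by simp
qed

lemma zc_ws_points:
  assumes d: "dtri T \<noteq> 0" shows "zc T ` ws_points T = rp ` set nine"
  unfolding ws_points_def nine_def by (simp add: zc_vertices[OF d] knot_coords[OF d] insert_commute)

lemma ws_segments_iff:
  assumes d: "dtri T \<noteq> 0" and x: "pos3 (zc T x)"
  shows "x \<in> ws_segments T \<longleftrightarrow> (\<exists>j<18. lf j \<bullet> zc T x = 0)"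
proof -
  have s2: "(\<Sum>i<2. h i) = h 0 + h (1::nat)" for h :: "nat \<Rightarrow> 'c::comm_monoid_add" by (simp add: eval_nat_numeral)
  have seg: "zc T ((1 - u) *\<^sub>R p + u *\<^sub>R q) = (1 - u) *\<^sub>R zc T p + u *\<^sub>R zc T q" for u p q
    using zc_affine[OF d, where n=2 and u="\<lambda>i. [1 - u, u] ! i" and p="\<lambda>i. [p, q] ! i"] by (simp add: s2)
  show ?thesis
  proof
    assume "x \<in> ws_segments T"
    then obtain p q u where pq: "p \<in> ws_points T" "q \<in> ws_points T" "x = (1 - u) *\<^sub>R p + u *\<^sub>R q"
      unfolding ws_segments_def closed_segment_def by blast
    obtain p' q' where p': "p' \<in> set nine" "zc T p = rp p'" and q': "q' \<in> set nine" "zc T q = rp q'"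
    proof -
      have "zc T p \<in> rp ` set nine" "zc T q \<in> rp ` set nine" using zc_ws_points[OF d] pq(1,2) by blast+
      then show ?thesis using that by blast
    qed
    have z: "zc T x = (1 - u) *\<^sub>R rp p' + u *\<^sub>R rp q'" unfolding pq(3) seg p' q' ..
    from nine_pairs[OF p'(1) q'(1)] show "\<exists>j<18. lf j \<bullet> zc T x = 0"
    proof (elim disjE exE conjE)
      fix f :: nat assume "f < 3" "crd f (rp p') = 0" "crd f (rp q') = 0"
      then have "crd f (zc T x) = 0" by (simp add: z)
      then show ?thesis using x \<open>f < 3\<close> by (auto simp: pos3_def)
    next
      fix j :: nat assume "j < 18" "lf j \<bullet> rp p' = 0" "lf j \<bullet> rp q' = 0"
      then show ?thesis by (intro exI[of _ j]) (simp add: z inner_add_right)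
    qed
  next
    assume "\<exists>j<18. lf j \<bullet> zc T x = 0"
    then obtain j where j: "j < 18" "lf j \<bullet> zc T x = 0" by blast
    obtain a b where ab: "0 \<le> a" "0 \<le> b" "zc T x = a *\<^sub>R rp (lp j) + b *\<^sub>R rp (lq j)"
      using pair_facts(8)[OF j x] by blast
    have n: "lp j \<in> set nine" "lq j \<in> set nine" using pair_facts[OF j(1)] by auto
    have "3 = a * csum (rp (lp j)) + b * csum (rp (lq j))"
      using arg_cong[OF ab(3), of csum] by (simp add: linear_add[OF linear_csum] linear_cmul[OF linear_csum])
    then have a: "a = 1 - b" using n csum_nine by simp
    obtain p q where p: "p \<in> ws_points T" "zc T p = rp (lp j)" and q: "q \<in> ws_points T" "zc T q = rp (lq j)"
    proof -
      have "rp (lp j) \<in> zc T ` ws_points T" "rp (lq j) \<in> zc T ` ws_points T" using zc_ws_points[OF d] n by blast+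
      then show ?thesis using that by (metis imageE)
    qed
    have "zc T ((1 - b) *\<^sub>R p + b *\<^sub>R q) = zc T x" unfolding seg p q ab(3) a ..
    then have "x = (1 - b) *\<^sub>R p + b *\<^sub>R q" using bpt_zc[OF d] by metis
    then have "x \<in> closed_segment p q" using ab a unfolding closed_segment_def by auto
    then show "x \<in> ws_segments T" unfolding ws_segments_def using p q by blast
  qed
qed

section \<open>Unisolvence of vertex and edge coefficients\<close>

definition ct_list :: "int list list" where
  "ct_list = (let c = coeff_list; f = map2 (\<lambda>x y. 2 * x - y) in
     take 21 c @ [f (c ! 21) (c ! 22), f (c ! 22) (c ! 21), f (c ! 23) (c ! 24), f (c ! 24) (c ! 23),
       f (c ! 25) (c ! 26), f (c ! 26) (c ! 25), c ! 27])"

fun icrd :: "nat \<Rightarrow> int3 \<Rightarrow> int" where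
  "icrd i (a, b, c) = (if i = 0 then a else if i = 1 then b else c)"

text \<open>The second derivative of a truncated cube in the coordinate directions a and c is 6
  times the product of two coefficients of the form with its positive part. \<open>wts\<close> lists
  one sixth of these derivatives at \<open>p\<close>, and \<open>hrow\<close> the resulting values
  for the 28 functions \<open>FT i\<close>.\<close>

definition wts :: "int3 \<Rightarrow> nat \<Rightarrow> nat \<Rightarrow> int list" where
  "wts p a c = map2 (\<lambda>l v. icrd a l * icrd c l * ipos v) lform_list (lvals p)"

definition hrow :: "int3 \<Rightarrow> nat \<Rightarrow> nat \<Rightarrow> int list" where
  "hrow p a c = map (\<lambda>r. isum r (wts p a c)) ct_list"

lemma ct_list_eval: "ct_list = [
    [48, 0, 0, 0, 0, 0, 0, 0, 0, 0, 0, 0, 0, 0, 0, 0, 0, 0, 0, 0, 0, 0, 0, 0, 0, 0, 0, 0],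
    [0, 0, 0, 0, 48, 0, 0, 0, 0, 0, 0, 0, 0, 0, 0, 0, 0, 0, 0, 0, 0, 0, 0, 0, 0, 0, 0, 0],
    [0, 0, 0, 0, 0, 0, 0, 0, 48, 0, 0, 0, 0, 0, 0, 0, 0, 0, 0, 0, 0, 0, 0, 0, 0, 0, 0, 0],
    [-48, 0, 6, 0, 0, 0, 0, 0, 0, 0, 0, 0, 0, 0, 0, 0, 0, 0, 0, 0, 0, 0, 0, 0, 0, 0, 0, 0],
    [-48, 6, 0, 0, 0, 0, 0, 0, 0, 0, 0, 0, 0, 0, 0, 0, 0, 0, 0, 0, 0, 0, 0, 0, 0, 0, 0, 0],
    [0, 0, 0, 0, -48, 6, 0, 0, 0, 0, 0, 0, 0, 0, 0, 0, 0, 0, 0, 0, 0, 0, 0, 0, 0, 0, 0, 0],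
    [0, 0, 0, 0, -48, 0, 6, 0, 0, 0, 0, 0, 0, 0, 0, 0, 0, 0, 0, 0, 0, 0, 0, 0, 0, 0, 0, 0],
    [0, 0, 0, 0, 0, 0, 0, 0, -48, 6, 0, 0, 0, 0, 0, 0, 0, 0, 0, 0, 0, 0, 0, 0, 0, 0, 0, 0],
    [0, 0, 0, 0, 0, 0, 0, 0, -48, 0, 6, 0, 0, 0, 0, 0, 0, 0, 0, 0, 0, 0, 0, 0, 0, 0, 0, 0],
    [24, 0, -12, 0, 0, 0, 0, 0, 0, 0, 0, 0, 0, 0, 72, 0, 0, 0, 0, 0, 0, 0, 0, 0, 0, 0, 0, 0],
    [24, -12, 0, 0, 0, 0, 0, 0, 0, 0, 0, 0, 0, 0, 0, 0, 72, 0, 0, 0, 0, 0, 0, 0, 0, 0, 0, 0],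
    [0, 0, 0, 0, 24, -12, 0, 0, 0, 0, 0, 0, 0, 0, 0, 0, 0, 72, 0, 0, 0, 0, 0, 0, 0, 0, 0, 0],
    [0, 0, 0, 0, 24, 0, -12, 0, 0, 0, 0, 0, 72, 0, 0, 0, 0, 0, 0, 0, 0, 0, 0, 0, 0, 0, 0, 0],
    [0, 0, 0, 0, 0, 0, 0, 0, 24, -12, 0, 0, 0, 72, 0, 0, 0, 0, 0, 0, 0, 0, 0, 0, 0, 0, 0, 0],
    [0, 0, 0, 0, 0, 0, 0, 0, 24, 0, -12, 0, 0, 0, 0, 72, 0, 0, 0, 0, 0, 0, 0, 0, 0, 0, 0, 0],
    [48, -6, -6, 6, 0, 0, 0, 0, 0, 0, 0, 0, 0, 0, 0, 0, 0, 0, 0, 0, 0, 0, 0, 0, 0, 0, 0, 0],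
    [0, 0, 0, 0, 48, -6, -6, 6, 0, 0, 0, 0, 0, 0, 0, 0, 0, 0, 0, 0, 0, 0, 0, 0, 0, 0, 0, 0],
    [0, 0, 0, 0, 0, 0, 0, 0, 48, -6, -6, 6, 0, 0, 0, 0, 0, 0, 0, 0, 0, 0, 0, 0, 0, 0, 0, 0],
    [-12, 0, 12, 0, -12, 0, 12, 0, 0, 0, 0, 24, -108, 0, -108, 0, 0, 0, 108, 108, -864, 12, 12, 48, -24, 48, -24, -48],
    [0, 0, 0, 24, -12, 12, 0, 0, -12, 0, 12, 0, 0, 0, 0, -108, 0, -108, -864, 108, 108, -24, 48, 12, 12, -24, 48, -48],
    [-12, 12, 0, 0, 0, 0, 0, 24, -12, 12, 0, 0, 0, -108, 0, 0, -108, 0, 108, -864, 108, 48, -24, -24, 48, 12, 12, -48],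
    [-24, 2, 8, -12, 12, -1, -16, 24, -6, 8, 2, -48, 162, -81, 0, 0, 0, 0, 0, -972, 1620, 12, -24, -114, 93, -60, 30, 40],
    [-24, 8, 2, -12, -6, 2, 8, -48, 12, -16, -1, 24, -81, 162, 0, 0, 0, 0, 0, 1620, -972, -60, 30, 93, -114, 12, -24, 40],
    [-6, 2, 8, -48, -24, 8, 2, -12, 12, -1, -16, 24, 0, 0, -81, 162, 0, 0, 1620, 0, -972, 30, -60, 12, -24, 93, -114, 40],
    [12, -1, -16, 24, -24, 2, 8, -12, -6, 2, 8, -48, 0, 0, 162, -81, 0, 0, -972, 0, 1620, -24, 12, -60, 30, -114, 93, 40],
    [12, -16, -1, 24, -6, 8, 2, -48, -24, 8, 2, -12, 0, 0, 0, 0, 162, -81, -972, 1620, 0, -114, 93, 30, -60, -24, 12, 40],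
    [-6, 8, 2, -48, 12, -16, -1, 24, -24, 2, 8, -12, 0, 0, 0, 0, -81, 162, 1620, -972, 0, 93, -114, -24, 12, 30, -60, 40],
    [12, -4, -4, 24, 12, -4, -4, 24, 12, -4, -4, 24, 0, 0, 0, 0, 0, 0, -324, -324, -324, 12, 12, 12, 12, 12, 12, -32]]"
  unfolding ct_list_def coeff_list_def Let_def by simp

lemma wts_0:
  "wts (3, 0, 0) 0 0 = [3, 24, 24, 24, 0, 0, 0, 0, 0, 0, 0, 0, 0, 0, 3, 0, 3, 0, 3, 0, 0, 3, 24, 0, 0, 3, 24, 3]"
  "wts (3, 0, 0) 0 1 = [-6, -48, -12, -12, 0, 0, 0, 0, 0, 0, 0, 0, 0, 0, 0, 0, -6, 0, 0, 0, 0, 6, 12, 0, 0, 0, 0, 3]"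
  "wts (3, 0, 0) 0 2 = [-6, -12, -48, -12, 0, 0, 0, 0, 0, 0, 0, 0, 0, 0, -6, 0, 0, 0, 0, 0, 0, 0, 0, 0, 0, 6, 12, 3]"
  "wts (3, 0, 0) 1 1 = [12, 96, 6, 6, 0, 0, 0, 0, 0, 0, 0, 0, 0, 0, 0, 0, 12, 0, 0, 0, 0, 12, 6, 0, 0, 0, 0, 3]"
  "wts (3, 0, 0) 1 2 = [12, 24, 24, 6, 0, 0, 0, 0, 0, 0, 0, 0, 0, 0, 0, 0, 0, 0, 0, 0, 0, 0, 0, 0, 0, 0, 0, 3]"
  "wts (3, 0, 0) 2 2 = [12, 6, 96, 6, 0, 0, 0, 0, 0, 0, 0, 0, 0, 0, 12, 0, 0, 0, 0, 0, 0, 0, 0, 0, 0, 12, 6, 3]"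
  by (simp_all add: wts_def lvals_simps lform_list_def ipos_def)

text \<open>In each of the nine tables of this kind only a few columns are nonzero; the last column,
  that of \<open>FT 27\<close>, is zero in all of them.\<close>

lemma hrow_0:
  "hrow (3, 0, 0) 0 0 = [144, 0, 0, 0, 0, 0, 0, 0, 0, 0, 0, 0, 0, 0, 0, 0, 0, 0, 0, 0, 0, 0, 0, 0, 0, 0, 0, 0]"
  "hrow (3, 0, 0) 0 1 = [-288, 0, 0, 216, 0, 0, 0, 0, 0, 0, 0, 0, 0, 0, 0, 0, 0, 0, 0, 0, 0, 0, 0, 0, 0, 0, 0, 0]"
  "hrow (3, 0, 0) 0 2 = [-288, 0, 0, 0, 216, 0, 0, 0, 0, 0, 0, 0, 0, 0, 0, 0, 0, 0, 0, 0, 0, 0, 0, 0, 0, 0, 0, 0]"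
  "hrow (3, 0, 0) 1 1 = [576, 0, 0, -540, 0, 0, 0, 0, 0, 216, 0, 0, 0, 0, 0, 0, 0, 0, 0, 0, 0, 0, 0, 0, 0, 0, 0, 0]"
  "hrow (3, 0, 0) 1 2 = [576, 0, 0, -432, -432, 0, 0, 0, 0, 0, 0, 0, 0, 0, 0, 324, 0, 0, 0, 0, 0, 0, 0, 0, 0, 0, 0, 0]"
  "hrow (3, 0, 0) 2 2 = [576, 0, 0, 0, -540, 0, 0, 0, 0, 0, 216, 0, 0, 0, 0, 0, 0, 0, 0, 0, 0, 0, 0, 0, 0, 0, 0, 0]"
  unfolding hrow_def wts_0 ct_list_eval isum_def by simp_all

lemma wts_1:
  "wts (2, 1, 0) 0 0 = [0, 0, 12, 12, 0, 0, 0, 0, 0, 0, 0, 0, 0, 0, 2, 0, 0, 0, 2, 0, 0, 4, 20, 0, 0, 2, 16, 3]"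
  "wts (2, 1, 0) 0 1 = [0, 0, -6, -6, 0, 0, 0, 0, 0, 0, 0, 0, 0, 0, 0, 0, 0, 0, 0, 0, 0, 8, 10, 0, 0, 0, 0, 3]"
  "wts (2, 1, 0) 0 2 = [0, 0, -24, -6, 0, 0, 0, 0, 0, 0, 0, 0, 0, 0, -4, 0, 0, 0, 0, 0, 0, 0, 0, 0, 0, 4, 8, 3]"
  "wts (2, 1, 0) 1 1 = [0, 0, 3, 3, 0, 0, 0, 0, 0, 0, 0, 0, 1, 0, 0, 0, 0, 0, 0, 1, 0, 16, 5, 1, 8, 0, 0, 3]"
  "wts (2, 1, 0) 1 2 = [0, 0, 12, 3, 0, 0, 0, 0, 0, 0, 0, 0, -2, 0, 0, 0, 0, 0, 0, 0, 0, 0, 0, 2, 4, 0, 0, 3]"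
  "wts (2, 1, 0) 2 2 = [0, 0, 48, 3, 0, 0, 0, 0, 0, 0, 0, 0, 4, 0, 8, 0, 0, 0, 0, 0, 0, 0, 0, 4, 2, 8, 4, 3]"
  by (simp_all add: wts_def lvals_simps lform_list_def ipos_def)

lemma hrow_1:
  "hrow (2, 1, 0) 0 0 = [0, 0, 0, 72, 0, 0, 0, 0, 0, 0, 0, 0, 0, 0, 0, 0, 0, 0, 0, 0, 0, 0, 0, 0, 0, 0, 0, 0]"
  "hrow (2, 1, 0) 0 1 = [0, 0, 0, -36, 0, 0, 0, 0, 0, 72, 0, 0, 0, 0, 0, 0, 0, 0, 0, 0, 0, 0, 0, 0, 0, 0, 0, 0]"
  "hrow (2, 1, 0) 0 2 = [0, 0, 0, -144, 0, 0, 0, 0, 0, 0, 0, 0, 0, 0, 0, 108, 0, 0, 0, 0, 0, 0, 0, 0, 0, 0, 0, 0]"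
  "hrow (2, 1, 0) 1 1 = [0, 0, 0, 18, 0, 0, 0, 0, 0, -36, 0, 0, 72, 0, 0, 0, 0, 0, 0, 0, 0, 0, 0, 0, 0, 0, 0, 0]"
  "hrow (2, 1, 0) 1 2 = [0, 0, 0, 72, 0, 0, 0, 0, 0, -144, 0, 0, -144, 0, 0, -54, 0, 0, 216, 0, 0, 0, 0, 0, 0, 0, 0, 0]"
  "hrow (2, 1, 0) 2 2 = [0, 0, 0, 288, 0, 0, 0, 0, 0, 0, 0, 0, 288, 0, 0, -270, 0, 0, -432, 0, 0, 486, 0, 0, 0, 0, 0, 0]"
  unfolding hrow_def wts_1 ct_list_eval isum_def by simp_all

lemma wts_2:
  "wts (1, 2, 0) 0 0 = [0, 0, 0, 0, 0, 0, 3, 3, 0, 0, 0, 0, 0, 0, 1, 0, 0, 0, 1, 0, 0, 5, 16, 0, 0, 1, 8, 3]"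
  "wts (1, 2, 0) 0 1 = [0, 0, 0, 0, 0, 0, -6, -6, 0, 0, 0, 0, 0, 0, 0, 0, 0, 0, 0, 0, 0, 10, 8, 0, 0, 0, 0, 3]"
  "wts (1, 2, 0) 0 2 = [0, 0, 0, 0, 0, 0, 12, 3, 0, 0, 0, 0, 0, 0, -2, 0, 0, 0, 0, 0, 0, 0, 0, 0, 0, 2, 4, 3]"
  "wts (1, 2, 0) 1 1 = [0, 0, 0, 0, 0, 0, 12, 12, 0, 0, 0, 0, 2, 0, 0, 0, 0, 0, 0, 2, 0, 20, 4, 2, 16, 0, 0, 3]"
  "wts (1, 2, 0) 1 2 = [0, 0, 0, 0, 0, 0, -24, -6, 0, 0, 0, 0, -4, 0, 0, 0, 0, 0, 0, 0, 0, 0, 0, 4, 8, 0, 0, 3]"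
  "wts (1, 2, 0) 2 2 = [0, 0, 0, 0, 0, 0, 48, 3, 0, 0, 0, 0, 8, 0, 4, 0, 0, 0, 0, 0, 0, 0, 0, 8, 4, 4, 2, 3]"
  by (simp_all add: wts_def lvals_simps lform_list_def ipos_def)

lemma hrow_2:
  "hrow (1, 2, 0) 0 0 = [0, 0, 0, 0, 0, 0, 18, 0, 0, 72, 0, 0, -36, 0, 0, 0, 0, 0, 0, 0, 0, 0, 0, 0, 0, 0, 0, 0]"
  "hrow (1, 2, 0) 0 1 = [0, 0, 0, 0, 0, 0, -36, 0, 0, 0, 0, 0, 72, 0, 0, 0, 0, 0, 0, 0, 0, 0, 0, 0, 0, 0, 0, 0]"
  "hrow (1, 2, 0) 0 2 = [0, 0, 0, 0, 0, 0, 72, 0, 0, -144, 0, 0, -144, 0, 0, 0, -54, 0, 216, 0, 0, 0, 0, 0, 0, 0, 0, 0]"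
  "hrow (1, 2, 0) 1 1 = [0, 0, 0, 0, 0, 0, 72, 0, 0, 0, 0, 0, 0, 0, 0, 0, 0, 0, 0, 0, 0, 0, 0, 0, 0, 0, 0, 0]"
  "hrow (1, 2, 0) 1 2 = [0, 0, 0, 0, 0, 0, -144, 0, 0, 0, 0, 0, 0, 0, 0, 0, 108, 0, 0, 0, 0, 0, 0, 0, 0, 0, 0, 0]"
  "hrow (1, 2, 0) 2 2 = [0, 0, 0, 0, 0, 0, 288, 0, 0, 288, 0, 0, 0, 0, 0, 0, -270, 0, -432, 0, 0, 0, 0, 0, 486, 0, 0, 0]"
  unfolding hrow_def wts_2 ct_list_eval isum_def by simp_all

lemma wts_3:
  "wts (0, 3, 0) 0 0 = [0, 0, 0, 0, 12, 96, 6, 6, 0, 0, 0, 0, 0, 0, 0, 0, 0, 12, 0, 0, 0, 6, 12, 0, 0, 0, 0, 3]"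
  "wts (0, 3, 0) 0 1 = [0, 0, 0, 0, -6, -48, -12, -12, 0, 0, 0, 0, 0, 0, 0, 0, 0, -6, 0, 0, 0, 12, 6, 0, 0, 0, 0, 3]"
  "wts (0, 3, 0) 0 2 = [0, 0, 0, 0, 12, 24, 24, 6, 0, 0, 0, 0, 0, 0, 0, 0, 0, 0, 0, 0, 0, 0, 0, 0, 0, 0, 0, 3]"
  "wts (0, 3, 0) 1 1 = [0, 0, 0, 0, 3, 24, 24, 24, 0, 0, 0, 0, 3, 0, 0, 0, 0, 3, 0, 3, 0, 24, 3, 3, 24, 0, 0, 3]"
  "wts (0, 3, 0) 1 2 = [0, 0, 0, 0, -6, -12, -48, -12, 0, 0, 0, 0, -6, 0, 0, 0, 0, 0, 0, 0, 0, 0, 0, 6, 12, 0, 0, 3]"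
  "wts (0, 3, 0) 2 2 = [0, 0, 0, 0, 12, 6, 96, 6, 0, 0, 0, 0, 12, 0, 0, 0, 0, 0, 0, 0, 0, 0, 0, 12, 6, 0, 0, 3]"
  by (simp_all add: wts_def lvals_simps lform_list_def ipos_def)

lemma hrow_3:
  "hrow (0, 3, 0) 0 0 = [0, 576, 0, 0, 0, 0, -540, 0, 0, 0, 0, 0, 216, 0, 0, 0, 0, 0, 0, 0, 0, 0, 0, 0, 0, 0, 0, 0]"
  "hrow (0, 3, 0) 0 1 = [0, -288, 0, 0, 0, 0, 216, 0, 0, 0, 0, 0, 0, 0, 0, 0, 0, 0, 0, 0, 0, 0, 0, 0, 0, 0, 0, 0]"
  "hrow (0, 3, 0) 0 2 = [0, 576, 0, 0, 0, -432, -432, 0, 0, 0, 0, 0, 0, 0, 0, 0, 324, 0, 0, 0, 0, 0, 0, 0, 0, 0, 0, 0]"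
  "hrow (0, 3, 0) 1 1 = [0, 144, 0, 0, 0, 0, 0, 0, 0, 0, 0, 0, 0, 0, 0, 0, 0, 0, 0, 0, 0, 0, 0, 0, 0, 0, 0, 0]"
  "hrow (0, 3, 0) 1 2 = [0, -288, 0, 0, 0, 216, 0, 0, 0, 0, 0, 0, 0, 0, 0, 0, 0, 0, 0, 0, 0, 0, 0, 0, 0, 0, 0, 0]"
  "hrow (0, 3, 0) 2 2 = [0, 576, 0, 0, 0, -540, 0, 0, 0, 0, 0, 216, 0, 0, 0, 0, 0, 0, 0, 0, 0, 0, 0, 0, 0, 0, 0, 0]"
  unfolding hrow_def wts_3 ct_list_eval isum_def by simp_all

lemma wts_4:
  "wts (0, 2, 1) 0 0 = [0, 0, 0, 0, 0, 48, 0, 3, 0, 0, 0, 0, 0, 0, 0, 4, 0, 8, 0, 0, 0, 4, 8, 0, 0, 2, 4, 3]"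
  "wts (0, 2, 1) 0 1 = [0, 0, 0, 0, 0, -24, 0, -6, 0, 0, 0, 0, 0, 0, 0, 0, 0, -4, 0, 0, 0, 8, 4, 0, 0, 0, 0, 3]"
  "wts (0, 2, 1) 0 2 = [0, 0, 0, 0, 0, 12, 0, 3, 0, 0, 0, 0, 0, 0, 0, -2, 0, 0, 0, 0, 0, 0, 0, 0, 0, 4, 2, 3]"
  "wts (0, 2, 1) 1 1 = [0, 0, 0, 0, 0, 12, 0, 12, 0, 0, 0, 0, 0, 0, 0, 0, 0, 2, 0, 2, 0, 16, 2, 4, 20, 0, 0, 3]"
  "wts (0, 2, 1) 1 2 = [0, 0, 0, 0, 0, -6, 0, -6, 0, 0, 0, 0, 0, 0, 0, 0, 0, 0, 0, 0, 0, 0, 0, 8, 10, 0, 0, 3]"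
  "wts (0, 2, 1) 2 2 = [0, 0, 0, 0, 0, 3, 0, 3, 0, 0, 0, 0, 0, 0, 0, 1, 0, 0, 0, 0, 1, 0, 0, 16, 5, 8, 1, 3]"
  by (simp_all add: wts_def lvals_simps lform_list_def ipos_def)

lemma hrow_4:
  "hrow (0, 2, 1) 0 0 = [0, 0, 0, 0, 0, 288, 0, 0, 0, 0, 0, 0, 0, 0, 288, 0, -270, 0, 0, -432, 0, 0, 0, 486, 0, 0, 0, 0]"
  "hrow (0, 2, 1) 0 1 = [0, 0, 0, 0, 0, -144, 0, 0, 0, 0, 0, 0, 0, 0, 0, 0, 108, 0, 0, 0, 0, 0, 0, 0, 0, 0, 0, 0]"
  "hrow (0, 2, 1) 0 2 = [0, 0, 0, 0, 0, 72, 0, 0, 0, 0, 0, -144, 0, 0, -144, 0, -54, 0, 0, 216, 0, 0, 0, 0, 0, 0, 0, 0]"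
  "hrow (0, 2, 1) 1 1 = [0, 0, 0, 0, 0, 72, 0, 0, 0, 0, 0, 0, 0, 0, 0, 0, 0, 0, 0, 0, 0, 0, 0, 0, 0, 0, 0, 0]"
  "hrow (0, 2, 1) 1 2 = [0, 0, 0, 0, 0, -36, 0, 0, 0, 0, 0, 72, 0, 0, 0, 0, 0, 0, 0, 0, 0, 0, 0, 0, 0, 0, 0, 0]"
  "hrow (0, 2, 1) 2 2 = [0, 0, 0, 0, 0, 18, 0, 0, 0, 0, 0, -36, 0, 0, 72, 0, 0, 0, 0, 0, 0, 0, 0, 0, 0, 0, 0, 0]"
  unfolding hrow_def wts_4 ct_list_eval isum_def by simp_all

lemma wts_5:
  "wts (0, 1, 2) 0 0 = [0, 0, 0, 0, 0, 0, 0, 0, 0, 0, 48, 3, 0, 0, 0, 8, 0, 4, 0, 0, 0, 2, 4, 0, 0, 4, 8, 3]"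
  "wts (0, 1, 2) 0 1 = [0, 0, 0, 0, 0, 0, 0, 0, 0, 0, 12, 3, 0, 0, 0, 0, 0, -2, 0, 0, 0, 4, 2, 0, 0, 0, 0, 3]"
  "wts (0, 1, 2) 0 2 = [0, 0, 0, 0, 0, 0, 0, 0, 0, 0, -24, -6, 0, 0, 0, -4, 0, 0, 0, 0, 0, 0, 0, 0, 0, 8, 4, 3]"
  "wts (0, 1, 2) 1 1 = [0, 0, 0, 0, 0, 0, 0, 0, 0, 0, 3, 3, 0, 0, 0, 0, 0, 1, 0, 1, 0, 8, 1, 5, 16, 0, 0, 3]"
  "wts (0, 1, 2) 1 2 = [0, 0, 0, 0, 0, 0, 0, 0, 0, 0, -6, -6, 0, 0, 0, 0, 0, 0, 0, 0, 0, 0, 0, 10, 8, 0, 0, 3]"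
  "wts (0, 1, 2) 2 2 = [0, 0, 0, 0, 0, 0, 0, 0, 0, 0, 12, 12, 0, 0, 0, 2, 0, 0, 0, 0, 2, 0, 0, 20, 4, 16, 2, 3]"
  by (simp_all add: wts_def lvals_simps lform_list_def ipos_def)

lemma hrow_5:
  "hrow (0, 1, 2) 0 0 = [0, 0, 0, 0, 0, 0, 0, 0, 288, 0, 0, 288, 0, 0, 0, 0, 0, -270, 0, -432, 0, 0, 0, 0, 0, 0, 486, 0]"
  "hrow (0, 1, 2) 0 1 = [0, 0, 0, 0, 0, 0, 0, 0, 72, 0, 0, -144, 0, 0, -144, 0, 0, -54, 0, 216, 0, 0, 0, 0, 0, 0, 0, 0]"
  "hrow (0, 1, 2) 0 2 = [0, 0, 0, 0, 0, 0, 0, 0, -144, 0, 0, 0, 0, 0, 0, 0, 0, 108, 0, 0, 0, 0, 0, 0, 0, 0, 0, 0]"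
  "hrow (0, 1, 2) 1 1 = [0, 0, 0, 0, 0, 0, 0, 0, 18, 0, 0, 72, 0, 0, -36, 0, 0, 0, 0, 0, 0, 0, 0, 0, 0, 0, 0, 0]"
  "hrow (0, 1, 2) 1 2 = [0, 0, 0, 0, 0, 0, 0, 0, -36, 0, 0, 0, 0, 0, 72, 0, 0, 0, 0, 0, 0, 0, 0, 0, 0, 0, 0, 0]"
  "hrow (0, 1, 2) 2 2 = [0, 0, 0, 0, 0, 0, 0, 0, 72, 0, 0, 0, 0, 0, 0, 0, 0, 0, 0, 0, 0, 0, 0, 0, 0, 0, 0, 0]"
  unfolding hrow_def wts_5 ct_list_eval isum_def by simp_all

lemma wts_6:
  "wts (0, 0, 3) 0 0 = [0, 0, 0, 0, 0, 0, 0, 0, 12, 6, 96, 6, 0, 0, 0, 12, 0, 0, 0, 0, 0, 0, 0, 0, 0, 6, 12, 3]"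
  "wts (0, 0, 3) 0 1 = [0, 0, 0, 0, 0, 0, 0, 0, 12, 24, 24, 6, 0, 0, 0, 0, 0, 0, 0, 0, 0, 0, 0, 0, 0, 0, 0, 3]"
  "wts (0, 0, 3) 0 2 = [0, 0, 0, 0, 0, 0, 0, 0, -6, -12, -48, -12, 0, 0, 0, -6, 0, 0, 0, 0, 0, 0, 0, 0, 0, 12, 6, 3]"
  "wts (0, 0, 3) 1 1 = [0, 0, 0, 0, 0, 0, 0, 0, 12, 96, 6, 6, 0, 12, 0, 0, 0, 0, 0, 0, 0, 0, 0, 6, 12, 0, 0, 3]"
  "wts (0, 0, 3) 1 2 = [0, 0, 0, 0, 0, 0, 0, 0, -6, -48, -12, -12, 0, -6, 0, 0, 0, 0, 0, 0, 0, 0, 0, 12, 6, 0, 0, 3]"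
  "wts (0, 0, 3) 2 2 = [0, 0, 0, 0, 0, 0, 0, 0, 3, 24, 24, 24, 0, 3, 0, 3, 0, 0, 0, 0, 3, 0, 0, 24, 3, 24, 3, 3]"
  by (simp_all add: wts_def lvals_simps lform_list_def ipos_def)

lemma hrow_6:
  "hrow (0, 0, 3) 0 0 = [0, 0, 576, 0, 0, 0, 0, -540, 0, 0, 0, 0, 0, 216, 0, 0, 0, 0, 0, 0, 0, 0, 0, 0, 0, 0, 0, 0]"
  "hrow (0, 0, 3) 0 1 = [0, 0, 576, 0, 0, 0, 0, -432, -432, 0, 0, 0, 0, 0, 0, 0, 0, 324, 0, 0, 0, 0, 0, 0, 0, 0, 0, 0]"
  "hrow (0, 0, 3) 0 2 = [0, 0, -288, 0, 0, 0, 0, 216, 0, 0, 0, 0, 0, 0, 0, 0, 0, 0, 0, 0, 0, 0, 0, 0, 0, 0, 0, 0]"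
  "hrow (0, 0, 3) 1 1 = [0, 0, 576, 0, 0, 0, 0, 0, -540, 0, 0, 0, 0, 0, 216, 0, 0, 0, 0, 0, 0, 0, 0, 0, 0, 0, 0, 0]"
  "hrow (0, 0, 3) 1 2 = [0, 0, -288, 0, 0, 0, 0, 0, 216, 0, 0, 0, 0, 0, 0, 0, 0, 0, 0, 0, 0, 0, 0, 0, 0, 0, 0, 0]"
  "hrow (0, 0, 3) 2 2 = [0, 0, 144, 0, 0, 0, 0, 0, 0, 0, 0, 0, 0, 0, 0, 0, 0, 0, 0, 0, 0, 0, 0, 0, 0, 0, 0, 0]"
  unfolding hrow_def wts_6 ct_list_eval isum_def by simp_all

lemma wts_7:
  "wts (1, 0, 2) 0 0 = [0, 0, 0, 0, 0, 0, 0, 0, 0, 3, 0, 3, 0, 0, 0, 0, 1, 0, 1, 0, 0, 1, 8, 0, 0, 5, 16, 3]"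
  "wts (1, 0, 2) 0 1 = [0, 0, 0, 0, 0, 0, 0, 0, 0, 12, 0, 3, 0, 0, 0, 0, -2, 0, 0, 0, 0, 2, 4, 0, 0, 0, 0, 3]"
  "wts (1, 0, 2) 0 2 = [0, 0, 0, 0, 0, 0, 0, 0, 0, -6, 0, -6, 0, 0, 0, 0, 0, 0, 0, 0, 0, 0, 0, 0, 0, 10, 8, 3]"
  "wts (1, 0, 2) 1 1 = [0, 0, 0, 0, 0, 0, 0, 0, 0, 48, 0, 3, 0, 8, 0, 0, 4, 0, 0, 0, 0, 4, 2, 4, 8, 0, 0, 3]"
  "wts (1, 0, 2) 1 2 = [0, 0, 0, 0, 0, 0, 0, 0, 0, -24, 0, -6, 0, -4, 0, 0, 0, 0, 0, 0, 0, 0, 0, 8, 4, 0, 0, 3]"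
  "wts (1, 0, 2) 2 2 = [0, 0, 0, 0, 0, 0, 0, 0, 0, 12, 0, 12, 0, 2, 0, 0, 0, 0, 0, 0, 2, 0, 0, 16, 2, 20, 4, 3]"
  by (simp_all add: wts_def lvals_simps lform_list_def ipos_def)

lemma hrow_7:
  "hrow (1, 0, 2) 0 0 = [0, 0, 0, 0, 0, 0, 0, 18, 0, 0, 72, 0, 0, -36, 0, 0, 0, 0, 0, 0, 0, 0, 0, 0, 0, 0, 0, 0]"
  "hrow (1, 0, 2) 0 1 = [0, 0, 0, 0, 0, 0, 0, 72, 0, 0, -144, 0, 0, -144, 0, 0, 0, -54, 0, 0, 216, 0, 0, 0, 0, 0, 0, 0]"
  "hrow (1, 0, 2) 0 2 = [0, 0, 0, 0, 0, 0, 0, -36, 0, 0, 0, 0, 0, 72, 0, 0, 0, 0, 0, 0, 0, 0, 0, 0, 0, 0, 0, 0]"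
  "hrow (1, 0, 2) 1 1 = [0, 0, 0, 0, 0, 0, 0, 288, 0, 0, 288, 0, 0, 0, 0, 0, 0, -270, 0, 0, -432, 0, 0, 0, 0, 486, 0, 0]"
  "hrow (1, 0, 2) 1 2 = [0, 0, 0, 0, 0, 0, 0, -144, 0, 0, 0, 0, 0, 0, 0, 0, 0, 108, 0, 0, 0, 0, 0, 0, 0, 0, 0, 0]"
  "hrow (1, 0, 2) 2 2 = [0, 0, 0, 0, 0, 0, 0, 72, 0, 0, 0, 0, 0, 0, 0, 0, 0, 0, 0, 0, 0, 0, 0, 0, 0, 0, 0, 0]"
  unfolding hrow_def wts_7 ct_list_eval isum_def by simp_all

lemma wts_8:
  "wts (2, 0, 1) 0 0 = [0, 12, 0, 12, 0, 0, 0, 0, 0, 0, 0, 0, 0, 0, 0, 0, 2, 0, 2, 0, 0, 2, 16, 0, 0, 4, 20, 3]"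
  "wts (2, 0, 1) 0 1 = [0, -24, 0, -6, 0, 0, 0, 0, 0, 0, 0, 0, 0, 0, 0, 0, -4, 0, 0, 0, 0, 4, 8, 0, 0, 0, 0, 3]"
  "wts (2, 0, 1) 0 2 = [0, -6, 0, -6, 0, 0, 0, 0, 0, 0, 0, 0, 0, 0, 0, 0, 0, 0, 0, 0, 0, 0, 0, 0, 0, 8, 10, 3]"
  "wts (2, 0, 1) 1 1 = [0, 48, 0, 3, 0, 0, 0, 0, 0, 0, 0, 0, 0, 4, 0, 0, 8, 0, 0, 0, 0, 8, 4, 2, 4, 0, 0, 3]"
  "wts (2, 0, 1) 1 2 = [0, 12, 0, 3, 0, 0, 0, 0, 0, 0, 0, 0, 0, -2, 0, 0, 0, 0, 0, 0, 0, 0, 0, 4, 2, 0, 0, 3]"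
  "wts (2, 0, 1) 2 2 = [0, 3, 0, 3, 0, 0, 0, 0, 0, 0, 0, 0, 0, 1, 0, 0, 0, 0, 0, 0, 1, 0, 0, 8, 1, 16, 5, 3]"
  by (simp_all add: wts_def lvals_simps lform_list_def ipos_def)

lemma hrow_8:
  "hrow (2, 0, 1) 0 0 = [0, 0, 0, 0, 72, 0, 0, 0, 0, 0, 0, 0, 0, 0, 0, 0, 0, 0, 0, 0, 0, 0, 0, 0, 0, 0, 0, 0]"
  "hrow (2, 0, 1) 0 1 = [0, 0, 0, 0, -144, 0, 0, 0, 0, 0, 0, 0, 0, 0, 0, 108, 0, 0, 0, 0, 0, 0, 0, 0, 0, 0, 0, 0]"
  "hrow (2, 0, 1) 0 2 = [0, 0, 0, 0, -36, 0, 0, 0, 0, 0, 72, 0, 0, 0, 0, 0, 0, 0, 0, 0, 0, 0, 0, 0, 0, 0, 0, 0]"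
  "hrow (2, 0, 1) 1 1 = [0, 0, 0, 0, 288, 0, 0, 0, 0, 0, 0, 0, 0, 288, 0, -270, 0, 0, 0, 0, -432, 0, 486, 0, 0, 0, 0, 0]"
  "hrow (2, 0, 1) 1 2 = [0, 0, 0, 0, 72, 0, 0, 0, 0, 0, -144, 0, 0, -144, 0, -54, 0, 0, 0, 0, 216, 0, 0, 0, 0, 0, 0, 0]"
  "hrow (2, 0, 1) 2 2 = [0, 0, 0, 0, 18, 0, 0, 0, 0, 0, -36, 0, 0, 72, 0, 0, 0, 0, 0, 0, 0, 0, 0, 0, 0, 0, 0, 0]"
  unfolding hrow_def wts_8 ct_list_eval isum_def by simp_all

lemma length_ct_list: "length ct_list = 28"
  by (simp add: ct_list_eval)

lemma ct_list_nth: "i < 28 \<Longrightarrow> j < 28 \<Longrightarrow> ct i j = of_int (ct_list ! i ! j)"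
proof -
  assume i: "i < 28" and j: "j < 28"
  have n: "map2 (\<lambda>x y. 2 * x - y) (coeff_list ! a) (coeff_list ! b) ! j = 2 * (coeff_list ! a ! j) - coeff_list ! b ! j"
    if "a < 28" "b < 28" for a b using length_coeff(2)[OF that(1)] length_coeff(2)[OF that(2)] j by simp
  have l: "length (take 21 coeff_list) = 21" by (simp add: length_coeff(1))
  show ?thesis
  proof (cases "i < 21")
    case True
    then show ?thesis by (simp add: ct_def cf_def ct_list_def Let_def nth_append l length_coeff(1))
  next
    case False
    then consider "i = 21" | "i = 22" | "i = 23" | "i = 24" | "i = 25" | "i = 26" | "i = 27" using i by linarith
    then show ?thesis
      by cases (simp_all add: ct_def cf_def length_coeff(1) ct_list_def Let_def nth_append l n)
  qed
qed

lemma length_ct_row: "i < 28 \<Longrightarrow> length (ct_list ! i) = 28"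
proof -
  assume "i < 28"
  then have "ct_list ! i \<in> set ct_list" using length_ct_list by simp
  moreover have "\<forall>r\<in>set ct_list. length r = 28" by (simp add: ct_list_eval)
  ultimately show ?thesis by blast
qed

text \<open>One sixth of the Hessian of the spline with coefficients \<open>b\<close>, viewed as a homogeneous cubic in the scaled
  barycentric coordinates; by Euler's identity it carries the whole 2-jet.\<close>

definition Hs :: "(nat \<Rightarrow> real) \<Rightarrow> hpt \<Rightarrow> nat \<Rightarrow> nat \<Rightarrow> real" where
  "Hs b z a c = (\<Sum>i<28. b i * (\<Sum>j<28. ct i j * (crd a (lf j) * crd c (lf j) * pw 1 (lf j \<bullet> z))))"

lemma Hs_sym: "Hs b z a c = Hs b z c a"
  by (simp add: Hs_def mult.commute mult.left_commute)

lemma Hs_hrow: "Hs b (rp p) a c = (\<Sum>i<28. b i * of_int (hrow p a c ! i))"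
  unfolding Hs_def
proof (rule sum.cong[OF refl])
  fix i :: nat assume "i \<in> {..<28}"
  then have i: "i < 28" by simp
  have w: "length (wts p a c) = 28" by (simp add: wts_def length_lform)
  have "hrow p a c ! i = (\<Sum>j<28. ct_list ! i ! j * wts p a c ! j)"
    using i by (simp add: hrow_def length_ct_list isum_eq length_ct_row w)
  moreover have "real_of_int (wts p a c ! j) = crd a (lf j) * crd c (lf j) * pw 1 (lf j \<bullet> rp p)" if "j < 28" for j
  proof -
    have "real_of_int (ipos v) = pw 1 (of_int v)" for v by (simp add: ipos_def pw_def)
    moreover have "real_of_int (icrd a l) = crd a (rp l)" for a l by (cases l) (simp add: crd_def)
    ultimately show ?thesis using that nth_lvals[OF that, of p]
      by (simp add: wts_def length_lform lf_def)
  qed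
  ultimately have "real_of_int (hrow p a c ! i) = (\<Sum>j<28. ct i j * (crd a (lf j) * crd c (lf j) * pw 1 (lf j \<bullet> rp p)))"
    using ct_list_nth[OF i] by simp
  then show "b i * (\<Sum>j<28. ct i j * (crd a (lf j) * crd c (lf j) * pw 1 (lf j \<bullet> rp p))) = b i * of_int (hrow p a c ! i)"
    by simp
qed

definition Hz :: "(nat \<Rightarrow> real) \<Rightarrow> hpt \<Rightarrow> bool" where
  "Hz b z \<longleftrightarrow> (\<forall>a<3. \<forall>c<3. Hs b z a c = 0)"

lemma Hz_six: "Hz b z \<longleftrightarrow> Hs b z 0 0 = 0 \<and> Hs b z 0 1 = 0 \<and> Hs b z 0 2 = 0 \<and> Hs b z 1 1 = 0 \<and> Hs b z 1 2 = 0 \<and> Hs b z 2 2 = 0"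
  unfolding Hz_def all_less_3 using Hs_sym[of b z 1 0] Hs_sym[of b z 2 0] Hs_sym[of b z 2 1] by auto

text \<open>Indices associated with vertex \<open>m\<close> and with the side opposite vertex \<open>f\<close>, shifted to start at 0.\<close>

definition vertex_ix :: "nat \<Rightarrow> nat set" where
  "vertex_ix m = (if m = 0 then {0, 3, 4, 9, 10, 15} else if m = 1 then {1, 5, 6, 11, 12, 16} else {2, 7, 8, 13, 14, 17})"
definition edge_ix :: "nat \<Rightarrow> nat set" where
  "edge_ix f = (if f = 0 then {19, 23, 26} else if f = 1 then {20, 22, 25} else {18, 21, 24})"
definition vtx :: "nat \<Rightarrow> int3" where
  "vtx m = (if m = 0 then (3,0,0) else if m = 1 then (0,3,0) else (0,0,3))"

lemma sum_less_28: "(\<Sum>i<28. f i) = sum_list (map f [0,1,2,3,4,5,6,7,8,9,10,11,12,13,14,15,16,17,18,19,20,21,22,23,24,25,26,27::nat])"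
  by (simp add: eval_nat_numeral add.assoc)

text \<open>At a vertex only the six columns of its indices are nonzero, and the entries of the
  quadratic form give a triangular system. At the first vertex, entry (0,0) yields index 0, then
  (0,1) and (0,2) yield 3 and 4, and (1,1), (1,2), (2,2) yield 9, 15 and 10.\<close>

lemma vertex_unisolvent:
  assumes "m < 3" shows "Hz b (rp (vtx m)) \<longleftrightarrow> (\<forall>i\<in>vertex_ix m. b i = 0)"
proof -
  have "m = 0 \<or> m = 1 \<or> m = 2" using assms by auto
  then show ?thesis
  proof (elim disjE)
    assume m: "m = 0"
    show ?thesis unfolding Hz_six Hs_hrow m by (simp add: vtx_def hrow_0 sum_less_28 vertex_ix_def del: One_nat_def, (auto; linarith)?)
  next
    assume m: "m = 1"
    show ?thesis unfolding Hz_six Hs_hrow m by (simp add: vtx_def hrow_3 sum_less_28 vertex_ix_def del: One_nat_def, (auto; linarith)?)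
  next
    assume m: "m = 2"
    show ?thesis unfolding Hz_six Hs_hrow m by (simp add: vtx_def hrow_6 sum_less_28 vertex_ix_def del: One_nat_def, (auto; linarith)?)
  qed
qed

text \<open>With the end points settled, three columns remain: one that occurs at both thirds and
  one for each third alone. For f = 2 a mixed entry yields \<open>b 18\<close>, and then entry (2,2)
  yields \<open>b 21\<close> at the first third and \<open>b 24\<close> at the second.\<close>

lemma edge_unisolvent:
  assumes "f < 3" "\<And>m i. m < 3 \<Longrightarrow> m \<noteq> f \<Longrightarrow> i \<in> vertex_ix m \<Longrightarrow> b i = 0"
  shows "Hz b (rp (edge_chain f ! 1)) \<and> Hz b (rp (edge_chain f ! 2)) \<longleftrightarrow> (\<forall>i\<in>edge_ix f. b i = 0)"
proof -
  have "f = 0 \<or> f = 1 \<or> f = 2" using assms by auto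
  then show ?thesis
  proof (elim disjE)
    assume f: "f = 0"
    have "\<forall>i\<in>vertex_ix 1. b i = 0" "\<forall>i\<in>vertex_ix 2. b i = 0" using assms(2)[of 1] assms(2)[of 2] f by auto
    then show ?thesis unfolding Hz_six Hs_hrow f by (simp add: edge_chain_def hrow_4 hrow_5 sum_less_28 vertex_ix_def edge_ix_def del: One_nat_def, (auto; linarith)?)
  next
    assume f: "f = 1"
    have "\<forall>i\<in>vertex_ix 0. b i = 0" "\<forall>i\<in>vertex_ix 2. b i = 0" using assms(2)[of 0] assms(2)[of 2] f by auto
    then show ?thesis unfolding Hz_six Hs_hrow f by (simp add: edge_chain_def hrow_7 hrow_8 sum_less_28 vertex_ix_def edge_ix_def del: One_nat_def, (auto; linarith)?)
  next
    assume f: "f = 2"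
    have "\<forall>i\<in>vertex_ix 0. b i = 0" "\<forall>i\<in>vertex_ix 1. b i = 0" using assms(2)[of 0] assms(2)[of 1] f by auto
    then show ?thesis unfolding Hz_six Hs_hrow f by (simp add: edge_chain_def hrow_1 hrow_2 sum_less_28 vertex_ix_def edge_ix_def del: One_nat_def, (auto; linarith)?)
  qed
qed

text \<open>The 2-jets at the boundary knots cannot see \<open>FT 27\<close>; its nonzero value at
  the centroid detects its coefficient.\<close>

lemma FT_27_center: "FT 27 (1, 1, 1) \<noteq> 0"
proof -
  have "FT 27 (1, 1, 1) = of_int (isum (ct_list ! 27) (map (\<lambda>l. ipos (idot l (1, 1, 1)) ^ 3) lform_list))"
  proof -
    have "FT 27 (1, 1, 1) = (\<Sum>j<28. of_int (ct_list ! 27 ! j * ipos (idot (lform_list ! j) (1, 1, 1)) ^ 3))"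
      unfolding FT_def
    proof (rule sum.cong[OF refl])
      fix j :: nat assume "j \<in> {..<28}"
      moreover have "real_of_int (ipos v ^ 3) = pw 3 (of_int v)" for v by (simp add: ipos_def pw_def)
      moreover have "lf j \<bullet> (1, 1, 1) = of_int (idot (lform_list ! j) (1, 1, 1))" using inner_rp[of "lform_list ! j" "(1, 1, 1)"] by (simp add: lf_def)
      ultimately show "ct 27 j * pw 3 (lf j \<bullet> (1, 1, 1)) = of_int (ct_list ! 27 ! j * ipos (idot (lform_list ! j) (1, 1, 1)) ^ 3)"
        using ct_list_nth[of 27 j] by simp
    qed
    then show ?thesis by (simp add: isum_eq length_ct_row length_lform)
  qed
  also have "isum (ct_list ! 27) (map (\<lambda>l. ipos (idot l (1, 1, 1)) ^ 3) lform_list) = 108"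
    by (simp add: ct_list_eval lform_list_def ipos_def isum_def)
  finally show ?thesis by simp
qed

text \<open>An injective linear map on 28-dimensional space is surjective. Serves twice: to express
  truncated cubes by the local basis and to prescribe nodal values.\<close>

lemma square_system_solvable:
  fixes M :: "nat \<Rightarrow> nat \<Rightarrow> real"
  assumes inj: "\<And>b. (\<And>k. k < 28 \<Longrightarrow> (\<Sum>i<28. M k i * b i) = 0) \<Longrightarrow> (\<And>i. i < 28 \<Longrightarrow> b i = 0)"
  shows "\<exists>b. \<forall>k<28. (\<Sum>i<28. M k i * b i) = y k"
proof -
  have "card {..<28::nat} = card (UNIV :: 28 set)" by simp
  then obtain h where h: "bij_betw h {..<28::nat} (UNIV :: 28 set)"
    using finite_same_card_bij[of "{..<28::nat}" "UNIV :: 28 set"] by auto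
  define g where "g = inv_into {..<28} h"
  have gh: "g (h i) = i" if "i < 28" for i using h that by (simp add: g_def bij_betw_def)
  have hg: "h (g k) = k" "g k < 28" for k
    using h bij_betw_inv_into_right[OF h, of k] bij_betwE[OF bij_betw_inv_into[OF h]] by (auto simp: g_def)
  define f :: "real^28 \<Rightarrow> real^28" where "f v = (\<chi> k. \<Sum>i<28. M (g k) i * v $ h i)" for v
  have lin: "linear f"
    by (rule linearI) (auto simp: f_def vec_eq_iff sum.distrib sum_distrib_left algebra_simps)
  have "inj f" unfolding linear_injective_0[OF lin]
  proof (intro allI impI)
    fix v assume v: "f v = 0"
    have "(\<Sum>i<28. M k i * v $ h i) = 0" if "k < 28" for k
      using arg_cong[OF v, of "\<lambda>w. w $ h k"] gh[OF that] by (simp add: f_def)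
    from inj[of "\<lambda>i. v $ h i", OF this] have "v $ h i = 0" if "i < 28" for i using that by blast
    then show "v = 0" using hg by (metis vec_eq_iff zero_index)
  qed
  then have "surj f" using linear_injective_imp_surjective[OF lin] by blast
  then obtain v where "f v = (\<chi> k. y (g k))" by (metis surjD)
  then have "(\<Sum>i<28. M k i * v $ h i) = y k" if "k < 28" for k
    using gh[OF that] by (auto simp: f_def vec_eq_iff dest: spec[of _ "h k"])
  then show ?thesis by (intro exI[of _ "\<lambda>i. v $ h i"]) blast
qed

section \<open>The local space: cubes spanning the cubics, polar forms, representation of local
  splines\<close>

lemma cubic_forms:
  "\<exists>e. \<forall>z. (\<alpha> \<bullet> z) * (\<beta> \<bullet> z) * (\<gamma> \<bullet> z) = (\<Sum>j\<in>{18..<28}. e j * (lf j \<bullet> z) ^ 3)"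
proof -
  obtain a1 a2 a3 b1 b2 b3 c1 c2 c3 where abc: "\<alpha> = (a1, a2, a3)" "\<beta> = (b1, b2, b3)" "\<gamma> = (c1, c2, c3)" by (metis prod.collapse)
  \<comment> \<open>\<open>m\<close> is one sixth of the coefficient of z1 z2 z3, so
    \<open>m * (z1 + z2 + z3)^3\<close> takes over that term.\<close>
  define m where "m = (a1*b2*c3 + a1*b3*c2 + a2*b1*c3 + a2*b3*c1 + a3*b1*c2 + a3*b2*c1) / 6"
  define p where "p a b c a' b' c' = a*b*c' + a*b'*c + a'*b*c - 3 * m" for a b c a' b' c'
  \<comment> \<open>the coefficients of \<open>z\<^sub>1\<^sup>2 z\<^sub>2\<close>, \<open>z\<^sub>1 z\<^sub>2\<^sup>2\<close>, ... after removing \<open>m (z\<^sub>1 + z\<^sub>2 + z\<^sub>3)\<^sup>3\<close>\<close>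
  define p12 where "p12 = p a1 b1 c1 a2 b2 c2" define p21 where "p21 = p a2 b2 c2 a1 b1 c1"
  define p23 where "p23 = p a2 b2 c2 a3 b3 c3" define p32 where "p32 = p a3 b3 c3 a2 b2 c2"
  define p13 where "p13 = p a1 b1 c1 a3 b3 c3" define p31 where "p31 = p a3 b3 c3 a1 b1 c1"
  \<comment> \<open>\<open>r x y\<close> and \<open>r y x\<close> are the weights with which the
    cubes of u + 2 v and 2 u + v produce the mixed terms \<open>x * u^2 * v + y * u * v^2\<close>;
    they solve a 2 by 2 linear system.\<close>
  define r where "r x y = (2 * y - x) / 18" for x y :: real
  have key: "\<And>z1 z2 z3. (a1*z1 + a2*z2 + a3*z3) * (b1*z1 + b2*z2 + b3*z3) * (c1*z1 + c2*z2 + c3*z3) =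
     (a1*b1*c1 - m - r p12 p21 - 8 * r p21 p12 - r p13 p31 - 8 * r p31 p13) * z1^3
     + (a2*b2*c2 - m - 8 * r p12 p21 - r p21 p12 - r p23 p32 - 8 * r p32 p23) * z2^3
     + (a3*b3*c3 - m - 8 * r p13 p31 - r p31 p13 - 8 * r p23 p32 - r p32 p23) * z3^3
     + r p12 p21 * (z1 + 2*z2)^3 + r p21 p12 * (2*z1 + z2)^3 + r p23 p32 * (z2 + 2*z3)^3 + r p32 p23 * (2*z2 + z3)^3
     + r p13 p31 * (z1 + 2*z3)^3 + r p31 p13 * (2*z1 + z3)^3 + m * (z1 + z2 + z3)^3"
  proof -
    fix z1 z2 z3 :: real
    have pair: "r x y * (u + 2 * v)^3 + r y x * (2 * u + v)^3 = (r x y + 8 * r y x) * u^3 + x * u^2 * v + y * u * v^2 + (8 * r x y + r y x) * v^3" for x y u v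
      by (simp add: r_def field_simps power3_eq_cube power2_eq_square)
    have ring: "(a1*z1 + a2*z2 + a3*z3) * (b1*z1 + b2*z2 + b3*z3) * (c1*z1 + c2*z2 + c3*z3) =
      (a1*b1*c1 - m) * z1^3 + (a2*b2*c2 - m) * z2^3 + (a3*b3*c3 - m) * z3^3 + (p12 * z1^2 * z2 + p21 * z1 * z2^2)
      + (p23 * z2^2 * z3 + p32 * z2 * z3^2) + (p13 * z1^2 * z3 + p31 * z1 * z3^2) + m * (z1 + z2 + z3)^3
      + (a1*b2*c3 + a1*b3*c2 + a2*b1*c3 + a2*b3*c1 + a3*b1*c2 + a3*b2*c1 - 6 * m) * (z1 * z2 * z3)"
      unfolding p12_def p21_def p23_def p32_def p13_def p31_def p_def
      by (simp add: algebra_simps power3_eq_cube power2_eq_square)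
    have m0: "a1*b2*c3 + a1*b3*c2 + a2*b1*c3 + a2*b3*c1 + a3*b1*c2 + a3*b2*c1 - 6 * m = 0" by (simp add: m_def)
    show "(a1*z1 + a2*z2 + a3*z3) * (b1*z1 + b2*z2 + b3*z3) * (c1*z1 + c2*z2 + c3*z3) =
     (a1*b1*c1 - m - r p12 p21 - 8 * r p21 p12 - r p13 p31 - 8 * r p31 p13) * z1^3
     + (a2*b2*c2 - m - 8 * r p12 p21 - r p21 p12 - r p23 p32 - 8 * r p32 p23) * z2^3
     + (a3*b3*c3 - m - 8 * r p13 p31 - r p31 p13 - 8 * r p23 p32 - r p32 p23) * z3^3
     + r p12 p21 * (z1 + 2*z2)^3 + r p21 p12 * (2*z1 + z2)^3 + r p23 p32 * (z2 + 2*z3)^3 + r p32 p23 * (2*z2 + z3)^3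
     + r p13 p31 * (z1 + 2*z3)^3 + r p31 p13 * (2*z1 + z3)^3 + m * (z1 + z2 + z3)^3"
      using ring pair[of p12 p21 z1 z2] pair[of p23 p32 z2 z3] pair[of p13 p31 z1 z3] unfolding m0
      by (simp add: left_diff_distrib distrib_right)
  qed
  define e where "e j = [a1*b1*c1 - m - r p12 p21 - 8 * r p21 p12 - r p13 p31 - 8 * r p31 p13,
     a2*b2*c2 - m - 8 * r p12 p21 - r p21 p12 - r p23 p32 - 8 * r p32 p23,
     a3*b3*c3 - m - 8 * r p13 p31 - r p31 p13 - 8 * r p23 p32 - r p32 p23,
     r p12 p21, r p21 p12, r p23 p32, r p32 p23, r p13 p31, r p31 p13, m] ! (j - 18)" for j :: nat
  have set: "{18..<28} = {18,19,20,21,22,23,24,25,26,27::nat}" by (simp add: set_eq_iff, presburger)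
  have "(\<alpha> \<bullet> z) * (\<beta> \<bullet> z) * (\<gamma> \<bullet> z) = (\<Sum>j\<in>{18..<28}. e j * (lf j \<bullet> z) ^ 3)" for z
  proof -
    obtain z1 z2 z3 where z: "z = (z1, z2, z3)" by (metis prod.collapse)
    have l: "lf 18 \<bullet> z = z1" "lf 19 \<bullet> z = z2" "lf 20 \<bullet> z = z3" "lf 21 \<bullet> z = z1 + 2*z2" "lf 22 \<bullet> z = 2*z1 + z2"
      "lf 23 \<bullet> z = z2 + 2*z3" "lf 24 \<bullet> z = 2*z2 + z3" "lf 25 \<bullet> z = z1 + 2*z3" "lf 26 \<bullet> z = 2*z1 + z3" "lf 27 \<bullet> z = z1 + z2 + z3"
      by (simp_all add: z lf_def lform_list_def)
    have "(\<Sum>j\<in>{18..<28}. e j * (lf j \<bullet> z) ^ 3) = (a1*z1 + a2*z2 + a3*z3) * (b1*z1 + b2*z2 + b3*z3) * (c1*z1 + c2*z2 + c3*z3)"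
      unfolding set key by (simp add: l e_def)
    then show ?thesis by (simp add: abc z add.assoc)
  qed
  then show ?thesis by blast
qed

text \<open>The 2-jet, indexed as in \<open>C2j\<close>, of the combination of truncated cubes with coefficients \<open>e\<close>;
  \<open>eb\<close> passes from spline coefficients to these.\<close>

definition G :: "tri \<Rightarrow> (nat \<Rightarrow> real) \<Rightarrow> nat \<Rightarrow> pt \<Rightarrow> real" where
  "G T e k x = (\<Sum>j<28. e j * pwj (nl T j) (cl T j) k x)"

definition eb :: "(nat \<Rightarrow> real) \<Rightarrow> nat \<Rightarrow> real" where "eb b j = (\<Sum>i<28. b i * ct i j)"

lemma G_C2j: "C2j UNIV (G T e)"
proof -
  have "C2j UNIV (\<lambda>k x. \<Sum>j\<in>{..<28}. e j * pwj (nl T j) (cl T j) k x)"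
    by (intro C2j_sum C2j_scale pwj_C2j) simp
  then show ?thesis by (simp add: G_def[abs_def])
qed

lemma G_0: "dtri T \<noteq> 0 \<Longrightarrow> G T e 0 x = (\<Sum>j<28. e j * pw 3 (lf j \<bullet> zc T x))"
  by (simp add: G_def pwj_def lf_zc)

lemma G_eb_0: "dtri T \<noteq> 0 \<Longrightarrow> G T (eb b) 0 x = (\<Sum>i<28. b i * FT i (zc T x))"
  unfolding G_0 eb_def FT_def sum_distrib_right sum_distrib_left
  by (subst sum.swap) (simp add: mult.assoc)

definition ml :: "tri \<Rightarrow> nat \<Rightarrow> real \<times> pt \<Rightarrow> real" where
  "ml T j \<alpha> = nl T j \<bullet> snd \<alpha> + fst \<alpha> * cl T j"

text \<open>Hessian of the homogeneous cubic on \<open>\<real> \<times> \<real>\<^sup>2\<close> that restricts to \<open>G T e\<close> on \<open>{1} \<times> \<real>\<^sup>2\<close>;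
  it encodes the whole 2-jet and no longer refers to the triangle.\<close>

definition polar :: "tri \<Rightarrow> (nat \<Rightarrow> real) \<Rightarrow> pt \<Rightarrow> real \<times> pt \<Rightarrow> real \<times> pt \<Rightarrow> real" where
  "polar T e x \<alpha> \<beta> = (\<Sum>j<28. e j * (ml T j \<alpha> * ml T j \<beta> * pw 1 (nl T j \<bullet> x + cl T j)))"

lemma pw_high: "pw 3 u = u * u * pw 1 u" "pw 2 u = u * pw 1 u"
  by (simp_all add: pw_def power3_eq_cube power2_eq_square)

lemma G_polar:
  "G T e 0 x = polar T e x (1, x) (1, x)" "G T e 1 x = 3 * polar T e x (0, (1, 0)) (1, x)"
  "G T e 2 x = 3 * polar T e x (0, (0, 1)) (1, x)" "G T e 3 x = 6 * polar T e x (0, (1, 0)) (0, (1, 0))"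
  "G T e 4 x = 6 * polar T e x (0, (1, 0)) (0, (0, 1))" "G T e 5 x = 6 * polar T e x (0, (0, 1)) (0, (1, 0))"
  "G T e 6 x = 6 * polar T e x (0, (0, 1)) (0, (0, 1))"
proof -
  have n: "nl T j \<bullet> (1, 0) = fst (nl T j)" "nl T j \<bullet> (0, 1) = snd (nl T j)" for j by (simp_all add: inner_prod_def)
  show "G T e 0 x = polar T e x (1, x) (1, x)" "G T e 1 x = 3 * polar T e x (0, (1, 0)) (1, x)"
    "G T e 2 x = 3 * polar T e x (0, (0, 1)) (1, x)" "G T e 3 x = 6 * polar T e x (0, (1, 0)) (0, (1, 0))"
    "G T e 4 x = 6 * polar T e x (0, (1, 0)) (0, (0, 1))" "G T e 5 x = 6 * polar T e x (0, (0, 1)) (0, (1, 0))"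
    "G T e 6 x = 6 * polar T e x (0, (0, 1)) (0, (0, 1))"
    unfolding G_def polar_def sum_distrib_left
    by (intro sum.cong refl; simp add: pwj_def ml_def n pw_high)+
qed

text \<open>Each argument splits as (s, u) = s (1, x) + (0, u - s x). By Euler's identity a slot
  filled with (1, x) lowers the order of the derivative, which accounts for the factors 1, 1/3 and
  1/6.\<close>

lemma polar_jets:
  fixes s t :: real and u v x :: pt
  defines "p \<equiv> u - s *\<^sub>R x" and "q \<equiv> v - t *\<^sub>R x"
  shows "polar T e x (s, u) (t, v) = s * t * G T e 0 x + s / 3 * (fst q * G T e 1 x + snd q * G T e 2 x)
    + t / 3 * (fst p * G T e 1 x + snd p * G T e 2 x)
    + (fst p * fst q * G T e 3 x + fst p * snd q * G T e 4 x + snd p * fst q * G T e 5 x + snd p * snd q * G T e 6 x) / 6"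
proof -
  have t: "ml T j (s, u) * ml T j (t, v) * pw 1 (nl T j \<bullet> x + cl T j) = s * t * pwj (nl T j) (cl T j) 0 x
    + (s * fst q / 3 + t * fst p / 3) * pwj (nl T j) (cl T j) 1 x + (s * snd q / 3 + t * snd p / 3) * pwj (nl T j) (cl T j) 2 x
    + fst p * fst q / 6 * pwj (nl T j) (cl T j) 3 x + fst p * snd q / 6 * pwj (nl T j) (cl T j) 4 x + snd p * fst q / 6 * pwj (nl T j) (cl T j) 5 x + snd p * snd q / 6 * pwj (nl T j) (cl T j) 6 x" for j
  proof -
    define l where "l = nl T j \<bullet> x + cl T j"
    have m: "ml T j (s, u) = s * l + (fst (nl T j) * fst p + snd (nl T j) * snd p)"
       "ml T j (t, v) = t * l + (fst (nl T j) * fst q + snd (nl T j) * snd q)"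
      by (simp_all add: ml_def l_def p_def q_def inner_prod_def algebra_simps)
    show ?thesis unfolding m unfolding pwj_def unfolding l_def[symmetric] pw_high
      by (simp add: field_simps)
  qed
  have lin: "(\<Sum>j<28. e j * (a0 * f0 j + a1 * f1 j + a2 * f2 j + a3 * f3 j + a4 * f4 j + a5 * f5 j + a6 * f6 j))
    = a0 * (\<Sum>j<28. e j * f0 j) + a1 * (\<Sum>j<28. e j * f1 j) + a2 * (\<Sum>j<28. e j * f2 j) + a3 * (\<Sum>j<28. e j * f3 j)
    + a4 * (\<Sum>j<28. e j * f4 j) + a5 * (\<Sum>j<28. e j * f5 j) + a6 * (\<Sum>j<28. e j * f6 j)"
    for a0 a1 a2 a3 a4 a5 a6 :: real and f0 f1 f2 f3 f4 f5 f6
    unfolding sum_distrib_left sum.distrib[symmetric] by (intro sum.cong refl) (simp only: distrib_left mult.left_commute)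
  show ?thesis unfolding polar_def t lin unfolding G_def[symmetric]
    by (simp add: field_simps)
qed

lemma jets_eq_iff: "(\<forall>k<7. G T e k x = G T' e' k x) \<longleftrightarrow> (\<forall>\<alpha> \<beta>. polar T e x \<alpha> \<beta> = polar T' e' x \<alpha> \<beta>)"
proof
  assume "\<forall>k<7. G T e k x = G T' e' k x"
  then have "polar T e x (s, u) (t, v) = polar T' e' x (s, u) (t, v)" for s u t v
    unfolding polar_jets all_less_7 by simp
  then show "\<forall>\<alpha> \<beta>. polar T e x \<alpha> \<beta> = polar T' e' x \<alpha> \<beta>" by (metis prod.collapse)
next
  assume "\<forall>\<alpha> \<beta>. polar T e x \<alpha> \<beta> = polar T' e' x \<alpha> \<beta>"
  then show "\<forall>k<7. G T e k x = G T' e' k x" unfolding all_less_7 G_polar by (simp only: simp_thms)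
qed

lemma polar_zero [simp]: "polar T (\<lambda>_. 0) x \<alpha> \<beta> = 0" and G_zero [simp]: "G T (\<lambda>_. 0) k x = 0"
  by (simp_all add: polar_def G_def)

lemma jets_zero_iff: "(\<forall>k<7. G T e k x = 0) \<longleftrightarrow> (\<forall>\<alpha> \<beta>. polar T e x \<alpha> \<beta> = 0)"
  using jets_eq_iff[of T e x T "\<lambda>_. 0"] by simp

lemma Hs_eb: "Hs b z a c = (\<Sum>j<28. eb b j * (crd a (lf j) * crd c (lf j) * pw 1 (lf j \<bullet> z)))"
  unfolding Hs_def eb_def sum_distrib_right sum_distrib_left
  by (subst sum.swap) (simp add: mult.assoc)

lemma crd_inner: "y \<bullet> z = crd 0 y * crd 0 z + crd 1 y * crd 1 z + crd 2 y * crd 2 z"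
  by (simp add: inner_prod_def crd_def add.assoc)

lemma Hz_polar:
  assumes d: "dtri T \<noteq> 0"
  shows "Hz b (zc T x) \<longleftrightarrow> (\<forall>\<alpha> \<beta>. polar T (eb b) x \<alpha> \<beta> = 0)"
proof
  \<comment> \<open>\<open>w a\<close> is vertex a of the triangle: a coefficient of a form is one
    third of its value there.\<close>
  define w where "w a = bpt T (if a = 0 then (3,0,0) else if a = 1 then (0,3,0) else (0,0,3))" for a :: nat
  have wz: "crd a (lf j) = ml T j (1, w a) / 3" if "a < 3" for a j
  proof -
    have "ml T j (1, w a) = lf j \<bullet> zc T (w a)" by (simp add: ml_def lf_zc[OF d])
    also have "\<dots> = 3 * crd a (lf j)"
      unfolding w_def by (subst zc_bpt[OF d]) (use that in \<open>auto simp: csum_def crd_def inner_prod_def\<close>)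
    finally show ?thesis by simp
  qed
  assume "\<forall>\<alpha> \<beta>. polar T (eb b) x \<alpha> \<beta> = 0"
  then have "polar T (eb b) x (1, w a) (1, w c) / 9 = 0" for a c by (simp only: div_0)
  moreover have "Hs b (zc T x) a c = polar T (eb b) x (1, w a) (1, w c) / 9" if "a < 3" "c < 3" for a c
    unfolding Hs_eb polar_def wz[OF that(1)] wz[OF that(2)] lf_zc[OF d] by (simp add: sum_divide_distrib)
  ultimately show "Hz b (zc T x)" by (simp add: Hz_def)
next
  assume H: "Hz b (zc T x)"
  show "\<forall>\<alpha> \<beta>. polar T (eb b) x \<alpha> \<beta> = 0"
  proof (intro allI)
    fix \<alpha> \<beta> :: "real \<times> pt"
    \<comment> \<open>The linear extension to the homogenised plane of the affine map
      \<open>zc T\<close>, which it equals at first component 1.\<close>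
    define h where "h \<alpha> = zc T (snd \<alpha>) + (fst \<alpha> - 1) *\<^sub>R zc T 0" for \<alpha> :: "real \<times> pt"
    have m: "ml T j \<alpha> = (\<Sum>a<3. crd a (lf j) * crd a (h \<alpha>))" for j \<alpha>
    proof -
      have "lf j \<bullet> zc T 0 = cl T j" by (simp add: cl_def)
      then have "ml T j \<alpha> = lf j \<bullet> h \<alpha>"
        by (simp add: ml_def h_def inner_add_right lf_zc[OF d] algebra_simps del: crd_add)
      then show ?thesis by (simp add: crd_inner eval_nat_numeral)
    qed
    have "polar T (eb b) x \<alpha> \<beta> = (\<Sum>a<3. \<Sum>c<3. crd a (h \<alpha>) * crd c (h \<beta>) * Hs b (zc T x) a c)"
    proof -
      have "polar T (eb b) x \<alpha> \<beta> = (\<Sum>j<28. \<Sum>a<3. \<Sum>c<3. crd a (h \<alpha>) * crd c (h \<beta>) * (eb b j * (crd a (lf j) * crd c (lf j) * pw 1 (lf j \<bullet> zc T x))))"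
        unfolding polar_def
        by (intro sum.cong refl) (simp add: m lf_zc[OF d] eval_nat_numeral algebra_simps)
      also have "\<dots> = (\<Sum>a<3. \<Sum>j<28. \<Sum>c<3. crd a (h \<alpha>) * crd c (h \<beta>) * (eb b j * (crd a (lf j) * crd c (lf j) * pw 1 (lf j \<bullet> zc T x))))"
        by (rule sum.swap)
      also have "\<dots> = (\<Sum>a<3. \<Sum>c<3. \<Sum>j<28. crd a (h \<alpha>) * crd c (h \<beta>) * (eb b j * (crd a (lf j) * crd c (lf j) * pw 1 (lf j \<bullet> zc T x))))"
        by (intro sum.cong refl sum.swap)
      finally show ?thesis unfolding Hs_eb sum_distrib_left .
    qed
    also have "\<dots> = 0" using H by (simp add: Hz_def)
    finally show "polar T (eb b) x \<alpha> \<beta> = 0" .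
  qed
qed

lemma jets_Hz: "dtri T \<noteq> 0 \<Longrightarrow> (\<forall>k<7. G T (eb b) k x = 0) \<longleftrightarrow> Hz b (zc T x)"
  using Hz_polar jets_zero_iff by metis

lemma index_cover:
  assumes "i < 27" obtains m where "m < 3" "i \<in> vertex_ix m" | f where "f < 3" "i \<in> edge_ix f"
proof -
  have "i \<in> vertex_ix 0 \<union> vertex_ix 1 \<union> vertex_ix 2 \<union> edge_ix 0 \<union> edge_ix 1 \<union> edge_ix 2"
    using assms by (simp add: vertex_ix_def edge_ix_def) presburger
  then show ?thesis using that[of 0] that(1)[of 1] that(1)[of 2] that(2)[of 1] that(2)[of 2] by auto
qed

lemma jets_vanish_on_triangle:
  assumes d: "dtri T \<noteq> 0" and z: "\<And>x. x \<in> tri_set T \<Longrightarrow> G T e 0 x = G T e' 0 x"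
    and x: "x \<in> tri_set T" and k: "k < 7"
  shows "G T e k x = G T e' k x"
  by (rule C2j_agree[OF C2j_subset[OF G_C2j] G_C2j open_interior interior_subset _ x _ k])
    (use z x interior_subset closure_interior_tri_set[OF d] in auto)

text \<open>A combination vanishing on the triangle has zero 2-jets up to the boundary. This kills
  the vertex coefficients, then the edge coefficients; a multiple of \<open>FT 27\<close> remains
  and is tested at the centroid.\<close>

lemma G_eb_inj:
  assumes d: "dtri T \<noteq> 0" and z: "\<And>x. x \<in> tri_set T \<Longrightarrow> G T (eb b) 0 x = 0" and i: "i < 28"
  shows "b i = 0"
proof -
  have H: "Hz b z" if "nonneg3 z" "csum z = 3" for z
  proof -
    have "bpt T z \<in> tri_set T" using that by (simp add: tri_set_zc[OF d] zc_bpt[OF d])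
    then have "\<forall>k<7. G T (eb b) k (bpt T z) = 0"
      using jets_vanish_on_triangle[OF d, of "eb b" "\<lambda>_. 0"] z by simp
    then show ?thesis using jets_Hz[OF d, of b "bpt T z"] zc_bpt[OF d that(2)] by simp
  qed
  have V: "b i = 0" if "m < 3" "i \<in> vertex_ix m" for m i
    using vertex_unisolvent[OF that(1), of b] that H[of "rp (vtx m)"]
    by (auto simp: vtx_def nonneg3_def all_less_3 csum_def crd_def split: if_splits)
  have E: "b i = 0" if "f < 3" "i \<in> edge_ix f" for f i
  proof -
    have "Hz b (rp (edge_chain f ! 1)) \<and> Hz b (rp (edge_chain f ! 2))"
      by (intro conjI H) (auto simp: edge_chain_def nonneg3_def all_less_3 csum_def crd_def)
    then show ?thesis using edge_unisolvent[OF that(1), of b] V that by blast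
  qed
  have lo: "b i = 0" if "i < 27" for i by (rule index_cover[OF that]) (use V E in auto)
  have "bpt T (1, 1, 1) \<in> tri_set T" by (simp add: tri_set_zc[OF d] zc_bpt[OF d] csum_def crd_def nonneg3_def)
  from z[OF this] have "(\<Sum>i<28. b i * FT i (1, 1, 1)) = 0"
    by (simp add: G_eb_0[OF d] zc_bpt[OF d] csum_def crd_def)
  moreover have "(\<Sum>i<28. b i * FT i (1, 1, 1)) = b 27 * FT 27 (1, 1, 1)"
  proof -
    have "{..<28} = insert 27 {..<27::nat}" by auto
    then show ?thesis using lo by simp
  qed
  ultimately have "b 27 = 0" using FT_27_center by simp
  then show ?thesis using lo[of i] i by (cases "i = 27") auto
qed

text \<open>There are as many basis functions as forms, 18 + 10 = 28, so independence of the former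
  makes the transition matrix \<open>ct\<close> invertible.\<close>

lemma eb_surj:
  assumes d: "dtri T \<noteq> 0" shows "\<exists>b. \<forall>j<28. eb b j = e j"
proof -
  have "b i = 0" if "\<And>k. k < 28 \<Longrightarrow> (\<Sum>i<28. ct i k * b i) = 0" "i < 28" for b i
  proof (rule G_eb_inj[OF d _ that(2)])
    fix x
    have "eb b j = 0" if "j < 28" for j using \<open>\<And>k. k < 28 \<Longrightarrow> _\<close>[OF that] by (simp add: eb_def mult.commute)
    then show "G T (eb b) 0 x = 0" by (simp add: G_def)
  qed
  then have "\<exists>b. \<forall>k<28. (\<Sum>i<28. ct i k * b i) = e k" by (rule square_system_solvable)
  then show ?thesis by (simp add: eb_def mult.commute)
qed

lemma polyd3_forms:
  assumes d: "dtri T \<noteq> 0" and q: "polyd 3 q"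
  shows "\<exists>e. \<forall>x. q x = (\<Sum>j\<in>{18..<28}. e j * (lf j \<bullet> zc T x) ^ 3)"
proof -
  define S where "S = {h. \<exists>e. \<forall>x. h x = (\<Sum>j\<in>{18..<28}. e j * (lf j \<bullet> zc T x) ^ 3)}"
  have add: "(\<lambda>x. h x + g x) \<in> S" if "h \<in> S" "g \<in> S" for h g
  proof -
    obtain e where e: "\<forall>x. h x = (\<Sum>j\<in>{18..<28}. e j * (lf j \<bullet> zc T x) ^ 3)" using \<open>h \<in> S\<close> unfolding S_def by blast
    obtain f where f: "\<forall>x. g x = (\<Sum>j\<in>{18..<28}. f j * (lf j \<bullet> zc T x) ^ 3)" using \<open>g \<in> S\<close> unfolding S_def by blast
    show ?thesis unfolding S_def mem_Collect_eq
      by (rule exI[of _ "\<lambda>j. e j + f j"], rule allI) (simp only: e[rule_format] f[rule_format] distrib_right sum.distrib)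
  qed
  have scale: "(\<lambda>x. c * h x) \<in> S" if "h \<in> S" for h c
  proof -
    obtain e where e: "\<forall>x. h x = (\<Sum>j\<in>{18..<28}. e j * (lf j \<bullet> zc T x) ^ 3)" using \<open>h \<in> S\<close> unfolding S_def by blast
    show ?thesis unfolding S_def mem_Collect_eq
      by (rule exI[of _ "\<lambda>j. c * e j"], rule allI) (simp only: e[rule_format] sum_distrib_left mult.assoc)
  qed
  have sum: "(\<lambda>x. \<Sum>i\<in>A. h i x) \<in> S" if "finite A" "\<And>i. i \<in> A \<Longrightarrow> h i \<in> S" for A :: "nat set" and h
    using that
  proof (induction rule: finite_induct)
    case empty
    show ?case unfolding S_def by (simp add: exI[of _ "\<lambda>_. 0"])
  qed (simp add: add)
  have prod: "(\<lambda>x. (\<alpha> \<bullet> zc T x) * (\<beta> \<bullet> zc T x) * (\<gamma> \<bullet> zc T x)) \<in> S" for \<alpha> \<beta> \<gamma>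
    using cubic_forms[of \<alpha> \<beta> \<gamma>] unfolding S_def by blast
  define X :: hpt where "X = (fst (tv1 T) / 3, fst (tv2 T) / 3, fst (tv3 T) / 3)"
  define Y :: hpt where "Y = (snd (tv1 T) / 3, snd (tv2 T) / 3, snd (tv3 T) / 3)"
  \<comment> \<open>The scaled coordinates sum to 3, so \<open>U\<close> represents the constant 1;
    it pads monomials of lower degree to products of three linear forms.\<close>
  define U :: hpt where "U = (1/3, 1/3, 1/3)"
  have XY: "X \<bullet> zc T x = fst x" "Y \<bullet> zc T x = snd x" "U \<bullet> zc T x = 1" for x
  proof -
    show "X \<bullet> zc T x = fst x" using arg_cong[OF bpt_zc[OF d, of x], of fst]
      by (simp add: X_def crd_inner bpt_def crd_def algebra_simps)
    show "Y \<bullet> zc T x = snd x" using arg_cong[OF bpt_zc[OF d, of x], of snd]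
      by (simp add: Y_def crd_inner bpt_def crd_def algebra_simps)
    show "U \<bullet> zc T x = 1" using csum_zc[of T x] by (simp add: U_def crd_inner csum_def crd_def)
  qed
  have mono: "(\<lambda>x. fst x ^ i * snd x ^ j) \<in> S" if "i + j \<le> 3" for i j
  proof -
    have "i = 0 \<and> j = 0 \<or> i = 0 \<and> j = 1 \<or> i = 0 \<and> j = 2 \<or> i = 0 \<and> j = 3 \<or> i = 1 \<and> j = 0 \<or> i = 1 \<and> j = 1 \<or> i = 1 \<and> j = 2
      \<or> i = 2 \<and> j = 0 \<or> i = 2 \<and> j = 1 \<or> i = 3 \<and> j = 0" using that by presburger
    then show ?thesis
      using prod[of U U U] prod[of U U Y] prod[of U Y Y] prod[of Y Y Y] prod[of U U X] prod[of U X Y] prod[of X Y Y]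
        prod[of U X X] prod[of X X Y] prod[of X X X]
      unfolding XY by (elim disjE) (simp_all add: power2_eq_square power3_eq_cube mult.assoc)
  qed
  from polyd_coeffs[OF q] obtain c where c: "\<forall>x. q x = (\<Sum>i\<le>3. \<Sum>j\<le>3 - i. c i j * fst x ^ i * snd x ^ j)" ..
  have "(\<lambda>x. \<Sum>i\<le>3. \<Sum>j\<le>3 - i. c i j * fst x ^ i * snd x ^ j) \<in> S"
  proof (intro sum)
    fix i j :: nat assume "i \<in> {..3}" "j \<in> {..3 - i}"
    then have "(\<lambda>x. c i j * (fst x ^ i * snd x ^ j)) \<in> S" by (intro scale mono) auto
    then show "(\<lambda>x. c i j * fst x ^ i * snd x ^ j) \<in> S" by (simp add: mult.assoc)
  qed auto
  moreover have "q = (\<lambda>x. \<Sum>i\<le>3. \<Sum>j\<le>3 - i. c i j * fst x ^ i * snd x ^ j)" using c by (intro ext) (rule spec)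
  ultimately have "q \<in> S" by simp
  then show ?thesis by (simp add: S_def)
qed

text \<open>A sign cell is an intersection of convex sets, hence connected, and it avoids the
  segments, so a single component contains it.\<close>

lemma sign_cell_in_ws_cell:
  assumes d: "dtri T \<noteq> 0"
    and K: "K = {x \<in> interior (tri_set T). \<forall>j\<in>{..<18}. if j \<in> P then 0 < nl T j \<bullet> x + cl T j else nl T j \<bullet> x + cl T j < 0}"
    and ne: "K \<noteq> {}"
  shows "\<exists>C\<in>ws_cells T. K \<subseteq> C"
proof -
  have "K = interior (tri_set T) \<inter> (\<Inter>j\<in>{..<18}. if j \<in> P then {x. nl T j \<bullet> x > - cl T j} else {x. nl T j \<bullet> x < - cl T j})"
  proof -
    have "x \<in> (if j \<in> P then {x. nl T j \<bullet> x > - cl T j} else {x. nl T j \<bullet> x < - cl T j})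
      \<longleftrightarrow> (if j \<in> P then 0 < nl T j \<bullet> x + cl T j else nl T j \<bullet> x + cl T j < 0)" for x j
      by (cases "j \<in> P") (simp_all, linarith+)
    then show ?thesis unfolding K by (intro set_eqI) (simp only: mem_Collect_eq Int_iff INT_iff)
  qed
  also have "convex \<dots>"
    by (intro convex_Int convex_INT) (auto simp: convex_halfspace_gt convex_halfspace_lt tri_set_def intro: convex_interior)
  finally have "connected K" by (rule convex_connected)
  moreover have "K \<subseteq> interior (tri_set T) - ws_segments T"
  proof
    fix x assume x: "x \<in> K"
    then have i: "x \<in> interior (tri_set T)" by (simp add: K)
    have "lf j \<bullet> zc T x \<noteq> 0" if "j < 18" for j using x that unfolding K lf_zc[OF d] by (cases "j \<in> P") force+
    then show "x \<in> interior (tri_set T) - ws_segments T"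
      using i ws_segments_iff[OF d, of x] interior_tri_set[OF d] by auto
  qed
  ultimately show ?thesis unfolding ws_cells_def using exists_component_superset[of K] ne by blast
qed

text \<open>The classification yields 18 truncated cubes and a polynomial. The polynomial is a
  combination of cubes of the ten forms that are positive inside, where they coincide with their
  truncations; the 2-jets then extend to the closed triangle by continuity.\<close>

lemma local_form:
  assumes d: "dtri T \<noteq> 0" and F: "C2j (tri_set T) F" and cub: "\<And>C. C \<in> ws_cells T \<Longrightarrow> cubic_on C (F 0)"
  shows "\<exists>b. \<forall>x\<in>tri_set T. \<forall>k<7. F k x = G T (eb b) k x"
proof -
  let ?U = "interior (tri_set T)"
  have "\<exists>q a. polyd 3 q \<and> (\<forall>x\<in>?U. F 0 x = q x + (\<Sum>j\<in>{..<18}. a j * pw 3 (nl T j \<bullet> x + cl T j)))"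
  proof (rule piecewise_cubic_classification)
    show "convex ?U" by (auto simp: tri_set_def intro: convex_interior)
    show "C2j ?U F" by (rule C2j_subset[OF F interior_subset])
    show "card {j \<in> {..<18}. nl T j \<bullet> x + cl T j = 0} \<le> 4" if "x \<in> ?U" for x
      using card_lines_through[of "zc T x"] that unfolding lf_zc[OF d] by (simp add: interior_tri_set[OF d])
    show "nl T j \<noteq> 0" if "j \<in> {..<18}" for j using nl_nonzero[OF d] that by simp
    show "crs (nl T i) (nl T j) \<noteq> 0"
      if "i \<in> {..<18}" "j \<in> {..<18}" "i \<noteq> j" "x \<in> ?U" "nl T i \<bullet> x + cl T i = 0" "nl T j \<bullet> x + cl T j = 0" for i j x
      using nl_crossing[OF d] that by auto
    fix P
    let ?K = "{x \<in> ?U. \<forall>j\<in>{..<18}. if j \<in> P then 0 < nl T j \<bullet> x + cl T j else nl T j \<bullet> x + cl T j < 0}"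
    show "cubic_on ?K (F 0)"
    proof (cases "?K = {}")
      case True
      show ?thesis unfolding True cubic_on_def by simp
    next
      case False
      from sign_cell_in_ws_cell[OF d refl False] obtain C where C: "C \<in> ws_cells T" "?K \<subseteq> C" ..
      show ?thesis using cub[OF C(1)] C(2) unfolding cubic_on_def by blast
    qed
  qed auto
  then obtain q a where q: "polyd 3 q" "\<And>x. x \<in> ?U \<Longrightarrow> F 0 x = q x + (\<Sum>j<18. a j * pw 3 (nl T j \<bullet> x + cl T j))" by blast
  obtain e where e: "\<forall>x. q x = (\<Sum>j\<in>{18..<28}. e j * (lf j \<bullet> zc T x) ^ 3)" using polyd3_forms[OF d q(1)] by blast
  define e' where "e' j = (if j < 18 then a j else e j)" for j
  obtain b where b: "\<And>j. j < 28 \<Longrightarrow> eb b j = e' j" using eb_surj[OF d, of e'] by blast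
  have U: "F 0 x = G T (eb b) 0 x" if x: "x \<in> ?U" for x
  proof -
    have "G T (eb b) 0 x = (\<Sum>j<28. e' j * pw 3 (lf j \<bullet> zc T x))" by (simp add: G_0[OF d] b)
    also have "\<dots> = (\<Sum>j<18. e' j * pw 3 (lf j \<bullet> zc T x)) + (\<Sum>j\<in>{18..<28}. e' j * pw 3 (lf j \<bullet> zc T x))"
      by (subst sum.union_disjoint[symmetric]) (auto intro!: sum.cong)
    also have "(\<Sum>j\<in>{18..<28}. e' j * pw 3 (lf j \<bullet> zc T x)) = q x"
      unfolding e[rule_format] using form_pos[of _ "zc T x"] x
      by (intro sum.cong refl) (auto simp: e'_def pw_def interior_tri_set[OF d] dest!: form_pos)
    finally show ?thesis using q(2)[OF x] by (simp add: e'_def lf_zc[OF d])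
  qed
  have "F k x = G T (eb b) k x" if "x \<in> tri_set T" "k < 7" for x k
    by (rule C2j_agree[OF F G_C2j open_interior interior_subset U that(1) _ that(2)])
      (use that closure_interior_tri_set[OF d] in auto)
  then show ?thesis by blast
qed

lemma G_cubic_on_cells:
  assumes d: "dtri T \<noteq> 0" and C: "C \<in> ws_cells T" shows "cubic_on C (G T e 0)"
proof -
  have Cs: "C \<subseteq> interior (tri_set T) - ws_segments T" "connected C"
    using C in_components_subset in_components_connected unfolding ws_cells_def by blast+
  have nz: "nl T j \<bullet> x + cl T j \<noteq> 0" if "x \<in> C" "j < 18" for x j
    using ws_segments_iff[OF d, of x] Cs(1) that unfolding interior_tri_set[OF d] lf_zc[OF d] by blast
  have sign: "(\<forall>x\<in>C. 0 < nl T j \<bullet> x + cl T j) \<or> (\<forall>x\<in>C. nl T j \<bullet> x + cl T j < 0)" if j: "j < 18" for j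
  proof (rule ccontr)
    assume "\<not> ?thesis"
    then obtain x y where xy: "x \<in> C" "y \<in> C" "nl T j \<bullet> x + cl T j < 0" "0 < nl T j \<bullet> y + cl T j"
      using nz[OF _ j] by (meson linorder_neqE_linordered_idom)
    have "connected ((\<lambda>x. nl T j \<bullet> x + cl T j) ` C)"
      by (intro connected_continuous_image Cs(2) continuous_intros)
    then have "0 \<in> (\<lambda>x. nl T j \<bullet> x + cl T j) ` C"
      using connectedD_interval[of "(\<lambda>x. nl T j \<bullet> x + cl T j) ` C" _ _ 0] xy by (meson imageI less_imp_le)
    then show False using nz[OF _ j] by auto
  qed
  have "\<exists>q. polyd 3 q \<and> (\<forall>x\<in>C. pw 3 (nl T j \<bullet> x + cl T j) = q x)" if j: "j < 28" for j
  proof -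
    have "(\<forall>x\<in>C. 0 < nl T j \<bullet> x + cl T j) \<or> (\<forall>x\<in>C. nl T j \<bullet> x + cl T j < 0)"
    proof (cases "j < 18")
      case False
      then have "0 < nl T j \<bullet> x + cl T j" if "x \<in> C" for x
        using form_pos[of j "zc T x"] j that Cs(1) unfolding interior_tri_set[OF d] lf_zc[OF d] by auto
      then show ?thesis by blast
    qed (rule sign)
    then show ?thesis
    proof
      assume "\<forall>x\<in>C. 0 < nl T j \<bullet> x + cl T j"
      then show ?thesis by (intro exI[of _ "\<lambda>x. (nl T j \<bullet> x + cl T j) ^ 3"] conjI polyd_affine_power) (simp add: pw_def)
    next
      assume "\<forall>x\<in>C. nl T j \<bullet> x + cl T j < 0"
      then show ?thesis by (intro exI[of _ "\<lambda>x. 0"] conjI polyd_const) (force simp: pw_def)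
    qed
  qed
  then obtain q where q: "\<And>j. j < 28 \<Longrightarrow> polyd 3 (q j)" "\<And>j x. j < 28 \<Longrightarrow> x \<in> C \<Longrightarrow> pw 3 (nl T j \<bullet> x + cl T j) = q j x"
    by metis
  have "polyd 3 (\<lambda>x. \<Sum>j<28. e j * q j x)" by (intro polyd_sum polyd_scale q) auto
  moreover have "\<forall>x\<in>C. G T e 0 x = (\<Sum>j<28. e j * q j x)" using q(2) by (simp add: G_def pwj_def)
  ultimately show ?thesis unfolding cubic_on_iff_polyd by blast
qed

section \<open>Edges and gluing\<close>

definition tvx :: "tri \<Rightarrow> nat \<Rightarrow> pt" where
  "tvx T m = (if m = 0 then tv1 T else if m = 1 then tv2 T else tv3 T)"

lemma ex_less_3: "(\<exists>i<3. P i) \<longleftrightarrow> P 0 \<or> P 1 \<or> P (2::nat)"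
  by (simp add: eval_nat_numeral Ex_less_Suc disj_ac)

definition third :: "pt \<Rightarrow> pt \<Rightarrow> pt" where "third v w = (2/3) *\<^sub>R v + (1/3) *\<^sub>R w"

lemma vset_tvx: "vset T = tvx T ` {..<3}"
  by (auto simp: vset_def tvx_def lessThan_nat_numeral)

lemma zc_tvx: "dtri T \<noteq> 0 \<Longrightarrow> zc T (tvx T m) = rp (vtx m)"
  by (simp add: tvx_def vtx_def zc_vertices rp_def)

lemma zc_third:
  assumes d: "dtri T \<noteq> 0" shows "zc T (third v w) = (2/3) *\<^sub>R zc T v + (1/3) *\<^sub>R zc T w"
proof -
  have "third v w = v + (- 1/3) *\<^sub>R (v - w)" by (simp add: third_def prod_eq_iff field_simps)
  then have "zc T (third v w) = zc T v + (- 1/3) *\<^sub>R (zc T v - zc T w)" by (simp only: zc_segment[OF d])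
  then show ?thesis by (simp add: prod_eq_iff field_simps)
qed

lemma zc_chain:
  assumes d: "dtri T \<noteq> 0" and f: "f < 3" and v: "v = tvx T ((f + 1) mod 3)" and w: "w = tvx T ((f + 2) mod 3)"
  shows "zc T v = rp (edge_chain f ! 0)" "zc T (third v w) = rp (edge_chain f ! 1)"
    "zc T (third w v) = rp (edge_chain f ! 2)" "zc T w = rp (edge_chain f ! 3)"
proof -
  have "f = 0 \<or> f = 1 \<or> f = 2" using f by auto
  then show "zc T v = rp (edge_chain f ! 0)" "zc T (third v w) = rp (edge_chain f ! 1)"
    "zc T (third w v) = rp (edge_chain f ! 2)" "zc T w = rp (edge_chain f ! 3)"
    unfolding zc_third[OF d] unfolding v w zc_tvx[OF d] by (elim disjE; simp add: edge_chain_def vtx_def rp_def)+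
qed

lemma edge_orientation:
  assumes "v \<in> vset T" "w \<in> vset T" "v \<noteq> w"
  shows "\<exists>f<3. v = tvx T ((f + 1) mod 3) \<and> w = tvx T ((f + 2) mod 3) \<or> w = tvx T ((f + 1) mod 3) \<and> v = tvx T ((f + 2) mod 3)"
proof -
  obtain a b where ab: "a < 3" "b < 3" "v = tvx T a" "w = tvx T b" using assms(1,2) unfolding vset_tvx by auto
  then have "a \<noteq> b" using assms(3) by auto
  moreover have "a = 0 \<or> a = 1 \<or> a = 2" "b = 0 \<or> b = 1 \<or> b = 2" using ab(1,2) by linarith+
  ultimately have "\<exists>f<3. a = (f + 1) mod 3 \<and> b = (f + 2) mod 3 \<or> b = (f + 1) mod 3 \<and> a = (f + 2) mod 3"
    unfolding ex_less_3 by (elim disjE) simp_all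
  then show ?thesis using ab(3,4) by blast
qed

text \<open>Interior lines of the split end at knots, so no form changes sign strictly between
  neighbouring points of the chain formed by the end points and the thirds.\<close>

lemma edge_signs:
  assumes d: "dtri T \<noteq> 0" and vw: "v \<in> vset T" "w \<in> vset T" "v \<noteq> w" and j: "j < 28"
  shows "0 \<le> ml T j (1, v) * ml T j (1, third v w) \<and> 0 \<le> ml T j (1, third v w) * ml T j (1, third w v)
    \<and> 0 \<le> ml T j (1, third w v) * ml T j (1, w)"
proof -
  have m: "ml T j (1, x) = lf j \<bullet> zc T x" for x by (simp add: ml_def lf_zc[OF d])
  have c: "0 \<le> (lf j \<bullet> rp (edge_chain f ! m)) * (lf j \<bullet> rp (edge_chain f ! Suc m))" if "f < 3" "m < 3" for f m
  proof -
    have "0 \<le> lvals (edge_chain f ! m) ! j * lvals (edge_chain f ! Suc m) ! j"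
      using compat_chain[OF that] j unfolding compat_def list_all2_conv_all_nth by (simp add: lvals_def length_lform)
    then have "0 \<le> real_of_int (lvals (edge_chain f ! m) ! j) * real_of_int (lvals (edge_chain f ! Suc m) ! j)"
      by (simp flip: of_int_mult)
    then show ?thesis by (simp only: nth_lvals[OF j])
  qed
  have s: "0 \<le> (lf j \<bullet> zc T a) * (lf j \<bullet> zc T (third a b)) \<and> 0 \<le> (lf j \<bullet> zc T (third a b)) * (lf j \<bullet> zc T (third b a))
     \<and> 0 \<le> (lf j \<bullet> zc T (third b a)) * (lf j \<bullet> zc T b)"
    if f: "f < 3" and "a = tvx T ((f + 1) mod 3)" "b = tvx T ((f + 2) mod 3)" for a b f
    unfolding zc_chain[OF d that] using c[OF f, of 0] c[OF f, of 1] c[OF f, of 2] by (simp add: eval_nat_numeral)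
  from edge_orientation[OF vw] obtain f where "f < 3"
    "v = tvx T ((f + 1) mod 3) \<and> w = tvx T ((f + 2) mod 3) \<or> w = tvx T ((f + 1) mod 3) \<and> v = tvx T ((f + 2) mod 3)" by blast
  then show ?thesis unfolding m using s[of f v w] s[of f w v] by (auto simp: mult.commute)
qed

lemma polar_sym: "polar T e x \<alpha> \<beta> = polar T e x \<beta> \<alpha>"
  by (simp add: polar_def mult_ac)

lemma polar_linear: "polar T e x (a *\<^sub>R \<alpha> + b *\<^sub>R \<beta>) \<gamma> = a * polar T e x \<alpha> \<gamma> + b * polar T e x \<beta> \<gamma>"
proof -
  have "ml T j (a *\<^sub>R \<alpha> + b *\<^sub>R \<beta>) = a * ml T j \<alpha> + b * ml T j \<beta>" for j
    by (simp add: ml_def inner_add_right algebra_simps)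
  then show ?thesis
    unfolding polar_def sum_distrib_left sum.distrib[symmetric] by (simp add: algebra_simps)
qed

text \<open>Symmetry of the polar form of the cubic along a segment on which no breakline is crossed;
  this is where \<open>C\<^sup>2\<close> smoothness across the points of the split enters.\<close>

lemma polar_swap:
  assumes "\<And>j. j < 28 \<Longrightarrow> 0 \<le> ml T j (1, x) * ml T j (1, y)"
  shows "polar T e x (1, y) \<beta> = polar T e y (1, x) \<beta>"
  unfolding polar_def
proof (intro sum.cong refl)
  fix j assume "j \<in> {..<28::nat}"
  then have "0 \<le> ml T j (1, x) * ml T j (1, y)" using assms by simp
  then have "ml T j (1, y) * pw 1 (ml T j (1, x)) = ml T j (1, x) * pw 1 (ml T j (1, y))"
    by (auto simp: pw_def zero_le_mult_iff)
  then show "e j * (ml T j (1, y) * ml T j \<beta> * pw 1 (nl T j \<bullet> x + cl T j)) = e j * (ml T j (1, x) * ml T j \<beta> * pw 1 (nl T j \<bullet> y + cl T j))"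
    by (simp add: ml_def)
qed

text \<open>Where no form changes sign, the positive parts, and with them the Hessian, are affine
  along the segment.\<close>

lemma polar_between:
  assumes s: "\<And>j. j < 28 \<Longrightarrow> 0 \<le> ml T j (1, x) * ml T j (1, y)" and t: "0 \<le> t" "t \<le> 1"
  shows "polar T e ((1 - t) *\<^sub>R x + t *\<^sub>R y) \<alpha> \<beta> = (1 - t) * polar T e x \<alpha> \<beta> + t * polar T e y \<alpha> \<beta>"
proof -
  have P: "pw 1 (nl T j \<bullet> ((1 - t) *\<^sub>R x + t *\<^sub>R y) + cl T j) = (1 - t) * pw 1 (nl T j \<bullet> x + cl T j) + t * pw 1 (nl T j \<bullet> y + cl T j)" if "j < 28" for j
  proof -
    define a where "a = nl T j \<bullet> x + cl T j"
    define b where "b = nl T j \<bullet> y + cl T j"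
    have l: "nl T j \<bullet> ((1 - t) *\<^sub>R x + t *\<^sub>R y) + cl T j = (1 - t) * a + t * b"
      by (simp add: a_def b_def inner_add_right algebra_simps)
    have p: "pw 1 u = max u 0" for u by (simp add: pw_def max_def)
    have "0 \<le> a * b" using s[OF that] by (simp add: ml_def a_def b_def)
    then consider "0 \<le> a" "0 \<le> b" | "a \<le> 0" "b \<le> 0" by (auto simp: zero_le_mult_iff)
    then show ?thesis unfolding l a_def[symmetric] b_def[symmetric]
    proof cases
      case 1
      then have "0 \<le> (1 - t) * a + t * b" using t by simp
      then show "pw 1 ((1 - t) * a + t * b) = (1 - t) * pw 1 a + t * pw 1 b" using 1 unfolding p by (simp only: max_absorb1)
    next
      case 2
      then have "(1 - t) * a \<le> 0" "t * b \<le> 0" using t by (auto simp: mult_nonneg_nonpos)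
      then show "pw 1 ((1 - t) * a + t * b) = (1 - t) * pw 1 a + t * pw 1 b" using 2 unfolding p by (simp add: max_def)
    qed
  qed
  show ?thesis unfolding polar_def sum_distrib_left sum.distrib[symmetric]
  proof (intro sum.cong refl)
    fix j assume "j \<in> {..<28::nat}"
    then have j: "j < 28" by simp
    show "e j * (ml T j \<alpha> * ml T j \<beta> * pw 1 (nl T j \<bullet> ((1 - t) *\<^sub>R x + t *\<^sub>R y) + cl T j))
      = (1 - t) * (e j * (ml T j \<alpha> * ml T j \<beta> * pw 1 (nl T j \<bullet> x + cl T j))) + t * (e j * (ml T j \<alpha> * ml T j \<beta> * pw 1 (nl T j \<bullet> y + cl T j)))"
      unfolding P[OF j] by (simp only: distrib_left mult.assoc mult.left_commute)
  qed
qed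

definition nrm :: "pt \<Rightarrow> pt \<Rightarrow> real \<times> pt" where "nrm v w = (0, perp (w - v))"

lemma frame_span:
  assumes "v \<noteq> w"
  shows "\<exists>a b c. \<alpha> = a *\<^sub>R (1, v) + (b *\<^sub>R (1, w) + c *\<^sub>R nrm v w)"
proof -
  obtain s u1 u2 where \<alpha>: "\<alpha> = (s, u1, u2)" by (metis prod.collapse)
  define p where "p = fst w - fst v"
  define q where "q = snd w - snd v"
  have n: "p * p + q * q \<noteq> 0"
  proof
    assume "p * p + q * q = 0"
    then have "p = 0 \<and> q = 0" by (simp add: sum_squares_eq_zero_iff)
    then show False using assms by (simp add: p_def q_def prod_eq_iff)
  qed
  define x where "x = u1 - s * fst v"
  define y where "y = u2 - s * snd v"
  \<comment> \<open>b and c are the components of (x, y) along \<open>w - v\<close> and along its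
    rotation by a right angle.\<close>
  define b where "b = (x * p + y * q) / (p * p + q * q)"
  define c where "c = (y * p - x * q) / (p * p + q * q)"
  have "b * p - c * q = x" "b * q + c * p = y"
  proof -
    have "(p * p + q * q) * b = x * p + y * q" "(p * p + q * q) * c = y * p - x * q" using n by (simp_all add: b_def c_def)
    then have "(p * p + q * q) * (b * p - c * q) = (p * p + q * q) * x" "(p * p + q * q) * (b * q + c * p) = (p * p + q * q) * y"
      by algebra+
    then show "b * p - c * q = x" "b * q + c * p = y" using n by auto
  qed
  then have "\<alpha> = (s - b) *\<^sub>R (1, v) + (b *\<^sub>R (1, w) + c *\<^sub>R nrm v w)"
    by (simp add: \<alpha> nrm_def perp_def prod_eq_iff x_def y_def p_def q_def algebra_simps)
  then show ?thesis by blast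
qed

text \<open>Write V, W for (1, v), (1, w) and D for the difference of the two forms. Swapping along
  the outer segments gives D p V = 0 and D q W = 0, and along the middle one D p W = D q V.
  Evaluating these at V, W and N leaves open only D p W N, which equals D q V N, and the entries N N
  at p and at q; three nodal values settle them.\<close>

lemma edge_jets_determined:
  fixes v w :: pt
  defines "p \<equiv> third v w" and "q \<equiv> third w v" and "N \<equiv> nrm v w"
  assumes d: "dtri T \<noteq> 0" "dtri T' \<noteq> 0" and vw: "v \<noteq> w" "v \<in> vset T" "w \<in> vset T" "v \<in> vset T'" "w \<in> vset T'"
    and jv: "\<forall>k<7. G T e k v = G T' e' k v" and jw: "\<forall>k<7. G T e k w = G T' e' k w"
    and nod: "polar T e p (1, p) N = polar T' e' p (1, p) N" "polar T e p N N = polar T' e' p N N" "polar T e q N N = polar T' e' q N N"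
    and x: "x \<in> closed_segment v w"
  shows "\<forall>k<7. G T e k x = G T' e' k x"
proof -
  define D where "D x \<alpha> \<beta> = polar T e x \<alpha> \<beta> - polar T' e' x \<alpha> \<beta>" for x \<alpha> \<beta>
  have sym: "D x \<alpha> \<beta> = D x \<beta> \<alpha>" for x \<alpha> \<beta> unfolding D_def using polar_sym by simp
  have lin: "D x (a *\<^sub>R \<alpha> + b *\<^sub>R \<beta>) \<gamma> = a * D x \<alpha> \<gamma> + b * D x \<beta> \<gamma>" for x a b \<alpha> \<beta> \<gamma>
    unfolding D_def polar_linear by (simp add: algebra_simps)
  note S = edge_signs[OF d(1) vw(2,3,1), folded p_def q_def] and S' = edge_signs[OF d(2) vw(4,5,1), folded p_def q_def]
  have swap: "D v (1, p) \<beta> = D p (1, v) \<beta>" "D p (1, q) \<beta> = D q (1, p) \<beta>" "D q (1, w) \<beta> = D w (1, q) \<beta>" for \<beta>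
    unfolding D_def
    using polar_swap[of T v p e] polar_swap[of T' v p e'] polar_swap[of T p q e] polar_swap[of T' p q e'] polar_swap[of T q w e] polar_swap[of T' q w e'] S S'
    by simp_all
  have D0: "D v \<alpha> \<beta> = 0" "D w \<alpha> \<beta> = 0" for \<alpha> \<beta> using jv jw unfolding jets_eq_iff D_def by (simp_all only: simp_thms diff_self)
  have pq: "(1::real, p) = (2/3) *\<^sub>R (1, v) + (1/3) *\<^sub>R (1, w)" "(1, q) = (1/3) *\<^sub>R (1, v) + (2/3) *\<^sub>R (1::real, w)"
    by (simp_all add: p_def q_def third_def)
  have pV: "D p (1, v) \<beta> = 0" and qW: "D q (1, w) \<beta> = 0" for \<beta> using swap(1,3)[of \<beta>] D0 by simp_all
  have mid: "2 * D p (1, w) \<beta> = 2 * D q (1, v) \<beta>" for \<beta>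
    using swap(2)[of \<beta>] unfolding pq lin pV qW by simp
  have pWN: "D p (1, w) N = 0" using nod(1) pV[of N] lin[of p "2/3" "(1, v)" "1/3" "(1, w)" N] unfolding pq(1)[symmetric] D_def by simp
  have pWW: "D p (1, w) (1, w) = 0" using mid[of "(1, w)"] sym[of q "(1, v)" "(1, w)"] qW[of "(1, v)"] by simp
  have qVV: "D q (1, v) (1, v) = 0" using mid[of "(1, v)"] sym[of p "(1, w)" "(1, v)"] pV[of "(1, w)"] by simp
  have NN: "D p N N = 0" "D q N N = 0" using nod(2,3) by (simp_all add: D_def)
  have ext: "D y \<alpha> \<beta> = 0" if b: "\<And>\<gamma> \<delta>. \<gamma> \<in> {(1, v), (1, w), N} \<Longrightarrow> \<delta> \<in> {(1, v), (1, w), N} \<Longrightarrow> D y \<gamma> \<delta> = 0" for y \<alpha> \<beta>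
  proof -
    have l3: "D y (a *\<^sub>R (1, v) + (b *\<^sub>R (1, w) + c *\<^sub>R N)) \<gamma> = a * D y (1, v) \<gamma> + (b * D y (1, w) \<gamma> + c * D y N \<gamma>)" for a b c \<gamma>
      using lin[of y a "(1, v)" 1 "b *\<^sub>R (1, w) + c *\<^sub>R N" \<gamma>] lin[of y b "(1, w)" c N \<gamma>] by simp
    obtain a b c where \<alpha>: "\<alpha> = a *\<^sub>R (1, v) + (b *\<^sub>R (1, w) + c *\<^sub>R N)" using frame_span[OF vw(1), of \<alpha>] unfolding N_def by blast
    obtain a' b' c' where \<beta>: "\<beta> = a' *\<^sub>R (1, v) + (b' *\<^sub>R (1, w) + c' *\<^sub>R N)" using frame_span[OF vw(1), of \<beta>] unfolding N_def by blast
    have "D y \<beta> \<gamma> = 0" if "\<gamma> \<in> {(1, v), (1, w), N}" for \<gamma>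
      unfolding \<beta> l3 using b[OF _ that] by simp
    then have "D y \<gamma> \<beta> = 0" if "\<gamma> \<in> {(1, v), (1, w), N}" for \<gamma> using sym[of y \<gamma> \<beta>] that by simp
    then show ?thesis unfolding \<alpha> l3 by simp
  qed
  have Dp: "D p \<alpha> \<beta> = 0" for \<alpha> \<beta>
  proof (rule ext)
    have s: "D p \<gamma> (1, v) = 0" "D p N (1, w) = 0" for \<gamma> using pV[of \<gamma>] sym[of p \<gamma> "(1, v)"] pWN sym[of p N "(1, w)"] by simp_all
    show "D p \<gamma> \<delta> = 0" if "\<gamma> \<in> {(1, v), (1, w), N}" "\<delta> \<in> {(1, v), (1, w), N}" for \<gamma> \<delta>
      using that by (elim insertE emptyE) (simp_all only: s pV pWN pWW NN)
  qed
  have qVN: "D q (1, v) N = 0" using mid[of N] pWN by simp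
  have Dq: "D q \<alpha> \<beta> = 0" for \<alpha> \<beta>
  proof (rule ext)
    have s: "D q \<gamma> (1, w) = 0" "D q N (1, v) = 0" for \<gamma> using qW[of \<gamma>] sym[of q \<gamma> "(1, w)"] qVN sym[of q N "(1, v)"] by simp_all
    show "D q \<gamma> \<delta> = 0" if "\<gamma> \<in> {(1, v), (1, w), N}" "\<delta> \<in> {(1, v), (1, w), N}" for \<gamma> \<delta>
      using that by (elim insertE emptyE) (simp_all only: s qW qVN qVV NN)
  qed
  obtain t where t: "0 \<le> t" "t \<le> 1" "x = (1 - t) *\<^sub>R v + t *\<^sub>R w" using x unfolding in_segment by blast
  have seg: "D ((1 - r) *\<^sub>R y + r *\<^sub>R z) \<alpha> \<beta> = 0"
    if "0 \<le> r" "r \<le> 1" "\<And>j. j < 28 \<Longrightarrow> 0 \<le> ml T j (1, y) * ml T j (1, z)" "\<And>j. j < 28 \<Longrightarrow> 0 \<le> ml T' j (1, y) * ml T' j (1, z)"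
      "D y \<alpha> \<beta> = 0" "D z \<alpha> \<beta> = 0" for r y z \<alpha> \<beta>
  proof -
    have "D ((1 - r) *\<^sub>R y + r *\<^sub>R z) \<alpha> \<beta> = (1 - r) * D y \<alpha> \<beta> + r * D z \<alpha> \<beta>"
      using polar_between[OF that(3,1,2), of e \<alpha> \<beta>] polar_between[OF that(4,1,2), of e' \<alpha> \<beta>]
      unfolding D_def right_diff_distrib by linarith
    then show ?thesis using that(5,6) by simp
  qed
  consider "t \<le> 1/3" | "1/3 \<le> t" "t \<le> 2/3" | "2/3 \<le> t" by linarith
  then have "D x \<alpha> \<beta> = 0" for \<alpha> \<beta>
  proof cases
    case 1
    have "x = (1 - 3 * t) *\<^sub>R v + (3 * t) *\<^sub>R p" by (simp add: t(3) p_def third_def prod_eq_iff field_simps)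
    then show ?thesis using seg[of "3 * t" v p \<alpha> \<beta>] 1 t(1) S S' D0 Dp by simp
  next
    case 2
    have "x = (1 - (3 * t - 1)) *\<^sub>R p + (3 * t - 1) *\<^sub>R q" by (simp add: t(3) p_def q_def third_def prod_eq_iff field_simps)
    then show ?thesis using seg[of "3 * t - 1" p q \<alpha> \<beta>] 2 S S' Dp Dq by simp
  next
    case 3
    have "x = (1 - (3 * t - 2)) *\<^sub>R q + (3 * t - 2) *\<^sub>R w" by (simp add: t(3) q_def third_def prod_eq_iff field_simps)
    then show ?thesis using seg[of "3 * t - 2" q w \<alpha> \<beta>] 3 t(2) S S' D0 Dq by simp
  qed
  then show ?thesis unfolding jets_eq_iff D_def by (simp only: right_minus_eq simp_thms)
qed

section \<open>Uniqueness of local coefficients and passage to the basis \<open>Bt\<close>\<close>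

lemma G_diff: "G T (\<lambda>j. e j - e' j) k x = G T e k x - G T e' k x"
  by (simp add: G_def left_diff_distrib sum_subtractf)

lemma eb_diff: "eb (\<lambda>i. b i - b' i) = (\<lambda>j. eb b j - eb b' j)"
  by (simp add: eb_def left_diff_distrib sum_subtractf fun_eq_iff)

lemma G_eb_unique:
  assumes d: "dtri T \<noteq> 0" and z: "\<And>x. x \<in> tri_set T \<Longrightarrow> G T (eb b) 0 x = G T (eb b') 0 x" and i: "i < 28"
  shows "b i = b' i"
  using G_eb_inj[OF d, of "\<lambda>i. b i - b' i"] z i by (simp add: eb_diff G_diff)

lemma jets_vertex: "dtri T \<noteq> 0 \<Longrightarrow> m < 3 \<Longrightarrow> (\<forall>k<7. G T (eb b) k (tvx T m) = 0) \<longleftrightarrow> (\<forall>i\<in>vertex_ix m. b i = 0)"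
  by (simp add: jets_Hz zc_tvx vertex_unisolvent)

lemma jets_edge:
  assumes d: "dtri T \<noteq> 0" and f: "f < 3" and v: "v = tvx T ((f + 1) mod 3)" and w: "w = tvx T ((f + 2) mod 3)"
    and z: "\<And>m i. m < 3 \<Longrightarrow> m \<noteq> f \<Longrightarrow> i \<in> vertex_ix m \<Longrightarrow> b i = 0"
  shows "(\<forall>k<7. G T (eb b) k (third v w) = 0) \<and> (\<forall>k<7. G T (eb b) k (third w v) = 0) \<longleftrightarrow> (\<forall>i\<in>edge_ix f. b i = 0)"
  unfolding jets_Hz[OF d] zc_chain[OF d f v w] using edge_unisolvent[OF f z] .

text \<open>Coefficients with respect to \<open>FT\<close> from coefficients with respect to the basis \<open>Bt\<close>.\<close>

definition tr :: "tri \<Rightarrow> (nat \<Rightarrow> real) \<Rightarrow> nat \<Rightarrow> real" where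
  "tr T \<beta> i = (if i < 27 then kap T i * \<beta> (Suc i)
     else kap T 27 / 3 * (\<Sum>j\<in>{21..<27}. \<beta> (Suc j)) - kap T 27 * \<beta> 28)"

lemma sum_Bt:
  assumes d: "dtri T \<noteq> 0" and x: "x \<in> tri_set T"
  shows "(\<Sum>i=1..28. \<beta> i * Bt T i x) = G T (eb (tr T \<beta>)) 0 x"
proof -
  define z where "z = zc T x"
  have s28: "{..<28} = insert 27 {..<27::nat}" by auto
  have "(\<Sum>i=1..28. \<beta> i * Bt T i x) = (\<Sum>i<28. \<beta> (Suc i) * Bt T (Suc i) x)"
    by (rule sum.reindex_bij_witness[of _ Suc "\<lambda>i. i - 1"]) auto
  also have "\<dots> = (\<Sum>i<27. \<beta> (Suc i) * Bt T (Suc i) x) + \<beta> 28 * Bt T 28 x"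
    unfolding s28 by (simp add: add.commute)
  also have "(\<Sum>i<27. \<beta> (Suc i) * Bt T (Suc i) x)
     = (\<Sum>i<27. tr T \<beta> i * FT i z + (if 21 \<le> i then \<beta> (Suc i) * (kap T 27 / 3 * FT 27 z) else 0))"
    using Bt_FT(1)[OF d x] by (intro sum.cong refl) (simp add: tr_def z_def algebra_simps)
  also have "\<dots> = (\<Sum>i<27. tr T \<beta> i * FT i z) + (\<Sum>i<27. if 21 \<le> i then \<beta> (Suc i) * (kap T 27 / 3 * FT 27 z) else 0)"
    by (rule sum.distrib)
  also have "(\<Sum>i<27. if 21 \<le> i then \<beta> (Suc i) * (kap T 27 / 3 * FT 27 z) else 0)
     = (\<Sum>i\<in>{21..<27}. \<beta> (Suc i) * (kap T 27 / 3 * FT 27 z))"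
    by (subst sum.inter_filter[symmetric]) (auto intro: sum.cong)
  also have "\<dots> = (\<Sum>i\<in>{21..<27}. \<beta> (Suc i)) * (kap T 27 / 3 * FT 27 z)" by (rule sum_distrib_right[symmetric])
  also have "(\<Sum>i<27. tr T \<beta> i * FT i z) + (\<Sum>i\<in>{21..<27}. \<beta> (Suc i)) * (kap T 27 / 3 * FT 27 z) + \<beta> 28 * Bt T 28 x
    = (\<Sum>i<27. tr T \<beta> i * FT i z) + tr T \<beta> 27 * FT 27 z"
    using Bt_FT(2)[OF d x] by (simp add: tr_def z_def algebra_simps)
  also have "\<dots> = (\<Sum>i<28. tr T \<beta> i * FT i z)" unfolding s28 by simp
  finally show ?thesis by (simp add: G_eb_0[OF d] z_def)
qed

lemma tr_surj:
  assumes nd: "nondegenerate T"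
  shows "\<exists>\<beta>. (\<forall>i. i \<notin> {1..28} \<longrightarrow> \<beta> i = 0) \<and> (\<forall>i<28. tr T \<beta> i = b i)"
proof -
  note k = kap_pos[OF nd]
  define g where "g i = b (i - 1) / kap T (i - 1)" for i
  \<comment> \<open>The first 27 values are forced by rescaling; the value at 28 is then solved from
    the equation of row 27.\<close>
  define \<beta> where "\<beta> i = (if i \<in> {1..27} then g i
    else if i = 28 then (\<Sum>j\<in>{21..<27}. g (Suc j)) / 3 - b 27 / kap T 27 else 0)" for i
  have s: "(\<Sum>j\<in>{21..<27}. \<beta> (Suc j)) = (\<Sum>j\<in>{21..<27}. g (Suc j))"
    by (intro sum.cong refl) (auto simp: \<beta>_def)
  have "tr T \<beta> i = b i" if "i < 28" for i
  proof (cases "i < 27")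
    case True
    then show ?thesis using k[of i] by (simp add: tr_def \<beta>_def g_def)
  next
    case False
    then have "i = 27" using that by simp
    then show ?thesis using k[of 27] unfolding tr_def s by (simp add: \<beta>_def field_simps)
  qed
  then show ?thesis by (intro exI[of _ \<beta>]) (auto simp: \<beta>_def)
qed

lemma tr_inj:
  assumes nd: "nondegenerate T" and z: "\<And>i. i \<notin> {1..28} \<Longrightarrow> \<beta> i = 0" "\<And>i. i \<notin> {1..28} \<Longrightarrow> \<beta>' i = 0"
    and eq: "\<And>i. i < 28 \<Longrightarrow> tr T \<beta> i = tr T \<beta>' i"
  shows "\<beta> = \<beta>'"
proof
  fix i
  note k = kap_pos[OF nd]
  have lo: "\<beta> (Suc j) = \<beta>' (Suc j)" if "j < 27" for j
    using eq[of j] k[of j] that by (simp add: tr_def)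
  have "(\<Sum>j\<in>{21..<27}. \<beta> (Suc j)) = (\<Sum>j\<in>{21..<27}. \<beta>' (Suc j))" using lo by (intro sum.cong) auto
  then have hi: "\<beta> 28 = \<beta>' 28" using eq[of 27] k[of 27] by (simp add: tr_def)
  show "\<beta> i = \<beta>' i"
  proof (cases "i \<in> {1..28}")
    case True
    then have "i = 28 \<or> i = Suc (i - 1) \<and> i - 1 < 27" by auto
    then show ?thesis using lo[of "i - 1"] hi by auto
  qed (simp add: z)
qed

text \<open>Justifies the definite description in \<open>bcoeffs\<close>: existence comes from
  \<open>tr_surj\<close>, uniqueness from the uniqueness of coefficients with respect to
  \<open>FT\<close> together with \<open>tr_inj\<close>, for sequences supported in {1..28}.\<close>

lemma tr_bcoeffs:
  assumes nd: "nondegenerate T" and s: "\<And>x. x \<in> tri_set T \<Longrightarrow> s x = G T (eb b) 0 x" and i: "i < 28"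
  shows "tr T (bcoeffs s T) i = b i"
proof -
  have d: "dtri T \<noteq> 0" using nondegenerate_dtri[OF nd] .
  obtain \<beta> where \<beta>: "\<forall>i. i \<notin> {1..28} \<longrightarrow> \<beta> i = 0" "\<forall>i<28. tr T \<beta> i = b i" using tr_surj[OF nd] by blast
  have "bcoeffs s T = \<beta>"
    unfolding bcoeffs_def
  proof (rule the_equality, intro conjI \<beta>(1) ballI)
    fix x assume x: "x \<in> tri_set T"
    have "eb (tr T \<beta>) = eb b" using \<beta>(2) by (simp add: eb_def fun_eq_iff)
    then show "s x = (\<Sum>i=1..28. \<beta> i * Bt T i x)" by (simp only: sum_Bt[OF d x] s[OF x])
  next
    fix \<gamma> assume \<gamma>: "(\<forall>i. i \<notin> {1..28} \<longrightarrow> \<gamma> i = 0) \<and> (\<forall>x\<in>tri_set T. s x = (\<Sum>i=1..28. \<gamma> i * Bt T i x))"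
    have "tr T \<gamma> i = b i" if "i < 28" for i
    proof (rule G_eb_unique[OF d _ that])
      fix x assume x: "x \<in> tri_set T"
      show "G T (eb (tr T \<gamma>)) 0 x = G T (eb b) 0 x" using \<gamma> x s[OF x] sum_Bt[OF d x, of \<gamma>] by simp
    qed
    then show "\<gamma> = \<beta>" using tr_inj[OF nd, of \<gamma> \<beta>] \<gamma> \<beta> by simp
  qed
  then show ?thesis using \<beta>(2) i by simp
qed

text \<open>The domain is a finite union of closed triangles, so derivatives within the single
  triangles combine to a derivative within the domain.\<close>

lemma has_derivative_finite_Union:
  assumes "finite A" "\<And>S. S \<in> A \<Longrightarrow> (f has_derivative D) (at x within S)" "bounded_linear D"
  shows "(f has_derivative D) (at x within \<Union>A)"
  using assms
proof (induction rule: finite_induct)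
  case empty
  then show ?case by (simp add: has_derivative_def)
next
  case (insert S A)
  then have "(f has_derivative D) (at x within S)" "(f has_derivative D) (at x within \<Union>A)" by simp_all
  then show ?case unfolding has_derivative_within unfolding Union_insert at_within_union by (simp only: filterlim_sup simp_thms)
qed

lemma has_derivative_closed_notin:
  assumes "closed S" "x \<notin> S" "bounded_linear D"
  shows "(f has_derivative D) (at x within S)"
proof -
  have "at x within S = bot" using assms(1,2) by (simp add: at_within_eq_bot_iff)
  then show ?thesis using assms(3) by (simp add: has_derivative_def)
qed

text \<open>Membership in the spline space expressed by local coefficients: the pieces, and
  agreement of their 2-jets on overlaps. \<open>S32_imp_rep\<close> and \<open>rep_imp_S32\<close>
  give the two directions, the second for functions that are 0 outside the domain.\<close>

definition rep :: "tri set \<Rightarrow> (pt \<Rightarrow> real) \<Rightarrow> (tri \<Rightarrow> nat \<Rightarrow> real) \<Rightarrow> bool" where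
  "rep \<T> s b \<longleftrightarrow> (\<forall>T\<in>\<T>. \<forall>x\<in>tri_set T. s x = G T (eb (b T)) 0 x) \<and>
    (\<forall>T\<in>\<T>. \<forall>T'\<in>\<T>. \<forall>x\<in>tri_set T \<inter> tri_set T'. \<forall>k<7. G T (eb (b T)) k x = G T' (eb (b T')) k x)"

lemma repD:
  assumes "rep \<T> s b"
  shows "T \<in> \<T> \<Longrightarrow> x \<in> tri_set T \<Longrightarrow> s x = G T (eb (b T)) 0 x"
    "T \<in> \<T> \<Longrightarrow> T' \<in> \<T> \<Longrightarrow> x \<in> tri_set T \<Longrightarrow> x \<in> tri_set T' \<Longrightarrow> k < 7 \<Longrightarrow> G T (eb (b T)) k x = G T' (eb (b T')) k x"
  using assms unfolding rep_def by blast+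

lemma triangulation_nd: "is_triangulation \<T> \<Longrightarrow> T \<in> \<T> \<Longrightarrow> nondegenerate T"
  by (simp add: is_triangulation_def)

lemma triangulation_dtri: "is_triangulation \<T> \<Longrightarrow> T \<in> \<T> \<Longrightarrow> dtri T \<noteq> 0"
  using triangulation_nd nondegenerate_dtri by blast

lemma closed_tri_set: "closed (tri_set T)"
  by (simp add: tri_set_def vset_def finite_imp_compact_convex_hull compact_imp_closed)

lemma S32_imp_rep:
  assumes t: "is_triangulation \<T>" and s: "s \<in> S32 \<T>"
  shows "\<exists>b. rep \<T> s b"
proof -
  obtain F where F: "F 0 = s" "C2j (domain_of \<T>) F" using s unfolding S32_def C2_on_iff_C2j by blast
  have "\<exists>b. \<forall>x\<in>tri_set T. \<forall>k<7. F k x = G T (eb b) k x" if T: "T \<in> \<T>" for T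
  proof (rule local_form[OF triangulation_dtri[OF t T]])
    show "C2j (tri_set T) F" by (rule C2j_subset[OF F(2)]) (use T in \<open>auto simp: domain_of_def\<close>)
    show "cubic_on C (F 0)" if "C \<in> ws_cells T" for C using s that T unfolding S32_def F(1) by blast
  qed
  then have "\<exists>b. \<forall>T\<in>\<T>. \<forall>x\<in>tri_set T. \<forall>k<7. F k x = G T (eb (b T)) k x" by (intro bchoice) blast
  then obtain b where b: "\<And>T x k. T \<in> \<T> \<Longrightarrow> x \<in> tri_set T \<Longrightarrow> k < 7 \<Longrightarrow> F k x = G T (eb (b T)) k x" by blast
  have "rep \<T> s b" unfolding rep_def
  proof (intro conjI ballI allI impI)
    show "s x = G T (eb (b T)) 0 x" if "T \<in> \<T>" "x \<in> tri_set T" for T x using b[OF that, of 0] F(1) by simp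
    show "G T (eb (b T)) k x = G T' (eb (b T')) k x" if "T \<in> \<T>" "T' \<in> \<T>" "x \<in> tri_set T \<inter> tri_set T'" "k < 7" for T T' x k
      using b[of T x k] b[of T' x k] that by simp
  qed
  then show ?thesis by blast
qed

text \<open>The derivatives at a point are taken from some triangle containing it; the matching
  2-jets make them the same for all such triangles. On each closed triangle they are then
  restrictions of the jets of one C^2 function on the plane.\<close>

lemma rep_imp_S32:
  assumes t: "is_triangulation \<T>" and r: "rep \<T> s b" and out: "\<And>x. x \<notin> domain_of \<T> \<Longrightarrow> s x = 0"
  shows "s \<in> S32 \<T>"
proof -
  have fin: "finite \<T>" using t by (simp add: is_triangulation_def)
  define tx where "tx x = (SOME T. T \<in> \<T> \<and> x \<in> tri_set T)" for x
  define F where "F k x = (if k = 0 then s x else G (tx x) (eb (b (tx x))) k x)" for k x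
  have FG: "F k x = G T (eb (b T)) k x" if "T \<in> \<T>" "x \<in> tri_set T" "k < 7" for T x k
  proof (cases "k = 0")
    case True
    then show ?thesis using repD(1)[OF r that(1,2)] by (simp add: F_def)
  next
    case False
    have "tx x \<in> \<T> \<and> x \<in> tri_set (tx x)" unfolding tx_def by (rule someI[of _ T]) (use that in blast)
    then show ?thesis using repD(2)[OF r, of "tx x" T x k] that False by (simp add: F_def)
  qed
  have GC: "continuous_on UNIV (G T e k)" if "k < 7" for T e k using G_C2j that unfolding C2j_def by blast
  have "continuous_on (domain_of \<T>) (F k)" if k: "k < 7" for k
    unfolding domain_of_def
  proof (rule continuous_on_closed_Union[OF fin closed_tri_set])
    fix T assume T: "T \<in> \<T>"
    have "continuous_on (tri_set T) (G T (eb (b T)) k)" using GC[OF k] continuous_on_subset by blast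
    then show "continuous_on (tri_set T) (F k)" by (rule continuous_on_eq) (rule FG[OF T _ k, symmetric])
  qed
  moreover have der: "(F k has_derivative (\<lambda>h. F k1 x * fst h + F k2 x * snd h)) (at x)"
    if x: "x \<in> interior (domain_of \<T>)" and k: "k < 7" "k1 < 7" "k2 < 7"
      and G: "\<And>T e. (G T e k has_derivative (\<lambda>h. G T e k1 x * fst h + G T e k2 x * snd h)) (at x)" for x k k1 k2
  proof -
    have bl: "bounded_linear (\<lambda>h::pt. F k1 x * fst h + F k2 x * snd h)"
      by (intro bounded_linear_add bounded_linear_const_mult bounded_linear_fst bounded_linear_snd)
    have "(F k has_derivative (\<lambda>h. F k1 x * fst h + F k2 x * snd h)) (at x within \<Union>(tri_set ` \<T>))"
    proof (rule has_derivative_finite_Union[OF _ _ bl])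
      fix S assume "S \<in> tri_set ` \<T>"
      then obtain T where T: "T \<in> \<T>" "S = tri_set T" by blast
      show "(F k has_derivative (\<lambda>h. F k1 x * fst h + F k2 x * snd h)) (at x within S)"
      proof (cases "x \<in> S")
        case True
        then have xT: "x \<in> tri_set T" by (simp add: T)
        have "(F k has_derivative (\<lambda>h. G T (eb (b T)) k1 x * fst h + G T (eb (b T)) k2 x * snd h)) (at x within S)"
          by (rule has_derivative_transform[OF True _ has_derivative_at_withinI[OF G]]) (use FG[OF T(1) _ k(1)] T(2) in simp)
        then show ?thesis by (simp only: FG[OF T(1) xT k(2)] FG[OF T(1) xT k(3)])
      next
        case False
        then show ?thesis using T(2) closed_tri_set bl by (intro has_derivative_closed_notin) auto
      qed
    qed (use fin in simp)
    moreover have "at x within \<Union>(tri_set ` \<T>) = at x"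
      using x unfolding domain_of_def by (rule at_within_interior)
    ultimately show ?thesis by simp
  qed
  moreover have dG: "(G T e 0 has_derivative (\<lambda>h. G T e 1 x * fst h + G T e 2 x * snd h)) (at x)"
    "(G T e 1 has_derivative (\<lambda>h. G T e 3 x * fst h + G T e 4 x * snd h)) (at x)"
    "(G T e 2 has_derivative (\<lambda>h. G T e 5 x * fst h + G T e 6 x * snd h)) (at x)" for T e x
    using G_C2j[of T e, unfolded C2j_def, THEN conjunct2, rule_format, of x] by (simp_all only: interior_UNIV UNIV_I simp_thms)
  have "(F 0 has_derivative (\<lambda>h. F 1 x * fst h + F 2 x * snd h)) (at x)"
    "(F 1 has_derivative (\<lambda>h. F 3 x * fst h + F 4 x * snd h)) (at x)"
    "(F 2 has_derivative (\<lambda>h. F 5 x * fst h + F 6 x * snd h)) (at x)" if "x \<in> interior (domain_of \<T>)" for x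
    using der[OF that _ _ _ dG(1)] der[OF that _ _ _ dG(2)] der[OF that _ _ _ dG(3)] by simp_all
  ultimately have "C2j (domain_of \<T>) F" unfolding C2j_def by blast
  moreover have "F 0 = s" by (simp add: F_def fun_eq_iff)
  ultimately have "C2_on (domain_of \<T>) s" unfolding C2_on_iff_C2j by blast
  moreover have "cubic_on C s" if T: "T \<in> \<T>" and C: "C \<in> ws_cells T" for T C
  proof -
    have "C \<subseteq> tri_set T" using C in_components_subset interior_subset unfolding ws_cells_def by blast
    then have "s x = G T (eb (b T)) 0 x" if "x \<in> C" for x using repD(1)[OF r T] that by blast
    then show ?thesis using G_cubic_on_cells[OF triangulation_dtri[OF t T] C, of "eb (b T)"] unfolding cubic_on_def by simp
  qed
  ultimately show ?thesis unfolding S32_def using out by blast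
qed

section \<open>The determining set determines the spline\<close>

lemma tvx_in_vset: "m < 3 \<Longrightarrow> tvx T m \<in> vset T"
  by (simp add: vset_tvx)

lemma tvx_inj:
  assumes "nondegenerate T" shows "inj_on (tvx T) {..<3}"
  using assms by (intro eq_card_imp_inj_on) (auto simp: nondegenerate_def vset_tvx)

lemma vset_tri_set: "v \<in> vset T \<Longrightarrow> v \<in> tri_set T"
  by (simp add: tri_set_def hull_inc)

lemma third_tri_set: "v \<in> vset T \<Longrightarrow> w \<in> vset T \<Longrightarrow> third v w \<in> tri_set T"
  unfolding third_def tri_set_def by (intro convexD[OF convex_convex_hull] hull_inc) auto

text \<open>Vanishing coefficients in one triangle mean a vanishing 2-jet, which is shared by all
  triangles at that point, and there it forces vanishing coefficients again. Vertices come before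
  edges because the edge system presupposes settled end points.\<close>

lemma low_coefficients_determined:
  assumes t: "is_triangulation \<T>" and r: "rep \<T> s b"
    and V: "\<And>v. v \<in> verts \<T> \<Longrightarrow> \<exists>T\<in>\<T>. \<exists>m<3. v = tvx T m \<and> (\<forall>i\<in>vertex_ix m. b T i = 0)"
    and E: "\<And>e. e \<in> edges \<T> \<Longrightarrow> \<exists>T\<in>\<T>. \<exists>f<3. e = {tvx T ((f + 1) mod 3), tvx T ((f + 2) mod 3)} \<and> (\<forall>i\<in>edge_ix f. b T i = 0)"
    and T: "T \<in> \<T>" and i: "i < 27"
  shows "b T i = 0"
proof -
  note D = triangulation_dtri[OF t]
  have iv: "b T i = 0" if T: "T \<in> \<T>" and m: "m < 3" and i: "i \<in> vertex_ix m" for T m i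
  proof -
    have vT: "tvx T m \<in> tri_set T" using tvx_in_vset[OF m] vset_tri_set by blast
    have "tvx T m \<in> verts \<T>" using T tvx_in_vset[OF m] unfolding verts_def by blast
    from V[OF this] obtain T' m' where T': "T' \<in> \<T>" "m' < 3" "tvx T m = tvx T' m'" "\<forall>i\<in>vertex_ix m'. b T' i = 0" by blast
    have vT': "tvx T m \<in> tri_set T'" using tvx_in_vset[OF T'(2)] vset_tri_set T'(3) by simp
    have "\<forall>k<7. G T' (eb (b T')) k (tvx T m) = 0" unfolding T'(3) using jets_vertex[OF D[OF T'(1)] T'(2)] T'(4) by blast
    then have "\<forall>k<7. G T (eb (b T)) k (tvx T m) = 0" using repD(2)[OF r T T'(1) vT vT'] by simp
    then show ?thesis using jets_vertex[OF D[OF T] m] i by blast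
  qed
  have ie: "b T i = 0" if T: "T \<in> \<T>" and f: "f < 3" and i: "i \<in> edge_ix f" for T f i
  proof -
    define v where "v = tvx T ((f + 1) mod 3)"
    define w where "w = tvx T ((f + 2) mod 3)"
    have vwT: "v \<in> vset T" "w \<in> vset T" by (simp_all add: v_def w_def tvx_in_vset)
    have "(f + 1) mod 3 \<noteq> (f + 2) mod 3" by presburger
    then have "v \<noteq> w" using inj_onD[OF tvx_inj[OF triangulation_nd[OF t T]]] unfolding v_def w_def by fastforce
    then have "{v, w} \<in> edges \<T>" using T vwT unfolding edges_def by blast
    from E[OF this] obtain T' f' where T': "T' \<in> \<T>" "f' < 3" and e: "{v, w} = {tvx T' ((f' + 1) mod 3), tvx T' ((f' + 2) mod 3)}"
      and z: "\<forall>i\<in>edge_ix f'. b T' i = 0" by blast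
    define v' where "v' = tvx T' ((f' + 1) mod 3)"
    define w' where "w' = tvx T' ((f' + 2) mod 3)"
    have vwT': "v \<in> vset T'" "w \<in> vset T'" using e tvx_in_vset[of "(f' + 1) mod 3" T'] tvx_in_vset[of "(f' + 2) mod 3" T'] by (auto simp: doubleton_eq_iff)
    have z': "(\<forall>k<7. G T' (eb (b T')) k (third v' w') = 0) \<and> (\<forall>k<7. G T' (eb (b T')) k (third w' v') = 0)"
      using jets_edge[OF D[OF T'(1)] T'(2) v'_def w'_def] iv[OF T'(1)] z by blast
    have "v = v' \<and> w = w' \<or> v = w' \<and> w = v'" using e unfolding v'_def w'_def doubleton_eq_iff .
    then have "(\<forall>k<7. G T' (eb (b T')) k (third v w) = 0) \<and> (\<forall>k<7. G T' (eb (b T')) k (third w v) = 0)"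
      using z' by auto
    then have "(\<forall>k<7. G T (eb (b T)) k (third v w) = 0) \<and> (\<forall>k<7. G T (eb (b T)) k (third w v) = 0)"
      using repD(2)[OF r T T'(1)] third_tri_set vwT vwT' by simp
    then show ?thesis using jets_edge[OF D[OF T] f v_def w_def] iv[OF T] i by blast
  qed
  show ?thesis by (rule index_cover[OF i]) (use iv[OF T] ie[OF T] in blast)+
qed

lemma vertex_indices_tvx: "nondegenerate T \<Longrightarrow> m < 3 \<Longrightarrow> vertex_indices T (tvx T m) = Suc ` vertex_ix m"
proof -
  assume nd: "nondegenerate T" and m: "m < 3"
  have ne: "tv1 T \<noteq> tv2 T" "tv1 T \<noteq> tv3 T" "tv2 T \<noteq> tv3 T"
    using inj_onD[OF tvx_inj[OF nd], of 0 1] inj_onD[OF tvx_inj[OF nd], of 0 2] inj_onD[OF tvx_inj[OF nd], of 1 2]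
    by (auto simp: tvx_def)
  have "m = 0 \<or> m = 1 \<or> m = 2" using m by auto
  then show ?thesis using ne by (elim disjE) (simp_all add: vertex_indices_def tvx_def vertex_ix_def eval_nat_numeral)
qed

lemma edge_indices_tvx:
  "nondegenerate T \<Longrightarrow> f < 3 \<Longrightarrow> edge_indices T {tvx T ((f + 1) mod 3), tvx T ((f + 2) mod 3)} = Suc ` edge_ix f"
proof -
  assume nd: "nondegenerate T" and m: "f < 3"
  have ne: "tv1 T \<noteq> tv2 T" "tv1 T \<noteq> tv3 T" "tv2 T \<noteq> tv3 T"
    using inj_onD[OF tvx_inj[OF nd], of 0 1] inj_onD[OF tvx_inj[OF nd], of 0 2] inj_onD[OF tvx_inj[OF nd], of 1 2]
    by (auto simp: tvx_def)
  have "f = 0 \<or> f = 1 \<or> f = 2" using m by auto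
  then show ?thesis using ne by (elim disjE) (simp_all add: edge_indices_def tvx_def edge_ix_def doubleton_eq_iff insert_commute)
qed

lemma vset_index: "v \<in> vset T \<Longrightarrow> \<exists>m<3. v = tvx T m"
  by (auto simp: vset_tvx)

lemma edge_index:
  assumes "e \<in> edges \<T>" "e \<subseteq> vset T"
  shows "\<exists>f<3. e = {tvx T ((f + 1) mod 3), tvx T ((f + 2) mod 3)}"
proof -
  obtain v w where e: "e = {v, w}" "v \<noteq> w" using assms(1) by (auto simp: edges_def)
  then show ?thesis using edge_orientation[of v T w] assms(2) by auto
qed

lemma MDS_determines:
  assumes t: "is_triangulation \<T>"
    and tv: "\<forall>v\<in>verts \<T>. tv v \<in> \<T> \<and> v \<in> vset (tv v)" and te: "\<forall>e\<in>edges \<T>. te e \<in> \<T> \<and> e \<subseteq> vset (te e)"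
    and s: "s \<in> S32 \<T>" and z: "\<And>T i. (T, i) \<in> MDS \<T> tv te \<Longrightarrow> bcoeffs s T i = 0" and x: "x \<in> domain_of \<T>"
  shows "s x = 0"
proof -
  obtain b where r: "rep \<T> s b" using S32_imp_rep[OF t s] ..
  have tr: "tr T (bcoeffs s T) i = b T i" if "T \<in> \<T>" "i < 28" for T i
    by (rule tr_bcoeffs[OF triangulation_nd[OF t that(1)] repD(1)[OF r that(1)] that(2)])
  have tr0: "b T i = 0" if "T \<in> \<T>" "i < 27" "bcoeffs s T (Suc i) = 0" for T i
    using tr[OF that(1), of i] that(2,3) by (simp add: tr_def)
  have lo: "b T i = 0" if T: "T \<in> \<T>" and i: "i < 27" for T i
  proof (rule low_coefficients_determined[OF t r _ _ T i])
    fix v assume v: "v \<in> verts \<T>"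
    then have Tv: "tv v \<in> \<T>" "v \<in> vset (tv v)" using tv by auto
    obtain m where m: "m < 3" "v = tvx (tv v) m" using vset_index[OF Tv(2)] by blast
    have "b (tv v) i = 0" if "i \<in> vertex_ix m" for i
    proof (rule tr0[OF Tv(1)])
      show "i < 27" using that by (auto simp: vertex_ix_def split: if_splits)
      have "Suc i \<in> vertex_indices (tv v) v"
        using vertex_indices_tvx[OF triangulation_nd[OF t Tv(1)] m(1)] that unfolding m(2)[symmetric] by simp
      then show "bcoeffs s (tv v) (Suc i) = 0" using v by (intro z) (unfold MDS_def, blast)
    qed
    then show "\<exists>T\<in>\<T>. \<exists>m<3. v = tvx T m \<and> (\<forall>i\<in>vertex_ix m. b T i = 0)" using Tv(1) m by blast
  next
    fix e assume e: "e \<in> edges \<T>"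
    then have Te: "te e \<in> \<T>" "e \<subseteq> vset (te e)" using te by auto
    obtain f where f: "f < 3" "e = {tvx (te e) ((f + 1) mod 3), tvx (te e) ((f + 2) mod 3)}" using edge_index[OF e Te(2)] by blast
    have "b (te e) i = 0" if "i \<in> edge_ix f" for i
    proof (rule tr0[OF Te(1)])
      show "i < 27" using that by (auto simp: edge_ix_def split: if_splits)
      have "Suc i \<in> edge_indices (te e) e"
        using edge_indices_tvx[OF triangulation_nd[OF t Te(1)] f(1)] that unfolding f(2)[symmetric] by simp
      then show "bcoeffs s (te e) (Suc i) = 0" using e by (intro z) (unfold MDS_def, blast)
    qed
    then show "\<exists>T\<in>\<T>. \<exists>f<3. e = {tvx T ((f + 1) mod 3), tvx T ((f + 2) mod 3)} \<and> (\<forall>i\<in>edge_ix f. b T i = 0)" using Te(1) f by blast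
  qed
  obtain T where T: "T \<in> \<T>" "x \<in> tri_set T" using x by (auto simp: domain_of_def)
  have b0: "bcoeffs s T (Suc i) = 0" if "i < 27" for i
    using tr[OF T(1), of i] lo[OF T(1) that] kap_pos[OF triangulation_nd[OF t T(1)], of i] that by (simp add: tr_def)
  \<comment> \<open>\<open>b T 27\<close> mixes the coefficient 28 with the coefficients 22 to 27,
    which are already known to vanish.\<close>
  have "bcoeffs s T 28 = 0" using T(1) by (intro z) (unfold MDS_def, blast)
  moreover have "(\<Sum>j\<in>{21..<27}. bcoeffs s T (Suc j)) = 0" using b0 by (intro sum.neutral) simp
  ultimately have "b T 27 = 0" using tr[OF T(1), of 27] by (simp add: tr_def)
  then have "b T i = 0" if "i < 28" for i using lo[OF T(1), of i] that by (cases "i = 27") auto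
  then have "eb (b T) = (\<lambda>_. 0)" by (simp add: eb_def fun_eq_iff)
  then show ?thesis using repD(1)[OF r T] by simp
qed

text \<open>Dual vectors form a basis: applying \<open>L\<close> to a linear relation gives
  independence, and the combination with coordinates \<open>L x\<close> differs from x by a vector
  with zero coordinates. \<open>L\<close> is assumed linear on \<open>S\<close> only, as nodal
  values are meaningful for splines only.\<close>

lemma (in vector_space) dim_eq_card_coordinates:
  fixes L :: "'b \<Rightarrow> 'k \<Rightarrow> 'a"
  assumes K: "finite K" and S: "subspace S"
    and add: "\<And>x y \<kappa>. x \<in> S \<Longrightarrow> y \<in> S \<Longrightarrow> \<kappa> \<in> K \<Longrightarrow> L (x + y) \<kappa> = L x \<kappa> + L y \<kappa>"
    and scl: "\<And>c x \<kappa>. x \<in> S \<Longrightarrow> \<kappa> \<in> K \<Longrightarrow> L (c *s x) \<kappa> = c * L x \<kappa>"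
    and inj: "\<And>x. x \<in> S \<Longrightarrow> (\<And>\<kappa>. \<kappa> \<in> K \<Longrightarrow> L x \<kappa> = 0) \<Longrightarrow> x = 0"
    and dual: "\<And>\<kappa>. \<kappa> \<in> K \<Longrightarrow> \<exists>x\<in>S. \<forall>\<mu>\<in>K. L x \<mu> = (if \<mu> = \<kappa> then 1 else 0)"
  shows "dim S = card K"
proof -
  from dual have "\<forall>\<kappa>\<in>K. \<exists>x. x \<in> S \<and> (\<forall>\<mu>\<in>K. L x \<mu> = (if \<mu> = \<kappa> then 1 else 0))" by blast
  from bchoice[OF this] obtain \<phi> where \<phi>: "\<And>\<kappa>. \<kappa> \<in> K \<Longrightarrow> \<phi> \<kappa> \<in> S"
    "\<And>\<kappa> \<mu>. \<kappa> \<in> K \<Longrightarrow> \<mu> \<in> K \<Longrightarrow> L (\<phi> \<kappa>) \<mu> = (if \<mu> = \<kappa> then 1 else 0)" by blast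
  have inj\<phi>: "inj_on \<phi> K"
  proof (rule inj_onI)
    fix \<kappa> \<mu> assume "\<kappa> \<in> K" "\<mu> \<in> K" "\<phi> \<kappa> = \<phi> \<mu>"
    then show "\<kappa> = \<mu>" using \<phi>(2)[of \<kappa> \<kappa>] \<phi>(2)[of \<mu> \<kappa>] by (auto split: if_splits)
  qed
  have Sum: "(\<Sum>\<kappa>\<in>A. c \<kappa> *s \<phi> \<kappa>) \<in> S \<and> (\<forall>\<mu>\<in>K. L (\<Sum>\<kappa>\<in>A. c \<kappa> *s \<phi> \<kappa>) \<mu> = (\<Sum>\<kappa>\<in>A. c \<kappa> * L (\<phi> \<kappa>) \<mu>))"
    if "finite A" "A \<subseteq> K" for A c
    using that
  proof (induction rule: finite_induct)
    case empty
    have "L 0 \<mu> = 0" if "\<mu> \<in> K" for \<mu> using scl[of 0 \<mu> 0] subspace_0[OF S] that by simp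
    then show ?case using subspace_0[OF S] by simp
  next
    case (insert \<kappa> A)
    then show ?case using \<phi>(1)[of \<kappa>] by (simp add: add scl subspace_add[OF S] subspace_scale[OF S])
  qed
  have coord: "L (\<Sum>\<kappa>\<in>K. c \<kappa> *s \<phi> \<kappa>) \<mu> = c \<mu>" if "\<mu> \<in> K" for c \<mu>
  proof -
    have "L (\<Sum>\<kappa>\<in>K. c \<kappa> *s \<phi> \<kappa>) \<mu> = (\<Sum>\<kappa>\<in>K. c \<kappa> * (if \<mu> = \<kappa> then 1 else 0))"
      using Sum[OF K order_refl] that \<phi>(2) by simp
    also have "\<dots> = c \<mu>" using that K by (simp add: if_distrib cong: if_cong)
    finally show ?thesis .
  qed
  show ?thesis
  proof (rule dim_unique[of "\<phi> ` K"])
    show "\<phi> ` K \<subseteq> S" using \<phi>(1) by blast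
    show "card (\<phi> ` K) = card K" by (rule card_image[OF inj\<phi>])
    show "independent (\<phi> ` K)"
    proof (rule independent_if_scalars_zero)
      fix f x assume z: "(\<Sum>x\<in>\<phi> ` K. f x *s x) = 0" and "x \<in> \<phi> ` K"
      then obtain \<mu> where \<mu>: "\<mu> \<in> K" "x = \<phi> \<mu>" by blast
      have "(\<Sum>\<kappa>\<in>K. f (\<phi> \<kappa>) *s \<phi> \<kappa>) = 0" using z by (simp add: sum.reindex[OF inj\<phi>])
      then have "f (\<phi> \<mu>) = L 0 \<mu>" using coord[OF \<mu>(1), of "\<lambda>\<kappa>. f (\<phi> \<kappa>)"] by simp
      also have "\<dots> = 0" using scl[of 0 \<mu> 0] subspace_0[OF S] \<mu>(1) by simp
      finally show "f x = 0" by (simp add: \<mu>(2))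
    qed (simp add: K)
    show "S \<subseteq> span (\<phi> ` K)"
    proof
      fix x assume x: "x \<in> S"
      define y where "y = (\<Sum>\<kappa>\<in>K. L x \<kappa> *s \<phi> \<kappa>)"
      have y: "y \<in> S" using Sum[OF K order_refl] unfolding y_def by blast
      \<comment> \<open>The difference is built from the two operations for which \<open>L\<close>
        is known to be linear.\<close>
      have "x + (-1) *s y = 0"
      proof (rule inj)
        show "x + (-1) *s y \<in> S" by (intro subspace_add[OF S] subspace_scale[OF S] x y)
        have "L y \<kappa> = L x \<kappa>" if "\<kappa> \<in> K" for \<kappa> unfolding y_def coord[OF that] ..
        then show "L (x + (-1) *s y) \<kappa> = 0" if "\<kappa> \<in> K" for \<kappa>
          unfolding add[OF x subspace_scale[OF S y] that] scl[OF y that] using that by simp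
      qed
      then have "x = y" by simp
      also have "y \<in> span (\<phi> ` K)" unfolding y_def by (intro span_sum span_scale span_base) blast
      finally show "x \<in> span (\<phi> ` K)" .
    qed
  qed
qed

section \<open>Cardinality of the determining set\<close>

lemma vertex_ix_edge_ix_facts:
  "m < 3 \<Longrightarrow> m' < 3 \<Longrightarrow> i \<in> vertex_ix m \<Longrightarrow> i \<in> vertex_ix m' \<Longrightarrow> m = m'"
  "f < 3 \<Longrightarrow> f' < 3 \<Longrightarrow> i \<in> edge_ix f \<Longrightarrow> i \<in> edge_ix f' \<Longrightarrow> f = f'"
  "i \<in> vertex_ix m \<Longrightarrow> i \<notin> edge_ix f" "i \<in> vertex_ix m \<Longrightarrow> i < 27" "i \<in> edge_ix f \<Longrightarrow> i < 27"
  "finite (vertex_ix m)" "finite (edge_ix f)" "card (vertex_ix m) = 6" "card (edge_ix f) = 3"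
proof -
  show "m = m'" if "m < 3" "m' < 3" "i \<in> vertex_ix m" "i \<in> vertex_ix m'"
  proof -
    have "m = 0 \<or> m = 1 \<or> m = 2" "m' = 0 \<or> m' = 1 \<or> m' = 2" using that(1,2) by linarith+
    then show ?thesis using that(3,4) by (elim disjE; simp add: vertex_ix_def; linarith?)
  qed
  show "f = f'" if "f < 3" "f' < 3" "i \<in> edge_ix f" "i \<in> edge_ix f'"
  proof -
    have "f = 0 \<or> f = 1 \<or> f = 2" "f' = 0 \<or> f' = 1 \<or> f' = 2" using that(1,2) by linarith+
    then show ?thesis using that(3,4) by (elim disjE; simp add: edge_ix_def; linarith?)
  qed
qed (auto simp: vertex_ix_def edge_ix_def split: if_splits)

lemma finite_triangulation:
  assumes "is_triangulation \<T>"
  shows "finite \<T>" "finite (verts \<T>)" "finite (edges \<T>)"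
proof -
  show f: "finite \<T>" using assms by (simp add: is_triangulation_def)
  then show v: "finite (verts \<T>)" by (simp add: verts_def vset_def)
  have "edges \<T> \<subseteq> Pow (verts \<T>)" by (auto simp: edges_def verts_def)
  then show "finite (edges \<T>)" using v finite_subset by blast
qed

text \<open>Several vertices or edges may choose the same triangle. Within one triangle the index
  sets of different vertices and edges are disjoint and none contains 28, so no pair is counted
  twice.\<close>

lemma card_MDS:
  assumes t: "is_triangulation \<T>"
    and tv: "\<forall>v\<in>verts \<T>. tv v \<in> \<T> \<and> v \<in> vset (tv v)" and te: "\<forall>e\<in>edges \<T>. te e \<in> \<T> \<and> e \<subseteq> vset (te e)"
  shows "card (MDS \<T> tv te) = 6 * card (verts \<T>) + 3 * card (edges \<T>) + card \<T>"
proof -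
  define A where "A = (SIGMA v:verts \<T>. vertex_indices (tv v) v)"
  define B where "B = (SIGMA e:edges \<T>. edge_indices (te e) e)"
  have V: "\<exists>m<3. v = tvx (tv v) m \<and> vertex_indices (tv v) v = Suc ` vertex_ix m" if "v \<in> verts \<T>" for v
  proof -
    have v: "tv v \<in> \<T>" "v \<in> vset (tv v)" using tv that by auto
    obtain m where "m < 3" "v = tvx (tv v) m" using vset_index[OF v(2)] by blast
    then show ?thesis using vertex_indices_tvx[OF triangulation_nd[OF t v(1)], of m] by (intro exI[of _ m]) simp
  qed
  have E: "\<exists>f<3. e = {tvx (te e) ((f + 1) mod 3), tvx (te e) ((f + 2) mod 3)} \<and> edge_indices (te e) e = Suc ` edge_ix f" if ee: "e \<in> edges \<T>" for e
  proof -
    have e: "te e \<in> \<T>" "e \<subseteq> vset (te e)" using te that by auto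
    obtain f where "f < 3" "e = {tvx (te e) ((f + 1) mod 3), tvx (te e) ((f + 2) mod 3)}" using edge_index[OF ee e(2)] by blast
    then show ?thesis using edge_indices_tvx[OF triangulation_nd[OF t e(1)], of f] by (intro exI[of _ f]) simp
  qed
  have cV: "finite (vertex_indices (tv v) v) \<and> card (vertex_indices (tv v) v) = 6" if "v \<in> verts \<T>" for v
    using V[OF that] vertex_ix_edge_ix_facts(6,8) by (auto simp: card_image)
  have cE: "finite (edge_indices (te e) e) \<and> card (edge_indices (te e) e) = 3" if "e \<in> edges \<T>" for e
    using E[OF that] vertex_ix_edge_ix_facts(7,9) by (auto simp: card_image)
  have cA: "finite A" "card A = 6 * card (verts \<T>)" and cB: "finite B" "card B = 3 * card (edges \<T>)"
    unfolding A_def B_def using finite_triangulation[OF t] cV cE by (simp_all add: card_SigmaI)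
  have eqA: "v = w" if a: "(v, i) \<in> A" "(w, j) \<in> A" "tv v = tv w" "i = j" for v i w j
  proof -
    have m: "v \<in> verts \<T>" "w \<in> verts \<T>" "j \<in> vertex_indices (tv v) v" "j \<in> vertex_indices (tv w) w" using a by (auto simp: A_def)
    obtain k where k: "k < 3" "v = tvx (tv v) k" "vertex_indices (tv v) v = Suc ` vertex_ix k" using V[OF m(1)] by blast
    obtain l where l: "l < 3" "w = tvx (tv w) l" "vertex_indices (tv w) w = Suc ` vertex_ix l" using V[OF m(2)] by blast
    have "k = l" using m(3,4) vertex_ix_edge_ix_facts(1)[OF k(1) l(1)] unfolding k(3) l(3) by auto
    then show ?thesis using k(2) l(2) a(3,4) by simp
  qed
  have injA: "inj_on (\<lambda>(v, i). (tv v, i)) A"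
    unfolding inj_on_def using eqA by fast
  have eqB: "v = w" if a: "(v, i) \<in> B" "(w, j) \<in> B" "te v = te w" "i = j" for v i w j
  proof -
    have m: "v \<in> edges \<T>" "w \<in> edges \<T>" "j \<in> edge_indices (te v) v" "j \<in> edge_indices (te w) w" using a by (auto simp: B_def)
    obtain k where k: "k < 3" "v = {tvx (te v) ((k + 1) mod 3), tvx (te v) ((k + 2) mod 3)}" "edge_indices (te v) v = Suc ` edge_ix k" using E[OF m(1)] by blast
    obtain l where l: "l < 3" "w = {tvx (te w) ((l + 1) mod 3), tvx (te w) ((l + 2) mod 3)}" "edge_indices (te w) w = Suc ` edge_ix l" using E[OF m(2)] by blast
    have "k = l" using m(3,4) vertex_ix_edge_ix_facts(2)[OF k(1) l(1)] unfolding k(3) l(3) by auto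
    then show ?thesis using k(2) l(2) a(3,4) by simp
  qed
  have injB: "inj_on (\<lambda>(e, i). (te e, i)) B"
    unfolding inj_on_def using eqB by fast
  have M: "MDS \<T> tv te = (\<lambda>(v, i). (tv v, i)) ` A \<union> (\<lambda>(e, i). (te e, i)) ` B \<union> (\<lambda>T. (T, 28)) ` \<T>"
    unfolding MDS_def A_def B_def by (auto simp: image_iff)
  have nA: "\<exists>m. x \<in> Suc ` vertex_ix m" if "(T, x) \<in> (\<lambda>(v, i). (tv v, i)) ` A" for T x using that V unfolding A_def by fastforce
  have nB: "\<exists>f. x \<in> Suc ` edge_ix f" if "(T, x) \<in> (\<lambda>(e, i). (te e, i)) ` B" for T x using that E unfolding B_def by fastforce
  have dAB: "(\<lambda>(v, i). (tv v, i)) ` A \<inter> (\<lambda>(e, i). (te e, i)) ` B = {}"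
  proof -
    have False if "(T, x) \<in> (\<lambda>(v, i). (tv v, i)) ` A" "(T, x) \<in> (\<lambda>(e, i). (te e, i)) ` B" for T x
      using nA[OF that(1)] nB[OF that(2)] vertex_ix_edge_ix_facts(3) by auto
    then show ?thesis by (metis disjoint_iff prod.collapse)
  qed
  have dT: "((\<lambda>(v, i). (tv v, i)) ` A \<union> (\<lambda>(e, i). (te e, i)) ` B) \<inter> (\<lambda>T. (T, 28)) ` \<T> = {}"
  proof -
    have False if "(T, 28) \<in> (\<lambda>(v, i). (tv v, i)) ` A \<or> (T, 28) \<in> (\<lambda>(e, i). (te e, i)) ` B" for T
    proof -
      have "\<exists>i<27. 28 = Suc i" using that nA[of T 28] nB[of T 28] vertex_ix_edge_ix_facts(4,5) by blast
      then show False by simp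
    qed
    note no28 = this
    show ?thesis
    proof (rule equals0I, elim IntE)
      fix y assume y: "y \<in> (\<lambda>(v, i). (tv v, i)) ` A \<union> (\<lambda>(e, i). (te e, i)) ` B" "y \<in> (\<lambda>T. (T, 28)) ` \<T>"
      from y(2) obtain T where T: "y = (T, 28)" by (rule imageE)
      from y(1) show False unfolding T Un_iff by (rule no28)
    qed
  qed
  have "card (MDS \<T> tv te) = card ((\<lambda>(v, i). (tv v, i)) ` A) + card ((\<lambda>(e, i). (te e, i)) ` B) + card ((\<lambda>T. (T, 28::nat)) ` \<T>)"
    unfolding M using cA(1) cB(1) finite_triangulation(1)[OF t]
    by (simp add: card_Un_disjoint[OF _ _ dT] card_Un_disjoint[OF _ _ dAB])
  also have "\<dots> = 6 * card (verts \<T>) + 3 * card (edges \<T>) + card \<T>"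
    unfolding card_image[OF injA] card_image[OF injB] cA(2) cB(2) by (simp add: card_image inj_on_def)
  finally show ?thesis .
qed

section \<open>Nodal values and the dimension\<close>

type_synonym node = "pt \<times> nat + pt set \<times> nat + tri"

definition nodes :: "tri set \<Rightarrow> node set" where
  "nodes \<T> = (verts \<T> \<times> {..<6}) <+> ((edges \<T> \<times> {..<3}) <+> \<T>)"

text \<open>One orientation per edge, fixed independently of the triangle, so that the triangles at
  the edge use the same normal and the same order of the two thirds.\<close>

definition ends :: "pt set \<Rightarrow> pt \<times> pt" where "ends e = (SOME p. e = {fst p, snd p})"

text \<open>Skips the redundant second mixed partial.\<close>

definition jet_index :: "nat \<Rightarrow> nat" where "jet_index k = (if k = 5 then 6 else k)"

text \<open>Degrees of freedom: the 2-jet at a vertex; on an edge one first normal derivative and two second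
  normal derivatives at the interior thirds; one free coefficient per triangle.\<close>

fun nodal :: "tri \<Rightarrow> (nat \<Rightarrow> real) \<Rightarrow> node \<Rightarrow> real" where
  "nodal T b (Inl (v, k)) = G T (eb b) (jet_index k) v"
| "nodal T b (Inr (Inl (e, k))) = (let v = fst (ends e); w = snd (ends e); p = third v w; q = third w v; N = nrm v w in
     if k = 0 then polar T (eb b) p (1, p) N else if k = 1 then polar T (eb b) p N N else polar T (eb b) q N N)"
| "nodal T b (Inr (Inr T')) = b 27"

lemma ends_eq: "e = {v, w} \<Longrightarrow> e = {fst (ends e), snd (ends e)}"
  unfolding ends_def by (rule someI[of _ "(v, w)"]) simp

lemma nodal_linear_form: "\<exists>m. \<forall>b. nodal T b \<kappa> = (\<Sum>i<28. m i * b i)"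
proof -
  have lin: "(\<Sum>j<28. eb b j * c j) = (\<Sum>i<28. (\<Sum>j<28. ct i j * c j) * b i)" for b c
    unfolding eb_def sum_distrib_right by (subst sum.swap) (simp add: mult_ac)
  have G: "\<exists>m. \<forall>b. G T (eb b) k x = (\<Sum>i<28. m i * b i)" for k x
    unfolding G_def lin by (rule exI[of _ "\<lambda>i. \<Sum>j<28. ct i j * pwj (nl T j) (cl T j) k x"]) simp
  have H: "\<exists>m. \<forall>b. polar T (eb b) x \<alpha> \<beta> = (\<Sum>i<28. m i * b i)" for x \<alpha> \<beta>
    unfolding polar_def lin
    by (rule exI[of _ "\<lambda>i. \<Sum>j<28. ct i j * (ml T j \<alpha> * ml T j \<beta> * pw 1 (nl T j \<bullet> x + cl T j))"]) simp
  have L: "\<exists>m. \<forall>b :: nat \<Rightarrow> real. b 27 = (\<Sum>i<28. m i * b i)"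
    by (intro exI[of _ "\<lambda>i. if i = 27 then 1 else 0"]) (simp add: if_distrib[of "\<lambda>x. x * _"] cong: if_cong)
  show ?thesis
  proof (cases "(T, \<lambda>_::nat. 0::real, \<kappa>)" rule: nodal.cases)
    case (1 T b v k)
    then show ?thesis using G by simp
  next
    case (2 T b e k)
    then show ?thesis using H by (cases "k = 0"; cases "k = 1") (simp_all add: Let_def)
  next
    case (3 T b T')
    then show ?thesis using L by simp
  qed
qed

lemma nodal_add: "nodal T (\<lambda>i. b i + b' i) \<kappa> = nodal T b \<kappa> + nodal T b' \<kappa>"
  and nodal_scale: "nodal T (\<lambda>i. c * b i) \<kappa> = c * nodal T b \<kappa>"
  and nodal_cong: "(\<And>i. i < 28 \<Longrightarrow> b i = b' i) \<Longrightarrow> nodal T b \<kappa> = nodal T b' \<kappa>"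
proof -
  obtain m where m: "\<And>b. nodal T b \<kappa> = (\<Sum>i<28. m i * b i)" using nodal_linear_form[of T \<kappa>] by blast
  show "nodal T (\<lambda>i. b i + b' i) \<kappa> = nodal T b \<kappa> + nodal T b' \<kappa>"
    by (simp add: m distrib_left sum.distrib)
  show "nodal T (\<lambda>i. c * b i) \<kappa> = c * nodal T b \<kappa>" by (simp add: m sum_distrib_left mult.left_commute)
  show "nodal T b \<kappa> = nodal T b' \<kappa>" if "\<And>i. i < 28 \<Longrightarrow> b i = b' i" using that by (simp add: m)
qed

text \<open>Six values determine the seven components because the two mixed derivatives agree by
  symmetry of the polar form.\<close>

lemma jets_from_nodal:
  assumes "\<And>k. k < 6 \<Longrightarrow> nodal T b (Inl (v, k)) = nodal T' b' (Inl (v, k))"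
  shows "\<forall>k<7. G T (eb b) k v = G T' (eb b') k v"
proof -
  have j: "G T (eb b) (jet_index k) v = G T' (eb b') (jet_index k) v" if "k < 6" for k using assms[OF that] by simp
  have "G T e 5 v = G T e 4 v" for T e unfolding G_polar by (simp only: polar_sym)
  then show ?thesis using j[of 0] j[of 1] j[of 2] j[of 3] j[of 4] j[of 5]
    unfolding all_less_7 by (simp add: jet_index_def)
qed

lemma edge_jets_from_nodal:
  assumes d: "dtri T \<noteq> 0" "dtri T' \<noteq> 0" and ne: "v \<noteq> w"
    and vw: "v \<in> vset T" "w \<in> vset T" "v \<in> vset T'" "w \<in> vset T'"
    and n: "\<And>k. k < 6 \<Longrightarrow> nodal T b (Inl (v, k)) = nodal T' b' (Inl (v, k))"
      "\<And>k. k < 6 \<Longrightarrow> nodal T b (Inl (w, k)) = nodal T' b' (Inl (w, k))"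
      "\<And>k. k < 3 \<Longrightarrow> nodal T b (Inr (Inl ({v, w}, k))) = nodal T' b' (Inr (Inl ({v, w}, k)))"
    and x: "x \<in> closed_segment v w"
  shows "\<forall>k<7. G T (eb b) k x = G T' (eb b') k x"
proof -
  \<comment> \<open>\<open>ends\<close> may list the end points in the opposite order; the nodal
    values refer to its order.\<close>
  define v' where "v' = fst (ends {v, w})"
  define w' where "w' = snd (ends {v, w})"
  have e: "{v, w} = {v', w'}" unfolding v'_def w'_def by (rule ends_eq) simp
  then have c: "v' = v \<and> w' = w \<or> v' = w \<and> w' = v" by (auto simp: doubleton_eq_iff)
  have n3: "nodal T b (Inr (Inl ({v, w}, 0))) = nodal T' b' (Inr (Inl ({v, w}, 0)))"
    "nodal T b (Inr (Inl ({v, w}, 1))) = nodal T' b' (Inr (Inl ({v, w}, 1)))"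
    "nodal T b (Inr (Inl ({v, w}, 2))) = nodal T' b' (Inr (Inl ({v, w}, 2)))" using n(3) by (simp_all del: nodal.simps)
  show ?thesis
  proof (rule edge_jets_determined[OF d])
    show "v' \<noteq> w'" "v' \<in> vset T" "w' \<in> vset T" "v' \<in> vset T'" "w' \<in> vset T'" using c ne vw by auto
    show "\<forall>k<7. G T (eb b) k v' = G T' (eb b') k v'" "\<forall>k<7. G T (eb b) k w' = G T' (eb b') k w'"
      using jets_from_nodal[of T b v T' b'] jets_from_nodal[of T b w T' b'] n(1,2) c by auto
    show "x \<in> closed_segment v' w'" using x c closed_segment_commute by metis
  qed (use n3 in \<open>simp_all only: nodal.simps Let_def v'_def w'_def if_True if_False zero_neq_one one_neq_zero zero_neq_numeral numeral_eq_one_iff semiring_norm refl simp_thms\<close>)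
qed

lemma nodes_mem:
  "Inl (v, k) \<in> nodes \<T> \<longleftrightarrow> v \<in> verts \<T> \<and> k < 6"
  "Inr (Inl (e, k)) \<in> nodes \<T> \<longleftrightarrow> e \<in> edges \<T> \<and> k < 3"
  "Inr (Inr T) \<in> nodes \<T> \<longleftrightarrow> T \<in> \<T>"
  by (auto simp: nodes_def)

lemma edges_mem: "T \<in> \<T> \<Longrightarrow> v \<in> vset T \<Longrightarrow> w \<in> vset T \<Longrightarrow> v \<noteq> w \<Longrightarrow> {v, w} \<in> edges \<T>"
  unfolding edges_def by blast

lemma edges_subset: "e \<in> edges {T} \<Longrightarrow> e \<subseteq> vset T"
  unfolding edges_def by blast

lemma nodes_iff: "\<kappa> \<in> nodes \<T> \<longleftrightarrow> (\<exists>T\<in>\<T>. \<kappa> \<in> nodes {T})"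
proof -
  have V: "v \<in> verts \<T> \<longleftrightarrow> (\<exists>T\<in>\<T>. v \<in> verts {T})" for v by (simp add: verts_def)
  have E: "e \<in> edges \<T> \<longleftrightarrow> (\<exists>T\<in>\<T>. e \<in> edges {T})" for e unfolding edges_def by blast
  show ?thesis
  proof (cases \<kappa>)
    case (Inl p)
    then show ?thesis using V[of "fst p"] by (cases p) (simp only: nodes_mem fst_conv, blast)
  next
    case (Inr q)
    then show ?thesis
    proof (cases q)
      case (Inl p)
      then show ?thesis using Inr E[of "fst p"] by (cases p) (simp only: nodes_mem fst_conv, blast)
    next
      case (Inr T)
      then show ?thesis using \<open>\<kappa> = Inr q\<close> by (simp only: nodes_mem, blast)
    qed
  qed
qed

lemma verts_single: "verts {T} = vset T"
  by (simp add: verts_def)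

lemma tvx_neq: "nondegenerate T \<Longrightarrow> tvx T ((f + 1) mod 3) \<noteq> tvx T ((f + 2) mod 3)"
proof
  assume "nondegenerate T" "tvx T ((f + 1) mod 3) = tvx T ((f + 2) mod 3)"
  then have "(f + 1) mod 3 = (f + 2) mod 3" using inj_onD[OF tvx_inj] by fastforce
  then show False by presburger
qed

text \<open>Comparison with the zero spline on the same triangle: equal nodal values make all 2-jets
  at the vertices and thirds vanish, hence the vertex and edge coefficients. The remaining
  coefficient is itself a nodal value.\<close>

lemma nodal_inj:
  assumes nd: "nondegenerate T" and z: "\<And>\<kappa>. \<kappa> \<in> nodes {T} \<Longrightarrow> nodal T b \<kappa> = 0" and i: "i < 28"
  shows "b i = 0"
proof -
  note d = nondegenerate_dtri[OF nd]
  have z0: "nodal T (\<lambda>_. 0) \<kappa> = 0" for \<kappa> using nodal_scale[of T 0 "\<lambda>_. 0" \<kappa>] by simp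
  have e0: "eb (\<lambda>_. 0) = (\<lambda>_. 0)" by (simp add: eb_def fun_eq_iff)
  have zv: "nodal T b (Inl (v, k)) = nodal T (\<lambda>_. 0) (Inl (v, k))" if "v \<in> vset T" "k < 6" for v k
    using z[of "Inl (v, k)"] that z0 by (simp only: nodes_mem verts_single)
  have iv: "b i = 0" if "m < 3" "i \<in> vertex_ix m" for m i
    using jets_from_nodal[OF zv[OF tvx_in_vset[OF that(1)]], unfolded e0 G_zero] jets_vertex[OF d that(1), of b] that(2) by blast
  have ie: "b i = 0" if f: "f < 3" and i: "i \<in> edge_ix f" for f i
  proof -
    define v where "v = tvx T ((f + 1) mod 3)"
    define w where "w = tvx T ((f + 2) mod 3)"
    have vw: "v \<in> vset T" "w \<in> vset T" by (simp_all add: v_def w_def tvx_in_vset)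
    have ne: "v \<noteq> w" using tvx_neq[OF nd] by (simp add: v_def w_def)
    have "\<forall>k<7. G T (eb b) k x = 0" if "x \<in> closed_segment v w" for x
    proof -
      have ze: "nodal T b (Inr (Inl ({v, w}, k))) = nodal T (\<lambda>_. 0) (Inr (Inl ({v, w}, k)))" if "k < 3" for k
        unfolding z0 using that by (intro z) (simp add: nodes_mem edges_mem[OF _ vw ne])
      from edge_jets_from_nodal[OF d d ne vw vw zv[OF vw(1)] zv[OF vw(2)] ze that] show ?thesis unfolding e0 G_zero .
    qed
    moreover have "third v w \<in> closed_segment v w" "third w v \<in> closed_segment v w"
      unfolding in_segment third_def
      by (intro exI[of _ "1/3"], simp add: prod_eq_iff field_simps) (intro exI[of _ "2/3"], simp add: prod_eq_iff field_simps)
    ultimately show ?thesis using jets_edge[OF d f v_def w_def] iv i by blast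
  qed
  have "b 27 = 0" using z[of "Inr (Inr T)"] by (simp add: nodes_mem)
  moreover have "b i = 0" if "i < 27" for i by (rule index_cover[OF that]) (use iv ie in blast)+
  ultimately show ?thesis using i by (cases "i = 27") auto
qed

lemma card_nodes:
  assumes "finite \<T>" "finite (verts \<T>)" "finite (edges \<T>)"
  shows "finite (nodes \<T>)" "card (nodes \<T>) = 6 * card (verts \<T>) + 3 * card (edges \<T>) + card \<T>"
  using assms by (simp_all add: nodes_def card_Plus card_cartesian_product)

lemma card_nodes_single:
  assumes nd: "nondegenerate T" shows "finite (nodes {T})" "card (nodes {T}) = 28"
proof -
  have c: "finite (vset T)" "card (vset T) = 3" using nd by (auto simp: nondegenerate_def vset_def)
  have e: "edges {T} = {e. e \<subseteq> vset T \<and> card e = 2}"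
  proof (intro set_eqI)
    fix e show "e \<in> edges {T} \<longleftrightarrow> e \<in> {e. e \<subseteq> vset T \<and> card e = 2}"
      unfolding edges_def card_2_iff mem_Collect_eq by blast
  qed
  have "card (edges {T}) = 3" unfolding e n_subsets[OF c(1)] c(2) by (simp add: eval_nat_numeral)
  moreover have "finite (edges {T})" unfolding e using c(1) by simp
  ultimately show "finite (nodes {T})" "card (nodes {T}) = 28"
    using card_nodes[of "{T}"] c by (simp_all add: verts_single)
qed

text \<open>A triangle has 3 * 6 + 3 * 3 + 1 = 28 nodes, as many as coefficients, so injectivity
  gives solvability.\<close>

lemma nodal_surj:
  assumes nd: "nondegenerate T" shows "\<exists>b. \<forall>\<kappa>\<in>nodes {T}. nodal T b \<kappa> = t \<kappa>"
proof -
  obtain h where h: "bij_betw h {..<28::nat} (nodes {T})"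
    using card_nodes_single[OF nd] finite_same_card_bij[of "{..<28::nat}" "nodes {T}"] by auto
  obtain m where m: "\<And>b \<kappa>. nodal T b \<kappa> = (\<Sum>i<28. m \<kappa> i * b i)"
    using nodal_linear_form by metis
  have "b i = 0" if z: "\<And>k. k < 28 \<Longrightarrow> (\<Sum>i<28. m (h k) i * b i) = 0" and i: "i < 28" for b i
  proof (rule nodal_inj[OF nd _ i])
    fix \<kappa> assume "\<kappa> \<in> nodes {T}"
    then obtain k where "k < 28" "\<kappa> = h k" using h by (auto simp: bij_betw_def)
    then show "nodal T b \<kappa> = 0" using z by (simp add: m)
  qed
  then have "\<exists>b. \<forall>k<28. (\<Sum>i<28. m (h k) i * b i) = t (h k)" by (rule square_system_solvable)
  then obtain b where "\<forall>k<28. nodal T b (h k) = t (h k)" unfolding m by blast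
  moreover have "nodes {T} = h ` {..<28}" using h by (simp add: bij_betw_def)
  ultimately have "\<forall>\<kappa>\<in>nodes {T}. nodal T b \<kappa> = t \<kappa>" by simp
  then show ?thesis by blast
qed

text \<open>Nodal values at vertices and edges are read off from 2-jets, which neighbouring pieces
  share; the node of a triangle belongs to that triangle alone.\<close>

lemma rep_nodal:
  assumes r: "rep \<T> s b" and T: "T \<in> \<T>" "T' \<in> \<T>" and \<kappa>: "\<kappa> \<in> nodes {T}" "\<kappa> \<in> nodes {T'}"
  shows "nodal T (b T) \<kappa> = nodal T' (b T') \<kappa>"
proof -
  have J: "\<forall>k<7. G T (eb (b T)) k x = G T' (eb (b T')) k x" if "x \<in> tri_set T" "x \<in> tri_set T'" for x
    using repD(2)[OF r T that] by blast
  have H: "polar T (eb (b T)) x \<alpha> \<beta> = polar T' (eb (b T')) x \<alpha> \<beta>" if "x \<in> tri_set T" "x \<in> tri_set T'" for x \<alpha> \<beta>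
    using J[OF that] unfolding jets_eq_iff by blast
  show ?thesis
  proof (cases "(T, b T, \<kappa>)" rule: nodal.cases)
    case (1 T0 b0 v k)
    then have v: "v \<in> vset T" "v \<in> vset T'" "k < 6" using \<kappa> by (simp_all add: nodes_mem verts_single)
    then have "jet_index k < 7" by (simp add: jet_index_def)
    then show ?thesis using J[OF vset_tri_set[OF v(1)] vset_tri_set[OF v(2)]] 1 by simp
  next
    case (2 T0 b0 e k)
    then have e: "e \<in> edges {T}" "e \<in> edges {T'}" using \<kappa> by (simp_all add: nodes_mem)
    obtain v w where vw: "e = {v, w}" using e(1) by (auto simp: edges_def)
    define v' where "v' = fst (ends e)"
    define w' where "w' = snd (ends e)"
    have "e = {v', w'}" unfolding v'_def w'_def by (rule ends_eq[OF vw])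
    then have "v' \<in> vset T" "w' \<in> vset T" "v' \<in> vset T'" "w' \<in> vset T'"
      using edges_subset[OF e(1)] edges_subset[OF e(2)] by blast+
    then have "third v' w' \<in> tri_set T" "third w' v' \<in> tri_set T" "third v' w' \<in> tri_set T'" "third w' v' \<in> tri_set T'"
      by (simp_all add: third_tri_set)
    then show ?thesis using 2 H by (simp add: Let_def v'_def w'_def)
  next
    case (3 T0 b0 T1)
    then have "T1 = T" "T1 = T'" using \<kappa> by (simp_all add: nodes_mem)
    then show ?thesis by simp
  qed
qed

text \<open>Two different triangles meet in a common edge, in a common vertex or not at all, and the
  nodes located there fix the 2-jets along the whole intersection.\<close>

lemma nodal_glue:
  assumes t: "is_triangulation \<T>" and n: "\<And>T \<kappa>. T \<in> \<T> \<Longrightarrow> \<kappa> \<in> nodes {T} \<Longrightarrow> nodal T (b T) \<kappa> = y \<kappa>"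
    and T: "T \<in> \<T>" "T' \<in> \<T>" and x: "x \<in> tri_set T" "x \<in> tri_set T'"
  shows "\<forall>k<7. G T (eb (b T)) k x = G T' (eb (b T')) k x"
proof (cases "T = T'")
  case False
  define I where "I = vset T \<inter> vset T'"
  note nd = triangulation_nd[OF t T(1)] triangulation_nd[OF t T(2)]
  note d = triangulation_dtri[OF t T(1)] triangulation_dtri[OF t T(2)]
  have xI: "x \<in> convex hull I"
    using t T False x unfolding is_triangulation_def I_def by blast
  have fin: "finite (vset T)" "card (vset T) = 3" "finite (vset T')" "card (vset T') = 3"
    using nd by (auto simp: nondegenerate_def vset_def)
  \<comment> \<open>A triangulation contains no two triangles with the same vertex set.\<close>
  have "card I \<noteq> 3"
  proof
    assume "card I = 3"
    then have "I = vset T" "I = vset T'" using fin card_subset_eq[of "vset T" I] card_subset_eq[of "vset T'" I] by (auto simp: I_def)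
    then show False using t T False unfolding is_triangulation_def by blast
  qed
  moreover have "card I \<le> 3" using card_mono[of "vset T" I] fin by (simp add: I_def)
  ultimately consider "card I = 0" | "card I = 1" | "card I = 2" by linarith
  then show ?thesis
  proof cases
    case 1
    then have "I = {}" using fin by (simp add: I_def)
    then show ?thesis using xI by simp
  next
    case 2
    then obtain v where v: "I = {v}" by (auto simp: card_1_singleton_iff)
    then have "v \<in> vset T" "v \<in> vset T'" by (auto simp: I_def)
    then have "nodal T (b T) (Inl (v, k)) = nodal T' (b T') (Inl (v, k))" if "k < 6" for k
      using n[OF T(1), of "Inl (v, k)"] n[OF T(2), of "Inl (v, k)"] that by (simp only: nodes_mem verts_single)
    from jets_from_nodal[OF this] show ?thesis using xI v by simp
  next
    case 3
    then obtain v w where vw: "I = {v, w}" "v \<noteq> w" by (auto simp: card_2_iff)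
    then have V: "v \<in> vset T" "w \<in> vset T" "v \<in> vset T'" "w \<in> vset T'" by (auto simp: I_def)
    have nv: "nodal T (b T) (Inl (u, k)) = nodal T' (b T') (Inl (u, k))" if "u \<in> {v, w}" "k < 6" for u k
    proof -
      have "Inl (u, k) \<in> nodes {T}" "Inl (u, k) \<in> nodes {T'}" using that V by (auto simp: nodes_mem verts_single)
      then show ?thesis by (simp only: n[OF T(1)] n[OF T(2)])
    qed
    have ne: "nodal T (b T) (Inr (Inl ({v, w}, k))) = nodal T' (b T') (Inr (Inl ({v, w}, k)))" if "k < 3" for k
    proof -
      have "Inr (Inl ({v, w}, k)) \<in> nodes {T}" "Inr (Inl ({v, w}, k)) \<in> nodes {T'}"
        using that by (simp_all add: nodes_mem edges_mem[OF _ V(1,2) vw(2)] edges_mem[OF _ V(3,4) vw(2)])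
      then show ?thesis by (simp only: n[OF T(1)] n[OF T(2)])
    qed
    have "x \<in> closed_segment v w" using xI by (simp add: vw(1) segment_convex_hull)
    from edge_jets_from_nodal[OF d vw(2) V nv nv ne this] show ?thesis by simp
  qed
qed simp

text \<open>Well defined despite the two choices: different triangles give the same value by
  \<open>rep_nodal\<close>, and different representing families by uniqueness of local
  coefficients.\<close>

definition nodal_value :: "tri set \<Rightarrow> (pt \<Rightarrow> real) \<Rightarrow> node \<Rightarrow> real" where
  "nodal_value \<T> s \<kappa> = (let T = (SOME T. T \<in> \<T> \<and> \<kappa> \<in> nodes {T}) in nodal T ((SOME b. rep \<T> s b) T) \<kappa>)"

lemma nodal_value_eq:
  assumes t: "is_triangulation \<T>" and r: "rep \<T> s b" and T: "T \<in> \<T>" and \<kappa>: "\<kappa> \<in> nodes {T}"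
  shows "nodal_value \<T> s \<kappa> = nodal T (b T) \<kappa>"
proof -
  define b' where "b' = (SOME b. rep \<T> s b)"
  define T' where "T' = (SOME T. T \<in> \<T> \<and> \<kappa> \<in> nodes {T})"
  have r': "rep \<T> s b'" unfolding b'_def using someI[of "rep \<T> s" b] r by simp
  have T': "T' \<in> \<T> \<and> \<kappa> \<in> nodes {T'}" unfolding T'_def by (rule someI[of _ T]) (use T \<kappa> in blast)
  have "nodal_value \<T> s \<kappa> = nodal T' (b' T') \<kappa>" by (simp add: nodal_value_def b'_def T'_def Let_def)
  also have "\<dots> = nodal T (b' T) \<kappa>" using rep_nodal[OF r' _ T _ \<kappa>] T' by blast
  also have "\<dots> = nodal T (b T) \<kappa>"
  proof (rule nodal_cong, rule G_eb_unique[OF triangulation_dtri[OF t T]])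
    fix x assume "x \<in> tri_set T"
    then show "G T (eb (b' T)) 0 x = G T (eb (b T)) 0 x" using repD(1)[OF r T] repD(1)[OF r' T] by simp
  qed
  finally show ?thesis .
qed

lemma eb_add: "eb (\<lambda>i. b i + b' i) = (\<lambda>j. eb b j + eb b' j)"
  and eb_scale: "eb (\<lambda>i. c * b i) = (\<lambda>j. c * eb b j)"
  by (simp_all add: eb_def fun_eq_iff distrib_right sum.distrib sum_distrib_left mult.assoc)

lemma G_add: "G T (\<lambda>j. e j + e' j) k x = G T e k x + G T e' k x"
  and G_scale: "G T (\<lambda>j. c * e j) k x = c * G T e k x"
  by (simp_all add: G_def distrib_right sum.distrib sum_distrib_left mult.assoc)

lemma rep_add:
  assumes r: "rep \<T> s b" and r': "rep \<T> s' b'"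
  shows "rep \<T> (s + s') (\<lambda>T i. b T i + b' T i)"
  unfolding rep_def eb_add G_add plus_fun_def
proof (intro conjI ballI allI impI)
  show "s x + s' x = G T (eb (b T)) 0 x + G T (eb (b' T)) 0 x" if "T \<in> \<T>" "x \<in> tri_set T" for T x
    by (simp only: repD(1)[OF r that] repD(1)[OF r' that])
  show "G T (eb (b T)) k x + G T (eb (b' T)) k x = G T' (eb (b T')) k x + G T' (eb (b' T')) k x"
    if "T \<in> \<T>" "T' \<in> \<T>" "x \<in> tri_set T \<inter> tri_set T'" "k < 7" for T T' x k
    by (simp only: repD(2)[OF r that(1,2) IntD1[OF that(3)] IntD2[OF that(3)] that(4)]
        repD(2)[OF r' that(1,2) IntD1[OF that(3)] IntD2[OF that(3)] that(4)])
qed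

lemma rep_scale:
  assumes r: "rep \<T> s b" shows "rep \<T> (fun_scale c s) (\<lambda>T i. c * b T i)"
  unfolding rep_def eb_scale G_scale fun_scale_def
proof (intro conjI ballI allI impI)
  show "c * s x = c * G T (eb (b T)) 0 x" if "T \<in> \<T>" "x \<in> tri_set T" for T x
    by (simp only: repD(1)[OF r that])
  show "c * G T (eb (b T)) k x = c * G T' (eb (b T')) k x"
    if "T \<in> \<T>" "T' \<in> \<T>" "x \<in> tri_set T \<inter> tri_set T'" "k < 7" for T T' x k
    by (simp only: repD(2)[OF r that(1,2) IntD1[OF that(3)] IntD2[OF that(3)] that(4)])
qed

lemma dim_S32:
  assumes t: "is_triangulation \<T>"
  shows "vector_space.dim fun_scale (S32 \<T>) = 6 * card (verts \<T>) + 3 * card (edges \<T>) + card \<T>"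
proof -
  interpret V: vector_space fun_scale
    by unfold_locales (simp_all add: fun_scale_def fun_eq_iff algebra_simps)
  note fin = finite_triangulation[OF t]
  have out: "s x = 0" if "s \<in> S32 \<T>" "x \<notin> domain_of \<T>" for s x using that unfolding S32_def by blast
  have S: "V.subspace (S32 \<T>)"
  proof (rule V.subspaceI)
    have "rep \<T> 0 (\<lambda>_ _. 0)" by (simp add: rep_def eb_def[abs_def])
    then show "0 \<in> S32 \<T>" by (rule rep_imp_S32[OF t]) simp
    show "s + s' \<in> S32 \<T>" if ss: "s \<in> S32 \<T>" "s' \<in> S32 \<T>" for s s'
    proof -
      obtain b where b: "rep \<T> s b" using S32_imp_rep[OF t ss(1)] by blast
      obtain b' where b': "rep \<T> s' b'" using S32_imp_rep[OF t ss(2)] by blast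
      show ?thesis by (rule rep_imp_S32[OF t rep_add[OF b b']]) (simp add: out ss)
    qed
    show "fun_scale c s \<in> S32 \<T>" if ss: "s \<in> S32 \<T>" for c s
    proof -
      obtain b where b: "rep \<T> s b" using S32_imp_rep[OF t ss] by blast
      show ?thesis by (rule rep_imp_S32[OF t rep_scale[OF b]]) (simp add: out ss fun_scale_def)
    qed
  qed
  have "V.dim (S32 \<T>) = card (nodes \<T>)"
  proof (rule V.dim_eq_card_coordinates[where L = "nodal_value \<T>", OF card_nodes(1)[OF fin] S])
    fix s s' \<kappa> assume s: "s \<in> S32 \<T>" "s' \<in> S32 \<T>" and \<kappa>: "\<kappa> \<in> nodes \<T>"
    obtain b where b: "rep \<T> s b" using S32_imp_rep[OF t s(1)] by blast
    obtain b' where b': "rep \<T> s' b'" using S32_imp_rep[OF t s(2)] by blast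
    obtain T where T: "T \<in> \<T>" "\<kappa> \<in> nodes {T}" using \<kappa> unfolding nodes_iff[of _ \<T>] by blast
    show "nodal_value \<T> (s + s') \<kappa> = nodal_value \<T> s \<kappa> + nodal_value \<T> s' \<kappa>"
      unfolding nodal_value_eq[OF t b T] nodal_value_eq[OF t b' T] nodal_value_eq[OF t rep_add[OF b b'] T] by (rule nodal_add)
  next
    fix c s \<kappa> assume s: "s \<in> S32 \<T>" and \<kappa>: "\<kappa> \<in> nodes \<T>"
    obtain b where b: "rep \<T> s b" using S32_imp_rep[OF t s] by blast
    obtain T where T: "T \<in> \<T>" "\<kappa> \<in> nodes {T}" using \<kappa> unfolding nodes_iff[of _ \<T>] by blast
    show "nodal_value \<T> (fun_scale c s) \<kappa> = c * nodal_value \<T> s \<kappa>"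
      unfolding nodal_value_eq[OF t b T] nodal_value_eq[OF t rep_scale[OF b] T] by (rule nodal_scale)
  next
    fix s assume s: "s \<in> S32 \<T>" and z: "\<And>\<kappa>. \<kappa> \<in> nodes \<T> \<Longrightarrow> nodal_value \<T> s \<kappa> = 0"
    obtain b where b: "rep \<T> s b" using S32_imp_rep[OF t s] by blast
    have "s x = 0" for x
    proof (cases "x \<in> domain_of \<T>")
      case True
      then obtain T where T: "T \<in> \<T>" "x \<in> tri_set T" by (auto simp: domain_of_def)
      have "b T i = 0" if "i < 28" for i
      proof (rule nodal_inj[OF triangulation_nd[OF t T(1)] _ that])
        fix \<kappa> assume \<kappa>: "\<kappa> \<in> nodes {T}"
        then have "\<kappa> \<in> nodes \<T>" unfolding nodes_iff[of _ \<T>] using T(1) by blast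
        then show "nodal T (b T) \<kappa> = 0" using z nodal_value_eq[OF t b T(1) \<kappa>] by simp
      qed
      then have "eb (b T) = (\<lambda>_. 0)" by (simp add: eb_def fun_eq_iff)
      then show ?thesis using repD(1)[OF b T] by simp
    qed (rule out[OF s])
    then show "s = 0" by (simp add: fun_eq_iff)
  next
    fix \<kappa> assume "\<kappa> \<in> nodes \<T>"
    \<comment> \<open>The dual spline of a node: the local systems are solved separately for the
      data \<open>y\<close>. A shared node has the same prescribed value in every triangle
      containing it, so the pieces fit together.\<close>
    define y where "y \<mu> = (if \<mu> = \<kappa> then 1 else 0 :: real)" for \<mu>
    have "\<forall>T\<in>\<T>. \<exists>b. \<forall>\<mu>\<in>nodes {T}. nodal T b \<mu> = y \<mu>" using nodal_surj triangulation_nd[OF t] by blast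
    from bchoice[OF this] obtain b where b: "\<And>T \<mu>. T \<in> \<T> \<Longrightarrow> \<mu> \<in> nodes {T} \<Longrightarrow> nodal T (b T) \<mu> = y \<mu>" by blast
    note glue = nodal_glue[OF t b]
    define s where "s x = (if x \<in> domain_of \<T> then (let T = (SOME T. T \<in> \<T> \<and> x \<in> tri_set T) in G T (eb (b T)) 0 x) else 0)" for x
    have r: "rep \<T> s b" unfolding rep_def
    proof (intro conjI ballI)
      fix T x assume T: "T \<in> \<T>" "x \<in> tri_set T"
      define T' where "T' = (SOME T. T \<in> \<T> \<and> x \<in> tri_set T)"
      have T': "T' \<in> \<T> \<and> x \<in> tri_set T'" unfolding T'_def by (rule someI[of _ T]) (use T in blast)
      have "x \<in> domain_of \<T>" using T by (auto simp: domain_of_def)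
      then have "s x = G T' (eb (b T')) 0 x" by (simp add: s_def T'_def Let_def)
      then show "s x = G T (eb (b T)) 0 x" using glue[of T' T x] T T' by simp
    next
      show "\<forall>k<7. G T (eb (b T)) k x = G T' (eb (b T')) k x" if "T \<in> \<T>" "T' \<in> \<T>" "x \<in> tri_set T \<inter> tri_set T'" for T T' x
        using glue[of T T' x] that by blast
    qed
    have "s \<in> S32 \<T>" by (rule rep_imp_S32[OF t r]) (simp add: s_def)
    moreover have "\<forall>\<mu>\<in>nodes \<T>. nodal_value \<T> s \<mu> = y \<mu>"
    proof
      fix \<mu> assume "\<mu> \<in> nodes \<T>"
      then obtain T where "T \<in> \<T>" "\<mu> \<in> nodes {T}" unfolding nodes_iff[of _ \<T>] by blast
      then show "nodal_value \<T> s \<mu> = y \<mu>" using nodal_value_eq[OF t r] b by simp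
    qed
    ultimately show "\<exists>s\<in>S32 \<T>. \<forall>\<mu>\<in>nodes \<T>. nodal_value \<T> s \<mu> = (if \<mu> = \<kappa> then 1 else 0)"
      unfolding y_def by blast
  qed
  then show ?thesis using card_nodes(2)[OF fin] by simp
qed

theorem theorem4p6:
  fixes \<T> :: "tri set" and tv :: "pt \<Rightarrow> tri" and te :: "pt set \<Rightarrow> tri"
  assumes "is_triangulation \<T>"
    and "connected (domain_of \<T>)"
    and "\<forall>v\<in>verts \<T>. tv v \<in> \<T> \<and> v \<in> vset (tv v)"
    and "\<forall>e\<in>edges \<T>. te e \<in> \<T> \<and> e \<subseteq> vset (te e)"
  shows "(\<forall>s\<in>S32 \<T>. (\<forall>(T, i)\<in>MDS \<T> tv te. bcoeffs s T i = 0) \<longrightarrow>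
                      (\<forall>x\<in>domain_of \<T>. s x = 0))
       \<and> card (MDS \<T> tv te) = 6 * card (verts \<T>) + 3 * card (edges \<T>) + card \<T>
       \<and> card (MDS \<T> tv te) = vector_space.dim fun_scale (S32 \<T>)"
proof (intro conjI ballI impI)
  show c: "card (MDS \<T> tv te) = 6 * card (verts \<T>) + 3 * card (edges \<T>) + card \<T>"
    by (rule card_MDS[OF assms(1,3,4)])
  show "card (MDS \<T> tv te) = vector_space.dim fun_scale (S32 \<T>)"
    unfolding c dim_S32[OF assms(1)] ..
  fix s x assume s: "s \<in> S32 \<T>" and z: "\<forall>(T, i)\<in>MDS \<T> tv te. bcoeffs s T i = 0" and x: "x \<in> domain_of \<T>"
  show "s x = 0" by (rule MDS_determines[OF assms(1,3,4) s _ x]) (use z in blast)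
qed

end
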